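(* Let $l\ge1$, $n\ge 0$, let $P^l_n$ be the tonal partition algebra over $\mathbb C$ with parameter $\delta\in\mathbb C$, $\delta\neq 0$. For $\underline\mu\in\Lambda(P^l_n)$ let $L_{\underline\mu}=\mathrm{head}\,\mathcal S^n_{\underline\mu}$. Let $\preceq$ be any order on $\Lambda(P^l_n)$ such that $\underline\mu\prec\underline\nu$ whenever $r_{|\underline\mu|}<r_{|\underline\nu|}$. Then the modules $\{\mathcal S^n_{\underline\mu}:\underline\mu\in\Lambda(P^l_n)\}$ have an upper-unitriangular decomposition matrix $([\mathcal S^n_{\underline\mu}:L_{\underline\nu}])_{\underline\mu,\underline\nu\in\Lambda(P^l_n)}$ with respect to $\preceq$; that is, $[\mathcal S^n_{\underline\mu}:L_{\underline\mu}]=1$ for all $\underline\mu$, and $[\mathcal S^n_{\underline\mu}:L_{\underline\nu}]\ne0$ implies $\underline\mu\preceq\underline\nu$.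
   Context: Partitions and products: for $n,m\ge 0$ let $\mathsf P_{n,m}$ be the set of set partitions of the disjoint union $\{1,\dots,n\}\cup\{1',\dots,m'\}$. For $p\in\mathsf P_{n,m}$, $p'\in\mathsf P_{m,r}$: rename each $i'$ of $p$ and each $i\in\{1,\dots,m\}$ of $p'$ as $i''$; take the finest partition of $\{1,\dots,n\}\cup\{1'',\dots,m''\}\cup\{1',\dots,r'\}$ such that every part of $p$ and of $p'$ is contained in a part; let $c$ be the number of its parts contained in $\{1'',\dots,m''\}$; delete all $i''$ (and empty parts) to get $q$; then $pp'=\delta^cq$. $p\otimes p'$ is side-by-side juxtaposition ($p'$ to the right). A part $s$ is $l$-tone if $|s\cap\{1,\dots,n\}|\equiv|s\cap\{1',\dots,m'\}|$ mod $l$; a partition is $l$-tone if all its parts are. The tonal partition algebra $P^l_n$ has basis the set $\mathsf P^l_n$ of $l$-tone partitions in $\mathsf P_{n,n}$. Propagating vector: a part is propagating if it meets both rows $\{1,\dots,n\}$, $\{1',\dots,n'\}$. For $p\in\mathsf P^l_n$ let $\#^i(p)$ ($1\le i\le l$) be the number of propagating parts $s$ with $|s\cap\{1,\dots,n\}|\equiv i$ mod $l$, and $\#^-(p)=(\#^1(p),\dots,\#^l(p))$. Index poset: for $\mathbf m=(m_1,\dots,m_l)$ let $r_{\mathbf m}=\sum_i i\,m_i$; $\gamma^{l,n}=\{\mathbf m\in\mathbb N_0^l:(n-r_{\mathbf m})/l\in\mathbb N_0\}$. With $\epsilon_i$ the standard basis of $\mathbb Z^l$, indices read mod $l$ in $\{1,\dots,l\}$,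 let $v_{ij}=\epsilon_{i+j}-\epsilon_i-\epsilon_j$ ($1\le i\le j\le l$); $\mathbf m\ge\mathbf m'$ iff $\mathbf m'-\mathbf m$ is a nonnegative integral combination of the $v_{ij}$. Elements and quotients: $b^i\in\mathsf P_{i,i}$ has the single part $\{1,\dots,i,1',\dots,i'\}$; $w\in\mathsf P_{l,0}$, $w^\star\in\mathsf P_{0,l}$ are the one-part partitions; $a^{\mathbf m}=a^{\mathbf m}_n=(b^l)^{\otimes m_l}\otimes(b^{l-1})^{\otimes m_{l-1}}\otimes\cdots\otimes(b^1)^{\otimes m_1}\otimes(ww^\star)^{\otimes(n-r_{\mathbf m})/l}$. $I^{<\mathbf m}=\sum_{\mathbf m'<\mathbf m}P^l_na^{\mathbf m'}P^l_n$ and $P^{\mathbf m}_n=P^l_n/I^{<\mathbf m}$. Standard modules: let $S_{\mathbf m}=S_{m_1}\times\cdots\times S_{m_l}$. The left ideal $P^{\mathbf m}_na^{\mathbf m}$ has basis the classes of those $p\in\mathsf P^l_n$ with $\#^-(p)=\mathbf m$ and with the same restriction to the bottom row, and the same non-propagating bottom parts, as $a^{\mathbf m}$. It is a right $S_{\mathbf m}$-module by permuting, for each $i$, the $m_i$ bottom blocks of size $i$ attached to propagating parts: if $B_{i,1},\dots,B_{i,m_i}$ are these blocks from left to right, then in $p\cdot\sigma$ the propagating part of $p$ with bottom block $B_{i,\sigma_i(j)}$ is given the bottom block $B_{i,j}$. Let $\Lambda_{\mathbf m}$ be the set of $l$-tuples $\underline\mu=(\mu^1,\dots,\mu^l)$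 of integer partitions with $\mu^i\vdash m_i$, and $\Lambda(P^l_n)=\bigsqcup_{\mathbf m\in\gamma^{l,n}}\Lambda_{\mathbf m}$; write $|\underline\mu|=\mathbf m$ if $\underline\mu\in\Lambda_{\mathbf m}$. Let $\mathrm{Sp}_{\underline\mu}$ be the Specht module of $S_{\mathbf m}$ (outer tensor product of Specht modules of the factors). The standard module is $\mathcal S^n_{\underline\mu}\cong\Delta_{\underline\mu}=P^{\mathbf m}_na^{\mathbf m}\otimes_{\mathbb CS_{\mathbf m}}\mathrm{Sp}_{\underline\mu}$, a left $P^l_n$-module. For $\delta\ne0$ over $\mathbb C$ each $\mathcal S^n_{\underline\mu}$ has a simple head $L_{\underline\mu}$, and the $L_{\underline\mu}$ form a complete set of simple $P^l_n$-modules. $[M:L]$ denotes composition multiplicity. *)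

theory Defs
  imports
    Complex_Main
    "HOL-Algebra.QuotRing"
    "HOL-Algebra.Module"
    "HOL-Algebra.Product_Groups"
    "HOL-Algebra.Free_Abelian_Groups"
    "HOL-Algebra.Generated_Groups"
    "HOL-Algebra.Sym_Groups"
    "HOL-Combinatorics.Permutations"
    "HOL-Library.Disjoint_Sets"
    "HOL-Library.Function_Algebras"
begin

section \<open>Modules over a not necessarily commutative ring\<close>

text \<open>
  The record \<open>module\<close> and the locale \<open>submodule\<close> of the library do not refer to commutativity of
  the scalars, so they are used here for left modules over any ring. The fields \<open>mult\<close> and \<open>one\<close>
  which the record inherits from rings play no role and are left undefined.
\<close>

definition module_iso ::
    "('a, 'r) ring_scheme \<Rightarrow> ('a, 'b, 'c) module_scheme \<Rightarrow> ('a, 'd, 'e) module_scheme \<Rightarrow> bool" where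
  "module_iso R M N \<longleftrightarrow>
     (\<exists>f. bij_betw f (carrier M) (carrier N)
        \<and> (\<forall>x\<in>carrier M. \<forall>y\<in>carrier M. f (x \<oplus>\<^bsub>M\<^esub> y) = f x \<oplus>\<^bsub>N\<^esub> f y)
        \<and> (\<forall>a\<in>carrier R. \<forall>x\<in>carrier M. f (a \<odot>\<^bsub>M\<^esub> x) = a \<odot>\<^bsub>N\<^esub> f x))"

definition quotient_module :: "('a, 'b, 'c) module_scheme \<Rightarrow> 'b set \<Rightarrow> ('a, 'b set) module" where
  "quotient_module M N =
     \<lparr>carrier = a_rcosets\<^bsub>M\<^esub> N, monoid.mult = undefined, one = undefined,
      ring.zero = N, add = set_add M,
      smult = (\<lambda>a X. \<Union>x\<in>X. N +>\<^bsub>M\<^esub> (a \<odot>\<^bsub>M\<^esub> x))\<rparr>"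

definition simple_module :: "('a, 'r) ring_scheme \<Rightarrow> ('a, 'b, 'c) module_scheme \<Rightarrow> bool" where
  "simple_module R M \<longleftrightarrow>
     carrier M \<noteq> {\<zero>\<^bsub>M\<^esub>} \<and> (\<forall>N. submodule N R M \<longrightarrow> N = {\<zero>\<^bsub>M\<^esub>} \<or> N = carrier M)"

definition maximal_submodule ::
    "'b set \<Rightarrow> ('a, 'r) ring_scheme \<Rightarrow> ('a, 'b, 'c) module_scheme \<Rightarrow> bool" where
  "maximal_submodule N R M \<longleftrightarrow>
     submodule N R M \<and> N \<noteq> carrier M
     \<and> (\<forall>N'. submodule N' R M \<and> N \<subseteq> N' \<longrightarrow> N' = N \<or> N' = carrier M)"

definition module_radical :: "('a, 'r) ring_scheme \<Rightarrow> ('a, 'b, 'c) module_scheme \<Rightarrow> 'b set" where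
  "module_radical R M = carrier M \<inter> \<Inter>{N. maximal_submodule N R M}"

definition module_head ::
    "('a, 'r) ring_scheme \<Rightarrow> ('a, 'b, 'c) module_scheme \<Rightarrow> ('a, 'b set) module" where
  "module_head R M = quotient_module M (module_radical R M)"

definition series_factor ::
    "('a, 'b, 'c) module_scheme \<Rightarrow> 'b set list \<Rightarrow> nat \<Rightarrow> ('a, 'b set) module" where
  "series_factor M Ns i = quotient_module (M\<lparr>carrier := Ns ! Suc i\<rparr>) (Ns ! i)"

definition composition_series ::
    "('a, 'r) ring_scheme \<Rightarrow> ('a, 'b, 'c) module_scheme \<Rightarrow> 'b set list \<Rightarrow> bool" where
  "composition_series R M Ns \<longleftrightarrow>
     Ns \<noteq> [] \<and> hd Ns = {\<zero>\<^bsub>M\<^esub>} \<and> last Ns = carrier M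
     \<and> (\<forall>N\<in>set Ns. submodule N R M)
     \<and> (\<forall>i. Suc i < length Ns \<longrightarrow> Ns ! i \<subseteq> Ns ! Suc i \<and> simple_module R (series_factor M Ns i))"

text \<open>By the Jordan-Hoelder theorem the following does not depend on the chosen series.\<close>

definition composition_multiplicity ::
    "('a, 'r) ring_scheme \<Rightarrow> ('a, 'b, 'c) module_scheme \<Rightarrow> ('a, 'd, 'e) module_scheme \<Rightarrow> nat" where
  "composition_multiplicity R M L =
     (let Ns = (SOME Ns. composition_series R M Ns)
      in card {i. Suc i < length Ns \<and> module_iso R (series_factor M Ns i) L})"

text \<open>
  Tensor product of a left \<open>A\<close>-module \<open>M\<close>, which is also a right \<open>R\<close>-module by \<open>act\<close>, with a left
  \<open>R\<close>-module \<open>N\<close>: the free abelian group on pairs modulo biadditivity and \<open>R\<close>-balancedness, with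
  \<open>A\<close> acting on the left factor.
\<close>

definition tensor_relations ::
    "('r, 's) ring_scheme \<Rightarrow> ('a, 'm, 'b) module_scheme \<Rightarrow> ('m \<Rightarrow> 'r \<Rightarrow> 'm)
     \<Rightarrow> ('r, 'v, 'c) module_scheme \<Rightarrow> ('m \<times> 'v \<Rightarrow>\<^sub>0 int) set" where
  "tensor_relations R M act N =
     {frag_of (x \<oplus>\<^bsub>M\<^esub> x', y) - frag_of (x, y) - frag_of (x', y) | x x' y.
        x \<in> carrier M \<and> x' \<in> carrier M \<and> y \<in> carrier N}
   \<union> {frag_of (x, y \<oplus>\<^bsub>N\<^esub> y') - frag_of (x, y) - frag_of (x, y') | x y y'.
        x \<in> carrier M \<and> y \<in> carrier N \<and> y' \<in> carrier N}
   \<union> {frag_of (act x r, y) - frag_of (x, r \<odot>\<^bsub>N\<^esub> y) | x r y.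
        x \<in> carrier M \<and> r \<in> carrier R \<and> y \<in> carrier N}"

definition tensor_module ::
    "('r, 's) ring_scheme \<Rightarrow> ('a, 'm, 'b) module_scheme \<Rightarrow> ('m \<Rightarrow> 'r \<Rightarrow> 'm)
     \<Rightarrow> ('r, 'v, 'c) module_scheme \<Rightarrow> ('a, ('m \<times> 'v \<Rightarrow>\<^sub>0 int) set) module" where
  "tensor_module R M act N =
     (let F = free_Abelian_group (carrier M \<times> carrier N);
          K = generate F (tensor_relations R M act N)
      in \<lparr>carrier = rcosets\<^bsub>F\<^esub> K, monoid.mult = undefined, one = undefined,
          ring.zero = K, add = set_mult F,
          smult = (\<lambda>a X. \<Union>c\<in>X. K #>\<^bsub>F\<^esub> frag_extend (\<lambda>(x, y). frag_of (a \<odot>\<^bsub>M\<^esub> x, y)) c)\<rparr>)"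


section \<open>Set partitions as diagrams\<close>

text \<open>
  \<open>Top i\<close>, \<open>Mid i\<close> and \<open>Bot i\<close> stand for \<open>i\<close>, \<open>i''\<close> and \<open>i'\<close>; diagrams have no vertices \<open>Mid i\<close>,
  these only occur while a product is formed.
\<close>

datatype vertex = Top nat | Mid nat | Bot nat

type_synonym diagram = "vertex set set"

definition diagrams :: "nat \<Rightarrow> nat \<Rightarrow> diagram set" where
  "diagrams n m = {p. partition_on (Top ` {1..n} \<union> Bot ` {1..m}) p}"

fun bot_to_mid :: "vertex \<Rightarrow> vertex" where
  "bot_to_mid (Bot i) = Mid i"
| "bot_to_mid v = v"

fun top_to_mid :: "vertex \<Rightarrow> vertex" where
  "top_to_mid (Top i) = Mid i"
| "top_to_mid v = v"

definition stacked_parts :: "diagram \<Rightarrow> diagram \<Rightarrow> vertex set set" where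
  "stacked_parts p p' = image bot_to_mid ` p \<union> image top_to_mid ` p'"

text \<open>
  The finest partition coarser than all parts of the two stacked diagrams, as the set of classes
  of the equivalence relation they generate; see \<open>glue_finest\<close> below.
\<close>

definition glue :: "nat \<Rightarrow> nat \<Rightarrow> nat \<Rightarrow> diagram \<Rightarrow> diagram \<Rightarrow> vertex set set" where
  "glue n m r p p' =
     (Top ` {1..n} \<union> Mid ` {1..m} \<union> Bot ` {1..r}) // (\<Union>s\<in>stacked_parts p p'. s \<times> s)\<^sup>+"

lemma stacked_parts_rel:
  assumes "p \<in> diagrams n m" "p' \<in> diagrams m r"
  defines "U \<equiv> Top ` {1..n} \<union> Mid ` {1..m} \<union> Bot ` {1..r}"
  shows "equiv U ((\<Union>s\<in>stacked_parts p p'. s \<times> s)\<^sup>+)"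
proof -
  have p: "\<Union>p = Top ` {1..n} \<union> Bot ` {1..m}" and p': "\<Union>p' = Top ` {1..m} \<union> Bot ` {1..r}"
    using assms(1,2) by (auto simp: diagrams_def partition_on_def)
  have "\<Union>(stacked_parts p p') = bot_to_mid ` \<Union>p \<union> top_to_mid ` \<Union>p'"
    by (auto simp: stacked_parts_def)
  also have "\<dots> = U"
    unfolding p p' U_def by (simp add: image_Un image_image Un_ac)
  finally have U: "\<Union>(stacked_parts p p') = U" .
  let ?R = "\<Union>s\<in>stacked_parts p p'. s \<times> s"
  have "?R \<subseteq> U \<times> U" using U by blast
  hence sub: "?R\<^sup>+ \<subseteq> U \<times> U" by (rule trancl_subset_Sigma)
  have "refl_on U (?R\<^sup>+)"
  proof (rule refl_onI)
    fix x assume "x \<in> U"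
    with U obtain s where "s \<in> stacked_parts p p'" "x \<in> s" by blast
    hence "(x, x) \<in> ?R" by blast
    thus "(x, x) \<in> ?R\<^sup>+" by (rule r_into_trancl)
  qed
  moreover have "sym (?R\<^sup>+)" by (rule sym_trancl) (auto simp: sym_def)
  ultimately show ?thesis using sub by (simp add: equiv_def)
qed

lemma glue_finest:
  assumes "p \<in> diagrams n m" "p' \<in> diagrams m r"
  defines "U \<equiv> Top ` {1..n} \<union> Mid ` {1..m} \<union> Bot ` {1..r}"
  shows "partition_on U (glue n m r p p')"
    and "\<And>s. s \<in> stacked_parts p p' \<Longrightarrow> \<exists>t\<in>glue n m r p p'. s \<subseteq> t"
    and "\<And>Q. partition_on U Q \<Longrightarrow> (\<And>s. s \<in> stacked_parts p p' \<Longrightarrow> \<exists>t\<in>Q. s \<subseteq> t)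
           \<Longrightarrow> refines U (glue n m r p p') Q"
proof -
  let ?R = "\<Union>s\<in>stacked_parts p p'. s \<times> s"
  have eq: "equiv U (?R\<^sup>+)" unfolding U_def by (rule stacked_parts_rel[OF assms(1,2)])
  have g: "glue n m r p p' = U // ?R\<^sup>+" by (simp add: glue_def U_def)
  show part: "partition_on U (glue n m r p p')"
    unfolding g by (rule partition_on_quotient[OF eq])
  show "\<exists>t\<in>glue n m r p p'. s \<subseteq> t" if s: "s \<in> stacked_parts p p'" for s
  proof -
    have "{} \<notin> p" "{} \<notin> p'" using assms(1,2) by (auto simp: diagrams_def partition_on_def)
    with s have "s \<noteq> {}" by (auto simp: stacked_parts_def)
    then obtain x where x: "x \<in> s" by blast
    have rel: "(x, y) \<in> ?R\<^sup>+" if "y \<in> s" for y using s x that by blast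
    from rel[OF x] eq have "x \<in> U" unfolding equiv_def by blast
    hence "?R\<^sup>+ `` {x} \<in> glue n m r p p'" unfolding g by (rule quotientI)
    with rel show ?thesis by blast
  qed
  show "refines U (glue n m r p p') Q"
    if Q: "partition_on U Q" and c: "\<And>s. s \<in> stacked_parts p p' \<Longrightarrow> \<exists>t\<in>Q. s \<subseteq> t" for Q
  proof -
    have step: "\<exists>t\<in>Q. x \<in> t \<and> y \<in> t" if "(x, y) \<in> ?R\<^sup>+" for x y
      using that
    proof (induction rule: trancl_induct)
      case (base y)
      then obtain s where s: "s \<in> stacked_parts p p'" "x \<in> s" "y \<in> s" by blast
      from c[OF s(1)] s show ?case by blast
    next
      case (step y z)
      from step.IH obtain t where t: "t \<in> Q" "x \<in> t" "y \<in> t" by blast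
      from step.hyps(2) obtain s where s: "s \<in> stacked_parts p p'" "y \<in> s" "z \<in> s" by blast
      from c[OF s(1)] s obtain t' where t': "t' \<in> Q" "y \<in> t'" "z \<in> t'" by blast
      from Q have "disjoint Q" by (rule partition_onD2)
      from disjointD[OF this t(1) t'(1)] t t' have "t = t'" by blast
      with t t' show ?case by blast
    qed
    have "\<exists>Y\<in>Q. t \<subseteq> Y" if "t \<in> glue n m r p p'" for t
    proof -
      from that obtain x where x: "x \<in> U" "t = ?R\<^sup>+ `` {x}" unfolding g by (rule quotientE)
      from x(1) partition_onD1[OF Q] obtain Y where Y: "Y \<in> Q" "x \<in> Y" by blast
      have "t \<subseteq> Y"
      proof
        fix y assume "y \<in> t"
        with x(2) have "(x, y) \<in> ?R\<^sup>+" by blast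
        from step[OF this] obtain t' where t': "t' \<in> Q" "x \<in> t'" "y \<in> t'" by blast
        from Q have "disjoint Q" by (rule partition_onD2)
        from disjointD[OF this t'(1) Y(1)] Y t' have "t' = Y" by blast
        with t' show "y \<in> Y" by simp
      qed
      with Y show ?thesis by blast
    qed
    with part Q show ?thesis by (simp add: refines_def)
  qed
qed

definition closed_components :: "nat \<Rightarrow> nat \<Rightarrow> nat \<Rightarrow> diagram \<Rightarrow> diagram \<Rightarrow> nat" where
  "closed_components n m r p p' = card {s \<in> glue n m r p p'. s \<subseteq> Mid ` {1..m}}"

definition diagram_comp :: "nat \<Rightarrow> nat \<Rightarrow> nat \<Rightarrow> diagram \<Rightarrow> diagram \<Rightarrow> diagram" where
  "diagram_comp n m r p p' = (\<lambda>s. s - range Mid) ` glue n m r p p' - {{}}"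

fun shift_vertex :: "nat \<Rightarrow> nat \<Rightarrow> vertex \<Rightarrow> vertex" where
  "shift_vertex n m (Top i) = Top (n + i)"
| "shift_vertex n m (Bot i) = Bot (m + i)"
| "shift_vertex n m (Mid i) = Mid i"

text \<open>Juxtaposition of \<open>p \<in> diagrams n m\<close> with \<open>p'\<close> on its right.\<close>

definition juxtapose :: "nat \<Rightarrow> nat \<Rightarrow> diagram \<Rightarrow> diagram \<Rightarrow> diagram" where
  "juxtapose n m p p' = p \<union> image (shift_vertex n m) ` p'"

definition tone_part :: "nat \<Rightarrow> vertex set \<Rightarrow> bool" where
  "tone_part l s \<longleftrightarrow> card (s \<inter> range Top) mod l = card (s \<inter> range Bot) mod l"

definition tonal_diagrams :: "nat \<Rightarrow> nat \<Rightarrow> diagram set" where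
  "tonal_diagrams l n = {p \<in> diagrams n n. \<forall>s\<in>p. tone_part l s}"

definition propagating :: "vertex set \<Rightarrow> bool" where
  "propagating s \<longleftrightarrow> s \<inter> range Top \<noteq> {} \<and> s \<inter> range Bot \<noteq> {}"


section \<open>The tonal partition algebra\<close>

text \<open>
  Elements are coefficient functions on diagrams that vanish off the basis. The unit is the
  diagram whose parts are \<open>{i, i'}\<close>.
\<close>

definition tonal_algebra :: "complex \<Rightarrow> nat \<Rightarrow> nat \<Rightarrow> (diagram \<Rightarrow> complex) ring" where
  "tonal_algebra \<delta> l n =
     \<lparr>carrier = {f. \<forall>p. p \<notin> tonal_diagrams l n \<longrightarrow> f p = 0},
      monoid.mult = (\<lambda>f g q. \<Sum>p\<in>tonal_diagrams l n. \<Sum>p'\<in>tonal_diagrams l n.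
                f p * g p' * \<delta> ^ closed_components n n n p p' * of_bool (diagram_comp n n n p p' = q)),
      one = (\<lambda>q. of_bool (q = (\<lambda>i. {Top i, Bot i}) ` {1..n})),
      ring.zero = (\<lambda>q. 0),
      add = (\<lambda>f g q. f q + g q)\<rparr>"

definition basis_vector :: "diagram \<Rightarrow> (diagram \<Rightarrow> complex)" where
  "basis_vector p = (\<lambda>q. of_bool (q = p))"


section \<open>The index poset\<close>

text \<open>
  An \<open>l\<close>-tuple indexed by \<open>1, \<dots>, l\<close> is a function that is \<open>0\<close> at all other arguments.
\<close>

definition propagating_vector :: "nat \<Rightarrow> diagram \<Rightarrow> nat \<Rightarrow> nat" where
  "propagating_vector l p =
     (\<lambda>i. if i \<in> {1..l}
          then card {s \<in> p. propagating s \<and> card (s \<inter> range Top) mod l = i mod l} else 0)"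

definition weight :: "nat \<Rightarrow> (nat \<Rightarrow> nat) \<Rightarrow> nat" where
  "weight l m = (\<Sum>i=1..l. i * m i)"

definition index_set :: "nat \<Rightarrow> nat \<Rightarrow> (nat \<Rightarrow> nat) set" where
  "index_set l n = {m. (\<forall>i. i \<notin> {1..l} \<longrightarrow> m i = 0) \<and> (\<exists>k. n = weight l m + k * l)}"

definition unit_vec :: "nat \<Rightarrow> nat \<Rightarrow> nat \<Rightarrow> int" where
  "unit_vec l i = (\<lambda>k. of_bool (k \<in> {1..l} \<and> k mod l = i mod l))"

definition merge_vec :: "nat \<Rightarrow> nat \<Rightarrow> nat \<Rightarrow> nat \<Rightarrow> int" where
  "merge_vec l i j = (\<lambda>k. unit_vec l (i + j) k - unit_vec l i k - unit_vec l j k)"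

definition index_le :: "nat \<Rightarrow> (nat \<Rightarrow> nat) \<Rightarrow> (nat \<Rightarrow> nat) \<Rightarrow> bool" where
  "index_le l m' m \<longleftrightarrow>
     (\<exists>c :: nat \<Rightarrow> nat \<Rightarrow> nat. \<forall>k\<in>{1..l}.
        int (m' k) - int (m k) = (\<Sum>i=1..l. \<Sum>j=i..l. int (c i j) * merge_vec l i j k))"

definition index_less :: "nat \<Rightarrow> (nat \<Rightarrow> nat) \<Rightarrow> (nat \<Rightarrow> nat) \<Rightarrow> bool" where
  "index_less l m' m \<longleftrightarrow> index_le l m' m \<and> m' \<noteq> m"


section \<open>The elements a and the quotient algebras\<close>

definition b_diagram :: "nat \<Rightarrow> diagram" where
  "b_diagram i = {Top ` {1..i} \<union> Bot ` {1..i}}"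

definition w_diagram :: "nat \<Rightarrow> diagram" where
  "w_diagram l = {Top ` {1..l}}"

definition wstar_diagram :: "nat \<Rightarrow> diagram" where
  "wstar_diagram l = {Bot ` {1..l}}"

text \<open>Tensor product from left to right of diagrams \<open>p\<close> with \<open>k\<close> vertices in each row, listed as \<open>(k, p)\<close>.\<close>

fun juxtapose_list :: "(nat \<times> diagram) list \<Rightarrow> diagram" where
  "juxtapose_list [] = {}"
| "juxtapose_list ((k, p) # ps) = juxtapose k k p (juxtapose_list ps)"

definition a_diagram :: "nat \<Rightarrow> nat \<Rightarrow> (nat \<Rightarrow> nat) \<Rightarrow> diagram" where
  "a_diagram l n m = juxtapose_list
     (concat (map (\<lambda>i. replicate (m i) (i, b_diagram i)) (rev [1..<Suc l]))
      @ replicate ((n - weight l m) div l)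
          (l, diagram_comp l 0 l (w_diagram l) (wstar_diagram l)))"

definition lower_ideal :: "complex \<Rightarrow> nat \<Rightarrow> nat \<Rightarrow> (nat \<Rightarrow> nat) \<Rightarrow> (diagram \<Rightarrow> complex) set" where
  "lower_ideal \<delta> l n m =
     genideal (tonal_algebra \<delta> l n)
       {basis_vector (a_diagram l n m') | m'. m' \<in> index_set l n \<and> index_less l m' m}"

definition quotient_algebra ::
    "complex \<Rightarrow> nat \<Rightarrow> nat \<Rightarrow> (nat \<Rightarrow> nat) \<Rightarrow> (diagram \<Rightarrow> complex) set ring" where
  "quotient_algebra \<delta> l n m = tonal_algebra \<delta> l n Quot lower_ideal \<delta> l n m"

abbreviation quotient_class ::
    "complex \<Rightarrow> nat \<Rightarrow> nat \<Rightarrow> (nat \<Rightarrow> nat) \<Rightarrow> (diagram \<Rightarrow> complex) \<Rightarrow> (diagram \<Rightarrow> complex) set" where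
  "quotient_class \<delta> l n m f \<equiv> lower_ideal \<delta> l n m +>\<^bsub>tonal_algebra \<delta> l n\<^esub> f"

text \<open>The left ideal generated by the class of \<open>a_diagram\<close>, as a left module of the tonal algebra.\<close>

definition left_ideal_module ::
    "complex \<Rightarrow> nat \<Rightarrow> nat \<Rightarrow> (nat \<Rightarrow> nat) \<Rightarrow> (diagram \<Rightarrow> complex, (diagram \<Rightarrow> complex) set) module" where
  "left_ideal_module \<delta> l n m =
     (let Q = quotient_algebra \<delta> l n m
      in \<lparr>carrier = {X \<otimes>\<^bsub>Q\<^esub> quotient_class \<delta> l n m (basis_vector (a_diagram l n m)) | X. X \<in> carrier Q},
          monoid.mult = undefined, one = undefined,
          ring.zero = \<zero>\<^bsub>Q\<^esub>, add = add Q,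
          smult = (\<lambda>f X. quotient_class \<delta> l n m f \<otimes>\<^bsub>Q\<^esub> X)\<rparr>)"


section \<open>The right action of the symmetric groups\<close>

definition multi_sym_group :: "nat \<Rightarrow> (nat \<Rightarrow> nat) \<Rightarrow> (nat \<Rightarrow> nat \<Rightarrow> nat) monoid" where
  "multi_sym_group l m = product_group {1..l} (\<lambda>i. sym_group (m i))"

definition group_algebra :: "('g, 'r) monoid_scheme \<Rightarrow> ('g \<Rightarrow> complex) ring" where
  "group_algebra G =
     \<lparr>carrier = {z. \<forall>g. g \<notin> carrier G \<longrightarrow> z g = 0},
      monoid.mult = (\<lambda>y z x. \<Sum>g\<in>carrier G. \<Sum>h\<in>carrier G. y g * z h * of_bool (g \<otimes>\<^bsub>G\<^esub> h = x)),
      one = (\<lambda>g. of_bool (g = \<one>\<^bsub>G\<^esub>)),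
      ring.zero = (\<lambda>g. 0),
      add = (\<lambda>y z g. y g + z g)\<rparr>"

definition bottom_row :: "diagram \<Rightarrow> vertex set set" where
  "bottom_row p = (\<lambda>s. s \<inter> range Bot) ` p - {{}}"

definition bottom_parts :: "diagram \<Rightarrow> vertex set set" where
  "bottom_parts p = {s \<in> p. s \<subseteq> range Bot}"

text \<open>The diagrams whose classes form a basis of the left ideal.\<close>

definition half_diagrams :: "nat \<Rightarrow> nat \<Rightarrow> (nat \<Rightarrow> nat) \<Rightarrow> diagram set" where
  "half_diagrams l n m =
     {p \<in> tonal_diagrams l n. propagating_vector l p = m
        \<and> bottom_row p = bottom_row (a_diagram l n m)
        \<and> bottom_parts p = bottom_parts (a_diagram l n m)}"

text \<open>
  The \<open>j\<close>-th bottom block of size \<open>i\<close>, from left to right, of a propagating part of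
  \<open>a_diagram l n m\<close>; it has the larger blocks and \<open>j - 1\<close> blocks of its own size to its left.
\<close>

definition block :: "nat \<Rightarrow> (nat \<Rightarrow> nat) \<Rightarrow> nat \<Rightarrow> nat \<Rightarrow> vertex set" where
  "block l m i j =
     (let k = (\<Sum>i'=Suc i..l. i' * m i') + (j - 1) * i in Bot ` {k + 1..k + i})"

definition permute_blocks ::
    "nat \<Rightarrow> (nat \<Rightarrow> nat) \<Rightarrow> (nat \<Rightarrow> nat \<Rightarrow> nat) \<Rightarrow> diagram \<Rightarrow> diagram" where
  "permute_blocks l m \<sigma> p =
     {s \<in> p. \<not> propagating s}
   \<union> {(s \<inter> range Top) \<union> block l m i j | s i j.
        s \<in> p \<and> propagating s \<and> i \<in> {1..l} \<and> j \<in> {1..m i}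
        \<and> s \<inter> range Bot = block l m i (\<sigma> i j)}"

text \<open>The coefficients of an element of the left ideal in the basis given by \<open>half_diagrams\<close>.\<close>

definition half_coeffs ::
    "complex \<Rightarrow> nat \<Rightarrow> nat \<Rightarrow> (nat \<Rightarrow> nat) \<Rightarrow> (diagram \<Rightarrow> complex) set \<Rightarrow> diagram \<Rightarrow> complex" where
  "half_coeffs \<delta> l n m X =
     (THE f. (\<forall>p. p \<notin> half_diagrams l n m \<longrightarrow> f p = 0) \<and> X = quotient_class \<delta> l n m f)"

definition right_action ::
    "complex \<Rightarrow> nat \<Rightarrow> nat \<Rightarrow> (nat \<Rightarrow> nat) \<Rightarrow> (diagram \<Rightarrow> complex) set
     \<Rightarrow> ((nat \<Rightarrow> nat \<Rightarrow> nat) \<Rightarrow> complex) \<Rightarrow> (diagram \<Rightarrow> complex) set" where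
  "right_action \<delta> l n m X z = quotient_class \<delta> l n m
     (\<lambda>q. \<Sum>p\<in>half_diagrams l n m. \<Sum>\<sigma>\<in>carrier (multi_sym_group l m).
        half_coeffs \<delta> l n m X p * z \<sigma> * of_bool (permute_blocks l m \<sigma> p = q))"


section \<open>Specht modules\<close>

definition int_partition :: "nat \<Rightarrow> nat list \<Rightarrow> bool" where
  "int_partition k \<mu> \<longleftrightarrow> sorted_wrt (\<ge>) \<mu> \<and> (\<forall>x\<in>set \<mu>. 0 < x) \<and> sum_list \<mu> = k"

definition young_cells :: "nat list \<Rightarrow> (nat \<times> nat) set" where
  "young_cells \<mu> = {(r, c). r < length \<mu> \<and> c < \<mu> ! r}"

definition tableaux :: "nat list \<Rightarrow> (nat \<times> nat \<Rightarrow> nat) set" where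
  "tableaux \<mu> = {t. bij_betw t (young_cells \<mu>) {1..sum_list \<mu>}}"

text \<open>A tabloid, i.e. a row-equivalence class of tableaux, is encoded by its sequence of row sets.\<close>

type_synonym tabloid = "nat \<Rightarrow> nat set"

definition tabloid_of :: "nat list \<Rightarrow> (nat \<times> nat \<Rightarrow> nat) \<Rightarrow> tabloid" where
  "tabloid_of \<mu> t = (\<lambda>r. t ` {x \<in> young_cells \<mu>. fst x = r})"

definition column_stabilizer :: "nat list \<Rightarrow> (nat \<times> nat \<Rightarrow> nat) \<Rightarrow> (nat \<Rightarrow> nat) set" where
  "column_stabilizer \<mu> t =
     {\<pi>. \<pi> permutes {1..sum_list \<mu>}
        \<and> (\<forall>c. \<pi> ` t ` {x \<in> young_cells \<mu>. snd x = c} = t ` {x \<in> young_cells \<mu>. snd x = c})}"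

definition polytabloid :: "nat list \<Rightarrow> (nat \<times> nat \<Rightarrow> nat) \<Rightarrow> tabloid \<Rightarrow> complex" where
  "polytabloid \<mu> t =
     (\<lambda>T. \<Sum>\<pi>\<in>column_stabilizer \<mu> t. of_int (sign \<pi>) * of_bool (T = tabloid_of \<mu> (\<pi> \<circ> t)))"

definition complex_span :: "('x \<Rightarrow> complex) set \<Rightarrow> ('x \<Rightarrow> complex) set" where
  "complex_span = module.span (\<lambda>c f x. c * f x)"

definition specht_space :: "nat list \<Rightarrow> (tabloid \<Rightarrow> complex) set" where
  "specht_space \<mu> = complex_span (polytabloid \<mu> ` tableaux \<mu>)"

text \<open>
  The outer tensor product is formed inside the tensor product of the spaces of functions on
  tabloids, which is the space of functions on (extensional) \<open>l\<close>-tuples of tabloids.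
\<close>

definition pure_tensor ::
    "nat \<Rightarrow> (nat \<Rightarrow> tabloid \<Rightarrow> complex) \<Rightarrow> (nat \<Rightarrow> tabloid) \<Rightarrow> complex" where
  "pure_tensor l v = (\<lambda>T. if T \<in> extensional {1..l} then \<Prod>i=1..l. v i (T i) else 0)"

definition permute_tabloids ::
    "nat \<Rightarrow> (nat \<Rightarrow> nat \<Rightarrow> nat) \<Rightarrow> (nat \<Rightarrow> tabloid) \<Rightarrow> (nat \<Rightarrow> tabloid)" where
  "permute_tabloids l \<sigma> T = (\<lambda>i. if i \<in> {1..l} then (\<lambda>r. \<sigma> i ` T i r) else T i)"

definition size_vector :: "(nat \<Rightarrow> nat list) \<Rightarrow> nat \<Rightarrow> nat" where
  "size_vector \<mu> = (\<lambda>i. sum_list (\<mu> i))"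

definition specht_module ::
    "nat \<Rightarrow> (nat \<Rightarrow> nat list) \<Rightarrow> ((nat \<Rightarrow> nat \<Rightarrow> nat) \<Rightarrow> complex, (nat \<Rightarrow> tabloid) \<Rightarrow> complex) module" where
  "specht_module l \<mu> =
     (let G = multi_sym_group l (size_vector \<mu>)
      in \<lparr>carrier = complex_span {pure_tensor l v | v. \<forall>i\<in>{1..l}. v i \<in> specht_space (\<mu> i)},
          monoid.mult = undefined, one = undefined,
          ring.zero = (\<lambda>T. 0), add = (\<lambda>x y T. x T + y T),
          smult = (\<lambda>z x T. \<Sum>\<sigma>\<in>carrier G. z \<sigma> * x (permute_tabloids l (inv\<^bsub>G\<^esub> \<sigma>) T))\<rparr>)"


section \<open>Standard modules\<close>

text \<open>
  As \<open>m\<close> vanishes outside \<open>{1..l}\<close>, the entries of a multipartition are \<open>[]\<close> there.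
\<close>

definition multipartitions :: "(nat \<Rightarrow> nat) \<Rightarrow> (nat \<Rightarrow> nat list) set" where
  "multipartitions m = {\<mu>. \<forall>i. int_partition (m i) (\<mu> i)}"

definition labels :: "nat \<Rightarrow> nat \<Rightarrow> (nat \<Rightarrow> nat list) set" where
  "labels l n = (\<Union>m\<in>index_set l n. multipartitions m)"

type_synonym standard_elt =
  "((diagram \<Rightarrow> complex) set \<times> ((nat \<Rightarrow> tabloid) \<Rightarrow> complex) \<Rightarrow>\<^sub>0 int) set"

definition standard_module ::
    "complex \<Rightarrow> nat \<Rightarrow> nat \<Rightarrow> (nat \<Rightarrow> nat list) \<Rightarrow> (diagram \<Rightarrow> complex, standard_elt) module" where
  "standard_module \<delta> l n \<mu> =
     (let m = size_vector \<mu>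
      in tensor_module (group_algebra (multi_sym_group l m))
           (left_ideal_module \<delta> l n m) (right_action \<delta> l n m) (specht_module l \<mu>))"

definition simple_head ::
    "complex \<Rightarrow> nat \<Rightarrow> nat \<Rightarrow> (nat \<Rightarrow> nat list) \<Rightarrow> (diagram \<Rightarrow> complex, standard_elt set) module" where
  "simple_head \<delta> l n \<mu> = module_head (tonal_algebra \<delta> l n) (standard_module \<delta> l n \<mu>)"

definition decomposition_matrix ::
    "complex \<Rightarrow> nat \<Rightarrow> nat \<Rightarrow> (nat \<Rightarrow> nat list) \<Rightarrow> (nat \<Rightarrow> nat list) \<Rightarrow> nat" where
  "decomposition_matrix \<delta> l n \<mu> \<nu> =
     composition_multiplicity (tonal_algebra \<delta> l n) (standard_module \<delta> l n \<mu>) (simple_head \<delta> l n \<nu>)"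

end

theory Submission
  imports Defs
begin

text \<open>
  Let \<open>e\<^sub>r\<close> be \<open>\<delta>\<close> to the power \<open>- k\<close> times the diagram that joins \<open>i\<close> to \<open>i'\<close> for \<open>i \<le> r\<close> and cuts the
  other vertices of each row into \<open>k\<close> blocks of size \<open>l\<close>; it is an idempotent. A diagram in \<open>e\<^sub>r P\<close> has
  \<open>k\<close> non-propagating parts on top, for which a half diagram of weight greater than \<open>r\<close> has no room, so
  \<open>e\<^sub>r\<close> annihilates the standard modules of weight greater than \<open>r\<close>. In a standard module of weight
  \<open>r\<close> every submodule that \<open>e\<^sub>r\<close> does not annihilate is the whole module: the products \<open>p q\<^sup>*\<close> carry
  the component of an element at a half diagram \<open>q\<close> to any other half diagram \<open>p\<close>, and the Specht
  modules are irreducible. Hence exactly one composition factor, the head, is not annihilated by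
  \<open>e\<^sub>r\<close>. So heads of weight \<open>r\<close> do not occur in standard modules of larger weight, and those of
  weight \<open>r\<close> contain them only as their own head. Two heads of weight \<open>r\<close> are
  told apart by an element of \<open>e\<^sub>r P e\<^sub>r\<close>: by a diagram \<open>a\<close> if the propagating vectors differ, by
  a column antisymmetrizer otherwise.

  Products of diagrams are handled through the sets of vertices that are unions of parts: such a
  set for \<open>p p'\<close> extends to the middle row in \<open>2\<close> to the power \<open>c\<close> ways, where \<open>c\<close> is the number of
  closed components.
\<close>

section \<open>Module theory: simple heads and multiplicities detected by an idempotent\<close>

section \<open>Modules generated by an idempotent\<close>

text \<open>Three obstacles shape the argument. In a quotient of a free abelian group it is hard to
  see that an element is nonzero; the model by equivariant functions is there so that elements can
  be told apart by their values. Secondly, the ideal below an index is given by generators only, yet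
  half diagrams must remain independent modulo it: a product that leaves the half diagrams absorbs a
  diagram of smaller index and so falls into the ideal, while the generators have fewer propagating
  parts than half diagrams, every \<open>merge_vec\<close> having coordinate sum -1. Thirdly,
  different indices can have the same weight, and the weight idempotent does not tell them apart.
  The number of propagating parts breaks the tie: the diagram \<open>a\<close> of the index with
  fewer parts (either one in case of equality) annihilates the core of the other module. Since
  composites carry a factor \<delta> for each closed component, nonzero \<delta> is used whenever a
  composite has to be recovered from a product. Irreducibility of Specht modules is James's
  argument; as polytabloids are real, orthogonality to all of them forces a Specht vector to
  vanish.\<close>

abbreviation sandwich where "sandwich M e a x \<equiv> e \<odot>\<^bsub>M\<^esub> (a \<odot>\<^bsub>M\<^esub> (e \<odot>\<^bsub>M\<^esub> x))"

locale left_module = R: ring R + M: abelian_group M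
  for R (structure) and M :: "('a, 'b, 'm) module_scheme" (structure) +
  assumes smult_closed: "\<And>a x. a \<in> carrier R \<Longrightarrow> x \<in> carrier M \<Longrightarrow> a \<odot>\<^bsub>M\<^esub> x \<in> carrier M"
    and smult_l_distr: "\<And>a b x. a \<in> carrier R \<Longrightarrow> b \<in> carrier R \<Longrightarrow> x \<in> carrier M \<Longrightarrow>
          (a \<oplus> b) \<odot>\<^bsub>M\<^esub> x = a \<odot>\<^bsub>M\<^esub> x \<oplus>\<^bsub>M\<^esub> b \<odot>\<^bsub>M\<^esub> x"
    and smult_r_distr: "\<And>a x y. a \<in> carrier R \<Longrightarrow> x \<in> carrier M \<Longrightarrow> y \<in> carrier M \<Longrightarrow>
          a \<odot>\<^bsub>M\<^esub> (x \<oplus>\<^bsub>M\<^esub> y) = a \<odot>\<^bsub>M\<^esub> x \<oplus>\<^bsub>M\<^esub> a \<odot>\<^bsub>M\<^esub> y"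
    and smult_assoc: "\<And>a b x. a \<in> carrier R \<Longrightarrow> b \<in> carrier R \<Longrightarrow> x \<in> carrier M \<Longrightarrow>
          (a \<otimes> b) \<odot>\<^bsub>M\<^esub> x = a \<odot>\<^bsub>M\<^esub> (b \<odot>\<^bsub>M\<^esub> x)"
    and smult_one: "\<And>x. x \<in> carrier M \<Longrightarrow> \<one> \<odot>\<^bsub>M\<^esub> x = x"
begin

lemma smult_r_null: assumes "a \<in> carrier R" shows "a \<odot>\<^bsub>M\<^esub> \<zero>\<^bsub>M\<^esub> = \<zero>\<^bsub>M\<^esub>"
proof -
  let ?z = "a \<odot>\<^bsub>M\<^esub> \<zero>\<^bsub>M\<^esub>"
  have c: "?z \<in> carrier M" using assms by (simp add: smult_closed)
  have "?z \<oplus>\<^bsub>M\<^esub> ?z = ?z \<oplus>\<^bsub>M\<^esub> \<zero>\<^bsub>M\<^esub>"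
    using smult_r_distr[OF assms M.zero_closed M.zero_closed] c by simp
  thus ?thesis using c M.add.l_cancel_one M.zero_closed by (metis M.r_zero M.add.l_cancel_one')
qed

lemma smult_l_null: assumes "x \<in> carrier M" shows "\<zero> \<odot>\<^bsub>M\<^esub> x = \<zero>\<^bsub>M\<^esub>"
proof -
  let ?z = "\<zero> \<odot>\<^bsub>M\<^esub> x"
  have c: "?z \<in> carrier M" using assms by (simp add: smult_closed)
  have "?z \<oplus>\<^bsub>M\<^esub> ?z = ?z \<oplus>\<^bsub>M\<^esub> \<zero>\<^bsub>M\<^esub>"
    using smult_l_distr[OF R.zero_closed R.zero_closed assms] c by simp
  thus ?thesis using c M.add.l_cancel_one M.zero_closed by (metis M.r_zero M.add.l_cancel_one')
qed

lemma smult_uminus_one: assumes "x \<in> carrier M"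
  shows "(\<ominus> \<one>) \<odot>\<^bsub>M\<^esub> x = \<ominus>\<^bsub>M\<^esub> x"
proof -
  have "(\<ominus> \<one>) \<odot>\<^bsub>M\<^esub> x \<oplus>\<^bsub>M\<^esub> x = (\<ominus> \<one> \<oplus> \<one>) \<odot>\<^bsub>M\<^esub> x"
    using assms by (simp add: smult_l_distr smult_one)
  also have "\<dots> = \<zero>\<^bsub>M\<^esub>" using assms by (simp add: R.l_neg smult_l_null)
  finally show ?thesis using assms smult_closed M.minus_equality by auto
qed

text \<open>The scalar -1 turns closure under scalars into closure under negation, which the
  subgroup part of \<open>submodule\<close> asks for.\<close>

lemma submodule_iff:
  "submodule N R M \<longleftrightarrow> N \<subseteq> carrier M \<and> \<zero>\<^bsub>M\<^esub> \<in> N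
     \<and> (\<forall>x\<in>N. \<forall>y\<in>N. x \<oplus>\<^bsub>M\<^esub> y \<in> N) \<and> (\<forall>a\<in>carrier R. \<forall>x\<in>N. a \<odot>\<^bsub>M\<^esub> x \<in> N)" (is "?l \<longleftrightarrow> ?r")
proof
  assume ?l
  then interpret submodule N R M .
  show ?r using subset one_closed m_closed smult_closed by auto
next
  assume r: ?r
  show ?l
  proof (intro submodule.intro subgroup.intro submodule_axioms.intro)
    fix x assume x: "x \<in> N"
    with r have "(\<ominus> \<one>) \<odot>\<^bsub>M\<^esub> x \<in> N" by blast
    moreover have "x \<in> carrier M" using x r by blast
    ultimately have "\<ominus>\<^bsub>M\<^esub> x \<in> N" by (simp add: smult_uminus_one)
    thus "inv\<^bsub>add_monoid M\<^esub> x \<in> N" by (simp add: a_inv_def)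
  qed (use r in auto)
qed

lemma submoduleD:
  assumes "submodule N R M"
  shows "N \<subseteq> carrier M" "\<zero>\<^bsub>M\<^esub> \<in> N" "\<And>x y. x \<in> N \<Longrightarrow> y \<in> N \<Longrightarrow> x \<oplus>\<^bsub>M\<^esub> y \<in> N"
    "\<And>a x. a \<in> carrier R \<Longrightarrow> x \<in> N \<Longrightarrow> a \<odot>\<^bsub>M\<^esub> x \<in> N" "\<And>x. x \<in> N \<Longrightarrow> x \<in> carrier M"
  using assms unfolding submodule_iff by auto

lemma submodule_abelian: "submodule N R M \<Longrightarrow> abelian_subgroup N M"
  by (rule abelian_subgroupI3) (auto intro: additive_subgroupI submodule.axioms M.abelian_group_axioms)

lemma submodule_uminus: "submodule N R M \<Longrightarrow> x \<in> N \<Longrightarrow> \<ominus>\<^bsub>M\<^esub> x \<in> N"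
  using submodule_abelian[THEN abelian_subgroup.axioms(1)] additive_subgroup.a_inv_closed by fastforce

lemma zero_submodule: "submodule {\<zero>\<^bsub>M\<^esub>} R M"
  unfolding submodule_iff by (auto simp: smult_r_null)

lemma carrier_submodule: "submodule (carrier M) R M"
  unfolding submodule_iff by (auto simp: smult_closed)

lemma left_module_submodule:
  assumes "submodule N R M" shows "left_module R (M\<lparr>carrier := N\<rparr>)"
proof (intro left_module.intro left_module_axioms.intro)
  note N = submoduleD[OF assms]
  show "ring R" by (rule R.ring_axioms)
  show "abelian_group (M\<lparr>carrier := N\<rparr>)"
  proof (rule abelian_groupI)
    fix x assume "x \<in> carrier (M\<lparr>carrier := N\<rparr>)"
    hence "x \<in> N" by simp
    thus "\<exists>y\<in>carrier (M\<lparr>carrier := N\<rparr>). y \<oplus>\<^bsub>M\<lparr>carrier := N\<rparr>\<^esub> x = \<zero>\<^bsub>M\<lparr>carrier := N\<rparr>\<^esub>"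
      using submodule_uminus[OF assms] N(1) by (auto intro!: bexI[of _ "\<ominus>\<^bsub>M\<^esub> x"] simp: M.l_neg subsetD)
  qed (use N in \<open>auto simp: M.a_ac subsetD\<close>)
qed (use submoduleD[OF assms] in \<open>auto simp: smult_l_distr smult_r_distr smult_assoc smult_one subsetD\<close>)

text \<open>Lets the factors of a series, which are formed inside the truncated module
  \<open>M\<lparr>carrier := N\<rparr>\<close>, be discussed through submodules of \<open>M\<close>
  itself.\<close>

lemma submodule_of_submodule:
  assumes "submodule N R M"
  shows "submodule N' R (M\<lparr>carrier := N\<rparr>) \<longleftrightarrow> submodule N' R M \<and> N' \<subseteq> N"
  using submoduleD(1)[OF assms]
  unfolding left_module.submodule_iff[OF left_module_submodule[OF assms]] submodule_iff by auto

end

locale left_module_quotient = left_module R M for R (structure) and M :: "('a, 'b, 'm) module_scheme" (structure) +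
  fixes N assumes sub: "submodule N R M"
begin

sublocale N: abelian_subgroup N M by (rule submodule_abelian[OF sub])

lemmas ND = submoduleD[OF sub]

lemma coset_eq_N: "x \<in> carrier M \<Longrightarrow> N +>\<^bsub>M\<^esub> x = N \<longleftrightarrow> x \<in> N"
  using M.a_coset_join1[OF _ _ N.a_subgroup] M.a_coset_join2[OF _ N.a_subgroup] by blast

lemma carrier_quotient: "carrier (quotient_module M N) = (\<lambda>x. N +>\<^bsub>M\<^esub> x) ` carrier M"
  by (auto simp: quotient_module_def A_RCOSETS_def')

lemma zero_quotient: "\<zero>\<^bsub>quotient_module M N\<^esub> = N"
  by (simp add: quotient_module_def)

lemma add_quotient: "x \<in> carrier M \<Longrightarrow> y \<in> carrier M \<Longrightarrow>
   (N +>\<^bsub>M\<^esub> x) \<oplus>\<^bsub>quotient_module M N\<^esub> (N +>\<^bsub>M\<^esub> y) = N +>\<^bsub>M\<^esub> (x \<oplus>\<^bsub>M\<^esub> y)"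
  by (simp add: quotient_module_def N.a_rcos_sum)

lemma smult_quotient:
  assumes "a \<in> carrier R" "x \<in> carrier M"
  shows "a \<odot>\<^bsub>quotient_module M N\<^esub> (N +>\<^bsub>M\<^esub> x) = N +>\<^bsub>M\<^esub> (a \<odot>\<^bsub>M\<^esub> x)"
proof -
  \<comment> \<open>Scalar multiplication of the quotient is a union over all representatives; each
    of them gives the same coset, so the union collapses to it.\<close>
  have "N +>\<^bsub>M\<^esub> (a \<odot>\<^bsub>M\<^esub> y) = N +>\<^bsub>M\<^esub> (a \<odot>\<^bsub>M\<^esub> x)" if "y \<in> N +>\<^bsub>M\<^esub> x" for y
  proof -
    from that obtain h where h: "h \<in> N" "y = h \<oplus>\<^bsub>M\<^esub> x" by (auto simp: a_r_coset_def')
    have "a \<odot>\<^bsub>M\<^esub> y = a \<odot>\<^bsub>M\<^esub> h \<oplus>\<^bsub>M\<^esub> a \<odot>\<^bsub>M\<^esub> x" using h assms ND by (simp add: smult_r_distr)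
    moreover have "a \<odot>\<^bsub>M\<^esub> h \<in> N" using h assms ND by simp
    ultimately have "a \<odot>\<^bsub>M\<^esub> y \<in> N +>\<^bsub>M\<^esub> (a \<odot>\<^bsub>M\<^esub> x)" by (auto simp: a_r_coset_def')
    thus ?thesis using M.a_repr_independence[OF _ _ N.a_subgroup] assms smult_closed by metis
  qed
  moreover have "x \<in> N +>\<^bsub>M\<^esub> x" using N.a_rcos_self assms by simp
  ultimately have "(\<Union>y\<in>N +>\<^bsub>M\<^esub> x. N +>\<^bsub>M\<^esub> (a \<odot>\<^bsub>M\<^esub> y)) = N +>\<^bsub>M\<^esub> (a \<odot>\<^bsub>M\<^esub> x)" by blast
  thus ?thesis by (simp add: quotient_module_def)
qed

lemma coset_zero: "N +>\<^bsub>M\<^esub> \<zero>\<^bsub>M\<^esub> = N" by (simp add: coset_eq_N ND)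

lemma left_module_quotient: "left_module R (quotient_module M N)"
proof (intro left_module.intro left_module_axioms.intro)
  let ?Q = "quotient_module M N"
  show "ring R" by (rule R.ring_axioms)
  show "abelian_group ?Q"
  proof (rule abelian_groupI)
    show "\<zero>\<^bsub>?Q\<^esub> \<in> carrier ?Q"
      unfolding zero_quotient carrier_quotient using coset_zero M.zero_closed by blast
    fix X assume "X \<in> carrier ?Q"
    then obtain x where x: "x \<in> carrier M" "X = N +>\<^bsub>M\<^esub> x" by (auto simp: carrier_quotient)
    show "\<zero>\<^bsub>?Q\<^esub> \<oplus>\<^bsub>?Q\<^esub> X = X"
      using add_quotient[OF M.zero_closed x(1)] x by (simp add: zero_quotient coset_zero)
    have "(N +>\<^bsub>M\<^esub> \<ominus>\<^bsub>M\<^esub> x) \<oplus>\<^bsub>?Q\<^esub> X = \<zero>\<^bsub>?Q\<^esub>"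
      using x by (simp add: add_quotient zero_quotient coset_zero M.l_neg)
    thus "\<exists>Y\<in>carrier ?Q. Y \<oplus>\<^bsub>?Q\<^esub> X = \<zero>\<^bsub>?Q\<^esub>" using x by (auto simp: carrier_quotient)
  qed (auto simp: carrier_quotient add_quotient M.a_ac)
qed (auto simp: carrier_quotient add_quotient smult_quotient smult_closed smult_l_distr smult_r_distr
       smult_assoc smult_one)

text \<open>The correspondence theorem: image and preimage under the coset map match the submodules
  of the quotient with the submodules of \<open>M\<close> that contain \<open>N\<close>.\<close>

lemma simple_quotient_iff: "simple_module R (quotient_module M N) \<longleftrightarrow> maximal_submodule N R M"
proof
  let ?Q = "quotient_module M N"
  note Qiff = left_module.submodule_iff[OF left_module_quotient]
  assume s: "simple_module R ?Q"
  have "N \<noteq> carrier M"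
  proof
    assume N: "N = carrier M"
    have "(\<lambda>x. N +>\<^bsub>M\<^esub> x) ` carrier M \<subseteq> {N}" using coset_eq_N[unfolded N] by (intro image_subsetI) (simp add: N)
    hence "carrier ?Q = {N}" using ND by (auto simp: carrier_quotient)
    with s show False by (simp add: simple_module_def zero_quotient)
  qed
  moreover have "N' = N \<or> N' = carrier M" if N': "submodule N' R M" "N \<subseteq> N'" for N'
  proof -
    note N'D = submoduleD[OF N'(1)]
    let ?S = "(\<lambda>x. N +>\<^bsub>M\<^esub> x) ` N'"
    have "submodule ?S R ?Q"
      unfolding Qiff zero_quotient carrier_quotient
    proof (intro conjI ballI)
      show "N \<in> ?S" using coset_zero N'D(2) by blast
    qed (use N'D in \<open>auto simp: add_quotient smult_quotient\<close>)
    with s consider "?S = {N}" | "?S = carrier ?Q" by (auto simp: simple_module_def zero_quotient)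
    thus ?thesis
    proof cases
      case 1
      have "x \<in> N" if x: "x \<in> N'" for x
      proof -
        have "N +>\<^bsub>M\<^esub> x = N" using 1 x by (metis imageI singletonD)
        thus ?thesis using coset_eq_N N'D(5)[OF x] by simp
      qed
      thus ?thesis using N'(2) by blast
    next
      case 2
      have "x \<in> N'" if x: "x \<in> carrier M" for x
      proof -
        have "N +>\<^bsub>M\<^esub> x \<in> ?S" using 2 x by (simp add: carrier_quotient)
        then obtain y where y: "y \<in> N'" "N +>\<^bsub>M\<^esub> x = N +>\<^bsub>M\<^esub> y" by auto
        hence "x \<in> N +>\<^bsub>M\<^esub> y" using N.a_rcos_self[OF x] by simp
        then obtain h where "h \<in> N" "x = h \<oplus>\<^bsub>M\<^esub> y" by (auto simp: a_r_coset_def')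
        thus ?thesis using N'(2) y N'D by blast
      qed
      thus ?thesis using N'D by blast
    qed
  qed
  ultimately show "maximal_submodule N R M" using sub by (auto simp: maximal_submodule_def)
next
  let ?Q = "quotient_module M N"
  note Qiff = left_module.submodule_iff[OF left_module_quotient]
  assume m: "maximal_submodule N R M"
  then obtain x where x: "x \<in> carrier M" "x \<notin> N" using ND(1) by (auto simp: maximal_submodule_def)
  hence "N +>\<^bsub>M\<^esub> x \<noteq> N" by (simp add: coset_eq_N)
  hence "carrier ?Q \<noteq> {\<zero>\<^bsub>?Q\<^esub>}" using x by (auto simp: carrier_quotient zero_quotient)
  moreover have "S = {\<zero>\<^bsub>?Q\<^esub>} \<or> S = carrier ?Q" if S: "submodule S R ?Q" for S
  proof -
    let ?N' = "{x \<in> carrier M. N +>\<^bsub>M\<^esub> x \<in> S}"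
    note S' = S[unfolded Qiff zero_quotient carrier_quotient]
    have "submodule ?N' R M" unfolding submodule_iff
      using S' by (auto simp: coset_zero add_quotient[symmetric] smult_quotient[symmetric] smult_closed)
    moreover have "N \<subseteq> ?N'"
    proof
      fix x assume "x \<in> N"
      hence "x \<in> carrier M" "N +>\<^bsub>M\<^esub> x = N" using ND coset_eq_N by auto
      thus "x \<in> ?N'" using S' by simp
    qed
    ultimately have "?N' = N \<or> ?N' = carrier M" using m by (auto simp: maximal_submodule_def)
    thus ?thesis
    proof
      assume e: "?N' = N"
      have "X = N" if "X \<in> S" for X
      proof -
        from that S' obtain x where x: "x \<in> carrier M" "X = N +>\<^bsub>M\<^esub> x" by auto
        with that e have "x \<in> N" by auto
        thus ?thesis using x coset_eq_N by simp
      qed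
      thus ?thesis using S' by (auto simp: zero_quotient)
    next
      assume "?N' = carrier M"
      thus ?thesis using S' by (auto simp: carrier_quotient)
    qed
  qed
  ultimately show "simple_module R ?Q" by (simp add: simple_module_def)
qed

end

context left_module begin

text \<open>Puts simplicity of a factor in terms of the lattice of submodules of \<open>M\<close>,
  the form in which a series is both built and analysed.\<close>

lemma series_factor_simple_iff:
  assumes "submodule (Ns ! i) R M" "submodule (Ns ! Suc i) R M" "Ns ! i \<subseteq> Ns ! Suc i"
  shows "simple_module R (series_factor M Ns i) \<longleftrightarrow>
     Ns ! i \<noteq> Ns ! Suc i \<and> (\<forall>N. submodule N R M \<and> Ns ! i \<subseteq> N \<and> N \<subseteq> Ns ! Suc i \<longrightarrow> N = Ns ! i \<or> N = Ns ! Suc i)"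
proof -
  interpret Q: left_module_quotient R "M\<lparr>carrier := Ns ! Suc i\<rparr>" "Ns ! i"
    by (intro left_module_quotient.intro left_module_quotient_axioms.intro left_module_submodule assms(2))
       (simp add: submodule_of_submodule assms)
  show ?thesis unfolding series_factor_def Q.simple_quotient_iff
    by (auto simp: maximal_submodule_def submodule_of_submodule assms)
qed

text \<open>The function \<open>d\<close> stands in for the dimension. By induction on
  \<open>d N\<close>, a submodule of greatest rank strictly below \<open>N\<close> is put under it;
  nothing fits in between because \<open>d\<close> is strictly monotone.\<close>

lemma composition_series_exists:
  fixes d :: "'b set \<Rightarrow> nat"
  assumes d: "\<And>N N'. submodule N R M \<Longrightarrow> submodule N' R M \<Longrightarrow> N \<subset> N' \<Longrightarrow> d N < d N'"
  shows "\<exists>Ns. composition_series R M Ns"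
proof -
  have "\<exists>Ns. Ns \<noteq> [] \<and> hd Ns = {\<zero>\<^bsub>M\<^esub>} \<and> last Ns = N \<and> (\<forall>N\<in>set Ns. submodule N R M)
     \<and> (\<forall>i. Suc i < length Ns \<longrightarrow> Ns ! i \<subseteq> Ns ! Suc i \<and> simple_module R (series_factor M Ns i))"
    if "submodule N R M" for N
    using that
  proof (induction "d N" arbitrary: N rule: less_induct)
    case less
    show ?case
    proof (cases "N = {\<zero>\<^bsub>M\<^esub>}")
      case True
      thus ?thesis by (intro exI[of _ "[N]"]) (auto simp: zero_submodule)
    next
      case False
      let ?P = "\<lambda>N'. submodule N' R M \<and> N' \<subset> N"
      have "?P {\<zero>\<^bsub>M\<^esub>}" using False submoduleD[OF less.prems] zero_submodule by auto
      then obtain N' where N': "?P N'" and mx: "\<And>K. ?P K \<Longrightarrow> d K \<le> d N'"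
        using ex_has_greatest_nat[of ?P _ d "d N"] d less.prems by (metis less_imp_le)
      from less.hyps[OF d] N' less.prems obtain Ns where
        Ns: "Ns \<noteq> []" "hd Ns = {\<zero>\<^bsub>M\<^esub>}" "last Ns = N'" "\<forall>N\<in>set Ns. submodule N R M"
          "\<And>i. Suc i < length Ns \<Longrightarrow> Ns ! i \<subseteq> Ns ! Suc i \<and> simple_module R (series_factor M Ns i)"
        by blast
      let ?Ms = "Ns @ [N]"
      have "?Ms ! i \<subseteq> ?Ms ! Suc i \<and> simple_module R (series_factor M ?Ms i)" if i: "Suc i < length ?Ms" for i
      proof (cases "Suc i < length Ns")
        case True
        hence "?Ms ! i = Ns ! i" "?Ms ! Suc i = Ns ! Suc i" by (auto simp: nth_append)
        thus ?thesis using Ns(5)[OF True] by (simp add: series_factor_def)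
      next
        case False
        hence "Suc i = length Ns" using i by simp
        hence e: "?Ms ! i = N'" "?Ms ! Suc i = N"
          using Ns(1,3) by (auto simp: nth_append last_conv_nth dest: arg_cong[of "Suc i" _ "\<lambda>x. x - 1"])
        have "K = N' \<or> K = N" if "submodule K R M" "N' \<subseteq> K" "K \<subseteq> N" for K
          using mx[of K] d[of N' K] N' that by (metis leD psubsetI)
        thus ?thesis using N' less.prems by (subst series_factor_simple_iff) (auto simp: e)
      qed
      thus ?thesis using Ns less.prems by (intro exI[of _ ?Ms]) auto
    qed
  qed
  from this[OF carrier_submodule] show ?thesis by (simp add: composition_series_def)
qed

end

text \<open>The case distinction on submodules says that every nonzero vector of the form e x
  generates \<open>M\<close>: the submodule generated by such a vector is not annihilated by
  \<open>e\<close>. A module of this kind has just one maximal submodule.\<close>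

locale idempotent_generated_module = left_module R M for R (structure) and M :: "('a, 'b, 'm) module_scheme" (structure) +
  fixes e
  assumes e_closed: "e \<in> carrier R" and e_idem: "e \<otimes> e = e"
    and submodule_cases: "\<And>N. submodule N R M \<Longrightarrow> N = carrier M \<or> (\<forall>x\<in>N. e \<odot>\<^bsub>M\<^esub> x = \<zero>\<^bsub>M\<^esub>)"
    and e_nonzero: "\<exists>x\<in>carrier M. e \<odot>\<^bsub>M\<^esub> x \<noteq> \<zero>\<^bsub>M\<^esub>"
begin

text \<open>The largest submodule annihilated by \<open>e\<close>. Quantifying over \<open>a\<close>
  makes the set stable under the ring, which the kernel of \<open>e\<close> alone need not
  be.\<close>

definition e_radical where
  "e_radical = {x \<in> carrier M. \<forall>a\<in>carrier R. e \<odot>\<^bsub>M\<^esub> (a \<odot>\<^bsub>M\<^esub> x) = \<zero>\<^bsub>M\<^esub>}"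

lemma e_radical_submodule: "submodule e_radical R M"
  unfolding submodule_iff
proof (intro conjI ballI)
  show "\<zero>\<^bsub>M\<^esub> \<in> e_radical" by (auto simp: e_radical_def smult_r_null e_closed)
  show "b \<odot>\<^bsub>M\<^esub> x \<in> e_radical" if b: "b \<in> carrier R" "x \<in> e_radical" for b x
  proof -
    have "e \<odot>\<^bsub>M\<^esub> (a \<odot>\<^bsub>M\<^esub> (b \<odot>\<^bsub>M\<^esub> x)) = \<zero>\<^bsub>M\<^esub>" if "a \<in> carrier R" for a
    proof -
      have "a \<odot>\<^bsub>M\<^esub> (b \<odot>\<^bsub>M\<^esub> x) = (a \<otimes> b) \<odot>\<^bsub>M\<^esub> x"
        using b that by (simp add: smult_assoc e_radical_def)
      thus ?thesis using b that by (simp add: e_radical_def)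
    qed
    thus ?thesis using b by (simp add: e_radical_def smult_closed)
  qed
qed (auto simp: e_radical_def smult_r_distr smult_closed e_closed)

lemma e_radical_nontrivial:
  assumes "x \<in> carrier M" "e \<odot>\<^bsub>M\<^esub> x \<noteq> \<zero>\<^bsub>M\<^esub>" shows "e \<odot>\<^bsub>M\<^esub> x \<notin> e_radical"
proof
  assume "e \<odot>\<^bsub>M\<^esub> x \<in> e_radical"
  \<comment> \<open>With a = 1 the defining condition reads e(ex) = 0, and idempotence makes the
    left side ex.\<close>
  hence "e \<odot>\<^bsub>M\<^esub> (\<one> \<odot>\<^bsub>M\<^esub> (e \<odot>\<^bsub>M\<^esub> x)) = \<zero>\<^bsub>M\<^esub>" by (simp add: e_radical_def)
  hence "(e \<otimes> e) \<odot>\<^bsub>M\<^esub> x = \<zero>\<^bsub>M\<^esub>"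
    using assms e_closed by (simp add: smult_one smult_closed smult_assoc)
  thus False using assms e_idem by simp
qed

lemma e_radical_proper: "e_radical \<noteq> carrier M"
proof -
  obtain x where "x \<in> carrier M" "e \<odot>\<^bsub>M\<^esub> x \<noteq> \<zero>\<^bsub>M\<^esub>" using e_nonzero by blast
  thus ?thesis using e_radical_nontrivial smult_closed[OF e_closed] by blast
qed

lemma proper_submodule_le:
  assumes "submodule N R M" "N \<noteq> carrier M" shows "N \<subseteq> e_radical"
proof
  fix x assume x: "x \<in> N"
  have "\<forall>x\<in>N. e \<odot>\<^bsub>M\<^esub> x = \<zero>\<^bsub>M\<^esub>" using submodule_cases assms by blast
  thus "x \<in> e_radical" using x submoduleD[OF assms(1)] by (auto simp: e_radical_def)
qed

lemma maximal_submodule_iff: "maximal_submodule N R M \<longleftrightarrow> N = e_radical"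
proof
  assume "maximal_submodule N R M"
  thus "N = e_radical"
    unfolding maximal_submodule_def using proper_submodule_le e_radical_submodule e_radical_proper by blast
next
  assume "N = e_radical"
  thus "maximal_submodule N R M"
    unfolding maximal_submodule_def using proper_submodule_le e_radical_submodule e_radical_proper by blast
qed

lemma head_eq: "module_head R M = quotient_module M e_radical"
proof -
  have "module_radical R M = e_radical"
    using submoduleD(1)[OF e_radical_submodule] by (auto simp: module_radical_def maximal_submodule_iff)
  thus ?thesis by (simp add: module_head_def)
qed

sublocale head: left_module_quotient R M e_radical
  by (intro left_module_quotient.intro left_module_axioms left_module_quotient_axioms.intro e_radical_submodule)

lemma head_left_module: "left_module R (module_head R M)"
  unfolding head_eq by (rule head.left_module_quotient)

lemma head_e_nonzero: "\<exists>X\<in>carrier (module_head R M). e \<odot>\<^bsub>module_head R M\<^esub> X \<noteq> \<zero>\<^bsub>module_head R M\<^esub>"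
proof -
  obtain x where x: "x \<in> carrier M" "e \<odot>\<^bsub>M\<^esub> x \<noteq> \<zero>\<^bsub>M\<^esub>" using e_nonzero by blast
  hence "e_radical +>\<^bsub>M\<^esub> (e \<odot>\<^bsub>M\<^esub> x) \<noteq> e_radical"
    using e_radical_nontrivial head.coset_eq_N smult_closed[OF e_closed] by simp
  thus ?thesis using x e_closed unfolding head_eq
    by (auto simp: head.carrier_quotient head.zero_quotient head.smult_quotient intro!: bexI[of _ x])
qed

end

text \<open>Isomorphisms are only asked to respect sums and scalars; the image of zero is its own
  double, hence zero.\<close>

lemma module_iso_zero:
  assumes "left_module R M" "left_module R N" "f \<in> carrier M \<rightarrow> carrier N"
    "\<forall>x\<in>carrier M. \<forall>y\<in>carrier M. f (x \<oplus>\<^bsub>M\<^esub> y) = f x \<oplus>\<^bsub>N\<^esub> f y"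
  shows "f \<zero>\<^bsub>M\<^esub> = \<zero>\<^bsub>N\<^esub>"
proof -
  interpret M: left_module R M by fact
  interpret N: left_module R N by fact
  have c: "f \<zero>\<^bsub>M\<^esub> \<in> carrier N" using assms(3) by auto
  have "f \<zero>\<^bsub>M\<^esub> \<oplus>\<^bsub>N\<^esub> f \<zero>\<^bsub>M\<^esub> = f \<zero>\<^bsub>M\<^esub> \<oplus>\<^bsub>N\<^esub> \<zero>\<^bsub>N\<^esub>"
    using assms(4)[rule_format, of "\<zero>\<^bsub>M\<^esub>" "\<zero>\<^bsub>M\<^esub>"] c by simp
  thus ?thesis using c N.M.add.l_cancel_one' N.M.r_zero by metis
qed

context left_module begin

lemma factor_left_module:
  assumes "composition_series R M Ns" "Suc i < length Ns"
  shows "left_module_quotient R (M\<lparr>carrier := Ns ! Suc i\<rparr>) (Ns ! i)"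
proof -
  have "submodule (Ns ! i) R M" "submodule (Ns ! Suc i) R M" "Ns ! i \<subseteq> Ns ! Suc i"
    using assms by (auto simp: composition_series_def)
  thus ?thesis
    by (intro left_module_quotient.intro left_module_quotient_axioms.intro left_module_submodule)
       (simp_all add: submodule_of_submodule)
qed

lemma factor_e_zero:
  assumes "composition_series R M Ns" "Suc i < length Ns" "a \<in> carrier R"
    and z: "\<And>x. x \<in> Ns ! Suc i \<Longrightarrow> a \<odot>\<^bsub>M\<^esub> x = \<zero>\<^bsub>M\<^esub>"
    and X: "X \<in> carrier (series_factor M Ns i)"
  shows "a \<odot>\<^bsub>series_factor M Ns i\<^esub> X = \<zero>\<^bsub>series_factor M Ns i\<^esub>"
proof -
  interpret Q: left_module_quotient R "M\<lparr>carrier := Ns ! Suc i\<rparr>" "Ns ! i"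
    by (rule factor_left_module[OF assms(1,2)])
  obtain x where x: "x \<in> Ns ! Suc i" "X = Ns ! i +>\<^bsub>M\<lparr>carrier := Ns ! Suc i\<rparr>\<^esub> x"
    using X by (auto simp: series_factor_def Q.carrier_quotient)
  show ?thesis using x z[OF x(1)] Q.smult_quotient[OF assms(3), of x] Q.coset_zero
    by (simp add: series_factor_def Q.zero_quotient)
qed

text \<open>A scalar that is zero on a submodule is zero on its quotients and on all isomorphic
  copies of these. In this way a factor is told apart from a head without being computed.\<close>

lemma not_iso_if_killed:
  assumes "composition_series R M Ns" "Suc i < length Ns" "a \<in> carrier R"
    and z: "\<And>x. x \<in> Ns ! Suc i \<Longrightarrow> a \<odot>\<^bsub>M\<^esub> x = \<zero>\<^bsub>M\<^esub>"
    and L: "left_module R L" "\<exists>X\<in>carrier L. a \<odot>\<^bsub>L\<^esub> X \<noteq> \<zero>\<^bsub>L\<^esub>"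
  shows "\<not> module_iso R (series_factor M Ns i) L"
proof
  interpret Q: left_module_quotient R "M\<lparr>carrier := Ns ! Suc i\<rparr>" "Ns ! i"
    by (rule factor_left_module[OF assms(1,2)])
  let ?F = "series_factor M Ns i"
  assume "module_iso R ?F L"
  then obtain f where f: "bij_betw f (carrier ?F) (carrier L)"
    "\<forall>x\<in>carrier ?F. \<forall>y\<in>carrier ?F. f (x \<oplus>\<^bsub>?F\<^esub> y) = f x \<oplus>\<^bsub>L\<^esub> f y"
    "\<forall>a\<in>carrier R. \<forall>x\<in>carrier ?F. f (a \<odot>\<^bsub>?F\<^esub> x) = a \<odot>\<^bsub>L\<^esub> f x" by (auto simp: module_iso_def)
  have F: "left_module R ?F" unfolding series_factor_def by (rule Q.left_module_quotient)
  have 0: "f \<zero>\<^bsub>?F\<^esub> = \<zero>\<^bsub>L\<^esub>"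
    by (rule module_iso_zero[OF F L(1) _ f(2)]) (use f(1) in \<open>auto simp: bij_betw_def\<close>)
  from L(2) obtain Y where Y: "Y \<in> carrier L" "a \<odot>\<^bsub>L\<^esub> Y \<noteq> \<zero>\<^bsub>L\<^esub>" by blast
  with f(1) obtain X where X: "X \<in> carrier ?F" "Y = f X" by (auto simp: bij_betw_def)
  have "a \<odot>\<^bsub>L\<^esub> Y = f (a \<odot>\<^bsub>?F\<^esub> X)" using f(3) assms(3) X by simp
  also have "\<dots> = \<zero>\<^bsub>L\<^esub>" using factor_e_zero[OF assms(1-3) z X(1)] 0 by simp
  finally show False using Y by simp
qed

text \<open>The series behind the multiplicity is an arbitrary choice, so the argument is made for
  an unspecified one; existence guarantees that the choice does return a series.\<close>

lemma composition_multiplicity_killed: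
  assumes ex: "\<exists>Ns. composition_series R M Ns" and "a \<in> carrier R"
    and z: "\<And>x. x \<in> carrier M \<Longrightarrow> a \<odot>\<^bsub>M\<^esub> x = \<zero>\<^bsub>M\<^esub>"
    and L: "left_module R L" "\<exists>X\<in>carrier L. a \<odot>\<^bsub>L\<^esub> X \<noteq> \<zero>\<^bsub>L\<^esub>"
  shows "composition_multiplicity R M L = 0"
proof -
  define Ns where "Ns = (SOME Ns. composition_series R M Ns)"
  have Ns: "composition_series R M Ns" unfolding Ns_def using ex by (rule someI_ex)
  have "\<not> module_iso R (series_factor M Ns i) L" if i: "Suc i < length Ns" for i
  proof (rule not_iso_if_killed[OF Ns i assms(2) _ L])
    fix x assume "x \<in> Ns ! Suc i"
    moreover have "submodule (Ns ! Suc i) R M" using Ns i by (auto simp: composition_series_def)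
    ultimately show "a \<odot>\<^bsub>M\<^esub> x = \<zero>\<^bsub>M\<^esub>" using z submoduleD(5) by blast
  qed
  hence "{i. Suc i < length Ns \<and> module_iso R (series_factor M Ns i) L} = {}" by blast
  thus ?thesis unfolding composition_multiplicity_def Ns_def[symmetric] Let_def by (simp only: card.empty)
qed

end

lemma module_iso_refl: "module_iso R M M"
  unfolding module_iso_def by (rule exI[of _ id]) auto

context idempotent_generated_module begin

text \<open>Only the last factor of a composition series is not killed by \<open>e\<close>, and it is the head.\<close>

lemma composition_multiplicity_eq:
  assumes ex: "\<exists>Ns. composition_series R M Ns"
    and L: "left_module R L" "\<exists>X\<in>carrier L. e \<odot>\<^bsub>L\<^esub> X \<noteq> \<zero>\<^bsub>L\<^esub>"
  shows "composition_multiplicity R M L = of_bool (module_iso R (module_head R M) L)"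
proof -
  define Ns where "Ns = (SOME Ns. composition_series R M Ns)"
  have cs: "composition_series R M Ns" unfolding Ns_def using ex by (rule someI_ex)
  hence Ns: "Ns \<noteq> []" "hd Ns = {\<zero>\<^bsub>M\<^esub>}" "last Ns = carrier M" "\<forall>N\<in>set Ns. submodule N R M"
    "\<And>i. Suc i < length Ns \<Longrightarrow> Ns ! i \<subseteq> Ns ! Suc i \<and> simple_module R (series_factor M Ns i)"
    by (auto simp: composition_series_def)
  have sm: "submodule (Ns ! i) R M" if "i < length Ns" for i using that Ns(4) by simp
  have strict: "Ns ! i \<subset> Ns ! Suc i" if i: "Suc i < length Ns" for i
    using Ns(5)[OF i] sm series_factor_simple_iff[of Ns i] i by auto
  have neq: "Ns ! i \<noteq> carrier M" if i: "Suc i < length Ns" for i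
    using strict[OF i] submoduleD(1)[OF sm[OF i]] by blast
  have len: "length Ns \<ge> 2"
  proof (rule ccontr)
    assume "\<not> length Ns \<ge> 2"
    with Ns(1) obtain N where "Ns = [N]" by (cases Ns) (auto simp: Suc_le_eq)
    hence "carrier M = {\<zero>\<^bsub>M\<^esub>}" using Ns by simp
    thus False using e_nonzero smult_r_null[OF e_closed] by auto
  qed
  \<comment> \<open>The factors are numbered from 0 and there is one fewer of them than entries of
    the series, so this is the number of the last factor.\<close>
  define k where "k = length Ns - 2"
  have k: "Suc (Suc k) = length Ns" using len by (simp add: k_def)
  have last: "Ns ! Suc k = carrier M" using Ns(1,3) k by (metis diff_Suc_1 last_conv_nth)
  have head: "series_factor M Ns k = module_head R M"
  proof -
    have "maximal_submodule (Ns ! k) R M"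
    proof -
      have "simple_module R (series_factor M Ns k)" using Ns(5)[of k] k by simp
      hence "Ns ! k \<noteq> carrier M \<and> (\<forall>N. submodule N R M \<and> Ns ! k \<subseteq> N \<and> N \<subseteq> carrier M \<longrightarrow> N = Ns ! k \<or> N = carrier M)"
        using series_factor_simple_iff[of Ns k] sm[of k] sm[of "Suc k"] Ns(5)[of k] k by (simp add: last)
      thus ?thesis using sm[of k] k submoduleD(1) unfolding maximal_submodule_def
        by (metis Suc_lessD lessI)
    qed
    hence "Ns ! k = e_radical" by (simp add: maximal_submodule_iff)
    thus ?thesis by (simp add: series_factor_def head_eq last)
  qed
  \<comment> \<open>Every earlier factor sits inside a proper submodule, which \<open>e\<close>
    annihilates by the case distinction.\<close>
  have other: "\<not> module_iso R (series_factor M Ns i) L" if i: "Suc i < length Ns" "i \<noteq> k" for i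
  proof (rule not_iso_if_killed[OF cs i(1) e_closed _ L])
    have "Suc (Suc i) < length Ns" using i k by linarith
    hence "Ns ! Suc i \<noteq> carrier M" using neq by blast
    thus "e \<odot>\<^bsub>M\<^esub> x = \<zero>\<^bsub>M\<^esub>" if "x \<in> Ns ! Suc i" for x
      using submodule_cases[OF sm[OF i(1)]] that by blast
  qed
  have "{i. Suc i < length Ns \<and> module_iso R (series_factor M Ns i) L}
      = (if module_iso R (module_head R M) L then {k} else {})"
  proof -
    have "{i. Suc i < length Ns \<and> module_iso R (series_factor M Ns i) L}
        = {i. i = k \<and> module_iso R (series_factor M Ns i) L}"
      using other k by (intro Collect_cong) (metis lessI)
    thus ?thesis unfolding head[symmetric] by auto
  qed
  thus ?thesis unfolding composition_multiplicity_def Ns_def[symmetric] Let_def by simp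
qed

text \<open>The invariant that tells heads apart. If eae is zero on \<open>M'\<close>, it is zero on
  both heads, so e(aex) lies in the radical of \<open>M\<close>; a vector of the form ey in the
  radical is zero by idempotence.\<close>

lemma head_iso_kills:
  assumes M': "idempotent_generated_module R M' e"
    and iso: "module_iso R (module_head R M') (module_head R M)"
    and a: "a \<in> carrier R" "\<forall>x\<in>carrier M'. sandwich M' e a x = \<zero>\<^bsub>M'\<^esub>"
    and x: "x \<in> carrier M"
  shows "sandwich M e a x = \<zero>\<^bsub>M\<^esub>"
proof (rule ccontr)
  interpret M': idempotent_generated_module R M' e by fact
  let ?L = "module_head R M" and ?L' = "module_head R M'"
  let ?y = "sandwich M e a x"
  let ?b = "e \<otimes> (a \<otimes> e)"
  have b: "?b \<in> carrier R" using a e_closed by simp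
  have yb: "?y = ?b \<odot>\<^bsub>M\<^esub> x" using a e_closed x by (simp add: smult_assoc smult_closed)
  assume "?y \<noteq> \<zero>\<^bsub>M\<^esub>"
  hence nz: "?y \<notin> e_radical"
    using e_radical_nontrivial[of "a \<odot>\<^bsub>M\<^esub> (e \<odot>\<^bsub>M\<^esub> x)"] x a e_closed smult_closed by blast
  from iso obtain f where f: "bij_betw f (carrier ?L') (carrier ?L)"
    "\<forall>x\<in>carrier ?L'. \<forall>y\<in>carrier ?L'. f (x \<oplus>\<^bsub>?L'\<^esub> y) = f x \<oplus>\<^bsub>?L\<^esub> f y"
    "\<forall>a\<in>carrier R. \<forall>x\<in>carrier ?L'. f (a \<odot>\<^bsub>?L'\<^esub> x) = a \<odot>\<^bsub>?L\<^esub> f x" by (auto simp: module_iso_def)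
  have 0: "f \<zero>\<^bsub>?L'\<^esub> = \<zero>\<^bsub>?L\<^esub>"
    by (rule module_iso_zero[OF M'.head_left_module head_left_module _ f(2)]) (use f(1) in \<open>auto simp: bij_betw_def\<close>)
  have "e_radical +>\<^bsub>M\<^esub> x \<in> carrier ?L" using x by (simp add: head_eq head.carrier_quotient)
  then obtain X' where X': "X' \<in> carrier ?L'" "f X' = e_radical +>\<^bsub>M\<^esub> x"
    using f(1) by (auto simp: bij_betw_def) (metis (no_types, lifting) imageE)
  then obtain x' where x': "x' \<in> carrier M'" "X' = M'.e_radical +>\<^bsub>M'\<^esub> x'"
    by (auto simp: M'.head_eq M'.head.carrier_quotient)
  have "?b \<odot>\<^bsub>M'\<^esub> x' = \<zero>\<^bsub>M'\<^esub>"
    using a x' e_closed by (simp add: M'.smult_assoc M'.smult_closed)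
  hence "?b \<odot>\<^bsub>?L'\<^esub> X' = \<zero>\<^bsub>?L'\<^esub>"
    using x' b by (simp add: M'.head_eq M'.head.smult_quotient M'.head.zero_quotient M'.head.coset_zero)
  hence "?b \<odot>\<^bsub>?L\<^esub> (e_radical +>\<^bsub>M\<^esub> x) = \<zero>\<^bsub>?L\<^esub>" using f(3) b X' 0 by metis
  hence "e_radical +>\<^bsub>M\<^esub> ?y = e_radical"
    using x b by (simp add: head_eq head.smult_quotient head.zero_quotient yb)
  moreover have "?y \<in> carrier M" using x a e_closed by (simp add: smult_closed)
  ultimately show False using nz head.coset_eq_N by blast
qed

end

section \<open>Transport along module isomorphisms\<close>

text \<open>The module axioms of \<open>S\<close> are to be derived from those of \<open>V\<close>:
  the intended target is a tensor product, where they are awkward to check on cosets, while the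
  source is a concrete space of functions.\<close>

locale left_module_iso = left_module R V for R (structure) and V :: "('a, 'b, 'm) module_scheme" +
  fixes S :: "('a, 'c, 'n) module_scheme" and \<Psi>
  assumes bij: "bij_betw \<Psi> (carrier V) (carrier S)" and iso_zero: "\<Psi> \<zero>\<^bsub>V\<^esub> = \<zero>\<^bsub>S\<^esub>"
    and iso_add: "\<And>x y. x \<in> carrier V \<Longrightarrow> y \<in> carrier V \<Longrightarrow> \<Psi> (x \<oplus>\<^bsub>V\<^esub> y) = \<Psi> x \<oplus>\<^bsub>S\<^esub> \<Psi> y"
    and iso_smult: "\<And>a x. a \<in> carrier R \<Longrightarrow> x \<in> carrier V \<Longrightarrow> \<Psi> (a \<odot>\<^bsub>V\<^esub> x) = a \<odot>\<^bsub>S\<^esub> \<Psi> x"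
begin

lemma carrier_iso: "carrier S = \<Psi> ` carrier V"
  using bij by (simp add: bij_betw_def)

lemma inj_iso: "x \<in> carrier V \<Longrightarrow> y \<in> carrier V \<Longrightarrow> \<Psi> x = \<Psi> y \<longleftrightarrow> x = y"
  using bij by (auto simp: bij_betw_def inj_on_def)

lemma iso_left_module: "left_module R S"
proof (intro left_module.intro left_module_axioms.intro)
  show "ring R" by (rule R.ring_axioms)
  note [simp] = iso_add[symmetric] iso_smult[symmetric] iso_zero[symmetric] smult_closed
  have e: "\<And>x. x \<in> carrier S \<Longrightarrow> \<exists>y\<in>carrier V. x = \<Psi> y" using carrier_iso by blast
  have c: "\<And>x. x \<in> carrier V \<Longrightarrow> \<Psi> x \<in> carrier S" using carrier_iso by blast
  show "abelian_group S"
  proof (rule abelian_groupI)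
    show "x \<oplus>\<^bsub>S\<^esub> y \<in> carrier S" if "x \<in> carrier S" "y \<in> carrier S" for x y using e[OF that(1)] e[OF that(2)] c by auto
    show "\<zero>\<^bsub>S\<^esub> \<in> carrier S" using c by simp
    show "x \<oplus>\<^bsub>S\<^esub> y \<oplus>\<^bsub>S\<^esub> z = x \<oplus>\<^bsub>S\<^esub> (y \<oplus>\<^bsub>S\<^esub> z)" if "x \<in> carrier S" "y \<in> carrier S" "z \<in> carrier S" for x y z
      using e[OF that(1)] e[OF that(2)] e[OF that(3)] by (auto simp: M.add.m_assoc)
    show "x \<oplus>\<^bsub>S\<^esub> y = y \<oplus>\<^bsub>S\<^esub> x" if "x \<in> carrier S" "y \<in> carrier S" for x y
      using e[OF that(1)] e[OF that(2)] by (auto simp: M.add.m_comm)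
    show "\<zero>\<^bsub>S\<^esub> \<oplus>\<^bsub>S\<^esub> x = x" if "x \<in> carrier S" for x using e[OF that] by auto
    show "\<exists>y\<in>carrier S. y \<oplus>\<^bsub>S\<^esub> x = \<zero>\<^bsub>S\<^esub>" if x: "x \<in> carrier S" for x
    proof -
      obtain y where y: "y \<in> carrier V" "x = \<Psi> y" using e[OF x] by blast
      thus ?thesis using c by (intro bexI[of _ "\<Psi> (\<ominus>\<^bsub>V\<^esub> y)"]) (simp_all add: M.l_neg)
    qed
  qed
  fix a b x y
  assume a: "a \<in> carrier R" and x: "x \<in> carrier S"
  obtain x' where x': "x' \<in> carrier V" "x = \<Psi> x'" using e[OF x] by blast
  show "a \<odot>\<^bsub>S\<^esub> x \<in> carrier S" using a x' c by simp
  show "b \<in> carrier R \<Longrightarrow> (a \<oplus> b) \<odot>\<^bsub>S\<^esub> x = a \<odot>\<^bsub>S\<^esub> x \<oplus>\<^bsub>S\<^esub> b \<odot>\<^bsub>S\<^esub> x" using a x' by (simp add: smult_l_distr)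
  show "b \<in> carrier R \<Longrightarrow> (a \<otimes> b) \<odot>\<^bsub>S\<^esub> x = a \<odot>\<^bsub>S\<^esub> (b \<odot>\<^bsub>S\<^esub> x)" using a x' by (simp add: smult_assoc)
  show "y \<in> carrier S \<Longrightarrow> a \<odot>\<^bsub>S\<^esub> (x \<oplus>\<^bsub>S\<^esub> y) = a \<odot>\<^bsub>S\<^esub> x \<oplus>\<^bsub>S\<^esub> a \<odot>\<^bsub>S\<^esub> y"
    using e[of y] a x' by (auto simp: smult_r_distr)
next
  show "x \<in> carrier S \<Longrightarrow> \<one> \<odot>\<^bsub>S\<^esub> x = x" for x
    unfolding carrier_iso using iso_smult[OF R.one_closed] smult_one by auto
qed

definition pre :: "'c set \<Rightarrow> 'b set" where "pre N = {x \<in> carrier V. \<Psi> x \<in> N}"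

lemma pre_submodule:
  assumes "submodule N R S" shows "submodule (pre N) R V" "N = \<Psi> ` pre N"
proof -
  interpret S: left_module R S by (rule iso_left_module)
  note N = S.submoduleD[OF assms]
  show "submodule (pre N) R V"
    unfolding submodule_iff pre_def using N(2-4) by (auto simp: iso_zero iso_add iso_smult smult_closed)
  show "N = \<Psi> ` pre N" using N(1) by (auto simp: carrier_iso pre_def)
qed

text \<open>The rank function lives on the concrete module, so submodules of \<open>S\<close> are
  ranked by their preimages.\<close>

lemma composition_series_iso:
  fixes d :: "'b set \<Rightarrow> nat"
  assumes d: "\<And>N N'. submodule N R V \<Longrightarrow> submodule N' R V \<Longrightarrow> N \<subset> N' \<Longrightarrow> d N < d N'"
  shows "\<exists>Ns. composition_series R S Ns"
proof (rule left_module.composition_series_exists[OF iso_left_module])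
  fix N N' assume N: "submodule N R S" "submodule N' R S" "N \<subset> N'"
  have "pre N \<subseteq> pre N'" using N(3) by (auto simp: pre_def)
  moreover have "pre N \<noteq> pre N'"
  proof
    assume "pre N = pre N'"
    hence "\<Psi> ` pre N = \<Psi> ` pre N'" by simp
    thus False using N(3) unfolding pre_submodule(2)[OF N(1), symmetric] pre_submodule(2)[OF N(2), symmetric] by blast
  qed
  ultimately show "d (pre N) < d (pre N')" using d[OF pre_submodule(1)[OF N(1)] pre_submodule(1)[OF N(2)]] by blast
qed

lemma idempotent_generated_iso:
  assumes "idempotent_generated_module R V e" shows "idempotent_generated_module R S e"
proof -
  interpret V: idempotent_generated_module R V e by fact
  have z: "e \<odot>\<^bsub>S\<^esub> \<Psi> x = \<zero>\<^bsub>S\<^esub> \<longleftrightarrow> e \<odot>\<^bsub>V\<^esub> x = \<zero>\<^bsub>V\<^esub>" if "x \<in> carrier V" for x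
    using that inj_iso[of "e \<odot>\<^bsub>V\<^esub> x" "\<zero>\<^bsub>V\<^esub>"] by (simp add: iso_smult[symmetric] iso_zero[symmetric] V.e_closed smult_closed)
  show ?thesis
  proof (intro idempotent_generated_module.intro iso_left_module idempotent_generated_module_axioms.intro V.e_closed V.e_idem)
    show "N = carrier S \<or> (\<forall>x\<in>N. e \<odot>\<^bsub>S\<^esub> x = \<zero>\<^bsub>S\<^esub>)" if N: "submodule N R S" for N
    proof -
      note p = pre_submodule[OF N]
      have "pre N = carrier V \<or> (\<forall>x\<in>pre N. e \<odot>\<^bsub>V\<^esub> x = \<zero>\<^bsub>V\<^esub>)" by (rule V.submodule_cases[OF p(1)])
      thus ?thesis
      proof
        assume "pre N = carrier V" thus ?thesis using p(2) carrier_iso by simp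
      next
        assume *: "\<forall>x\<in>pre N. e \<odot>\<^bsub>V\<^esub> x = \<zero>\<^bsub>V\<^esub>"
        have "e \<odot>\<^bsub>S\<^esub> y = \<zero>\<^bsub>S\<^esub>" if "y \<in> N" for y
        proof -
          obtain x where "x \<in> pre N" "y = \<Psi> x" using p(2) \<open>y \<in> N\<close> by blast
          thus ?thesis using * z[of x] by (simp add: pre_def)
        qed
        thus ?thesis by blast
      qed
    qed
    show "\<exists>x\<in>carrier S. e \<odot>\<^bsub>S\<^esub> x \<noteq> \<zero>\<^bsub>S\<^esub>" using V.e_nonzero z carrier_iso by blast
  qed
qed

end

lemma module_iso_sym:
  assumes "left_module R M" "module_iso R M N" shows "module_iso R N M"
proof -
  interpret left_module R M by fact
  obtain f where f: "bij_betw f (carrier M) (carrier N)"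
    "\<And>x y. x \<in> carrier M \<Longrightarrow> y \<in> carrier M \<Longrightarrow> f (x \<oplus>\<^bsub>M\<^esub> y) = f x \<oplus>\<^bsub>N\<^esub> f y"
    "\<And>a x. a \<in> carrier R \<Longrightarrow> x \<in> carrier M \<Longrightarrow> f (a \<odot>\<^bsub>M\<^esub> x) = a \<odot>\<^bsub>N\<^esub> f x"
    using assms(2) unfolding module_iso_def by blast
  let ?g = "inv_into (carrier M) f"
  have g: "?g y \<in> carrier M" "f (?g y) = y" if "y \<in> carrier N" for y
    using that bij_betw_imp_surj_on[OF f(1)] by (auto intro: inv_into_into f_inv_into_f)
  have gf: "?g (f x) = x" if "x \<in> carrier M" for x using bij_betw_inv_into_left[OF f(1) that] .
  have "?g (x \<oplus>\<^bsub>N\<^esub> y) = ?g x \<oplus>\<^bsub>M\<^esub> ?g y" if "x \<in> carrier N" "y \<in> carrier N" for x y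
    using gf[of "?g x \<oplus>\<^bsub>M\<^esub> ?g y"] f(2)[of "?g x" "?g y"] g that by simp
  moreover have "?g (a \<odot>\<^bsub>N\<^esub> x) = a \<odot>\<^bsub>M\<^esub> ?g x" if "a \<in> carrier R" "x \<in> carrier N" for a x
    using gf[of "a \<odot>\<^bsub>M\<^esub> ?g x"] f(3)[of a "?g x"] g that smult_closed by simp
  ultimately show ?thesis using bij_betw_inv_into[OF f(1)] unfolding module_iso_def by blast
qed

lemma tensor_relationsI:
  "x \<in> carrier M \<Longrightarrow> x' \<in> carrier M \<Longrightarrow> y \<in> carrier N \<Longrightarrow>
    frag_of (x \<oplus>\<^bsub>M\<^esub> x', y) - frag_of (x, y) - frag_of (x', y) \<in> tensor_relations R M ac N"
  "x \<in> carrier M \<Longrightarrow> y \<in> carrier N \<Longrightarrow> y' \<in> carrier N \<Longrightarrow>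
    frag_of (x, y \<oplus>\<^bsub>N\<^esub> y') - frag_of (x, y) - frag_of (x, y') \<in> tensor_relations R M ac N"
  "x \<in> carrier M \<Longrightarrow> r \<in> carrier R \<Longrightarrow> y \<in> carrier N \<Longrightarrow>
    frag_of (ac x r, y) - frag_of (x, r \<odot>\<^bsub>N\<^esub> y) \<in> tensor_relations R M ac N"
  unfolding tensor_relations_def by blast+

lemma tensor_relationsE:
  assumes "c \<in> tensor_relations R M ac N"
  obtains (left) x x' y where "x \<in> carrier M" "x' \<in> carrier M" "y \<in> carrier N"
      "c = frag_of (x \<oplus>\<^bsub>M\<^esub> x', y) - frag_of (x, y) - frag_of (x', y)"
  | (right) x y y' where "x \<in> carrier M" "y \<in> carrier N" "y' \<in> carrier N"
      "c = frag_of (x, y \<oplus>\<^bsub>N\<^esub> y') - frag_of (x, y) - frag_of (x, y')"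
  | (balanced) x r y where "x \<in> carrier M" "r \<in> carrier R" "y \<in> carrier N"
      "c = frag_of (ac x r, y) - frag_of (x, r \<odot>\<^bsub>N\<^esub> y)"
  using assms unfolding tensor_relations_def by blast

section \<open>Combinatorics of diagrams: composition through two-colourings, and the algebra built
  on it\<close>

section \<open>Unions of parts\<close>

definition row_pair :: "nat set \<Rightarrow> nat set \<Rightarrow> vertex set" where
  "row_pair f g = Top ` f \<union> Bot ` g"

text \<open>Within the vertices of \<open>p\<close> such a set is a union of parts. Taken as a
  relation between subsets of the top row and subsets of the bottom row, the notion turns
  composition of diagrams into composition of relations.\<close>

definition compatible :: "diagram \<Rightarrow> nat set \<Rightarrow> nat set \<Rightarrow> bool" where
  "compatible p f g \<longleftrightarrow> (\<forall>s\<in>p. s \<subseteq> row_pair f g \<or> s \<inter> row_pair f g = {})"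

lemma row_pair_simps [simp]:
  "Top i \<in> row_pair f g \<longleftrightarrow> i \<in> f" "Bot i \<in> row_pair f g \<longleftrightarrow> i \<in> g" "Mid i \<notin> row_pair f g"
  by (auto simp: row_pair_def)

lemma row_pair_vertices: "f \<subseteq> {1..n} \<Longrightarrow> g \<subseteq> {1..m} \<Longrightarrow> row_pair f g \<subseteq> Top ` {1..n} \<union> Bot ` {1..m}"
  by (auto simp: row_pair_def)

lemma eq_row_pair:
  assumes "s \<subseteq> Top ` {1..n} \<union> Bot ` {1..m}"
  obtains f g where "s = row_pair f g" "f \<subseteq> {1..n}" "g \<subseteq> {1..m}"
proof (rule that)
  show "s = row_pair {i. Top i \<in> s} {i. Bot i \<in> s}"
    using assms by (fastforce simp: row_pair_def)
qed (use assms in auto)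

lemma diagramsD:
  assumes "p \<in> diagrams n m"
  shows "\<Union>p = Top ` {1..n} \<union> Bot ` {1..m}" "{} \<notin> p"
    "\<And>s t x. s \<in> p \<Longrightarrow> t \<in> p \<Longrightarrow> x \<in> s \<Longrightarrow> x \<in> t \<Longrightarrow> s = t"
    "\<And>s. s \<in> p \<Longrightarrow> s \<subseteq> Top ` {1..n} \<union> Bot ` {1..m}"
  using assms unfolding diagrams_def partition_on_def disjoint_def mem_Collect_eq by blast+

lemma finite_diagrams: "finite (diagrams n m)"
proof (rule finite_subset)
  show "diagrams n m \<subseteq> Pow (Pow (Top ` {1..n} \<union> Bot ` {1..m}))"
    using diagramsD(4) by blast
qed simp

lemma finite_diagram: "p \<in> diagrams n m \<Longrightarrow> finite p"
  by (rule finite_subset[of _ "Pow (Top ` {1..n} \<union> Bot ` {1..m})"]) (use diagramsD(4) in blast, simp)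

lemma compatible_part:
  assumes "p \<in> diagrams n m" "row_pair f g \<in> p" shows "compatible p f g"
  unfolding compatible_def using diagramsD(3)[OF assms(1)] assms(2) by blast

lemma compatible_empty [simp]: "compatible p {} {}"
  by (auto simp: compatible_def row_pair_def)

text \<open>Parts are the minimal nonempty compatible sets. A part \<open>s\<close> of
  \<open>p\<close> is compatible with \<open>q\<close>, so it contains every part \<open>t\<close>
  of \<open>q\<close> that it meets; exchanging the roles puts \<open>s\<close> inside
  \<open>t\<close>.\<close>

lemma diagram_subset_if_compatible:
  assumes p: "p \<in> diagrams n m" and q: "q \<in> diagrams n m"
    and c: "\<And>f g. f \<subseteq> {1..n} \<Longrightarrow> g \<subseteq> {1..m} \<Longrightarrow> compatible p f g \<longleftrightarrow> compatible q f g"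
  shows "p \<subseteq> q"
proof
  fix s assume s: "s \<in> p"
  obtain f g where fg: "s = row_pair f g" "f \<subseteq> {1..n}" "g \<subseteq> {1..m}"
    using eq_row_pair diagramsD(4)[OF p s] by metis
  obtain x where x: "x \<in> s" using s diagramsD(2)[OF p] by fastforce
  obtain t where t: "t \<in> q" "x \<in> t" using x s diagramsD(1)[OF p] diagramsD(1)[OF q] by blast
  obtain f' g' where fg': "t = row_pair f' g'" "f' \<subseteq> {1..n}" "g' \<subseteq> {1..m}"
    using eq_row_pair diagramsD(4)[OF q t(1)] by metis
  have "compatible p f g" using compatible_part[OF p] s fg by simp
  hence "compatible q f g" using c fg by simp
  hence 1: "t \<subseteq> s" unfolding compatible_def using t x fg(1) by blast
  have "compatible q f' g'" using compatible_part[OF q] t fg' by simp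
  hence "compatible p f' g'" using c fg' by simp
  hence "s \<subseteq> t" unfolding compatible_def using s t x fg'(1) by blast
  with 1 t show "s \<in> q" by auto
qed

lemma diagram_eqI:
  assumes "p \<in> diagrams n m" "q \<in> diagrams n m"
    and "\<And>f g. f \<subseteq> {1..n} \<Longrightarrow> g \<subseteq> {1..m} \<Longrightarrow> compatible p f g \<longleftrightarrow> compatible q f g"
  shows "p = q"
  using diagram_subset_if_compatible[OF assms(1,2)] diagram_subset_if_compatible[OF assms(2,1)] assms(3)
  by blast

text \<open>Congruence of the two cardinalities is additive over disjoint unions, so it passes from
  parts to unions of parts. In this form it chains through the middle row of a composition.\<close>

lemma tonal_iff_compatible:
  assumes p: "p \<in> diagrams n m"
  shows "(\<forall>s\<in>p. tone_part l s) \<longleftrightarrow>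
    (\<forall>f g. f \<subseteq> {1..n} \<longrightarrow> g \<subseteq> {1..m} \<longrightarrow> compatible p f g \<longrightarrow> card f mod l = card g mod l)"
proof -
  have row: "row_pair f g \<inter> range Top = Top ` f" "row_pair f g \<inter> range Bot = Bot ` g" for f g
    by (auto simp: row_pair_def)
  have cards: "card (row_pair f g \<inter> range Top) = card f" "card (row_pair f g \<inter> range Bot) = card g" for f g
    unfolding row by (auto simp: card_image inj_on_def)
  show ?thesis
  proof
    assume t: "\<forall>s\<in>p. tone_part l s"
    show "\<forall>f g. f \<subseteq> {1..n} \<longrightarrow> g \<subseteq> {1..m} \<longrightarrow> compatible p f g \<longrightarrow> card f mod l = card g mod l"
    proof (intro allI impI)
      fix f g assume fg: "f \<subseteq> {1..n}" "g \<subseteq> {1..m}" "compatible p f g"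
      let ?A = "{s \<in> p. s \<subseteq> row_pair f g}"
      have U: "row_pair f g = \<Union>?A"
      proof
        show "row_pair f g \<subseteq> \<Union>?A"
        proof
          fix x assume x: "x \<in> row_pair f g"
          then obtain s where s: "s \<in> p" "x \<in> s" using row_pair_vertices[OF fg(1,2)] diagramsD(1)[OF p] by blast
          with fg(3) x have "s \<subseteq> row_pair f g" unfolding compatible_def by blast
          with s show "x \<in> \<Union>?A" by blast
        qed
      qed blast
      have fin: "finite ?A" "\<And>s. s \<in> ?A \<Longrightarrow> finite s"
        using finite_diagram[OF p] diagramsD(4)[OF p] by (auto intro: finite_subset)
      have card_sum: "card (row_pair f g \<inter> X) = (\<Sum>s\<in>?A. card (s \<inter> X))" for X
      proof -
        have "row_pair f g \<inter> X = (\<Union>s\<in>?A. s \<inter> X)" using U by blast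
        moreover have "card (\<Union>s\<in>?A. s \<inter> X) = (\<Sum>s\<in>?A. card (s \<inter> X))"
        proof (rule card_UN_disjoint)
          show "\<forall>i\<in>?A. \<forall>j\<in>?A. i \<noteq> j \<longrightarrow> (i \<inter> X) \<inter> (j \<inter> X) = {}" using diagramsD(3)[OF p] by blast
        qed (use fin in auto)
        ultimately show ?thesis by simp
      qed
      have "card f mod l = (\<Sum>s\<in>?A. card (s \<inter> range Top) mod l) mod l"
        using card_sum[of "range Top"] by (simp add: cards mod_sum_eq)
      also have "\<dots> = (\<Sum>s\<in>?A. card (s \<inter> range Bot) mod l) mod l"
        using t unfolding tone_part_def by (metis (mono_tags, lifting) mem_Collect_eq sum.cong)
      also have "\<dots> = card g mod l"
        using card_sum[of "range Bot"] by (simp add: cards mod_sum_eq)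
      finally show "card f mod l = card g mod l" .
    qed
  next
    assume r: "\<forall>f g. f \<subseteq> {1..n} \<longrightarrow> g \<subseteq> {1..m} \<longrightarrow> compatible p f g \<longrightarrow> card f mod l = card g mod l"
    show "\<forall>s\<in>p. tone_part l s"
    proof
      fix s assume s: "s \<in> p"
      obtain f g where fg: "s = row_pair f g" "f \<subseteq> {1..n}" "g \<subseteq> {1..m}"
        using eq_row_pair diagramsD(4)[OF p s] by metis
      have "compatible p f g" using compatible_part[OF p] s fg by simp
      thus "tone_part l s" using r fg by (simp add: tone_part_def cards)
    qed
  qed
qed

section \<open>Composition of diagrams\<close>

context
  fixes n m r :: nat and p p' :: diagram
  assumes p: "p \<in> diagrams n m" and p': "p' \<in> diagrams m r"
begin

private abbreviation "U \<equiv> Top ` {1..n} \<union> Mid ` {1..m} \<union> Bot ` {1..r}"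
private abbreviation "Q \<equiv> glue n m r p p'"

private lemma QU: "\<Union>Q = U" and Qne: "{} \<notin> Q"
  and Qdisj: "\<And>s t x. s \<in> Q \<Longrightarrow> t \<in> Q \<Longrightarrow> x \<in> s \<Longrightarrow> x \<in> t \<Longrightarrow> s = t"
proof -
  note g = glue_finest(1)[OF p p']
  show "\<Union>Q = U" using partition_onD1[OF g] by simp
  show "{} \<notin> Q" by (rule partition_onD3[OF g])
  show "s = t" if "s \<in> Q" "t \<in> Q" "x \<in> s" "x \<in> t" for s t x
    using disjointD[OF partition_onD2[OF g] that(1,2)] that(3,4) by blast
qed

text \<open>A vertex set is a union of classes of the generated equivalence relation exactly if it
  splits none of the generating parts; \<open>f\<close>, \<open>h\<close> and \<open>g\<close> are
  its traces on the three rows.\<close>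

private lemma compatible_glue:
  assumes "f \<subseteq> {1..n}" "h \<subseteq> {1..m}" "g \<subseteq> {1..r}"
  defines "Z \<equiv> Top ` f \<union> Mid ` h \<union> Bot ` g"
  shows "compatible p f h \<and> compatible p' h g \<longleftrightarrow> (\<forall>t\<in>Q. t \<subseteq> Z \<or> t \<inter> Z = {})"
proof
  assume c: "compatible p f h \<and> compatible p' h g"
  have s: "s \<subseteq> Z \<or> s \<inter> Z = {}" if s: "s \<in> stacked_parts p p'" for s
    using s unfolding stacked_parts_def
  proof
    assume "s \<in> (`) bot_to_mid ` p"
    then obtain s' where s': "s' \<in> p" "s = bot_to_mid ` s'" by blast
    have v: "s' \<subseteq> Top ` {1..n} \<union> Bot ` {1..m}" using diagramsD(4)[OF p s'(1)] .
    have "bot_to_mid x \<in> Z \<longleftrightarrow> x \<in> row_pair f h" if "x \<in> s'" for x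
      using that v by (cases x) (auto simp: Z_def)
    moreover have "s' \<subseteq> row_pair f h \<or> s' \<inter> row_pair f h = {}" using c s' by (auto simp: compatible_def)
    ultimately show ?thesis using s'(2) by blast
  next
    assume "s \<in> (`) top_to_mid ` p'"
    then obtain s' where s': "s' \<in> p'" "s = top_to_mid ` s'" by blast
    have v: "s' \<subseteq> Top ` {1..m} \<union> Bot ` {1..r}" using diagramsD(4)[OF p' s'(1)] .
    have "top_to_mid x \<in> Z \<longleftrightarrow> x \<in> row_pair h g" if "x \<in> s'" for x
      using that v by (cases x) (auto simp: Z_def)
    moreover have "s' \<subseteq> row_pair h g \<or> s' \<inter> row_pair h g = {}" using c s' by (auto simp: compatible_def)
    ultimately show ?thesis using s'(2) by blast
  qed
  have step: "x \<in> Z \<longleftrightarrow> y \<in> Z" if "(x, y) \<in> (\<Union>s\<in>stacked_parts p p'. s \<times> s)\<^sup>+" for x y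
    using that
  proof (induction rule: trancl_induct)
    case (base y) thus ?case using s by blast
  next
    case (step y z) thus ?case using s by blast
  qed
  show "\<forall>t\<in>Q. t \<subseteq> Z \<or> t \<inter> Z = {}"
  proof
    fix t assume "t \<in> Q"
    then obtain x where "t = (\<Union>s\<in>stacked_parts p p'. s \<times> s)\<^sup>+ `` {x}"
      unfolding glue_def by (rule quotientE)
    thus "t \<subseteq> Z \<or> t \<inter> Z = {}" using step by blast
  qed
next
  assume c: "\<forall>t\<in>Q. t \<subseteq> Z \<or> t \<inter> Z = {}"
  have s: "s \<subseteq> Z \<or> s \<inter> Z = {}" if "s \<in> stacked_parts p p'" for s
    using glue_finest(2)[OF p p' that] c by blast
  show "compatible p f h \<and> compatible p' h g"
    unfolding compatible_def
  proof (intro conjI ballI)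
    fix s assume s': "s \<in> p"
    have v: "s \<subseteq> Top ` {1..n} \<union> Bot ` {1..m}" using diagramsD(4)[OF p s'] .
    have "bot_to_mid x \<in> Z \<longleftrightarrow> x \<in> row_pair f h" if "x \<in> s" for x
      using that v by (cases x) (auto simp: Z_def)
    moreover have "bot_to_mid ` s \<subseteq> Z \<or> bot_to_mid ` s \<inter> Z = {}"
      by (rule s) (use s' in \<open>auto simp: stacked_parts_def\<close>)
    ultimately show "s \<subseteq> row_pair f h \<or> s \<inter> row_pair f h = {}" by blast
  next
    fix s assume s': "s \<in> p'"
    have v: "s \<subseteq> Top ` {1..m} \<union> Bot ` {1..r}" using diagramsD(4)[OF p' s'] .
    have "top_to_mid x \<in> Z \<longleftrightarrow> x \<in> row_pair h g" if "x \<in> s" for x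
      using that v by (cases x) (auto simp: Z_def)
    moreover have "top_to_mid ` s \<subseteq> Z \<or> top_to_mid ` s \<inter> Z = {}"
      by (rule s) (use s' in \<open>auto simp: stacked_parts_def\<close>)
    ultimately show "s \<subseteq> row_pair h g \<or> s \<inter> row_pair h g = {}" by blast
  qed
qed

lemma diagram_comp_closed: "diagram_comp n m r p p' \<in> diagrams n r"
  unfolding diagrams_def mem_Collect_eq diagram_comp_def
proof (rule partition_onI)
  have "\<Union>((\<lambda>s. s - range Mid) ` Q - {{}}) = \<Union>Q - range Mid" by blast
  also have "\<dots> = Top ` {1..n} \<union> Bot ` {1..r}" unfolding QU by auto
  finally show "\<Union>((\<lambda>s. s - range Mid) ` Q - {{}}) = Top ` {1..n} \<union> Bot ` {1..r}" .
  show "disjnt s t" if st: "s \<in> (\<lambda>s. s - range Mid) ` Q - {{}}" "t \<in> (\<lambda>s. s - range Mid) ` Q - {{}}"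
    "s \<noteq> t" for s t
  proof (rule ccontr)
    assume "\<not> disjnt s t"
    then obtain x where x: "x \<in> s" "x \<in> t" by (auto simp: disjnt_def)
    from st obtain s' t' where "s' \<in> Q" "s = s' - range Mid" "t' \<in> Q" "t = t' - range Mid" by blast
    with x Qdisj st(3) show False by blast
  qed
qed auto

text \<open>
  Two-valued colourings of the middle row: each closed component can be coloured freely, all
  other components get the colour of the outer vertices in them.
\<close>

lemma card_compatible_comp:
  assumes f: "f \<subseteq> {1..n}" and g: "g \<subseteq> {1..r}"
  shows "card {h. h \<subseteq> {1..m} \<and> compatible p f h \<and> compatible p' h g} =
    (if compatible (diagram_comp n m r p p') f g then 2 ^ closed_components n m r p p' else 0)"
proof -
  define Z where "Z h = Top ` f \<union> Mid ` h \<union> Bot ` g" for h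
  define A where "A = {h. h \<subseteq> {1..m} \<and> (\<forall>t\<in>Q. t \<subseteq> Z h \<or> t \<inter> Z h = {})}"
  define Cl where "Cl = {s \<in> Q. s \<subseteq> Mid ` {1..m}}"
  have set_eq: "{h. h \<subseteq> {1..m} \<and> compatible p f h \<and> compatible p' h g} = A"
    unfolding A_def Z_def by (intro Collect_cong conj_cong refl compatible_glue[OF f _ g])
  have Zrow: "t \<inter> Z h - range Mid = t \<inter> row_pair f g" for t h by (auto simp: Z_def row_pair_def)
  show ?thesis
  proof (cases "compatible (diagram_comp n m r p p') f g")
    case False
    have "A = {}"
    proof (rule ccontr)
      assume "A \<noteq> {}"
      then obtain h where h: "\<forall>t\<in>Q. t \<subseteq> Z h \<or> t \<inter> Z h = {}" by (auto simp: A_def)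
      have "compatible (diagram_comp n m r p p') f g"
        unfolding compatible_def diagram_comp_def
      proof
        fix s assume "s \<in> (\<lambda>s. s - range Mid) ` Q - {{}}"
        then obtain t where t: "t \<in> Q" "s = t - range Mid" by blast
        from h t(1) have "t \<subseteq> Z h \<or> t \<inter> Z h = {}" by blast
        thus "s \<subseteq> row_pair f g \<or> s \<inter> row_pair f g = {}" using Zrow[of t h] t(2) by blast
      qed
      with False show False by simp
    qed
    thus ?thesis using False by (simp only: set_eq if_False card.empty)
  next
    case True
    \<comment> \<open>Components with an outer vertex, all of whose outer vertices are in the given
      set. Their middle vertices are forced into \<open>h\<close>.\<close>
    define Op where "Op = {t \<in> Q. \<not> t \<subseteq> range Mid \<and> t - range Mid \<subseteq> row_pair f g}"
    have QM: "t \<subseteq> Mid ` {1..m} \<longleftrightarrow> t \<subseteq> range Mid" if "t \<in> Q" for t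
    proof
      assume a: "t \<subseteq> range Mid"
      have "t \<subseteq> U" using QU that by blast
      show "t \<subseteq> Mid ` {1..m}"
      proof
        fix x assume x: "x \<in> t"
        with a obtain i where "x = Mid i" by blast
        moreover have "x \<in> U" using x \<open>t \<subseteq> U\<close> by blast
        ultimately show "x \<in> Mid ` {1..m}" by auto
      qed
    qed blast
    have Cl: "Cl = {t \<in> Q. t \<subseteq> range Mid}" unfolding Cl_def using QM by blast
    have op: "t - range Mid \<subseteq> row_pair f g \<or> t \<inter> row_pair f g = {}" if "t \<in> Q" for t
    proof (cases "t \<subseteq> range Mid")
      case True thus ?thesis by auto
    next
      case False
      hence "t - range Mid \<in> diagram_comp n m r p p'" using that by (auto simp: diagram_comp_def)
      moreover have "t \<inter> row_pair f g = (t - range Mid) \<inter> row_pair f g" by (auto simp: row_pair_def)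
      ultimately show ?thesis using True unfolding compatible_def by auto
    qed
    \<comment> \<open>A colouring corresponds to the set of closed components it contains: the
      forced components are added on the way there and dropped on the way back.\<close>
    have "bij_betw (\<lambda>S. {i \<in> {1..m}. \<exists>t\<in>S \<union> Op. Mid i \<in> t}) (Pow Cl) A"
    proof (rule bij_betw_byWitness[where f' = "\<lambda>h. {t \<in> Cl. t \<subseteq> Mid ` h}"])
      show "\<forall>S\<in>Pow Cl. {t \<in> Cl. t \<subseteq> Mid ` {i \<in> {1..m}. \<exists>t\<in>S \<union> Op. Mid i \<in> t}} = S"
      proof
        fix S assume S: "S \<in> Pow Cl"
        have 1: "t \<in> S" if t: "t \<in> {t \<in> Cl. t \<subseteq> Mid ` {i \<in> {1..m}. \<exists>t\<in>S \<union> Op. Mid i \<in> t}}" for t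
        proof -
        obtain x where "x \<in> t" using t Qne by (fastforce simp: Cl)
        with t obtain i t' where i: "x = Mid i" "t' \<in> S \<union> Op" "Mid i \<in> t'" by blast
        have "t' \<in> Q" using i S by (auto simp: Cl Op_def)
        have "t \<in> Q" using t by (simp add: Cl)
        from Qdisj[OF this \<open>t' \<in> Q\<close> \<open>x \<in> t\<close>] i have "t = t'" by simp
        with i t show "t \<in> S" by (auto simp: Cl Op_def)
        qed
        have 2: "t \<in> {t \<in> Cl. t \<subseteq> Mid ` {i \<in> {1..m}. \<exists>t\<in>S \<union> Op. Mid i \<in> t}}" if t: "t \<in> S" for t
        proof -
        have "t \<in> Cl" using t S by auto
        moreover have "t \<subseteq> Mid ` {i \<in> {1..m}. \<exists>t\<in>S \<union> Op. Mid i \<in> t}"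
          using t \<open>t \<in> Cl\<close> unfolding Cl_def by blast
        ultimately show ?thesis by blast
        qed
        show "{t \<in> Cl. t \<subseteq> Mid ` {i \<in> {1..m}. \<exists>t\<in>S \<union> Op. Mid i \<in> t}} = S" using 1 2 by blast
      qed
      show "\<forall>h\<in>A. {i \<in> {1..m}. \<exists>t\<in>{t \<in> Cl. t \<subseteq> Mid ` h} \<union> Op. Mid i \<in> t} = h"
      proof
        fix h assume h: "h \<in> A"
        have 1: "i \<in> h" if "i \<in> {i \<in> {1..m}. \<exists>t\<in>{t \<in> Cl. t \<subseteq> Mid ` h} \<union> Op. Mid i \<in> t}" for i
        proof -
        from that obtain t where t: "t \<in> {t \<in> Cl. t \<subseteq> Mid ` h} \<union> Op" "Mid i \<in> t" by blast
        show "i \<in> h"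
        proof (cases "t \<in> Op")
          case True
          hence "t \<inter> row_pair f g \<noteq> {}" "t \<in> Q" by (auto simp: Op_def)
          hence "t \<inter> Z h \<noteq> {}" using Zrow[of t h] by blast
          with h \<open>t \<in> Q\<close> have "t \<subseteq> Z h" by (auto simp: A_def)
          with t show ?thesis by (auto simp: Z_def)
        next
          case False with t show ?thesis by auto
        qed
        qed
        have 2: "i \<in> {i \<in> {1..m}. \<exists>t\<in>{t \<in> Cl. t \<subseteq> Mid ` h} \<union> Op. Mid i \<in> t}" if i: "i \<in> h" for i
        proof -
        have i1: "i \<in> {1..m}" using h i by (auto simp: A_def)
        then obtain t where t: "t \<in> Q" "Mid i \<in> t" using QU by blast
        have "Mid i \<in> Z h" using i by (simp add: Z_def)
        hence tZ: "t \<subseteq> Z h" using h t by (auto simp: A_def)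
        have "t \<in> {t \<in> Cl. t \<subseteq> Mid ` h} \<union> Op"
        proof (cases "t \<subseteq> range Mid")
          case True
          hence "t \<subseteq> Mid ` h" using tZ by (auto simp: Z_def)
          thus ?thesis using True t by (auto simp: Cl)
        next
          case False
          have "t - range Mid \<subseteq> row_pair f g" using tZ Zrow[of t h] by blast
          thus ?thesis using False t by (auto simp: Op_def)
        qed
        with t i1 show ?thesis by blast
        qed
        show "{i \<in> {1..m}. \<exists>t\<in>{t \<in> Cl. t \<subseteq> Mid ` h} \<union> Op. Mid i \<in> t} = h" using 1 2 by blast
      qed
      show "(\<lambda>S. {i \<in> {1..m}. \<exists>t\<in>S \<union> Op. Mid i \<in> t}) ` Pow Cl \<subseteq> A"
      proof (rule image_subsetI)
        fix S assume S: "S \<in> Pow Cl"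
        let ?h = "{i \<in> {1..m}. \<exists>t\<in>S \<union> Op. Mid i \<in> t}"
        have "t \<subseteq> Z ?h \<or> t \<inter> Z ?h = {}" if t: "t \<in> Q" for t
        proof (cases "t \<in> S \<union> Op")
          case True
          have "x \<in> Z ?h" if x: "x \<in> t" for x
          proof (cases x)
            case (Mid i)
            have "i \<in> {1..m}" using x t QU Mid by blast
            thus ?thesis using True x Mid by (auto simp: Z_def)
          qed (use True x S in \<open>auto simp: Op_def Cl Z_def row_pair_def\<close>)
          thus ?thesis by blast
        next
          case False
          have "x \<notin> Z ?h" if x: "x \<in> t" for x
          proof
            assume xZ: "x \<in> Z ?h"
            show False
            proof (cases "x \<in> range Mid")
              case True
              then obtain i t' where i: "x = Mid i" "t' \<in> S \<union> Op" "Mid i \<in> t'" using xZ by (auto simp: Z_def)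
              have "t' \<in> Q" using i S by (auto simp: Cl Op_def)
              from Qdisj[OF t this x] i have "t = t'" by simp
              with i False show False by simp
            next
              case nm: False
              hence "x \<in> row_pair f g" using xZ by (auto simp: Z_def)
              with x op[OF t] have "t - range Mid \<subseteq> row_pair f g" by blast
              with nm x t have "t \<in> Op" by (auto simp: Op_def)
              with False show False by simp
            qed
          qed
          thus ?thesis by blast
        qed
        thus "?h \<in> A" by (auto simp: A_def)
      qed
    qed auto
    from bij_betw_same_card[OF this] have "card A = card (Pow Cl)" by simp
    also have "\<dots> = 2 ^ closed_components n m r p p'"
    proof -
      have "finite Q" by (rule finite_UnionD) (simp add: QU)
      thus ?thesis by (simp add: card_Pow closed_components_def Cl_def)
    qed
    finally show ?thesis using True by (simp only: set_eq if_True)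
  qed
qed

lemma compatible_comp_iff:
  assumes "f \<subseteq> {1..n}" "g \<subseteq> {1..r}"
  shows "compatible (diagram_comp n m r p p') f g \<longleftrightarrow>
    (\<exists>h\<subseteq>{1..m}. compatible p f h \<and> compatible p' h g)"
proof -
  let ?H = "{h. h \<subseteq> {1..m} \<and> compatible p f h \<and> compatible p' h g}"
  have "finite ?H" by (rule finite_subset[of _ "Pow {1..m}"]) auto
  hence "(\<exists>h\<subseteq>{1..m}. compatible p f h \<and> compatible p' h g) \<longleftrightarrow> card ?H \<noteq> 0" by auto
  thus ?thesis unfolding card_compatible_comp[OF assms] by simp
qed

text \<open>One count identifies both data. At the empty sets, which are compatible with every
  diagram, it gives the exponent; where it is nonzero in general gives the compatible pairs and
  hence the diagram.\<close>

lemma diagram_compI: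
  assumes q: "q \<in> diagrams n r"
    and c: "\<And>f g. f \<subseteq> {1..n} \<Longrightarrow> g \<subseteq> {1..r} \<Longrightarrow>
       card {h. h \<subseteq> {1..m} \<and> compatible p f h \<and> compatible p' h g} = (if compatible q f g then 2 ^ k else 0)"
  shows "diagram_comp n m r p p' = q" "closed_components n m r p p' = k"
proof -
  have eq: "(if compatible (diagram_comp n m r p p') f g then 2 ^ closed_components n m r p p' else 0)
      = (if compatible q f g then (2::nat) ^ k else 0)" if "f \<subseteq> {1..n}" "g \<subseteq> {1..r}" for f g
    using c[OF that] card_compatible_comp[OF that] by simp
  show "closed_components n m r p p' = k" using eq[of "{}" "{}"] by simp
  show "diagram_comp n m r p p' = q"
  proof (rule diagram_eqI[OF diagram_comp_closed q])
    show "compatible (diagram_comp n m r p p') f g \<longleftrightarrow> compatible q f g"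
      if "f \<subseteq> {1..n}" "g \<subseteq> {1..r}" for f g
      using eq[OF that] by (simp split: if_splits)
  qed
qed

end

abbreviation "dcomp n \<equiv> diagram_comp n n n"
abbreviation "loops n \<equiv> closed_components n n n"

text \<open>Both bracketings count the same pairs of colourings of the two middle rows, summed in a
  different order. The count determines the product diagram as well as the total number of
  loops.\<close>

lemma diagram_comp_assoc:
  assumes p: "p \<in> diagrams n n" and q: "q \<in> diagrams n n" and r: "r \<in> diagrams n n"
  shows "dcomp n (dcomp n p q) r = dcomp n p (dcomp n q r)"
    and "loops n p q + loops n (dcomp n p q) r
       = loops n q r + loops n p (dcomp n q r)"
proof -
  let ?N = "{1..n}" and ?o = "dcomp n" and ?c = "loops n"
  have fin: "finite {h. h \<subseteq> ?N \<and> P h}" for P by (rule finite_subset[of _ "Pow ?N"]) auto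
  have left: "card {(h, h'). h \<subseteq> ?N \<and> h' \<subseteq> ?N \<and> compatible p f h \<and> compatible q h h' \<and> compatible r h' g}
     = (if compatible (?o (?o p q) r) f g then 2 ^ (?c p q + ?c (?o p q) r) else 0)" (is "card ?S = _")
    if fg: "f \<subseteq> ?N" "g \<subseteq> ?N" for f g
  proof -
    have "?S = (\<lambda>(x, y). (y, x)) ` (SIGMA h':{h'. h' \<subseteq> ?N \<and> compatible r h' g}.
        {h. h \<subseteq> ?N \<and> compatible p f h \<and> compatible q h h'})" by (auto simp: image_iff)
    moreover have "inj_on (\<lambda>(x, y). (y, x)) X" for X :: "(nat set \<times> nat set) set" by (auto simp: inj_on_def)
    ultimately have "card ?S = (\<Sum>h'\<in>{h'. h' \<subseteq> ?N \<and> compatible r h' g}.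
        card {h. h \<subseteq> ?N \<and> compatible p f h \<and> compatible q h h'})"
      using fin by (simp add: card_image)
    also have "\<dots> = (\<Sum>h'\<in>{h'. h' \<subseteq> ?N \<and> compatible r h' g}. if compatible (?o p q) f h' then 2 ^ ?c p q else 0)"
      by (intro sum.cong refl card_compatible_comp p q fg) auto
    also have "\<dots> = (\<Sum>h'\<in>{h'. h' \<subseteq> ?N \<and> compatible (?o p q) f h' \<and> compatible r h' g}. 2 ^ ?c p q)"
      by (intro sum.mono_neutral_cong_right fin) auto
    also have "\<dots> = 2 ^ ?c p q * card {h'. h' \<subseteq> ?N \<and> compatible (?o p q) f h' \<and> compatible r h' g}" by simp
    also have "\<dots> = (if compatible (?o (?o p q) r) f g then 2 ^ (?c p q + ?c (?o p q) r) else 0)"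
      using card_compatible_comp[OF diagram_comp_closed[OF p q] r fg] by (simp add: power_add)
    finally show ?thesis .
  qed
  have right: "card {(h, h'). h \<subseteq> ?N \<and> h' \<subseteq> ?N \<and> compatible p f h \<and> compatible q h h' \<and> compatible r h' g}
     = (if compatible (?o p (?o q r)) f g then 2 ^ (?c q r + ?c p (?o q r)) else 0)" (is "card ?S = _")
    if fg: "f \<subseteq> ?N" "g \<subseteq> ?N" for f g
  proof -
    have "?S = (SIGMA h:{h. h \<subseteq> ?N \<and> compatible p f h}.
        {h'. h' \<subseteq> ?N \<and> compatible q h h' \<and> compatible r h' g})" by auto
    hence "card ?S = (\<Sum>h\<in>{h. h \<subseteq> ?N \<and> compatible p f h}.
        card {h'. h' \<subseteq> ?N \<and> compatible q h h' \<and> compatible r h' g})"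
      using fin by simp
    also have "\<dots> = (\<Sum>h\<in>{h. h \<subseteq> ?N \<and> compatible p f h}. if compatible (?o q r) h g then 2 ^ ?c q r else 0)"
      by (intro sum.cong refl card_compatible_comp q r fg) auto
    also have "\<dots> = (\<Sum>h\<in>{h. h \<subseteq> ?N \<and> compatible p f h \<and> compatible (?o q r) h g}. 2 ^ ?c q r)"
      by (intro sum.mono_neutral_cong_right fin) auto
    also have "\<dots> = 2 ^ ?c q r * card {h. h \<subseteq> ?N \<and> compatible p f h \<and> compatible (?o q r) h g}" by simp
    also have "\<dots> = (if compatible (?o p (?o q r)) f g then 2 ^ (?c q r + ?c p (?o q r)) else 0)"
      using card_compatible_comp[OF p diagram_comp_closed[OF q r] fg] by (simp add: power_add)
    finally show ?thesis .
  qed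
  have eq: "(if compatible (?o (?o p q) r) f g then (2::nat) ^ (?c p q + ?c (?o p q) r) else 0)
     = (if compatible (?o p (?o q r)) f g then 2 ^ (?c q r + ?c p (?o q r)) else 0)"
    if "f \<subseteq> ?N" "g \<subseteq> ?N" for f g using left[OF that] right[OF that] by simp
  show "?c p q + ?c (?o p q) r = ?c q r + ?c p (?o q r)" using eq[of "{}" "{}"] by simp
  show "?o (?o p q) r = ?o p (?o q r)"
  proof (rule diagram_eqI)
    show "compatible (?o (?o p q) r) f g \<longleftrightarrow> compatible (?o p (?o q r)) f g"
      if "f \<subseteq> ?N" "g \<subseteq> ?N" for f g
      using eq[OF that] by (simp split: if_splits)
  qed (intro diagram_comp_closed p q r)+
qed

section \<open>The unit diagram and tonal diagrams\<close>

definition unit_diagram :: "nat \<Rightarrow> diagram" where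
  "unit_diagram n = (\<lambda>i. {Top i, Bot i}) ` {1..n}"

lemma unit_diagram_closed: "unit_diagram n \<in> diagrams n n"
  unfolding diagrams_def mem_Collect_eq unit_diagram_def
  by (rule partition_onI) (auto simp: disjnt_def)

lemma compatible_unit:
  assumes "f \<subseteq> {1..n}" "g \<subseteq> {1..n}"
  shows "compatible (unit_diagram n) f g \<longleftrightarrow> f = g"
proof -
  have "compatible (unit_diagram n) f g \<longleftrightarrow> (\<forall>i\<in>{1..n}. i \<in> f \<longleftrightarrow> i \<in> g)"
    by (auto simp: compatible_def unit_diagram_def ball_simps(9))
  thus ?thesis using assms by blast
qed

lemma diagram_comp_unit:
  assumes p: "p \<in> diagrams n n"
  shows "dcomp n (unit_diagram n) p = p" "loops n (unit_diagram n) p = 0"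
    "dcomp n p (unit_diagram n) = p" "loops n p (unit_diagram n) = 0"
proof -
  have 1: "card {h. h \<subseteq> {1..n} \<and> compatible (unit_diagram n) f h \<and> compatible p h g} = (if compatible p f g then 2 ^ 0 else 0)"
    if "f \<subseteq> {1..n}" "g \<subseteq> {1..n}" for f g
  proof -
    have "{h. h \<subseteq> {1..n} \<and> compatible (unit_diagram n) f h \<and> compatible p h g} = (if compatible p f g then {f} else {})"
      using that by (auto simp: compatible_unit)
    thus ?thesis by simp
  qed
  have 2: "card {h. h \<subseteq> {1..n} \<and> compatible p f h \<and> compatible (unit_diagram n) h g} = (if compatible p f g then 2 ^ 0 else 0)"
    if "f \<subseteq> {1..n}" "g \<subseteq> {1..n}" for f g
  proof -
    have "{h. h \<subseteq> {1..n} \<and> compatible p f h \<and> compatible (unit_diagram n) h g} = (if compatible p f g then {g} else {})"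
      using that by (auto simp: compatible_unit)
    thus ?thesis by simp
  qed
  show "dcomp n (unit_diagram n) p = p" "loops n (unit_diagram n) p = 0"
    using diagram_compI[OF unit_diagram_closed p p 1] by auto
  show "dcomp n p (unit_diagram n) = p" "loops n p (unit_diagram n) = 0"
    using diagram_compI[OF p unit_diagram_closed p 2] by auto
qed

lemma tonal_diagramsD: "p \<in> tonal_diagrams l n \<Longrightarrow> p \<in> diagrams n n"
  by (simp add: tonal_diagrams_def)

lemma tonal_diagrams_iff:
  "p \<in> tonal_diagrams l n \<longleftrightarrow> p \<in> diagrams n n \<and>
    (\<forall>f g. f \<subseteq> {1..n} \<longrightarrow> g \<subseteq> {1..n} \<longrightarrow> compatible p f g \<longrightarrow> card f mod l = card g mod l)"
  using tonal_iff_compatible[of p n n l] by (auto simp: tonal_diagrams_def)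

lemma finite_tonal_diagrams: "finite (tonal_diagrams l n)"
  by (rule finite_subset[OF _ finite_diagrams[of n n]]) (auto simp: tonal_diagrams_def)

lemma unit_diagram_tonal: "unit_diagram n \<in> tonal_diagrams l n"
  by (auto simp: tonal_diagrams_iff unit_diagram_closed compatible_unit)

lemma diagram_comp_tonal:
  assumes p: "p \<in> tonal_diagrams l n" and q: "q \<in> tonal_diagrams l n"
  shows "dcomp n p q \<in> tonal_diagrams l n"
  unfolding tonal_diagrams_iff
proof (intro conjI allI impI diagram_comp_closed tonal_diagramsD[OF p] tonal_diagramsD[OF q])
  fix f g assume fg: "f \<subseteq> {1..n}" "g \<subseteq> {1..n}" "compatible (dcomp n p q) f g"
  then obtain h where "h \<subseteq> {1..n}" "compatible p f h" "compatible q h g"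
    using compatible_comp_iff[OF tonal_diagramsD[OF p] tonal_diagramsD[OF q] fg(1,2)] by blast
  thus "card f mod l = card g mod l" using p q fg unfolding tonal_diagrams_iff by metis
qed

section \<open>The tonal partition algebra is a ring\<close>

lemma sum_mult_of_bool:
  fixes f :: "'d \<Rightarrow> complex"
  shows "finite D \<Longrightarrow> (\<Sum>a\<in>D. f a * of_bool (b = a)) = (if b \<in> D then f b else 0)"
    "finite D \<Longrightarrow> (\<Sum>a\<in>D. of_bool (a = b) * f a) = (if b \<in> D then f b else 0)"
proof -
  have *: "f a * of_bool (b = a) = (if b = a then f a else 0)" "of_bool (a = b) * f a = (if a = b then f a else 0)" for a
    by auto
  show "finite D \<Longrightarrow> (\<Sum>a\<in>D. f a * of_bool (b = a)) = (if b \<in> D then f b else 0)"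
    unfolding * by (rule sum.delta')
  show "finite D \<Longrightarrow> (\<Sum>a\<in>D. of_bool (a = b) * f a) = (if b \<in> D then f b else 0)"
    unfolding * by (rule sum.delta)
qed

context
  fixes \<delta> :: complex and l n :: nat
begin

private abbreviation "D \<equiv> tonal_diagrams l n"
private abbreviation "cp \<equiv> dcomp n"
private abbreviation "w \<equiv> (\<lambda>p p'. \<delta> ^ loops n p p')"
private abbreviation "mu \<equiv> (\<lambda>f g q. \<Sum>p\<in>D. \<Sum>p'\<in>D. f p * g p' * w p p' * of_bool (cp p p' = q))"

lemma tonal_algebra_simps:
  "carrier (tonal_algebra \<delta> l n) = {f. \<forall>p. p \<notin> D \<longrightarrow> f p = 0}"
  "monoid.mult (tonal_algebra \<delta> l n) = mu"
  "one (tonal_algebra \<delta> l n) = basis_vector (unit_diagram n)"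
  "ring.zero (tonal_algebra \<delta> l n) = (\<lambda>q. 0)"
  "add (tonal_algebra \<delta> l n) = (\<lambda>f g q. f q + g q)"
  by (simp_all add: tonal_algebra_def basis_vector_def unit_diagram_def)

private lemma closed: "p \<in> D \<Longrightarrow> p' \<in> D \<Longrightarrow> cp p p' \<in> D"
  by (rule diagram_comp_tonal)

text \<open>Summing a product against a test function \<open>k\<close> amounts to evaluating
  \<open>k\<close> at the composites; applied on both sides, this reduces associativity to the level
  of diagrams.\<close>

private lemma mu_sum:
  "(\<Sum>a\<in>D. mu f g a * k a) = (\<Sum>p\<in>D. \<Sum>p'\<in>D. f p * g p' * w p p' * k (cp p p'))"
proof -
  have "(\<Sum>a\<in>D. mu f g a * k a) = (\<Sum>a\<in>D. \<Sum>p\<in>D. \<Sum>p'\<in>D. f p * g p' * w p p' * k a * of_bool (cp p p' = a))"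
    by (simp add: sum_distrib_left sum_distrib_right mult_ac)
  also have "\<dots> = (\<Sum>p\<in>D. \<Sum>p'\<in>D. \<Sum>a\<in>D. f p * g p' * w p p' * k a * of_bool (cp p p' = a))"
    by (subst sum.swap) (intro sum.cong refl sum.swap)
  also have "\<dots> = (\<Sum>p\<in>D. \<Sum>p'\<in>D. f p * g p' * w p p' * k (cp p p'))"
    using closed by (intro sum.cong refl) (simp add: sum_mult_of_bool finite_tonal_diagrams)
  finally show ?thesis .
qed

private lemma mu_assoc:
  shows "mu (mu f g) h = mu f (mu g h)"
proof
  fix q
  have gen: "(\<Sum>p\<in>D. f p * (\<Sum>a\<in>D. G a * (w p a * of_bool (cp p a = q))))
      = (\<Sum>p\<in>D. \<Sum>a\<in>D. f p * G a * w p a * of_bool (cp p a = q))" for G :: "diagram \<Rightarrow> complex"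
    by (simp add: sum_distrib_left mult.assoc)
  have "mu (mu f g) h q = (\<Sum>a\<in>D. mu f g a * (\<Sum>r\<in>D. h r * w a r * of_bool (cp a r = q)))"
    by (simp only: sum_distrib_left mult.assoc)
  also have "\<dots> = (\<Sum>p\<in>D. \<Sum>p'\<in>D. f p * g p' * w p p' * (\<Sum>r\<in>D. h r * w (cp p p') r * of_bool (cp (cp p p') r = q)))"
    by (rule mu_sum)
  also have "\<dots> = (\<Sum>p\<in>D. \<Sum>p'\<in>D. \<Sum>r\<in>D. f p * g p' * h r * (w p p' * w (cp p p') r) * of_bool (cp (cp p p') r = q))"
    by (simp add: sum_distrib_left mult_ac)
  also have "\<dots> = (\<Sum>p\<in>D. \<Sum>p'\<in>D. \<Sum>r\<in>D. f p * g p' * h r * (w p' r * w p (cp p' r)) * of_bool (cp p (cp p' r) = q))"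
  proof (intro sum.cong refl)
    \<comment> \<open>The individual loop counts depend on the bracketing, but their sum does not,
      so the two weights are merged into a single power.\<close>
    fix p p' r assume "p \<in> D" "p' \<in> D" "r \<in> D"
    note a = diagram_comp_assoc[OF this[THEN tonal_diagramsD]]
    show "f p * g p' * h r * (w p p' * w (cp p p') r) * of_bool (cp (cp p p') r = q)
      = f p * g p' * h r * (w p' r * w p (cp p' r)) * of_bool (cp p (cp p' r) = q)"
      using a(2) by (simp add: a(1) power_add[symmetric])
  qed
  also have "\<dots> = (\<Sum>p\<in>D. f p * (\<Sum>p'\<in>D. \<Sum>r\<in>D. g p' * h r * w p' r * (w p (cp p' r) * of_bool (cp p (cp p' r) = q))))"
    by (simp add: sum_distrib_left mult_ac)
  also have "\<dots> = (\<Sum>p\<in>D. f p * (\<Sum>a\<in>D. mu g h a * (w p a * of_bool (cp p a = q))))"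
    by (simp only: mu_sum)
  also have "\<dots> = mu f (mu g h) q" by (rule gen)
  finally show "mu (mu f g) h q = mu f (mu g h) q" .
qed

lemma tonal_algebra_ring: "ring (tonal_algebra \<delta> l n)"
proof (rule ringI)
  let ?R = "tonal_algebra \<delta> l n"
  show "abelian_group ?R"
  proof (rule abelian_groupI)
    fix f assume "f \<in> carrier ?R"
    thus "\<exists>g\<in>carrier ?R. g \<oplus>\<^bsub>?R\<^esub> f = \<zero>\<^bsub>?R\<^esub>"
      by (intro bexI[of _ "\<lambda>q. - f q"]) (auto simp: tonal_algebra_simps)
  qed (auto simp: tonal_algebra_simps add_ac)
  have out: "mu f g q = 0" if "q \<notin> D" for f g q
    by (intro sum.neutral ballI) (use that closed in auto)
  show "Group.monoid ?R"
  proof (rule monoidI)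
    show "f \<otimes>\<^bsub>?R\<^esub> g \<in> carrier ?R" for f g using out by (simp add: tonal_algebra_simps)
    show "f \<otimes>\<^bsub>?R\<^esub> g \<otimes>\<^bsub>?R\<^esub> h = f \<otimes>\<^bsub>?R\<^esub> (g \<otimes>\<^bsub>?R\<^esub> h)" for f g h
      unfolding tonal_algebra_simps by (rule mu_assoc)
    show "\<one>\<^bsub>?R\<^esub> \<in> carrier ?R"
      using unit_diagram_tonal by (auto simp: tonal_algebra_simps basis_vector_def)
    fix f assume f: "f \<in> carrier ?R"
    show "\<one>\<^bsub>?R\<^esub> \<otimes>\<^bsub>?R\<^esub> f = f"
    proof
      fix q
      have "mu (basis_vector (unit_diagram n)) f q =
         (\<Sum>p\<in>D. of_bool (p = unit_diagram n) * (\<Sum>p'\<in>D. f p' * w p p' * of_bool (cp p p' = q)))"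
        by (simp add: sum_distrib_left basis_vector_def mult.assoc)
      also have "\<dots> = (\<Sum>p'\<in>D. f p' * w (unit_diagram n) p' * of_bool (cp (unit_diagram n) p' = q))"
        by (simp add: sum_mult_of_bool finite_tonal_diagrams unit_diagram_tonal)
      also have "\<dots> = (\<Sum>p'\<in>D. of_bool (p' = q) * f p')"
        by (intro sum.cong refl) (simp add: diagram_comp_unit[OF tonal_diagramsD])
      also have "\<dots> = f q" using f
        by (subst sum_mult_of_bool(2)) (auto simp: finite_tonal_diagrams tonal_algebra_simps)
      finally show "(\<one>\<^bsub>?R\<^esub> \<otimes>\<^bsub>?R\<^esub> f) q = f q" by (simp add: tonal_algebra_simps)
    qed
    show "f \<otimes>\<^bsub>?R\<^esub> \<one>\<^bsub>?R\<^esub> = f"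
    proof
      fix q
      have "mu f (basis_vector (unit_diagram n)) q =
         (\<Sum>p\<in>D. \<Sum>p'\<in>D. of_bool (p' = unit_diagram n) * (f p * w p p' * of_bool (cp p p' = q)))"
        by (simp add: basis_vector_def mult_ac)
      also have "\<dots> = (\<Sum>p\<in>D. f p * w p (unit_diagram n) * of_bool (cp p (unit_diagram n) = q))"
        by (intro sum.cong refl, subst sum_mult_of_bool(2)) (simp_all add: finite_tonal_diagrams unit_diagram_tonal)
      also have "\<dots> = (\<Sum>p\<in>D. of_bool (p = q) * f p)"
        by (intro sum.cong refl) (simp add: diagram_comp_unit[OF tonal_diagramsD])
      also have "\<dots> = f q" using f
        by (subst sum_mult_of_bool(2)) (auto simp: finite_tonal_diagrams tonal_algebra_simps)
      finally show "(f \<otimes>\<^bsub>?R\<^esub> \<one>\<^bsub>?R\<^esub>) q = f q" by (simp add: tonal_algebra_simps)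
    qed
  qed
qed (simp_all add: tonal_algebra_simps algebra_simps sum.distrib)

lemma mult_basis_vector:
  assumes "p \<in> D" "p' \<in> D"
  shows "basis_vector p \<otimes>\<^bsub>tonal_algebra \<delta> l n\<^esub> basis_vector p' = (\<lambda>q. w p p' * basis_vector (cp p p') q)"
proof
  fix q
  have "mu (basis_vector p) (basis_vector p') q =
      (\<Sum>x\<in>D. of_bool (x = p) * (\<Sum>y\<in>D. of_bool (y = p') * (w x y * of_bool (cp x y = q))))"
    by (simp add: basis_vector_def sum_distrib_left mult_ac)
  also have "\<dots> = w p p' * of_bool (cp p p' = q)"
    using assms by (simp add: sum_mult_of_bool finite_tonal_diagrams)
  finally show "(basis_vector p \<otimes>\<^bsub>tonal_algebra \<delta> l n\<^esub> basis_vector p') q = w p p' * basis_vector (cp p p') q"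
    by (simp add: tonal_algebra_simps basis_vector_def eq_commute)
qed

end

section \<open>Diagrams as partial bijections between blocks, and compositions in this normal
  form\<close>

section \<open>Diagrams by their propagating and non-propagating parts\<close>

definition row_split :: "nat \<Rightarrow> nat set set \<Rightarrow> nat set set \<Rightarrow> bool" where
  "row_split n X W \<longleftrightarrow> X \<inter> W = {} \<and> partition_on {1..n} (X \<union> W)"

text \<open>Normal form of a diagram: \<open>P\<close> pairs the two halves of each propagating
  part, while \<open>W\<close> and \<open>W'\<close> are the blocks of parts confined to one
  row.\<close>

definition joined :: "(nat set \<times> nat set) set \<Rightarrow> nat set set \<Rightarrow> nat set set \<Rightarrow> diagram" where
  "joined P W W' = (\<lambda>(x, y). row_pair x y) ` P \<union> (\<lambda>u. row_pair u {}) ` W \<union> (\<lambda>u. row_pair {} u) ` W'"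

text \<open>The injectivity conditions make \<open>P\<close> a bijection between its blocks on top
  and below, so a diagram is a partial bijection between two set partitions.\<close>

definition joinable :: "nat \<Rightarrow> (nat set \<times> nat set) set \<Rightarrow> nat set set \<Rightarrow> nat set set \<Rightarrow> bool" where
  "joinable n P W W' \<longleftrightarrow> inj_on fst P \<and> inj_on snd P \<and> row_split n (fst ` P) W \<and> row_split n (snd ` P) W'"

lemma row_pair_eq_iff [simp]: "row_pair f g = row_pair f' g' \<longleftrightarrow> f = f' \<and> g = g'"
proof
  assume e: "row_pair f g = row_pair f' g'"
  have "i \<in> f \<longleftrightarrow> i \<in> f'" "i \<in> g \<longleftrightarrow> i \<in> g'" for i
    using e row_pair_simps(1)[of i f g] row_pair_simps(1)[of i f' g']
      row_pair_simps(2)[of i f g] row_pair_simps(2)[of i f' g'] by auto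
  thus "f = f' \<and> g = g'" by blast
qed simp

lemma row_pair_subset_iff [simp]: "row_pair x y \<subseteq> row_pair f g \<longleftrightarrow> x \<subseteq> f \<and> y \<subseteq> g"
  by (auto simp: row_pair_def)

lemma row_pair_disjoint_iff [simp]: "row_pair x y \<inter> row_pair f g = {} \<longleftrightarrow> x \<inter> f = {} \<and> y \<inter> g = {}"
  by (auto simp: row_pair_def)

lemma row_pair_empty_iff [simp]:
  "row_pair x y = {} \<longleftrightarrow> x = {} \<and> y = {}" "{} = row_pair x y \<longleftrightarrow> x = {} \<and> y = {}"
  by (auto simp: row_pair_def)

lemma row_splitD:
  assumes "row_split n X W"
  shows "X \<inter> W = {}" "\<Union>(X \<union> W) = {1..n}" "\<And>x. x \<in> X \<union> W \<Longrightarrow> x \<noteq> {}"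
    "\<And>x. x \<in> X \<union> W \<Longrightarrow> x \<subseteq> {1..n}"
    "\<And>x y i. x \<in> X \<union> W \<Longrightarrow> y \<in> X \<union> W \<Longrightarrow> i \<in> x \<Longrightarrow> i \<in> y \<Longrightarrow> x = y"
    "\<And>i. i \<in> {1..n} \<Longrightarrow> \<exists>x\<in>X \<union> W. i \<in> x" "finite X" "finite W" "\<And>x. x \<in> X \<union> W \<Longrightarrow> finite x"
proof -
  have p: "partition_on {1..n} (X \<union> W)" and d: "X \<inter> W = {}" using assms by (auto simp: row_split_def)
  show "X \<inter> W = {}" by (rule d)
  show U: "\<Union>(X \<union> W) = {1..n}" using partition_onD1[OF p] by simp
  show "x \<noteq> {}" if "x \<in> X \<union> W" for x using partition_onD3[OF p] that by auto
  show s: "x \<subseteq> {1..n}" if "x \<in> X \<union> W" for x using U that by blast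
  show "x = y" if "x \<in> X \<union> W" "y \<in> X \<union> W" "i \<in> x" "i \<in> y" for x y i
    using disjointD[OF partition_onD2[OF p] that(1,2)] that(3,4) by blast
  show "\<exists>x\<in>X \<union> W. i \<in> x" if "i \<in> {1..n}" for i using U that by blast
  have "finite (X \<union> W)" by (rule finite_UnionD) (simp only: U finite_atLeastAtMost)
  thus "finite X" "finite W" by auto
  show "finite x" if "x \<in> X \<union> W" for x using s[OF that] by (rule finite_subset) simp
qed

lemma row_splitI:
  assumes "X \<inter> W = {}" "\<Union>(X \<union> W) = {1..n}" "{} \<notin> X \<union> W"
    "\<And>x y i. x \<in> X \<union> W \<Longrightarrow> y \<in> X \<union> W \<Longrightarrow> i \<in> x \<Longrightarrow> i \<in> y \<Longrightarrow> x = y"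
  shows "row_split n X W"
  unfolding row_split_def
proof (intro conjI assms(1-3) partition_onI)
  show "disjnt p q" if "p \<in> X \<union> W" "q \<in> X \<union> W" "p \<noteq> q" for p q
    unfolding disjnt_iff using assms(4)[OF that(1,2)] that(3) by blast
qed

lemma row_split_card:
  assumes "row_split n X W"
  shows "n = (\<Sum>x\<in>X. card x) + (\<Sum>x\<in>W. card x)"
proof -
  note r = row_splitD[OF assms]
  have "card (\<Union>(X \<union> W)) = (\<Sum>x\<in>X \<union> W. card x)"
  proof (rule card_Union_disjoint)
    show "pairwise disjnt (X \<union> W)" unfolding pairwise_def disjnt_iff using r(5) by blast
  qed (use r(9) in blast)
  thus ?thesis using r(1,2,7,8) by (simp add: sum.union_disjoint)
qed

text \<open>The blocks in \<open>Y\<close> have their colour prescribed by \<open>A\<close> and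
  those in \<open>X\<close> are free, so a colouring amounts to a subset of
  \<open>X\<close>.\<close>

lemma card_row_colourings:
  assumes r: "row_split n Y X"
  shows "card {h. h \<subseteq> {1..n} \<and> (\<forall>y\<in>Y. if A y then y \<subseteq> h else y \<inter> h = {}) \<and> (\<forall>u\<in>X. u \<subseteq> h \<or> u \<inter> h = {})}
     = 2 ^ card X" (is "card ?H = _")
proof -
  note R = row_splitD[OF r]
  let ?f = "\<lambda>S. \<Union>({y \<in> Y. A y} \<union> S)"
  have "bij_betw ?f (Pow X) ?H"
  proof (rule bij_betw_byWitness[where f' = "\<lambda>h. {u \<in> X. u \<subseteq> h}"])
    have mem: "u \<in> S" if S: "S \<subseteq> X" and u: "u \<in> X" "i \<in> u" "i \<in> ?f S" for S u i
    proof -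
      from u(3) obtain v where v: "v \<in> {y \<in> Y. A y} \<union> S" "i \<in> v" by blast
      hence "u = v" using R(5)[of u v i] u S by auto
      thus ?thesis using v u R(1) by auto
    qed
    show "\<forall>S\<in>Pow X. {u \<in> X. u \<subseteq> ?f S} = S"
    proof
      fix S assume S: "S \<in> Pow X"
      have "u \<in> S" if u: "u \<in> X" "u \<subseteq> ?f S" for u
      proof -
        obtain i where "i \<in> u" using R(3)[of u] u by blast
        thus ?thesis using mem[of S u i] S u by blast
      qed
      thus "{u \<in> X. u \<subseteq> ?f S} = S" using S by blast
    qed
    show "\<forall>h\<in>?H. ?f {u \<in> X. u \<subseteq> h} = h"
    proof
      fix h assume h: "h \<in> ?H"
      have "i \<in> ?f {u \<in> X. u \<subseteq> h}" if i: "i \<in> h" for i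
      proof -
        have "i \<in> {1..n}" using h i by blast
        from R(6)[OF this] obtain v where v: "v \<in> Y \<union> X" "i \<in> v" by blast
        show ?thesis
        proof (cases "v \<in> Y")
          case True
          hence "if A v then v \<subseteq> h else v \<inter> h = {}" using h by blast
          hence "A v" using v i by (auto split: if_splits)
          thus ?thesis using True v by blast
        next
          case False
          hence "v \<in> X" using v by blast
          hence "v \<subseteq> h \<or> v \<inter> h = {}" using h by blast
          hence "v \<subseteq> h" using v i by blast
          thus ?thesis using \<open>v \<in> X\<close> v by blast
        qed
      qed
      moreover have "y \<subseteq> h" if "y \<in> Y" "A y" for y
      proof -
        have "if A y then y \<subseteq> h else y \<inter> h = {}" using h that by blast
        thus ?thesis using that by simp
      qed
      ultimately show "?f {u \<in> X. u \<subseteq> h} = h" by blast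
    qed
    show "?f ` Pow X \<subseteq> ?H"
    proof (rule image_subsetI)
      fix S assume S: "S \<in> Pow X"
      have "?f S \<subseteq> {1..n}" using R(2) S by blast
      moreover have "if A y then y \<subseteq> ?f S else y \<inter> ?f S = {}" if y: "y \<in> Y" for y
      proof (cases "A y")
        case False
        have "v = y" if "v \<in> {y \<in> Y. A y} \<union> S" "i \<in> v" "i \<in> y" for v i
          using R(5)[of v y i] that y S by blast
        hence "y \<inter> ?f S = {}" using False y R(1) S by blast
        thus ?thesis using False by simp
      qed (use y in auto)
      moreover have "u \<subseteq> ?f S \<or> u \<inter> ?f S = {}" if "u \<in> X" for u
        using mem[of S u] that S by blast
      ultimately show "?f S \<in> ?H" unfolding mem_Collect_eq by blast
    qed
  qed auto
  from bij_betw_same_card[OF this] show ?thesis using R(8) by (simp add: card_Pow)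
qed

lemma joinableD:
  assumes "joinable n P W W'"
  shows "row_split n (fst ` P) W" "row_split n (snd ` P) W'"
    "\<And>x y y'. (x, y) \<in> P \<Longrightarrow> (x, y') \<in> P \<Longrightarrow> y = y'" "\<And>x x' y. (x, y) \<in> P \<Longrightarrow> (x', y) \<in> P \<Longrightarrow> x = x'"
    "inj_on fst P" "inj_on snd P" "finite P"
proof -
  show 1: "row_split n (fst ` P) W" "row_split n (snd ` P) W'" and 2: "inj_on fst P" "inj_on snd P"
    using assms by (auto simp: joinable_def)
  show "\<And>x y y'. (x, y) \<in> P \<Longrightarrow> (x, y') \<in> P \<Longrightarrow> y = y'" using inj_onD[OF 2(1)] by fastforce
  show "\<And>x x' y. (x, y) \<in> P \<Longrightarrow> (x', y) \<in> P \<Longrightarrow> x = x'" using inj_onD[OF 2(2)] by fastforce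
  show "finite P" using row_splitD(7)[OF 1(1)] 2(1) by (rule finite_imageD)
qed

lemma joined_closed:
  assumes j: "joinable n P W W'"
  shows "joined P W W' \<in> diagrams n n"
  unfolding diagrams_def mem_Collect_eq
proof (rule partition_onI)
  note J = joinableD[OF j]
  note T = row_splitD[OF J(1)] and B = row_splitD[OF J(2)]
  have "\<Union>(joined P W W') = Top ` \<Union>(fst ` P \<union> W) \<union> Bot ` \<Union>(snd ` P \<union> W')"
    by (force simp: joined_def row_pair_def)
  thus "\<Union>(joined P W W') = Top ` {1..n} \<union> Bot ` {1..n}" by (simp only: T(2) B(2))
  show "disjnt s t" if s: "s \<in> joined P W W'" and t: "t \<in> joined P W W'" and st: "s \<noteq> t" for s t
  proof (rule ccontr)
    assume "\<not> disjnt s t"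
    then obtain v where v: "v \<in> s" "v \<in> t" by (auto simp: disjnt_iff)
    have form: "(\<exists>x y. z = row_pair x y \<and> ((x, y) \<in> P \<or> x \<in> W \<and> y = {} \<or> x = {} \<and> y \<in> W'))"
      if "z \<in> joined P W W'" for z using that by (auto simp: joined_def)
    obtain x y where xy: "s = row_pair x y" "(x, y) \<in> P \<or> x \<in> W \<and> y = {} \<or> x = {} \<and> y \<in> W'"
      using form[OF s] by blast
    obtain x' y' where xy': "t = row_pair x' y'" "(x', y') \<in> P \<or> x' \<in> W \<and> y' = {} \<or> x' = {} \<and> y' \<in> W'"
      using form[OF t] by blast
    show False
    proof (cases v)
      case (Top i)
      hence i: "i \<in> x" "i \<in> x'" using v xy(1) xy'(1) by auto
      have m: "x \<in> fst ` P \<union> W" "x' \<in> fst ` P \<union> W" using i xy(2) xy'(2) by force+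
      have e: "x = x'" by (rule T(5)[OF m i])
      have "y = y'"
      proof (cases "x \<in> W")
        case True
        hence "x \<notin> fst ` P" using T(1) by blast
        thus ?thesis using xy(2) xy'(2) e i by force
      next
        case False
        thus ?thesis using xy(2) xy'(2) e i J(3) by force
      qed
      with e st xy xy' show False by simp
    next
      case (Bot i)
      hence i: "i \<in> y" "i \<in> y'" using v xy(1) xy'(1) by auto
      have m: "y \<in> snd ` P \<union> W'" "y' \<in> snd ` P \<union> W'" using i xy(2) xy'(2) by force+
      have e: "y = y'" by (rule B(5)[OF m i])
      have "x = x'"
      proof (cases "y \<in> W'")
        case True
        hence "y \<notin> snd ` P" using B(1) by blast
        thus ?thesis using xy(2) xy'(2) e i by force
      next
        case False
        thus ?thesis using xy(2) xy'(2) e i J(4) by force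
      qed
      with e st xy xy' show False by simp
    qed (use v xy in auto)
  qed
  show "{} \<notin> joined P W W'"
  proof
    assume "{} \<in> joined P W W'"
    then obtain x y where "x = {}" "y = {}" "(x, y) \<in> P \<or> x \<in> W \<or> y \<in> W'"
      unfolding joined_def by auto
    thus False using T(3)[of "{}"] B(3)[of "{}"] by force
  qed
qed

lemma ball_joined:
  "(\<forall>s\<in>joined P W W'. Q s) \<longleftrightarrow> (\<forall>x y. (x, y) \<in> P \<longrightarrow> Q (row_pair x y)) \<and>
     (\<forall>u\<in>W. Q (row_pair u {})) \<and> (\<forall>u\<in>W'. Q (row_pair {} u))"
  unfolding joined_def by auto

definition unsplit :: "nat set \<Rightarrow> nat set \<Rightarrow> bool" where
  "unsplit u f \<longleftrightarrow> u \<subseteq> f \<or> u \<inter> f = {}"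

definition unsplit2 :: "nat set \<Rightarrow> nat set \<Rightarrow> nat set \<Rightarrow> nat set \<Rightarrow> bool" where
  "unsplit2 x y f g \<longleftrightarrow> x \<subseteq> f \<and> y \<subseteq> g \<or> x \<inter> f = {} \<and> y \<inter> g = {}"

text \<open>A nonempty middle block cannot be both inside and outside the middle set, so the
  alternatives on its two sides agree.\<close>

lemma unsplit2_trans: "unsplit2 x y f h \<Longrightarrow> unsplit2 y z h g \<Longrightarrow> y \<noteq> {} \<Longrightarrow> unsplit2 x z f g"
  unfolding unsplit2_def by auto

lemma unsplit2_unsplit: "unsplit2 x y f g \<Longrightarrow> unsplit x f \<and> unsplit y g"
  unfolding unsplit2_def unsplit_def by blast

lemma mem_fst_snd: "(x, y) \<in> P \<Longrightarrow> x \<in> fst ` P" "(x, y) \<in> P \<Longrightarrow> y \<in> snd ` P"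
  by force+

lemma compatible_joined:
  "compatible (joined P W W') f g \<longleftrightarrow>
     (\<forall>x y. (x, y) \<in> P \<longrightarrow> unsplit2 x y f g) \<and> (\<forall>u\<in>W. unsplit u f) \<and> (\<forall>u\<in>W'. unsplit u g)"
  unfolding compatible_def ball_joined unsplit_def unsplit2_def by simp

lemma mem_joined:
  "row_pair x y \<in> joined P W W' \<longleftrightarrow> (x, y) \<in> P \<or> x \<in> W \<and> y = {} \<or> x = {} \<and> y \<in> W'"
  unfolding joined_def by auto

lemma joinedE: "s \<in> joined P W W' \<Longrightarrow> \<exists>x y. s = row_pair x y"
  unfolding joined_def by auto

text \<open>All blocks are nonempty, so the kind of a part can be read off from which of its two
  halves is empty.\<close>

lemma joined_parts:
  assumes "joinable n P W W'"
  shows "row_pair x y \<in> joined P W W' \<and> x \<noteq> {} \<and> y \<noteq> {} \<longleftrightarrow> (x, y) \<in> P"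
    "row_pair x {} \<in> joined P W W' \<longleftrightarrow> x \<in> W"
    "row_pair {} y \<in> joined P W W' \<longleftrightarrow> y \<in> W'"
proof -
  have P: "x \<noteq> {}" "y \<noteq> {}" if "(x, y) \<in> P" for x y
    using row_splitD(3)[OF joinableD(1)[OF assms], of x] row_splitD(3)[OF joinableD(2)[OF assms], of y] that
    by (force intro: rev_image_eqI)+
  have W: "u \<noteq> {}" if "u \<in> W" for u using row_splitD(3)[OF joinableD(1)[OF assms]] that by blast
  have W': "u \<noteq> {}" if "u \<in> W'" for u using row_splitD(3)[OF joinableD(2)[OF assms]] that by blast
  show "row_pair x y \<in> joined P W W' \<and> x \<noteq> {} \<and> y \<noteq> {} \<longleftrightarrow> (x, y) \<in> P"
    unfolding mem_joined using P by blast
  show "row_pair x {} \<in> joined P W W' \<longleftrightarrow> x \<in> W"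
    unfolding mem_joined using P W W' by blast
  show "row_pair {} y \<in> joined P W W' \<longleftrightarrow> y \<in> W'"
    unfolding mem_joined using P W W' by blast
qed

lemma diagram_eq_joined:
  assumes p: "p \<in> diagrams n n"
  obtains P W W' where "joinable n P W W'" "p = joined P W W'"
proof (rule that)
  note D = diagramsD[OF p]
  let ?P = "{(x, y). row_pair x y \<in> p \<and> x \<noteq> {} \<and> y \<noteq> {}}"
  let ?W = "{x. row_pair x {} \<in> p}" and ?W' = "{y. row_pair {} y \<in> p}"
  have uniq: "x = x' \<and> y = y'" if "row_pair x y \<in> p" "row_pair x' y' \<in> p" "i \<in> x \<and> i \<in> x' \<or> i \<in> y \<and> i \<in> y'" for x y x' y' i
  proof -
    have "\<exists>v. v \<in> row_pair x y \<and> v \<in> row_pair x' y'" using that(3) row_pair_simps by metis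
    thus ?thesis using D(3)[OF that(1,2)] by auto
  qed
  show "p = joined ?P ?W ?W'"
  proof (rule Set.set_eqI)
    fix s
    show "s \<in> p \<longleftrightarrow> s \<in> joined ?P ?W ?W'"
    proof
      assume s: "s \<in> p"
      obtain f g where fg: "s = row_pair f g" "f \<subseteq> {1..n}" "g \<subseteq> {1..n}"
        using eq_row_pair D(4)[OF s] by metis
      thus "s \<in> joined ?P ?W ?W'" using s D(2) by (cases "f = {}"; cases "g = {}") (auto simp: joined_def)
    qed (auto simp: joined_def)
  qed
  have ex: "\<exists>x y. row_pair x y \<in> p \<and> v \<in> row_pair x y" if "v \<in> Top ` {1..n} \<union> Bot ` {1..n}" for v
  proof -
    from that D(1) obtain s where s: "s \<in> p" "v \<in> s" by blast
    obtain f g where "s = row_pair f g" using eq_row_pair D(4)[OF s(1)] by metis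
    thus ?thesis using s by blast
  qed
  have v: "x \<subseteq> {1..n} \<and> y \<subseteq> {1..n}" if "row_pair x y \<in> p" for x y
  proof -
    have "row_pair x y \<subseteq> row_pair {1..n} {1..n}" using D(4)[OF that] by (simp add: row_pair_def)
    thus ?thesis by simp
  qed
  have ne: "row_pair {} {} \<notin> p" using D(2) row_pair_empty_iff(1)[of "{}" "{}"] by metis
  have top: "\<And>x. x \<in> fst ` ?P \<union> ?W \<longleftrightarrow> x \<noteq> {} \<and> (\<exists>y. row_pair x y \<in> p)" using ne by force
  have bot: "\<And>y. y \<in> snd ` ?P \<union> ?W' \<longleftrightarrow> y \<noteq> {} \<and> (\<exists>x. row_pair x y \<in> p)" using ne by force
  show "joinable n ?P ?W ?W'"
    unfolding joinable_def
  proof (intro conjI)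
    show "inj_on fst ?P"
    proof (rule inj_onI)
      fix z w assume zw: "z \<in> ?P" "w \<in> ?P" "fst z = fst w"
      obtain x y y' where e: "z = (x, y)" "w = (x, y')" using zw(3) by (cases z; cases w) auto
      then obtain i where "i \<in> x" using zw by auto
      thus "z = w" using uniq[of x y x y' i] zw e by auto
    qed
    show "inj_on snd ?P"
    proof (rule inj_onI)
      fix z w assume zw: "z \<in> ?P" "w \<in> ?P" "snd z = snd w"
      obtain x x' y where e: "z = (x, y)" "w = (x', y)" using zw(3) by (cases z; cases w) auto
      then obtain i where "i \<in> y" using zw by auto
      thus "z = w" using uniq[of x y x' y i] zw e by auto
    qed
    show "row_split n (fst ` ?P) ?W"
    proof (rule row_splitI)
      show "fst ` ?P \<inter> ?W = {}"
      proof (rule equals0I)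
        fix x assume "x \<in> fst ` ?P \<inter> ?W"
        then obtain z where z: "z \<in> ?P" "x = fst z" and xe: "row_pair x {} \<in> p" by blast
        obtain y where "z = (x, y)" using z(2) by (metis prod.collapse)
        hence xy: "row_pair x y \<in> p" "x \<noteq> {}" "y \<noteq> {}" using z(1) by simp_all
        then obtain i where "i \<in> x" by blast
        thus False using uniq[of x y x "{}" i] xy xe by blast
      qed
      show "\<Union>(fst ` ?P \<union> ?W) = {1..n}"
      proof
        show "\<Union>(fst ` ?P \<union> ?W) \<subseteq> {1..n}"
        proof (rule Union_least)
          fix x assume "x \<in> fst ` ?P \<union> ?W"
          then obtain y where "row_pair x y \<in> p" unfolding top by blast
          from v[OF this] show "x \<subseteq> {1..n}" by (rule conjunct1)
        qed
        show "{1..n} \<subseteq> \<Union>(fst ` ?P \<union> ?W)"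
        proof
          fix i assume "i \<in> {1..n}"
          then obtain x y where "row_pair x y \<in> p" "i \<in> x" using ex[of "Top i"] by auto
          thus "i \<in> \<Union>(fst ` ?P \<union> ?W)" using top by blast
        qed
      qed
      show "{} \<notin> fst ` ?P \<union> ?W" using top by blast
      show "x = y" if xy: "x \<in> fst ` ?P \<union> ?W" "y \<in> fst ` ?P \<union> ?W" "i \<in> x" "i \<in> y" for x y i
      proof -
        obtain z w where "row_pair x z \<in> p" "row_pair y w \<in> p" using xy(1,2) unfolding top by blast
        thus ?thesis using uniq[of x z y w i] xy(3,4) by blast
      qed
    qed
    show "row_split n (snd ` ?P) ?W'"
    proof (rule row_splitI)
      show "snd ` ?P \<inter> ?W' = {}"
      proof (rule equals0I)
        fix y assume "y \<in> snd ` ?P \<inter> ?W'"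
        then obtain z where z: "z \<in> ?P" "y = snd z" and ye: "row_pair {} y \<in> p" by blast
        obtain x where "z = (x, y)" using z(2) by (metis prod.collapse)
        hence xy: "row_pair x y \<in> p" "x \<noteq> {}" "y \<noteq> {}" using z(1) by simp_all
        then obtain i where "i \<in> y" by blast
        thus False using uniq[of x y "{}" y i] xy ye by blast
      qed
      show "\<Union>(snd ` ?P \<union> ?W') = {1..n}"
      proof
        show "\<Union>(snd ` ?P \<union> ?W') \<subseteq> {1..n}"
        proof (rule Union_least)
          fix y assume "y \<in> snd ` ?P \<union> ?W'"
          then obtain x where "row_pair x y \<in> p" unfolding bot by blast
          from v[OF this] show "y \<subseteq> {1..n}" by (rule conjunct2)
        qed
        show "{1..n} \<subseteq> \<Union>(snd ` ?P \<union> ?W')"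
        proof
          fix i assume "i \<in> {1..n}"
          then obtain x y where "row_pair x y \<in> p" "i \<in> y" using ex[of "Bot i"] by auto
          thus "i \<in> \<Union>(snd ` ?P \<union> ?W')" using bot by blast
        qed
      qed
      show "{} \<notin> snd ` ?P \<union> ?W'" using bot by blast
      show "x = y" if xy: "x \<in> snd ` ?P \<union> ?W'" "y \<in> snd ` ?P \<union> ?W'" "i \<in> x" "i \<in> y" for x y i
      proof -
        obtain z w where "row_pair z x \<in> p" "row_pair w y \<in> p" using xy(1,2) unfolding bot by blast
        thus ?thesis using uniq[of z x w y i] xy(3,4) by blast
      qed
    qed
  qed
qed

lemma joined_eq_iff:
  assumes "joinable n P W W'" "joinable n Q X X'"
  shows "joined P W W' = joined Q X X' \<longleftrightarrow> P = Q \<and> W = X \<and> W' = X'"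
proof
  assume e: "joined P W W' = joined Q X X'"
  have "P = Q"
    using joined_parts(1)[OF assms(1)] joined_parts(1)[OF assms(2)] unfolding e by auto
  moreover have "W = X" using joined_parts(2)[OF assms(1)] joined_parts(2)[OF assms(2)] unfolding e by auto
  moreover have "W' = X'" using joined_parts(3)[OF assms(1)] joined_parts(3)[OF assms(2)] unfolding e by auto
  ultimately show "P = Q \<and> W = X \<and> W' = X'" by blast
qed simp

lemma joined_tonal_iff:
  assumes j: "joinable n P W W'"
  shows "joined P W W' \<in> tonal_diagrams l n \<longleftrightarrow> (\<forall>x y. (x, y) \<in> P \<longrightarrow> card x mod l = card y mod l)
     \<and> (\<forall>u\<in>W \<union> W'. card u mod l = 0)"
proof -
  have r: "row_pair f g \<inter> range Top = Top ` f" "row_pair f g \<inter> range Bot = Bot ` g" for f g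
    by (auto simp: row_pair_def)
  have t: "tone_part l (row_pair f g) \<longleftrightarrow> card f mod l = card g mod l" for f g
    unfolding tone_part_def r by (simp add: card_image inj_on_def)
  show ?thesis
    using joined_closed[OF j] unfolding tonal_diagrams_def mem_Collect_eq ball_joined t
    by (auto simp: ball_Un)
qed

text \<open>Reflection in the horizontal axis, the anti-involution behind the notation
  \<open>q\<^sup>*\<close>. It carries statements about the bottom row over to the top row.\<close>

definition flip :: "diagram \<Rightarrow> diagram" where
  "flip p = (\<lambda>s. {v. \<exists>i. v = Top i \<and> Bot i \<in> s \<or> v = Bot i \<and> Top i \<in> s}) ` p"

lemma flip_joined: "flip (joined P W W') = joined (P\<inverse>) W' W"
proof -
  have r: "{v. \<exists>i. v = Top i \<and> Bot i \<in> row_pair x y \<or> v = Bot i \<and> Top i \<in> row_pair x y} = row_pair y x" for x y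
    by (auto simp: row_pair_def)
  have m: "row_pair y x \<in> joined (P\<inverse>) W' W \<longleftrightarrow> row_pair x y \<in> joined P W W'" for x y
    unfolding mem_joined by auto
  show ?thesis
  proof (intro equalityI subsetI)
    fix s assume "s \<in> flip (joined P W W')"
    then obtain s' where s': "s' \<in> joined P W W'"
      "s = {v. \<exists>i. v = Top i \<and> Bot i \<in> s' \<or> v = Bot i \<and> Top i \<in> s'}" unfolding flip_def by blast
    then obtain x y where xy: "s' = row_pair x y" using joinedE by metis
    show "s \<in> joined (P\<inverse>) W' W" using s'(1) unfolding s'(2) xy r m .
  next
    fix s assume s: "s \<in> joined (P\<inverse>) W' W"
    then obtain x y where xy: "s = row_pair y x" using joinedE by metis
    show "s \<in> flip (joined P W W')"
      unfolding flip_def using s r[of x y, symmetric] unfolding xy m by (rule_tac image_eqI)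
  qed
qed

lemma joinable_converse: "joinable n P W W' \<longleftrightarrow> joinable n (P\<inverse>) W' W"
proof -
  have "fst ` (P\<inverse>) = snd ` P" "snd ` (P\<inverse>) = fst ` P" by force+
  moreover have "inj_on fst (P\<inverse>) \<longleftrightarrow> inj_on snd P" "inj_on snd (P\<inverse>) \<longleftrightarrow> inj_on fst P"
    by (auto simp: inj_on_def Ball_def)
  ultimately show ?thesis by (auto simp: joinable_def)
qed

lemma flip_closed:
  assumes "p \<in> diagrams n n" shows "flip p \<in> diagrams n n" "compatible (flip p) f g \<longleftrightarrow> compatible p g f"
    "flip (flip p) = p"
proof -
  obtain P W W' where j: "joinable n P W W'" "p = joined P W W'" using diagram_eq_joined[OF assms] by blast
  show "flip p \<in> diagrams n n"
    using joined_closed[of n "P\<inverse>" W' W] joinable_converse[of n P W W'] j by (simp add: flip_joined)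
  show "compatible (flip p) f g \<longleftrightarrow> compatible p g f"
    unfolding j(2) flip_joined compatible_joined converse_iff
    by (auto simp: unsplit2_def)
  show "flip (flip p) = p" by (simp add: j(2) flip_joined)
qed

text \<open>Reflection exchanges the two arguments of \<open>compatible\<close>, and the count of
  middle colourings is symmetric in the two factors.\<close>

lemma flip_comp:
  assumes p: "p \<in> diagrams n n" and q: "q \<in> diagrams n n"
  shows "dcomp n (flip q) (flip p) = flip (dcomp n p q)"
    "loops n (flip q) (flip p) = loops n p q"
proof -
  have pq: "dcomp n p q \<in> diagrams n n" by (rule diagram_comp_closed[OF p q])
  have c: "card {h. h \<subseteq> {1..n} \<and> compatible (flip q) f h \<and> compatible (flip p) h g}
     = (if compatible (flip (dcomp n p q)) f g then 2 ^ loops n p q else 0)"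
    if "f \<subseteq> {1..n}" "g \<subseteq> {1..n}" for f g
    unfolding flip_closed(2)[OF p] flip_closed(2)[OF q] flip_closed(2)[OF pq]
    using card_compatible_comp[OF p q that(2,1)] by (simp add: conj_commute)
  show "dcomp n (flip q) (flip p) = flip (dcomp n p q)"
    "loops n (flip q) (flip p) = loops n p q"
    using diagram_compI[OF flip_closed(1)[OF q] flip_closed(1)[OF p] flip_closed(1)[OF pq] c] by auto
qed

lemma flip_tonal:
  assumes "p \<in> tonal_diagrams l n" shows "flip p \<in> tonal_diagrams l n"
proof -
  note p = tonal_diagramsD[OF assms]
  show ?thesis unfolding tonal_diagrams_iff flip_closed(2)[OF p]
    using flip_closed(1)[OF p] assms[unfolded tonal_diagrams_iff] by metis
qed

section \<open>Compositions with matching middle rows\<close>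

lemma joinable_relcomp:
  assumes p: "joinable n P W X" and q: "joinable n Q X' W'" and m: "snd ` P = fst ` Q"
  shows "joinable n (P O Q) W W'"
proof -
  note p' = joinableD[OF p] and q' = joinableD[OF q]
  have 1: "fst ` (P O Q) = fst ` P"
  proof
    show "fst ` P \<subseteq> fst ` (P O Q)"
    proof
      fix x assume "x \<in> fst ` P"
      then obtain y where xy: "(x, y) \<in> P" by force
      hence "y \<in> fst ` Q" using m by force
      then obtain z where "(y, z) \<in> Q" by force
      with xy show "x \<in> fst ` (P O Q)" by force
    qed
  qed force
  have 2: "snd ` (P O Q) = snd ` Q"
  proof
    show "snd ` Q \<subseteq> snd ` (P O Q)"
    proof
      fix z assume "z \<in> snd ` Q"
      then obtain y where yz: "(y, z) \<in> Q" by force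
      hence "y \<in> snd ` P" using m by force
      then obtain x where "(x, y) \<in> P" by force
      with yz show "z \<in> snd ` (P O Q)" by force
    qed
  qed force
  have "inj_on fst (P O Q)"
  proof (rule inj_onI)
    fix z w assume "z \<in> P O Q" "w \<in> P O Q" "fst z = fst w"
    then obtain x y u y' u' where "z = (x, u)" "w = (x, u')" "(x, y) \<in> P" "(y, u) \<in> Q" "(x, y') \<in> P" "(y', u') \<in> Q"
      by auto
    thus "z = w" using p'(3)[of x y y'] q'(3)[of y u u'] by simp
  qed
  moreover have "inj_on snd (P O Q)"
  proof (rule inj_onI)
    fix z w assume "z \<in> P O Q" "w \<in> P O Q" "snd z = snd w"
    then obtain x y u y' x' where "z = (x, u)" "w = (x', u)" "(x, y) \<in> P" "(y, u) \<in> Q" "(x', y') \<in> P" "(y', u) \<in> Q"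
      by auto
    thus "z = w" using q'(4)[of y u y'] p'(4)[of x y x'] by simp
  qed
  ultimately show ?thesis using 1 2 p'(1) q'(2) by (simp add: joinable_def)
qed

text \<open>Here the middle blocks of the two diagrams agree. The colour of a propagating block is
  then forced by its end in the top row, while each cut block of the middle row is a component of
  its own and can be coloured freely.\<close>

lemma matched_comp:
  assumes p: "joinable n P W X" and q: "joinable n Q X W'" and m: "snd ` P = fst ` Q"
  shows "dcomp n (joined P W X) (joined Q X W') = joined (P O Q) W W'"
    "loops n (joined P W X) (joined Q X W') = card X"
proof -
  note p' = joinableD[OF p] and q' = joinableD[OF q]
  note T = row_splitD[OF p'(1)] and M = row_splitD[OF p'(2)] and B = row_splitD[OF q'(2)]
  have pq: "joinable n (P O Q) W W'" by (rule joinable_relcomp[OF p q m])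
  have c: "card {h. h \<subseteq> {1..n} \<and> compatible (joined P W X) f h \<and> compatible (joined Q X W') h g}
     = (if compatible (joined (P O Q) W W') f g then 2 ^ card X else 0)" (is "card ?H = _")
    if "f \<subseteq> {1..n}" "g \<subseteq> {1..n}" for f g
  proof (cases "compatible (joined (P O Q) W W') f g")
    case True
    \<comment> \<open>The colour of a middle block is copied from its partner on top, which is
      unique since \<open>snd\<close> is injective on \<open>P\<close>.\<close>
    let ?A = "\<lambda>y. \<exists>x. (x, y) \<in> P \<and> x \<subseteq> f"
    have "?H = {h. h \<subseteq> {1..n} \<and> (\<forall>y\<in>snd ` P. if ?A y then y \<subseteq> h else y \<inter> h = {}) \<and> (\<forall>u\<in>X. u \<subseteq> h \<or> u \<inter> h = {})}"
    proof (rule Collect_cong, rule conj_cong[OF refl])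
      fix h assume "h \<subseteq> {1..n}"
      have 1: "compatible (joined P W X) f h \<and> compatible (joined Q X W') h g \<longleftrightarrow>
        ((\<forall>x y. (x, y) \<in> P \<longrightarrow> unsplit2 x y f h) \<and> (\<forall>y z. (y, z) \<in> Q \<longrightarrow> unsplit2 y z h g)) \<and> (\<forall>u\<in>X. unsplit u h)"
        using True unfolding compatible_joined by blast
      have A: "?A y \<longleftrightarrow> x \<subseteq> f" if "(x, y) \<in> P" for x y using p'(4)[OF that] that by metis
      have 2: "(\<forall>x y. (x, y) \<in> P \<longrightarrow> unsplit2 x y f h) \<and> (\<forall>y z. (y, z) \<in> Q \<longrightarrow> unsplit2 y z h g)
        \<longleftrightarrow> (\<forall>y\<in>snd ` P. if ?A y then y \<subseteq> h else y \<inter> h = {})" (is "?l1 \<and> ?l2 \<longleftrightarrow> ?r")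
      proof
        assume l: "?l1 \<and> ?l2"
        show ?r
        proof
          fix y assume "y \<in> snd ` P"
          then obtain x where x: "(x, y) \<in> P" by force
          have "x \<noteq> {}" using T(3)[of x] mem_fst_snd(1)[OF x] by blast
          moreover have "unsplit2 x y f h" using l x by blast
          ultimately show "if ?A y then y \<subseteq> h else y \<inter> h = {}" unfolding A[OF x] unsplit2_def by auto
        qed
      next
        assume r: ?r
        have tr: "unsplit2 x z f g" if "(x, y) \<in> P" "(y, z) \<in> Q" for x y z
          using True that unfolding compatible_joined by blast
        have yz: "\<exists>x. (x, y) \<in> P" if "(y, z) \<in> Q" for y z
        proof -
          have "y \<in> snd ` P" unfolding m using that by (rule mem_fst_snd(1))
          thus ?thesis by force
        qed
        have xy: "\<exists>z. (y, z) \<in> Q" if "(x, y) \<in> P" for x y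
        proof -
          have "y \<in> fst ` Q" unfolding m[symmetric] using that by (rule mem_fst_snd(2))
          thus ?thesis by force
        qed
        have ry: "if x \<subseteq> f then y \<subseteq> h else y \<inter> h = {}" if "(x, y) \<in> P" for x y
          using bspec[OF r mem_fst_snd(2)[OF that]] unfolding A[OF that] .
        show "?l1 \<and> ?l2"
        proof (intro conjI allI impI)
          fix x y assume x: "(x, y) \<in> P"
          then obtain z where z: "(y, z) \<in> Q" using xy by blast
          have "x \<noteq> {}" using T(3)[of x] mem_fst_snd(1)[OF x] by blast
          thus "unsplit2 x y f h"
            using tr[OF x z] ry[OF x] unfolding unsplit2_def by (auto split: if_splits)
        next
          fix y z assume z: "(y, z) \<in> Q"
          then obtain x where x: "(x, y) \<in> P" using yz by blast
          have "x \<noteq> {}" using T(3)[of x] mem_fst_snd(1)[OF x] by blast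
          thus "unsplit2 y z h g"
            using tr[OF x z] ry[OF x] unfolding unsplit2_def by (auto split: if_splits)
        qed
      qed
      show "compatible (joined P W X) f h \<and> compatible (joined Q X W') h g \<longleftrightarrow>
        (\<forall>y\<in>snd ` P. if ?A y then y \<subseteq> h else y \<inter> h = {}) \<and> (\<forall>u\<in>X. u \<subseteq> h \<or> u \<inter> h = {})"
        unfolding 1 2 unsplit_def by (rule refl)
    qed
    thus ?thesis using True card_row_colourings[OF p'(2), of ?A] by simp
  next
    case False
    have "?H = {}"
    proof (rule ccontr)
      assume "?H \<noteq> {}"
      then obtain h where h: "compatible (joined P W X) f h" "compatible (joined Q X W') h g" by blast
      have "unsplit2 x z f g" if "(x, y) \<in> P" "(y, z) \<in> Q" for x y z
      proof -
        have "y \<noteq> {}" using M(3)[of y] mem_fst_snd(2)[OF that(1)] by blast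
        moreover have "unsplit2 x y f h" "unsplit2 y z h g" using h that unfolding compatible_joined by blast+
        ultimately show ?thesis using unsplit2_trans by blast
      qed
      hence "compatible (joined (P O Q) W W') f g" using h unfolding compatible_joined by blast
      with False show False by simp
    qed
    thus ?thesis using False by simp
  qed
  show "dcomp n (joined P W X) (joined Q X W') = joined (P O Q) W W'"
    "loops n (joined P W X) (joined Q X W') = card X"
    using diagram_compI[OF joined_closed[OF p] joined_closed[OF q] joined_closed[OF pq] c] by auto
qed

lemma joinable_Id: "row_split n B C \<Longrightarrow> joinable n (Id_on B) C C"
proof -
  have "fst ` Id_on B = B" "snd ` Id_on B = B" by force+
  thus "row_split n B C \<Longrightarrow> joinable n (Id_on B) C C" by (auto simp: joinable_def inj_on_def)
qed

text \<open>The middle colouring has to repeat the bottom one on the blocks of \<open>B\<close> and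
  is free on those of \<open>C\<close>. Unlike \<open>matched_comp\<close> this allows
  \<open>q\<close> to join several blocks of \<open>B\<close>, as happens when a product has left
  the half diagrams.\<close>

lemma diagonal_absorb:
  assumes q: "q \<in> diagrams n n" and BC: "row_split n B C"
    and B: "\<And>f g b. compatible q f g \<Longrightarrow> f \<subseteq> {1..n} \<Longrightarrow> g \<subseteq> {1..n} \<Longrightarrow> b \<in> B \<Longrightarrow> b \<subseteq> g \<or> b \<inter> g = {}"
    and C: "\<And>u. u \<in> C \<Longrightarrow> row_pair {} u \<in> q"
  shows "dcomp n q (joined (Id_on B) C C) = q"
    "loops n q (joined (Id_on B) C C) = card C"
proof -
  note R = row_splitD[OF BC]
  \<comment> \<open>Outside the parts in \<open>C\<close>, all that matters about the bottom set is
    which blocks of \<open>B\<close> it contains.\<close>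
  have transfer: "compatible q f g'"
    if g: "compatible q f g" and "g' \<subseteq> {1..n}" "g \<subseteq> {1..n}" and
      Bg: "\<And>b. b \<in> B \<Longrightarrow> b \<subseteq> g \<and> b \<subseteq> g' \<or> b \<inter> g = {} \<and> b \<inter> g' = {}"
      and Cg: "\<And>u. u \<in> C \<Longrightarrow> u \<subseteq> g' \<or> u \<inter> g' = {}" for f g g'
    unfolding compatible_def
  proof
    fix s assume s: "s \<in> q"
    show "s \<subseteq> row_pair f g' \<or> s \<inter> row_pair f g' = {}"
    proof (cases "\<exists>u\<in>C. s = row_pair {} u")
      case True
      then obtain u where "u \<in> C" "s = row_pair {} u" by blast
      thus ?thesis using Cg[of u] by simp
    next
      case False
      have "v \<in> row_pair f g \<longleftrightarrow> v \<in> row_pair f g'" if v: "v \<in> s" for v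
      proof (cases v)
        case (Bot i)
        have "i \<in> {1..n}" using diagramsD(4)[OF q s] v Bot by auto
        from R(6)[OF this] obtain b where b: "b \<in> B \<union> C" "i \<in> b" by blast
        have "b \<notin> C"
        proof
          assume "b \<in> C"
          from diagramsD(3)[OF q s C[OF this] v] Bot b False \<open>b \<in> C\<close> show False by auto
        qed
        hence "b \<in> B" using b by blast
        thus ?thesis using Bg[of b] b Bot by auto
      qed auto
      moreover have "s \<subseteq> row_pair f g \<or> s \<inter> row_pair f g = {}" using g s by (auto simp: compatible_def)
      ultimately show ?thesis by blast
    qed
  qed
  have c: "card {h. h \<subseteq> {1..n} \<and> compatible q f h \<and> compatible (joined (Id_on B) C C) h g}
     = (if compatible q f g then 2 ^ card C else 0)" (is "card ?H = _")
    if fg: "f \<subseteq> {1..n}" "g \<subseteq> {1..n}" for f g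
  proof (cases "compatible q f g")
    case True
    have Cg: "u \<subseteq> g \<or> u \<inter> g = {}" if "u \<in> C" for u
      using True C[OF that] unfolding compatible_def by fastforce
    have "?H = {h. h \<subseteq> {1..n} \<and> (\<forall>b\<in>B. if b \<subseteq> g then b \<subseteq> h else b \<inter> h = {}) \<and> (\<forall>u\<in>C. u \<subseteq> h \<or> u \<inter> h = {})}"
    proof (rule Collect_cong, rule conj_cong[OF refl])
      fix h assume h: "h \<subseteq> {1..n}"
      have Bg: "b \<subseteq> g \<or> b \<inter> g = {}" if "b \<in> B" for b using B[OF True fg that] .
      have ne: "b \<noteq> {}" if "b \<in> B" for b using R(3) that by blast
      have d: "compatible (joined (Id_on B) C C) h g \<longleftrightarrow>
        (\<forall>b\<in>B. if b \<subseteq> g then b \<subseteq> h else b \<inter> h = {}) \<and> (\<forall>u\<in>C. u \<subseteq> h \<or> u \<inter> h = {})"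
      proof -
        have "(b \<subseteq> h \<and> b \<subseteq> g \<or> b \<inter> h = {} \<and> b \<inter> g = {}) \<longleftrightarrow> (if b \<subseteq> g then b \<subseteq> h else b \<inter> h = {})" if "b \<in> B" for b
          using Bg[OF that] ne[OF that] by auto
        thus ?thesis unfolding compatible_joined unsplit_def unsplit2_def using Cg by (auto simp: Id_on_def)
      qed
      have "compatible q f h" if r: "(\<forall>b\<in>B. if b \<subseteq> g then b \<subseteq> h else b \<inter> h = {}) \<and> (\<forall>u\<in>C. u \<subseteq> h \<or> u \<inter> h = {})"
      proof (rule transfer[OF True h fg(2)])
        fix b assume b: "b \<in> B"
        show "b \<subseteq> g \<and> b \<subseteq> h \<or> b \<inter> g = {} \<and> b \<inter> h = {}"
          using r b Bg[OF b] ne[OF b] by (auto split: if_splits)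
      qed (use r in blast)
      thus "compatible q f h \<and> compatible (joined (Id_on B) C C) h g \<longleftrightarrow>
        (\<forall>b\<in>B. if b \<subseteq> g then b \<subseteq> h else b \<inter> h = {}) \<and> (\<forall>u\<in>C. u \<subseteq> h \<or> u \<inter> h = {})"
        unfolding d by blast
    qed
    thus ?thesis using True card_row_colourings[OF BC, of "\<lambda>b. b \<subseteq> g"] by simp
  next
    case False
    have "?H = {}"
    proof (rule ccontr)
      assume "?H \<noteq> {}"
      then obtain h where h: "h \<subseteq> {1..n}" "compatible q f h" "compatible (joined (Id_on B) C C) h g" by blast
      have "compatible q f g"
        by (rule transfer[OF h(2) fg(2) h(1)]) (use h(3) in \<open>auto simp: compatible_joined Id_on_def unsplit_def unsplit2_def\<close>)
      with False show False by simp
    qed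
    thus ?thesis using False by simp
  qed
  show "dcomp n q (joined (Id_on B) C C) = q"
    "loops n q (joined (Id_on B) C C) = card C"
    using diagram_compI[OF q joined_closed[OF joinable_Id[OF BC]] q c] by auto
qed

text \<open>A part that meets the set is contained in it by compatibility and contains it by
  minimality, the part being compatible itself.\<close>

lemma part_if_minimal:
  assumes p: "p \<in> diagrams n n" and c: "compatible p f0 g0" and ne: "row_pair f0 g0 \<noteq> {}"
    and sub: "f0 \<subseteq> {1..n}" "g0 \<subseteq> {1..n}"
    and mi: "\<And>f g. f \<subseteq> {1..n} \<Longrightarrow> g \<subseteq> {1..n} \<Longrightarrow> compatible p f g \<Longrightarrow>
        row_pair f0 g0 \<subseteq> row_pair f g \<or> row_pair f0 g0 \<inter> row_pair f g = {}"
  shows "row_pair f0 g0 \<in> p"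
proof -
  obtain v where v: "v \<in> row_pair f0 g0" using ne by blast
  hence "v \<in> Top ` {1..n} \<union> Bot ` {1..n}" using row_pair_vertices[OF sub] by blast
  then obtain s where s: "s \<in> p" "v \<in> s" using diagramsD(1)[OF p] by blast
  obtain f g where fg: "s = row_pair f g" "f \<subseteq> {1..n}" "g \<subseteq> {1..n}"
    using eq_row_pair diagramsD(4)[OF p s(1)] by metis
  have "s \<subseteq> row_pair f0 g0 \<or> s \<inter> row_pair f0 g0 = {}" using c s(1) unfolding compatible_def by blast
  moreover have "compatible p f g" using compatible_part[OF p] s fg by simp
  ultimately have "s = row_pair f0 g0" using mi[of f g] fg s v by blast
  thus ?thesis using s by simp
qed

section \<open>The number of propagating parts\<close>

definition prop_pairs :: "diagram \<Rightarrow> (nat set \<times> nat set) set" where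
  "prop_pairs p = {(x, y). row_pair x y \<in> p \<and> x \<noteq> {} \<and> y \<noteq> {}}"

lemma prop_pairs_joined: "joinable n P W W' \<Longrightarrow> prop_pairs (joined P W W') = P"
  unfolding prop_pairs_def using joined_parts(1)[of n P W W'] by auto

lemma prop_pairs_flip: "p \<in> diagrams n n \<Longrightarrow> prop_pairs (flip p) = (prop_pairs p)\<inverse>"
  by (metis diagram_eq_joined flip_joined joinable_converse prop_pairs_joined)

text \<open>The bottom half \<open>y\<close> of a propagating part of the product contains the
  bottom half of a propagating part of \<open>q\<close>. Otherwise \<open>y\<close> with the empty
  set above it would be compatible with \<open>q\<close>, hence with the product, and would cut the
  part in two. Disjointness of the halves makes the choice injective.\<close>

lemma card_prop_pairs_comp:
  assumes p: "p \<in> diagrams n n" and q: "q \<in> diagrams n n"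
  shows "card (prop_pairs (dcomp n p q)) \<le> card (prop_pairs q)"
proof -
  let ?pq = "dcomp n p q"
  have pq: "?pq \<in> diagrams n n" by (rule diagram_comp_closed[OF p q])
  obtain P W W' where P: "joinable n P W W'" "?pq = joined P W W'" using diagram_eq_joined[OF pq] by blast
  obtain Q X X' where Q: "joinable n Q X X'" "q = joined Q X X'" using diagram_eq_joined[OF q] by blast
  note PD = joinableD[OF P(1)] and QD = joinableD[OF Q(1)]
  have ex: "\<exists>x' y'. (x', y') \<in> Q \<and> y' \<subseteq> y" if xy: "(x, y) \<in> P" for x y
  proof (rule ccontr)
    assume no: "\<nexists>x' y'. (x', y') \<in> Q \<and> y' \<subseteq> y"
    have sub: "x \<subseteq> {1..n}" "y \<subseteq> {1..n}" and ne: "x \<noteq> {}" "y \<noteq> {}"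
      using row_splitD(3,4)[OF PD(1), of x] row_splitD(3,4)[OF PD(2), of y] mem_fst_snd[OF xy] by simp_all
    have "row_pair x y \<in> ?pq" using joined_parts(1)[OF P(1)] xy P(2) by blast
    hence c: "compatible ?pq x y" by (rule compatible_part[OF pq])
    then obtain h where h: "compatible q h y" using compatible_comp_iff[OF p q sub] by blast
    have "compatible q {} y"
      unfolding Q(2) compatible_joined
    proof (intro conjI allI impI ballI)
      fix x' y' assume q': "(x', y') \<in> Q"
      have "unsplit2 x' y' h y" using h q' unfolding Q(2) compatible_joined by blast
      thus "unsplit2 x' y' {} y" using no q' unfolding unsplit2_def by blast
    next
      show "unsplit u {}" for u by (simp add: unsplit_def)
      show "unsplit u y" if "u \<in> X'" for u using h that unfolding Q(2) compatible_joined by blast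
    qed
    hence "compatible ?pq {} y" using compatible_comp_iff[OF p q, of "{}" y] sub by auto
    hence "unsplit2 x y {} y" using xy unfolding P(2) compatible_joined by blast
    thus False using ne by (auto simp: unsplit2_def)
  qed
  define c where "c z = (SOME w. w \<in> Q \<and> snd w \<subseteq> snd z)" for z :: "nat set \<times> nat set"
  have c: "c z \<in> Q \<and> snd (c z) \<subseteq> snd z" if z: "z \<in> P" for z
  proof -
    obtain x y where xy: "z = (x, y)" by (cases z)
    have "\<exists>w. w \<in> Q \<and> snd w \<subseteq> snd z" using ex[of x y] z xy by force
    thus ?thesis unfolding c_def by (rule someI_ex)
  qed
  have "card P \<le> card Q"
  proof (rule card_inj_on_le)
    show "c ` P \<subseteq> Q" using c by blast
    show "inj_on c P"
    proof (rule inj_onI)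
      fix z w assume zw: "z \<in> P" "w \<in> P" "c z = c w"
      have "snd (c z) \<noteq> {}" using row_splitD(3)[OF QD(2)] c[OF zw(1)] by blast
      then obtain i where "i \<in> snd z" "i \<in> snd w" using c[OF zw(1)] c[OF zw(2)] zw(3) by auto
      hence "snd z = snd w" using row_splitD(5)[OF PD(2), of "snd z" "snd w"] zw by blast
      thus "z = w" using PD(6) zw by (auto dest: inj_onD)
    qed
  qed (rule QD(7))
  thus ?thesis unfolding P(2) using Q(2) by (simp add: prop_pairs_joined[OF P(1)] prop_pairs_joined[OF Q(1)])
qed

lemma card_prop_pairs_comp':
  assumes p: "p \<in> diagrams n n" and q: "q \<in> diagrams n n"
  shows "card (prop_pairs (dcomp n p q)) \<le> card (prop_pairs p)"
proof -
  have "card (prop_pairs (dcomp n p q)) = card (prop_pairs (flip (dcomp n p q)))"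
    by (simp add: prop_pairs_flip[OF diagram_comp_closed[OF p q]] card_inverse)
  also have "\<dots> \<le> card (prop_pairs (flip p))"
    unfolding flip_comp(1)[OF p q, symmetric] by (intro card_prop_pairs_comp flip_closed p q)
  also have "\<dots> = card (prop_pairs p)" by (simp add: prop_pairs_flip[OF p] card_inverse)
  finally show ?thesis .
qed

section \<open>The diagrams \<open>a\<close>, propagating vectors and half diagrams\<close>

section \<open>The diagrams a\<close>

definition iv :: "nat \<Rightarrow> nat \<Rightarrow> nat set" where
  "iv k i = {k + 1..k + i}"

definition shifted :: "nat \<Rightarrow> diagram \<Rightarrow> diagram" where
  "shifted k p = (\<lambda>s. shift_vertex k k ` s) ` p"

definition blk :: "nat \<Rightarrow> (nat \<Rightarrow> nat) \<Rightarrow> nat \<Rightarrow> nat \<Rightarrow> nat set" where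
  "blk l m i j = iv ((\<Sum>i'=Suc i..l. i' * m i') + (j - 1) * i) i"

definition through_blocks :: "nat \<Rightarrow> (nat \<Rightarrow> nat) \<Rightarrow> nat set set" where
  "through_blocks l m = {blk l m i j | i j. i \<in> {1..l} \<and> j \<in> {1..m i}}"

text \<open>These depend on the index only through its weight \<open>r\<close>, so the diagrams
  \<open>a\<close> of all indices of one weight share them with the weight idempotent.\<close>

definition cut_blocks :: "nat \<Rightarrow> nat \<Rightarrow> nat \<Rightarrow> nat set set" where
  "cut_blocks l n r = (\<lambda>j. iv (r + (j - 1) * l) l) ` {1..(n - r) div l}"

lemma block_eq: "block l m i j = row_pair {} (blk l m i j)"
  by (simp add: block_def blk_def iv_def row_pair_def Let_def)

lemma card_iv [simp]: "card (iv k i) = i"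
  by (simp add: iv_def)

lemma iv_eq_iff:
  assumes "1 \<le> i" shows "iv k i = iv k' i \<longleftrightarrow> k = k'"
proof
  assume e: "iv k i = iv k' i"
  have "k + 1 \<in> iv k' i" "k' + 1 \<in> iv k i" using assms e unfolding iv_def by auto
  thus "k = k'" unfolding iv_def by simp
qed simp

lemma iv_shift: "(+) k ` iv j i = iv (k + j) i"
  unfolding iv_def image_add_atLeastAtMost by (simp add: add.assoc)

lemma shift_row_pair: "shift_vertex k k ` row_pair x y = row_pair ((+) k ` x) ((+) k ` y)"
  by (auto simp: row_pair_def image_Un image_image)

lemma shifted_simps:
  "shifted k {} = {}" "shifted k (p \<union> q) = shifted k p \<union> shifted k q"
  "shifted k (shifted j p) = shifted (k + j) p"
proof -
  have "shift_vertex k k (shift_vertex j j v) = shift_vertex (k + j) (k + j) v" for v by (cases v) auto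
  thus "shifted k (shifted j p) = shifted (k + j) p"
    unfolding shifted_def image_image by simp
qed (auto simp: shifted_def)

lemma shifted_joined:
  "shifted k (joined P W W') = joined (map_prod ((`) ((+) k)) ((`) ((+) k)) ` P) ((`) ((+) k) ` W) ((`) ((+) k) ` W')"
  unfolding shifted_def joined_def image_Un image_image
  by (simp add: shift_row_pair split_beta)

lemma juxtapose_list_append:
  "juxtapose_list (xs @ ys) = juxtapose_list xs \<union> shifted (sum_list (map fst xs)) (juxtapose_list ys)"
proof (induction xs)
  case Nil
  have "shift_vertex 0 0 v = v" for v by (cases v) auto
  thus ?case by (simp add: shifted_def)
next
  case (Cons x xs)
  obtain k p where x: "x = (k, p)" by (cases x)
  show ?case unfolding x append_Cons juxtapose_list.simps juxtapose_def shifted_def[symmetric] Cons.IH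
    by (simp add: shifted_simps Un_assoc)
qed

lemma shifted_closed:
  assumes p: "p \<in> diagrams a a" and q: "q \<in> diagrams b b"
  shows "p \<union> shifted a q \<in> diagrams (a + b) (a + b)"
proof -
  let ?V = "\<lambda>a. Top ` {1..a} \<union> Bot ` {1..a}"
  let ?f = "shift_vertex a a"
  have inj: "inj_on ?f (?V b)" by (auto simp: inj_on_def)
  have im: "?f ` ?V b = Top ` {a + 1..a + b} \<union> Bot ` {a + 1..a + b}"
  proof -
    have "?f ` ?V b = Top ` ((+) a ` {1..b}) \<union> Bot ` ((+) a ` {1..b})" by (simp only: image_Un image_image shift_vertex.simps)
    thus ?thesis by (simp only: image_add_atLeastAtMost add.commute[of a 1] add.commute[of a b])
  qed
  have "{} \<notin> (`) ?f ` q" using diagramsD(2)[OF q] by auto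
  moreover have "partition_on (?f ` ?V b) ((`) ?f ` q - {{}})"
    by (rule partition_on_inj_image[OF _ inj]) (use q in \<open>simp add: diagrams_def\<close>)
  ultimately have 2: "partition_on (?f ` ?V b) (shifted a q)" by (simp add: shifted_def)
  have 1: "partition_on (?V a) p" using p by (simp add: diagrams_def)
  have nd: "x \<notin> ?f ` ?V b" if "x \<in> ?V a" for x using that unfolding im by (cases x) auto
  have d: "?V a \<inter> ?f ` ?V b = {}"
  proof (rule equals0I)
    fix x assume x: "x \<in> ?V a \<inter> ?f ` ?V b"
    from nd[OF IntD1[OF x]] IntD2[OF x] show False by (rule notE)
  qed
  have "partition_on (?V a \<union> ?f ` ?V b) (p \<union> shifted a q)"
  proof (rule partition_onI)
    show "\<Union>(p \<union> shifted a q) = ?V a \<union> ?f ` ?V b"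
      unfolding Union_Un_distrib partition_onD1[OF 1, symmetric] partition_onD1[OF 2, symmetric] ..
    show "{} \<notin> p \<union> shifted a q" using partition_onD3[OF 1] partition_onD3[OF 2] by blast
    have s1: "s \<subseteq> ?V a" if "s \<in> p" for s unfolding partition_onD1[OF 1] using that by (rule Union_upper)
    have s2: "s \<subseteq> ?f ` ?V b" if "s \<in> shifted a q" for s unfolding partition_onD1[OF 2] using that by (rule Union_upper)
    have d': "disjnt s t" if "s \<in> p" "t \<in> shifted a q" for s t
      unfolding disjnt_def using s1[OF that(1)] s2[OF that(2)] d by (metis Int_mono subset_empty)
    show "disjnt s t" if st: "s \<in> p \<union> shifted a q" "t \<in> p \<union> shifted a q" "s \<noteq> t" for s t
    proof -
      consider "s \<in> p" "t \<in> p" | "s \<in> shifted a q" "t \<in> shifted a q"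
        | "s \<in> p" "t \<in> shifted a q" | "t \<in> p" "s \<in> shifted a q" using st by blast
      thus ?thesis
      proof cases
        case 1
        thus ?thesis using disjointD[OF partition_onD2[OF \<open>partition_on (?V a) p\<close>]] st(3) by (simp add: disjnt_def)
      next
        case 2
        thus ?thesis using disjointD[OF partition_onD2[OF \<open>partition_on (?f ` ?V b) (shifted a q)\<close>]] st(3) by (simp add: disjnt_def)
      next
        case 3
        thus ?thesis by (rule d')
      next
        case 4
        thus ?thesis using d' disjnt_sym by blast
      qed
    qed
  qed
  moreover have "?V a \<union> ?f ` ?V b = ?V (a + b)"
  proof -
    have "{1..a + b} = {1..a} \<union> {a + 1..a + b}" by auto
    thus ?thesis unfolding im by (simp only: image_Un Un_ac)
  qed
  ultimately show ?thesis by (simp add: diagrams_def)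
qed

lemma juxtapose_list_closed:
  "(\<And>k p. (k, p) \<in> set xs \<Longrightarrow> p \<in> diagrams k k) \<Longrightarrow>
    juxtapose_list xs \<in> diagrams (sum_list (map fst xs)) (sum_list (map fst xs))"
proof (induction xs)
  case Nil
  show ?case by (simp add: diagrams_def partition_on_def)
next
  case (Cons x xs)
  obtain k p where x: "x = (k, p)" by (cases x)
  have "p \<union> shifted k (juxtapose_list xs) \<in> diagrams (k + sum_list (map fst xs)) (k + sum_list (map fst xs))"
    by (rule shifted_closed) (use Cons x in auto)
  thus ?case by (simp add: x juxtapose_def shifted_def)
qed

lemma b_diagram_eq: "b_diagram i = joined (Id_on {iv 0 i}) {} {}"
  by (auto simp: b_diagram_def joined_def iv_def row_pair_def)

lemma row_split_single: "1 \<le> i \<Longrightarrow> row_split i {iv 0 i} {}" "1 \<le> i \<Longrightarrow> row_split i {} {iv 0 i}"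
  by (rule row_splitI, simp, simp add: iv_def, simp add: iv_def, simp)+

lemma b_diagram_closed: "1 \<le> i \<Longrightarrow> b_diagram i \<in> diagrams i i"
  unfolding b_diagram_eq by (intro joined_closed joinable_Id row_split_single)

lemma cut_diagram:
  assumes "1 \<le> l"
  shows "diagram_comp l 0 l (w_diagram l) (wstar_diagram l) = joined {} {iv 0 l} {iv 0 l}"
    "joined {} {iv 0 l} {iv 0 l} \<in> diagrams l l"
proof -
  have j: "joinable l {} {iv 0 l} {iv 0 l}"
    using row_split_single(2)[OF assms] by (simp add: joinable_def)
  show q: "joined {} {iv 0 l} {iv 0 l} \<in> diagrams l l" by (rule joined_closed[OF j])
  have w: "w_diagram l \<in> diagrams l 0" "wstar_diagram l \<in> diagrams 0 l"
    using assms by (simp_all add: diagrams_def w_diagram_def wstar_diagram_def partition_on_space)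
  have s: "w_diagram l = {row_pair (iv 0 l) {}}" "wstar_diagram l = {row_pair {} (iv 0 l)}"
    by (auto simp: w_diagram_def wstar_diagram_def iv_def row_pair_def)
  have c: "card {h. h \<subseteq> {1..0} \<and> compatible (w_diagram l) f h \<and> compatible (wstar_diagram l) h g}
      = (if compatible (joined {} {iv 0 l} {iv 0 l}) f g then 2 ^ 0 else 0)" for f g
  proof -
    have "compatible (w_diagram l) f h \<longleftrightarrow> unsplit (iv 0 l) f" "compatible (wstar_diagram l) h g \<longleftrightarrow> unsplit (iv 0 l) g" for h
      unfolding s compatible_def unsplit_def by simp_all
    hence "{h. h \<subseteq> {1..0} \<and> compatible (w_diagram l) f h \<and> compatible (wstar_diagram l) h g}
       = (if compatible (joined {} {iv 0 l} {iv 0 l}) f g then {{}} else {})"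
      unfolding compatible_joined by auto
    thus ?thesis by simp
  qed
  show "diagram_comp l 0 l (w_diagram l) (wstar_diagram l) = joined {} {iv 0 l} {iv 0 l}"
    by (rule diagram_compI(1)[OF w q c])
qed

lemma juxtapose_replicate_b:
  "juxtapose_list (replicate t (i, b_diagram i)) = joined (Id_on ((\<lambda>j. iv ((j - 1) * i) i) ` {1..t})) {} {}"
proof (induction t)
  case 0 show ?case by (simp add: joined_def)
next
  case (Suc t)
  have "shifted i (juxtapose_list (replicate t (i, b_diagram i)))
      = joined (Id_on ((\<lambda>j. iv (i + (j - 1) * i) i) ` {1..t})) {} {}"
    unfolding Suc.IH shifted_joined by (simp add: Id_on_def image_UN image_image iv_shift)
  also have "(\<lambda>j. iv (i + (j - 1) * i) i) ` {1..t} = (\<lambda>j. iv ((j - 1) * i) i) ` Suc ` {1..t}"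
    unfolding image_image by (rule image_cong[OF refl]) (auto simp: gr0_conv_Suc Suc_le_eq)
  finally have "juxtapose_list (replicate (Suc t) (i, b_diagram i))
      = joined (Id_on {iv 0 i}) {} {} \<union> joined (Id_on ((\<lambda>j. iv ((j - 1) * i) i) ` Suc ` {1..t})) {} {}"
    by (simp add: juxtapose_def shifted_def b_diagram_eq)
  also have "\<dots> = joined (Id_on ({iv 0 i} \<union> (\<lambda>j. iv ((j - 1) * i) i) ` Suc ` {1..t})) {} {}"
    unfolding joined_def Id_on_def by auto
  also have "{iv 0 i} \<union> (\<lambda>j. iv ((j - 1) * i) i) ` Suc ` {1..t} = (\<lambda>j. iv ((j - 1) * i) i) ` insert 1 (Suc ` {1..t})"
    by simp
  also have "insert 1 (Suc ` {1..t}) = {1..Suc t}" by (auto simp: image_Suc_atLeastAtMost)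
  finally show ?case .
qed

lemma juxtapose_replicate_cut:
  "juxtapose_list (replicate t (l, joined {} {iv 0 l} {iv 0 l}))
     = joined {} ((\<lambda>j. iv ((j - 1) * l) l) ` {1..t}) ((\<lambda>j. iv ((j - 1) * l) l) ` {1..t})"
proof (induction t)
  case 0 show ?case by (simp add: joined_def)
next
  case (Suc t)
  have e: "(\<lambda>j. iv (l + (j - 1) * l) l) ` {1..t} = (\<lambda>j. iv ((j - 1) * l) l) ` Suc ` {1..t}"
    unfolding image_image by (rule image_cong[OF refl]) (auto simp: gr0_conv_Suc Suc_le_eq)
  have "shifted l (juxtapose_list (replicate t (l, joined {} {iv 0 l} {iv 0 l})))
      = joined {} ((\<lambda>j. iv ((j - 1) * l) l) ` Suc ` {1..t}) ((\<lambda>j. iv ((j - 1) * l) l) ` Suc ` {1..t})"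
    unfolding Suc.IH shifted_joined e[symmetric] by (simp add: image_image iv_shift)
  hence "juxtapose_list (replicate (Suc t) (l, joined {} {iv 0 l} {iv 0 l}))
      = joined {} {iv 0 l} {iv 0 l} \<union> joined {} ((\<lambda>j. iv ((j - 1) * l) l) ` Suc ` {1..t}) ((\<lambda>j. iv ((j - 1) * l) l) ` Suc ` {1..t})"
    by (simp add: juxtapose_def shifted_def)
  also have "\<dots> = joined {} ((\<lambda>j. iv ((j - 1) * l) l) ` insert 1 (Suc ` {1..t})) ((\<lambda>j. iv ((j - 1) * l) l) ` insert 1 (Suc ` {1..t}))"
    unfolding joined_def by (simp add: insert_commute)
  also have "insert 1 (Suc ` {1..t}) = {1..Suc t}" by (auto simp: image_Suc_atLeastAtMost)
  finally show ?case .
qed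

lemma through_blocksE:
  assumes "y \<in> through_blocks l m"
  obtains i j where "i \<in> {1..l}" "j \<in> {1..m i}" "y = blk l m i j"
  using assms unfolding through_blocks_def by blast

lemma blk_in: "i \<in> {1..l} \<Longrightarrow> j \<in> {1..m i} \<Longrightarrow> blk l m i j \<in> through_blocks l m"
  unfolding through_blocks_def by blast

text \<open>Passing from \<open>L\<close> to \<open>Suc L\<close> puts the largest blocks on the
  left and shifts all others by their total length, in agreement with the offset in
  \<open>blk\<close>.\<close>

lemma juxtapose_blocks:
  "juxtapose_list (concat (map (\<lambda>i. replicate (m i) (i, b_diagram i)) (rev [1..<Suc L])))
     = joined (Id_on (through_blocks L m)) {} {}"
  "sum_list (map fst (concat (map (\<lambda>i. replicate (m i) (i, b_diagram i)) (rev [1..<Suc L])))) = weight L m"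
proof (induction L)
  case 0
  { case 1 show ?case by (simp add: through_blocks_def joined_def) }
  { case 2 show ?case by (simp add: weight_def) }
next
  case (Suc L)
  define xs where "xs L = concat (map (\<lambda>i. replicate (m i) (i, b_diagram i)) (rev [1..<Suc L]))" for L
  have xs: "xs (Suc L) = replicate (m (Suc L)) (Suc L, b_diagram (Suc L)) @ xs L" by (simp add: xs_def)
  note IH = Suc.IH[folded xs_def]
  have sr: "sum_list (map fst (replicate (m (Suc L)) (Suc L, b_diagram (Suc L)))) = Suc L * m (Suc L)"
    by (simp add: sum_list_replicate)
  { case 1
    let ?A = "(\<lambda>j. iv ((j - 1) * Suc L) (Suc L)) ` {1..m (Suc L)}"
    let ?B = "(\<lambda>b. (+) (Suc L * m (Suc L)) ` b) ` through_blocks L m"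
    have "juxtapose_list (xs (Suc L)) = joined (Id_on ?A) {} {} \<union> joined (Id_on ?B) {} {}"
      unfolding xs juxtapose_list_append juxtapose_replicate_b sr IH(1) shifted_joined
      by (simp add: Id_on_def image_UN)
    also have "\<dots> = joined (Id_on (?A \<union> ?B)) {} {}" unfolding joined_def Id_on_def by auto
    also have "?A \<union> ?B = through_blocks (Suc L) m"
    proof -
      have bj: "blk (Suc L) m (Suc L) j = iv ((j - 1) * Suc L) (Suc L)" for j by (simp add: blk_def)
      have A: "?A = blk (Suc L) m (Suc L) ` {1..m (Suc L)}" by (rule image_cong[OF refl]) (rule bj[symmetric])
      have b: "(+) (Suc L * m (Suc L)) ` blk L m i j = blk (Suc L) m i j" if "i \<in> {1..L}" for i j
        unfolding blk_def iv_shift using that by (simp add: add_ac)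
      have B: "?B = {blk (Suc L) m i j | i j. i \<in> {1..L} \<and> j \<in> {1..m i}}"
      proof (intro equalityI subsetI)
        fix x assume "x \<in> ?B"
        then obtain i j where ij: "i \<in> {1..L}" "j \<in> {1..m i}" "x = (+) (Suc L * m (Suc L)) ` blk L m i j"
          by (auto simp: through_blocks_def)
        thus "x \<in> {blk (Suc L) m i j | i j. i \<in> {1..L} \<and> j \<in> {1..m i}}" using b by blast
      next
        fix x assume "x \<in> {blk (Suc L) m i j | i j. i \<in> {1..L} \<and> j \<in> {1..m i}}"
        then obtain i j where ij: "i \<in> {1..L}" "j \<in> {1..m i}" "x = blk (Suc L) m i j" by blast
        have "blk L m i j \<in> through_blocks L m" using ij unfolding through_blocks_def by blast
        thus "x \<in> ?B" using b[OF ij(1)] ij(3) by blast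
      qed
      have i: "i \<in> {1..Suc L} \<longleftrightarrow> i = Suc L \<or> i \<in> {1..L}" for i by auto
      show ?thesis unfolding A B
      proof (intro equalityI subsetI)
        fix x assume "x \<in> blk (Suc L) m (Suc L) ` {1..m (Suc L)} \<union> {blk (Suc L) m i j | i j. i \<in> {1..L} \<and> j \<in> {1..m i}}"
        then obtain i' j where "i' \<in> {1..Suc L}" "j \<in> {1..m i'}" "x = blk (Suc L) m i' j" using i by blast
        thus "x \<in> through_blocks (Suc L) m" using blk_in by blast
      next
        fix x assume "x \<in> through_blocks (Suc L) m"
        then obtain i' j where "i' \<in> {1..Suc L}" "j \<in> {1..m i'}" "x = blk (Suc L) m i' j" by (rule through_blocksE)
        thus "x \<in> blk (Suc L) m (Suc L) ` {1..m (Suc L)} \<union> {blk (Suc L) m i j | i j. i \<in> {1..L} \<and> j \<in> {1..m i}}"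
          unfolding i by blast
      qed
    qed
    finally show ?case unfolding xs_def . }
  { case 2 show ?case unfolding xs_def[symmetric] xs map_append sum_list_append sr IH(2) by (simp add: weight_def) }
qed

lemma card_blk [simp]: "card (blk l m i j) = i"
  by (simp add: blk_def)

lemma blk_eq_iff:
  assumes "i \<in> {1..l}" "j \<in> {1..m i}" "i' \<in> {1..l}" "j' \<in> {1..m i'}"
  shows "blk l m i j = blk l m i' j' \<longleftrightarrow> i = i' \<and> j = j'"
proof
  assume e: "blk l m i j = blk l m i' j'"
  have i: "i = i'" using arg_cong[OF e, of card] by simp
  have "(j - 1) * i = (j' - 1) * i" using e assms(1) unfolding i blk_def by (subst (asm) iv_eq_iff) (use assms in auto)
  thus "i = i' \<and> j = j'" using i assms by auto
qed simp

lemma card_through_block: "y \<in> through_blocks l m \<Longrightarrow> card y \<in> {1..l}"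
  by (erule through_blocksE) (simp only: card_blk)

lemma through_blocks_of_card:
  assumes "i \<in> {1..l}"
  shows "{y \<in> through_blocks l m. card y = i} = blk l m i ` {1..m i}" "card {y \<in> through_blocks l m. card y = i} = m i"
proof -
  show e: "{y \<in> through_blocks l m. card y = i} = blk l m i ` {1..m i}"
  proof (intro equalityI subsetI)
    fix y assume "y \<in> {y \<in> through_blocks l m. card y = i}"
    thus "y \<in> blk l m i ` {1..m i}" by (auto elim!: through_blocksE simp del: One_nat_def)
  next
    fix y assume "y \<in> blk l m i ` {1..m i}"
    thus "y \<in> {y \<in> through_blocks l m. card y = i}" using blk_in[OF assms] by (auto simp del: One_nat_def)
  qed
  have "inj_on (blk l m i) {1..m i}" using blk_eq_iff[OF assms _ assms] by (intro inj_onI) blast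
  thus "card {y \<in> through_blocks l m. card y = i} = m i" unfolding e by (simp add: card_image)
qed

lemma card_cut_block: "u \<in> cut_blocks l n r \<Longrightarrow> card u = l"
  by (auto simp: cut_blocks_def)

lemma index_setD:
  assumes "m \<in> index_set l n"
  shows "n = weight l m + (n - weight l m) div l * l" "weight l m \<le> n" "\<And>i. i \<notin> {1..l} \<Longrightarrow> m i = 0"
proof -
  obtain k where k: "n = weight l m + k * l" using assms by (auto simp: index_set_def)
  show "n = weight l m + (n - weight l m) div l * l" using k by (cases "l = 0") auto
  show "weight l m \<le> n" using k by simp
  show "\<And>i. i \<notin> {1..l} \<Longrightarrow> m i = 0" using assms by (auto simp: index_set_def)
qed

lemma a_diagram_eq:
  assumes l: "1 \<le> l"
  shows "a_diagram l n m = joined (Id_on (through_blocks l m)) (cut_blocks l n (weight l m)) (cut_blocks l n (weight l m))"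
proof -
  let ?r = "weight l m"
  have c: "(\<lambda>b. (+) ?r ` b) ` (\<lambda>j. iv ((j - 1) * l) l) ` {1..(n - ?r) div l} = cut_blocks l n ?r"
    unfolding cut_blocks_def image_image iv_shift ..
  show ?thesis
    unfolding a_diagram_def juxtapose_list_append juxtapose_blocks cut_diagram(1)[OF l] juxtapose_replicate_cut shifted_joined c
    unfolding joined_def by auto
qed

lemma a_diagram_closed:
  assumes l: "1 \<le> l" and m: "m \<in> index_set l n"
  shows "a_diagram l n m \<in> diagrams n n"
proof -
  let ?xs = "concat (map (\<lambda>i. replicate (m i) (i, b_diagram i)) (rev [1..<Suc l]))
      @ replicate ((n - weight l m) div l) (l, diagram_comp l 0 l (w_diagram l) (wstar_diagram l))"
  have "juxtapose_list ?xs \<in> diagrams (sum_list (map fst ?xs)) (sum_list (map fst ?xs))"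
    by (rule juxtapose_list_closed) (use l cut_diagram[OF l] b_diagram_closed in \<open>auto split: if_splits\<close>)
  moreover have "sum_list (map fst ?xs) = n"
    unfolding map_append sum_list_append juxtapose_blocks(2) using index_setD(1)[OF m] by (simp add: sum_list_replicate)
  ultimately show ?thesis unfolding a_diagram_def by simp
qed

text \<open>Transfers the partition property of a diagonal diagram to its blocks. For
  \<open>a\<close> that property comes from juxtaposition, so no arithmetic with intervals
  arises.\<close>

lemma row_split_of_diagonal:
  assumes "joined (Id_on B) C C \<in> diagrams n n" "{} \<notin> B" "{} \<notin> C"
  shows "row_split n B C"
proof (rule row_splitI)
  note D = diagramsD[OF assms(1)]
  have mB: "row_pair b b \<in> joined (Id_on B) C C" if "b \<in> B" for b unfolding mem_joined using that by blast
  have mC: "row_pair c {} \<in> joined (Id_on B) C C" if "c \<in> C" for c unfolding mem_joined using that by blast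
  show "B \<inter> C = {}"
  proof (rule equals0I)
    fix b assume b: "b \<in> B \<inter> C"
    then obtain i where "i \<in> b" using assms(2) by (metis IntD1 equals0I)
    hence "row_pair b b = row_pair b {}" using D(3)[OF mB mC, of b b "Top i"] b by auto
    thus False using \<open>i \<in> b\<close> by simp
  qed
  have "Top i \<in> \<Union>(joined (Id_on B) C C) \<longleftrightarrow> i \<in> \<Union>(B \<union> C)" for i
  proof
    assume "Top i \<in> \<Union>(joined (Id_on B) C C)"
    then obtain s where s: "s \<in> joined (Id_on B) C C" "Top i \<in> s" by blast
    then obtain x y where xy: "s = row_pair x y" using joinedE by blast
    hence "i \<in> x" "row_pair x y \<in> joined (Id_on B) C C" using s by simp_all
    thus "i \<in> \<Union>(B \<union> C)" unfolding mem_joined by blast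
  next
    assume "i \<in> \<Union>(B \<union> C)"
    then obtain b where "b \<in> B \<union> C" "i \<in> b" by blast
    hence "row_pair b b \<in> joined (Id_on B) C C \<or> row_pair b {} \<in> joined (Id_on B) C C" using mB mC by blast
    moreover have "Top i \<in> row_pair b b" "Top i \<in> row_pair b {}" using \<open>i \<in> b\<close> by simp_all
    ultimately show "Top i \<in> \<Union>(joined (Id_on B) C C)" by blast
  qed
  moreover have "Top i \<in> \<Union>(joined (Id_on B) C C) \<longleftrightarrow> i \<in> {1..n}" for i unfolding D(1) by auto
  ultimately show "\<Union>(B \<union> C) = {1..n}" by blast
  show "{} \<notin> B \<union> C" using assms by blast
  have ex: "\<exists>y. row_pair x y \<in> joined (Id_on B) C C" if "x \<in> B \<union> C" for x using that mB mC by blast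
  show "x = y" if xy: "x \<in> B \<union> C" "y \<in> B \<union> C" "i \<in> x" "i \<in> y" for x y i
  proof -
    obtain x' y' where "row_pair x x' \<in> joined (Id_on B) C C" "row_pair y y' \<in> joined (Id_on B) C C"
      using ex xy(1,2) by blast
    from D(3)[OF this, of "Top i"] show ?thesis using xy(3,4) by simp
  qed
qed

context
  fixes l n :: nat and m :: "nat \<Rightarrow> nat"
  assumes l: "1 \<le> l" and m: "m \<in> index_set l n"
begin

lemma blocks_row_split: "row_split n (through_blocks l m) (cut_blocks l n (weight l m))"
proof (rule row_split_of_diagonal)
  show "joined (Id_on (through_blocks l m)) (cut_blocks l n (weight l m)) (cut_blocks l n (weight l m)) \<in> diagrams n n"
    using a_diagram_closed[OF l m] by (simp only: a_diagram_eq[OF l])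
  show "{} \<notin> through_blocks l m" using card_through_block[of "{}" l m] by auto
  show "{} \<notin> cut_blocks l n (weight l m)" using card_cut_block[of "{}"] l by fastforce
qed

lemma card_cut_blocks: "card (cut_blocks l n (weight l m)) = (n - weight l m) div l"
proof -
  have "inj_on (\<lambda>j. iv (weight l m + (j - 1) * l) l) {1..(n - weight l m) div l}"
  proof (rule inj_onI)
    fix j j' assume j: "j \<in> {1..(n - weight l m) div l}" "j' \<in> {1..(n - weight l m) div l}"
      "iv (weight l m + (j - 1) * l) l = iv (weight l m + (j' - 1) * l) l"
    hence "(j - 1) * l = (j' - 1) * l" by (subst (asm) iv_eq_iff[OF l]) simp
    thus "j = j'" using l j(1,2) by auto
  qed
  thus ?thesis unfolding cut_blocks_def by (simp add: card_image)
qed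

lemma sum_cut_blocks: "(\<Sum>u\<in>cut_blocks l n (weight l m). card u) = n - weight l m"
  using index_setD(1)[OF m] by (simp add: card_cut_block card_cut_blocks)

lemma sum_through_blocks: "(\<Sum>y\<in>through_blocks l m. card y) = weight l m"
  using row_split_card[OF blocks_row_split] sum_cut_blocks index_setD(2)[OF m] by simp

end

lemma card_through_blocks:
  shows "card (through_blocks l m) = (\<Sum>i=1..l. m i)"
proof -
  have "through_blocks l m = (\<Union>i\<in>{1..l}. blk l m i ` {1..m i})" unfolding through_blocks_def by blast
  also have "card \<dots> = (\<Sum>i=1..l. card (blk l m i ` {1..m i}))"
    by (rule card_UN_disjoint) (auto dest: arg_cong[of _ _ card])
  also have "\<dots> = (\<Sum>i=1..l. m i)"
    by (rule sum.cong[OF refl]) (simp only: through_blocks_of_card(1)[symmetric] through_blocks_of_card(2))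
  finally show ?thesis .
qed

section \<open>Propagating vectors\<close>

lemma mod_class_unique:
  assumes "i \<in> {1..l}" "j \<in> {1..l}" "i mod l = j mod (l::nat)" shows "i = j"
proof (cases "i = l \<or> j = l")
  case True
  thus ?thesis using assms by (cases "i = l"; cases "j = l") auto
qed (use assms in auto)

text \<open>Residues are represented by 1 to l, as in the index set, so that residue 0 becomes l.
  Hence the class of a positive number does not exceed that number.\<close>

definition tone_class :: "nat \<Rightarrow> nat \<Rightarrow> nat" where
  "tone_class l c = (if c mod l = 0 then l else c mod l)"

lemma tone_class:
  assumes "1 \<le> l"
  shows "tone_class l c \<in> {1..l}" "tone_class l c mod l = c mod l" "i \<in> {1..l} \<Longrightarrow> tone_class l c = i \<longleftrightarrow> c mod l = i mod l"
    "c \<in> {1..l} \<Longrightarrow> tone_class l c = c" "0 < c \<Longrightarrow> tone_class l c \<le> c"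
proof -
  show 1: "tone_class l c \<in> {1..l}" using assms by (auto simp: tone_class_def Suc_le_eq intro: less_imp_le)
  show 2: "tone_class l c mod l = c mod l" by (simp add: tone_class_def)
  show 3: "tone_class l c = i \<longleftrightarrow> c mod l = i mod l" if "i \<in> {1..l}" for i
    using mod_class_unique[OF 1 that] 2 by auto
  show "c \<in> {1..l} \<Longrightarrow> tone_class l c = c" using 3 by blast
  show "0 < c \<Longrightarrow> tone_class l c \<le> c"
    by (auto simp: tone_class_def dvd_imp_le mod_eq_0_iff_dvd)
qed

lemma propagating_vector_joined:
  assumes j: "joinable n P W W'" and l: "1 \<le> l"
  shows "propagating_vector l (joined P W W') i =
    (if i \<in> {1..l} then card {z \<in> P. tone_class l (card (fst z)) = i} else 0)"
proof (cases "i \<in> {1..l}")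
  case True
  let ?A = "{s \<in> joined P W W'. propagating s \<and> card (s \<inter> range Top) mod l = i mod l}"
  have pr: "propagating (row_pair x y) \<longleftrightarrow> x \<noteq> {} \<and> y \<noteq> {}" for x y
    by (auto simp: propagating_def row_pair_def)
  have ct: "card (row_pair x y \<inter> range Top) = card x" for x y
  proof -
    have "row_pair x y \<inter> range Top = Top ` x" by (auto simp: row_pair_def)
    thus ?thesis by (simp add: card_image inj_on_def)
  qed
  have "?A = (\<lambda>(x, y). row_pair x y) ` {z \<in> P. tone_class l (card (fst z)) = i}"
  proof (intro equalityI subsetI)
    fix s assume s: "s \<in> ?A"
    then obtain x y where xy: "s = row_pair x y" using joinedE by blast
    hence "x \<noteq> {}" "y \<noteq> {}" "card x mod l = i mod l" using s by (auto simp: pr ct)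
    moreover hence "(x, y) \<in> P" using s joined_parts(1)[OF j] unfolding xy by blast
    ultimately have "(x, y) \<in> {z \<in> P. tone_class l (card (fst z)) = i}" using tone_class(3)[OF l True] by simp
    thus "s \<in> (\<lambda>(x, y). row_pair x y) ` {z \<in> P. tone_class l (card (fst z)) = i}" unfolding xy by (rule rev_image_eqI) simp
  next
    fix s assume "s \<in> (\<lambda>(x, y). row_pair x y) ` {z \<in> P. tone_class l (card (fst z)) = i}"
    then obtain x y where xy: "s = row_pair x y" "(x, y) \<in> P" "tone_class l (card x) = i" by auto
    thus "s \<in> ?A" using joined_parts(1)[OF j, of x y] tone_class(3)[OF l True] by (simp add: pr ct)
  qed
  moreover have "inj_on (\<lambda>(x, y). row_pair x y) X" for X by (auto simp: inj_on_def)
  ultimately have "card ?A = card {z \<in> P. tone_class l (card (fst z)) = i}" by (simp add: card_image)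
  thus ?thesis using True by (simp only: propagating_vector_def if_True)
qed (simp only: propagating_vector_def if_False)

lemma sum_by_class:
  assumes "finite P" "1 \<le> (l::nat)" "\<And>z. z \<in> P \<Longrightarrow> cl z \<in> {1..l}"
  shows "(\<Sum>i=1..l. g i * card {z \<in> P. cl z = i}) = (\<Sum>z\<in>P. g (cl z) :: nat)"
proof -
  have "(\<Sum>z\<in>P. g (cl z)) = (\<Sum>i=1..l. \<Sum>z\<in>{z \<in> P. cl z = i}. g (cl z))"
    by (rule sum.group[symmetric]) (use assms in auto)
  also have "\<dots> = (\<Sum>i=1..l. g i * card {z \<in> P. cl z = i})"
    by (rule sum.cong[OF refl]) (simp add: mult.commute)
  finally show ?thesis by simp
qed

lemma weight_propagating_vector:
  assumes j: "joinable n P W W'" and l: "1 \<le> l"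
  shows "weight l (propagating_vector l (joined P W W')) = (\<Sum>z\<in>P. tone_class l (card (fst z)))"
    "(\<Sum>i=1..l. propagating_vector l (joined P W W') i) = card P"
proof -
  note f = joinableD(7)[OF j]
  have "weight l (propagating_vector l (joined P W W')) = (\<Sum>i=1..l. i * card {z \<in> P. tone_class l (card (fst z)) = i})"
    unfolding weight_def by (rule sum.cong[OF refl]) (simp only: propagating_vector_joined[OF j l] if_True)
  also have "\<dots> = (\<Sum>z\<in>P. tone_class l (card (fst z)))" by (rule sum_by_class[OF f l tone_class(1)[OF l]])
  finally show "weight l (propagating_vector l (joined P W W')) = (\<Sum>z\<in>P. tone_class l (card (fst z)))" .
  have "(\<Sum>i=1..l. propagating_vector l (joined P W W') i) = (\<Sum>i=1..l. 1 * card {z \<in> P. tone_class l (card (fst z)) = i})"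
    by (rule sum.cong[OF refl]) (simp only: propagating_vector_joined[OF j l] if_True mult_1)
  also have "\<dots> = (\<Sum>z\<in>P. 1)" by (rule sum_by_class[OF f l tone_class(1)[OF l]])
  finally show "(\<Sum>i=1..l. propagating_vector l (joined P W W') i) = card P" by simp
qed

lemma sum_card_fst:
  assumes j: "joinable n P W W'" shows "n = (\<Sum>z\<in>P. card (fst z)) + (\<Sum>u\<in>W. card u)"
  using row_split_card[OF joinableD(1)[OF j]] joinableD(5)[OF j] by (simp add: sum.reindex)

lemma card_fst_pos:
  assumes j: "joinable n P W W'" and z: "z \<in> P" shows "0 < card (fst z)" "0 < card (snd z)"
proof -
  note T = row_splitD[OF joinableD(1)[OF j]] and B = row_splitD[OF joinableD(2)[OF j]]
  show "0 < card (fst z)" using T(3)[of "fst z"] T(9)[of "fst z"] z by (simp add: card_gt_0_iff)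
  show "0 < card (snd z)" using B(3)[of "snd z"] B(9)[of "snd z"] z by (simp add: card_gt_0_iff)
qed

text \<open>Each propagating block exceeds its tone class by a multiple of l, and the size of each
  cut block is a multiple of l, so n differs from the weight by a multiple of l.\<close>

lemma propagating_vector_index:
  assumes j: "joinable n P W W'" and l: "1 \<le> l" and t: "joined P W W' \<in> tonal_diagrams l n"
  shows "propagating_vector l (joined P W W') \<in> index_set l n"
proof -
  let ?w = "weight l (propagating_vector l (joined P W W'))"
  have w: "?w = (\<Sum>z\<in>P. tone_class l (card (fst z)))" by (rule weight_propagating_vector(1)[OF j l])
  have le: "tone_class l (card (fst z)) \<le> card (fst z)" if "z \<in> P" for z
    using tone_class(5)[OF l] card_fst_pos(1)[OF j that] .
  have le_sum: "?w \<le> (\<Sum>z\<in>P. card (fst z))" unfolding w by (rule sum_mono) (rule le)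
  have "(\<Sum>z\<in>P. card (fst z) - tone_class l (card (fst z))) = (\<Sum>z\<in>P. card (fst z)) - ?w"
    unfolding w by (rule sum_subtractf_nat) (rule le)
  with le_sum sum_card_fst[OF j] have
    "n - ?w = (\<Sum>z\<in>P. card (fst z) - tone_class l (card (fst z))) + (\<Sum>u\<in>W. card u)" and "?w \<le> n"
    by linarith+
  moreover have "l dvd (\<Sum>z\<in>P. card (fst z) - tone_class l (card (fst z))) + (\<Sum>u\<in>W. card u)"
  proof (intro dvd_add dvd_sum)
    show "l dvd card (fst z) - tone_class l (card (fst z))" if "z \<in> P" for z
      using mod_eq_dvd_iff_nat[OF le[OF that], of l] tone_class(2)[OF l] by simp
    show "l dvd card u" if "u \<in> W" for u
      using t that unfolding joined_tonal_iff[OF j] by (auto simp: mod_eq_0_iff_dvd)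
  qed
  ultimately have "l dvd n - ?w" "?w \<le> n" by simp_all
  then obtain k where "n - ?w = l * k" by (auto elim: dvdE)
  hence "n = ?w + k * l" using \<open>?w \<le> n\<close> by (simp add: mult.commute)
  thus ?thesis using propagating_vector_joined[OF j l] by (auto simp: index_set_def)
qed

section \<open>Half diagrams\<close>

lemma bottom_row_joined:
  assumes j: "joinable n P W W'"
  shows "bottom_row (joined P W W') = row_pair {} ` (snd ` P \<union> W')" "bottom_parts (joined P W W') = row_pair {} ` W'"
proof -
  note T = row_splitD[OF joinableD(1)[OF j]] and B = row_splitD[OF joinableD(2)[OF j]]
  have b: "row_pair x y \<inter> range Bot = row_pair {} y" for x y by (auto simp: row_pair_def)
  have "{} \<notin> snd ` P \<union> W'" using B(3) by blast
  hence ne: "row_pair {} {} \<notin> row_pair {} ` (snd ` P \<union> W')" by (auto simp: image_iff)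
  have "(\<lambda>s. s \<inter> range Bot) ` joined P W W' = row_pair {} ` (snd ` P) \<union> row_pair {} ` W' \<union> (\<lambda>u. row_pair {} {}) ` W"
    unfolding joined_def image_Un image_image by (simp add: split_beta b Un_ac)
  hence e: "(\<lambda>s. s \<inter> range Bot) ` joined P W W' = row_pair {} ` (snd ` P \<union> W') \<union> (\<lambda>u. row_pair {} {}) ` W"
    by (simp only: image_Un)
  have Z: "(\<lambda>u. row_pair {} {}) ` W \<subseteq> {{}}" by (simp add: image_subset_iff)
  have "row_pair {} {} = {}" by simp
  hence "{} \<notin> row_pair {} ` (snd ` P \<union> W')" using ne by metis
  moreover have "Y \<union> Z - {{}} = Y" if "Z \<subseteq> {{}}" "{} \<notin> Y" for Y Z :: diagram using that by blast
  ultimately show "bottom_row (joined P W W') = row_pair {} ` (snd ` P \<union> W')"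
    unfolding bottom_row_def e using Z by metis
  have s: "row_pair x y \<subseteq> range Bot \<longleftrightarrow> x = {}" for x y by (auto simp: row_pair_def)
  show "bottom_parts (joined P W W') = row_pair {} ` W'"
  proof (intro equalityI subsetI)
    fix v assume "v \<in> bottom_parts (joined P W W')"
    hence v: "v \<in> joined P W W'" "v \<subseteq> range Bot" by (auto simp: bottom_parts_def)
    then obtain x y where xy: "v = row_pair x y" using joinedE by blast
    hence "x = {}" using v s by blast
    thus "v \<in> row_pair {} ` W'" using v(1) joined_parts(3)[OF j] unfolding xy by blast
  next
    fix v assume "v \<in> row_pair {} ` W'"
    thus "v \<in> bottom_parts (joined P W W')" unfolding bottom_parts_def using joined_parts(3)[OF j] s by blast
  qed
qed

lemma row_pair_image_eq: "row_pair {} ` A = row_pair {} ` B \<longleftrightarrow> A = B"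
  by (rule inj_image_eq_iff) (simp add: inj_def)

context
  fixes l n :: nat and m :: "nat \<Rightarrow> nat"
  assumes l: "1 \<le> l" and m: "m \<in> index_set l n"
begin

private abbreviation "B \<equiv> through_blocks l m"
private abbreviation "C \<equiv> cut_blocks l n (weight l m)"

text \<open>The propagating vector can be read off the bottom row: a through block has between 1 and
  l elements and is congruent in size to its partner on top, so its size is the tone class of the
  partner.\<close>

lemma half_diagrams_iff:
  "q \<in> half_diagrams l n m \<longleftrightarrow>
     q \<in> tonal_diagrams l n \<and> (\<exists>P W. joinable n P W C \<and> snd ` P = B \<and> q = joined P W C)"
proof
  have aj: "joinable n (Id_on B) C C" by (rule joinable_Id[OF blocks_row_split[OF l m]])
  have sB: "snd ` Id_on B = B" by force
  have arow: "bottom_row (a_diagram l n m) = row_pair {} ` (B \<union> C)" "bottom_parts (a_diagram l n m) = row_pair {} ` C"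
    unfolding a_diagram_eq[OF l] bottom_row_joined[OF aj] sB by simp_all
  show "q \<in> tonal_diagrams l n \<and> (\<exists>P W. joinable n P W C \<and> snd ` P = B \<and> q = joined P W C)"
    if q: "q \<in> half_diagrams l n m"
  proof -
    have t: "q \<in> tonal_diagrams l n" using q by (simp add: half_diagrams_def)
    obtain P W W' where j: "joinable n P W W'" "q = joined P W W'" using diagram_eq_joined[OF tonal_diagramsD[OF t]] by blast
    have W': "W' = C"
      using q arow bottom_row_joined(2)[OF j(1)] by (simp add: half_diagrams_def j(2) row_pair_image_eq)
    have "snd ` P \<union> W' = B \<union> C"
      using q arow bottom_row_joined(1)[OF j(1)] by (simp add: half_diagrams_def j(2) row_pair_image_eq)
    hence "snd ` P = B" using row_splitD(1)[OF joinableD(2)[OF j(1)]] row_splitD(1)[OF blocks_row_split[OF l m]] W' by blast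
    thus ?thesis using t j W' by blast
  qed
  show "q \<in> half_diagrams l n m"
    if q: "q \<in> tonal_diagrams l n \<and> (\<exists>P W. joinable n P W C \<and> snd ` P = B \<and> q = joined P W C)"
  proof -
    from q obtain P W where j: "joinable n P W C" "snd ` P = B" "q = joined P W C" by blast
    have "propagating_vector l q i = m i" for i
    proof (cases "i \<in> {1..l}")
      case True
      have tc: "tone_class l (card (fst z)) = card (snd z)" if z: "z \<in> P" for z
      proof -
        have "card (snd z) \<in> {1..l}" using card_through_block[of "snd z" l m] j(2) z by blast
        moreover have "card (fst z) mod l = card (snd z) mod l"
          using q z unfolding j(3) joined_tonal_iff[OF j(1)] by (cases z) auto
        ultimately show ?thesis using tone_class(3)[OF l] by blast
      qed
      have e1: "{z \<in> P. tone_class l (card (fst z)) = i} = {z \<in> P. card (snd z) = i}" using tc by auto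
      have e2: "snd ` {z \<in> P. card (snd z) = i} = {y \<in> B. card y = i}" unfolding j(2)[symmetric] by blast
      have "card (snd ` {z \<in> P. card (snd z) = i}) = card {z \<in> P. card (snd z) = i}"
        by (rule card_image) (rule inj_on_subset[OF joinableD(6)[OF j(1)]], blast)
      hence "card {z \<in> P. tone_class l (card (fst z)) = i} = m i"
        unfolding e1 e2 through_blocks_of_card(2)[OF True] by (rule sym)
      thus ?thesis using True by (simp only: j(3) propagating_vector_joined[OF j(1) l] if_True)
    next
      case False
      thus ?thesis using index_setD(3)[OF m False] by (simp only: propagating_vector_def if_False)
    qed
    thus ?thesis using q arow bottom_row_joined[OF j(1)] j by (auto simp: half_diagrams_def)
  qed
qed

text \<open>The inequality of block sizes is what bounds weights later: a top block is congruent in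
  size to a bottom block with at most l elements, hence at least as large.\<close>

lemma half_diagramE:
  assumes "q \<in> half_diagrams l n m"
  obtains P W where "joinable n P W C" "snd ` P = B" "q = joined P W C" "q \<in> tonal_diagrams l n"
    "\<And>z. z \<in> P \<Longrightarrow> card (fst z) mod l = card (snd z) mod l" "\<And>z. z \<in> P \<Longrightarrow> card (snd z) \<le> card (fst z)"
proof -
  from assms obtain P W where j: "joinable n P W C" "snd ` P = B" "q = joined P W C" "q \<in> tonal_diagrams l n"
    unfolding half_diagrams_iff by blast
  have c: "card (fst z) mod l = card (snd z) mod l" if "z \<in> P" for z
    using j(4) that unfolding j(3) joined_tonal_iff[OF j(1)] by (cases z) auto
  have "card (snd z) \<le> card (fst z)" if z: "z \<in> P" for z
  proof -
    have "card (snd z) \<in> {1..l}" using card_through_block[of "snd z" l m] j(2) z by blast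
    hence "tone_class l (card (fst z)) = card (snd z)" using tone_class(3)[OF l] c[OF z] by blast
    thus ?thesis using tone_class(5)[OF l card_fst_pos(1)[OF j(1) z]] by simp
  qed
  with j c show thesis by (rule that)
qed

lemma diagonal_tonal:
  assumes "row_split n B' C'" "\<And>u. u \<in> C' \<Longrightarrow> card u mod l = 0"
  shows "joined (Id_on B') C' C' \<in> tonal_diagrams l n"
  unfolding joined_tonal_iff[OF joinable_Id[OF assms(1)]] using assms(2) by auto

lemma a_diagram_half: "a_diagram l n m \<in> half_diagrams l n m"
proof -
  have "joined (Id_on B) C C \<in> tonal_diagrams l n"
    by (rule diagonal_tonal[OF blocks_row_split[OF l m]]) (simp add: card_cut_block)
  moreover have "joinable n (Id_on B) C C" by (rule joinable_Id[OF blocks_row_split[OF l m]])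
  moreover have "snd ` Id_on B = B" by force
  ultimately show ?thesis unfolding half_diagrams_iff a_diagram_eq[OF l] by blast
qed

lemma card_prop_pairs_half:
  assumes "q \<in> half_diagrams l n m" shows "card (prop_pairs q) = (\<Sum>i=1..l. m i)"
proof -
  obtain P W where j: "joinable n P W C" "snd ` P = B" "q = joined P W C" using half_diagramE[OF assms] by metis
  have "card P = card B" unfolding j(2)[symmetric] using joinableD(6)[OF j(1)] by (simp add: card_image)
  thus ?thesis by (simp add: j(3) prop_pairs_joined[OF j(1)] card_through_blocks)
qed

end

section \<open>Irreducibility and separation of Specht modules, after James\<close>

section \<open>Complex linear spans\<close>

lemma complex_function_space: "vector_space (\<lambda>c f x. c * f x :: complex)"
  by unfold_locales (auto simp: algebra_simps plus_fun_def)

interpretation fun_space: vector_space "\<lambda>c (f :: 'x \<Rightarrow> complex) x. c * f x"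
  by (rule complex_function_space)

lemma complex_span_eq: "complex_span S = fun_space.span S"
  by (simp add: complex_span_def)

lemma complex_span_closed:
  "x \<in> complex_span S \<Longrightarrow> y \<in> complex_span S \<Longrightarrow> (\<lambda>T. x T + y T) \<in> complex_span S"
  "x \<in> complex_span S \<Longrightarrow> (\<lambda>T. c * x T) \<in> complex_span S"
  "(\<lambda>T. 0) \<in> complex_span S" "x \<in> S \<Longrightarrow> x \<in> complex_span S"
  using fun_space.span_add[of x S y] fun_space.span_scale[of x S c] fun_space.span_zero[of S] fun_space.span_base[of x S]
  by (auto simp: complex_span_eq plus_fun_def zero_fun_def)

lemma complex_span_induct [consumes 1, case_names zero add scale base]:
  assumes "x \<in> complex_span S" "P (\<lambda>T. 0)" "\<And>x y. P x \<Longrightarrow> P y \<Longrightarrow> P (\<lambda>T. x T + y T)"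
    "\<And>c x. P x \<Longrightarrow> P (\<lambda>T. c * x T)" "\<And>x. x \<in> S \<Longrightarrow> P x"
  shows "P x"
proof (rule fun_space.span_induct[of x S P])
  show "x \<in> fun_space.span S" using assms(1) by (simp add: complex_span_eq)
  show "fun_space.subspace (Collect P)"
    unfolding fun_space.subspace_def using assms(2-4) by (auto simp: plus_fun_def zero_fun_def)
qed (use assms(5) in auto)

lemma complex_span_sum:
  "(\<And>i. i \<in> I \<Longrightarrow> f i \<in> complex_span S) \<Longrightarrow> (\<lambda>T. \<Sum>i\<in>I. f i T) \<in> complex_span S"
proof (induction I rule: infinite_finite_induct)
  case (insert i I)
  thus ?case using complex_span_closed(1)[of "f i" S "\<lambda>T. \<Sum>i\<in>I. f i T"] by simp
qed (auto simp: complex_span_closed)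

lemma complex_span_subset:
  assumes "S \<subseteq> complex_span S'" shows "complex_span S \<subseteq> complex_span S'"
proof
  fix x assume "x \<in> complex_span S"
  thus "x \<in> complex_span S'"
    by (rule complex_span_induct) (use assms complex_span_closed in auto)
qed

section \<open>Tabloids and polytabloids\<close>

abbreviation act_tabloid :: "(nat \<Rightarrow> nat) \<Rightarrow> tabloid \<Rightarrow> tabloid" where
  "act_tabloid \<pi> T \<equiv> (\<lambda>r. \<pi> ` T r)"

definition tabloids :: "nat list \<Rightarrow> tabloid set" where
  "tabloids \<mu> = tabloid_of \<mu> ` tableaux \<mu>"

text \<open>The coefficient at \<open>T\<close> of the signed column sum of \<open>t\<close> applied
  to the tabloid \<open>S\<close>; a polytabloid is the case where \<open>S\<close> is the tabloid
  of \<open>t\<close>. Admitting \<open>S\<close> of another shape makes it possible to compare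
  partitions.\<close>

definition signed_orbit :: "nat list \<Rightarrow> (nat \<times> nat \<Rightarrow> nat) \<Rightarrow> tabloid \<Rightarrow> tabloid \<Rightarrow> complex" where
  "signed_orbit \<mu> t S T = (\<Sum>\<pi>\<in>column_stabilizer \<mu> t. of_int (sign \<pi>) * of_bool (T = act_tabloid \<pi> S))"

lemma tabloid_of_comp: "tabloid_of \<mu> (\<pi> \<circ> t) = act_tabloid \<pi> (tabloid_of \<mu> t)"
  by (auto simp: tabloid_of_def image_comp)

lemma polytabloid_eq: "polytabloid \<mu> t = signed_orbit \<mu> t (tabloid_of \<mu> t)"
  unfolding polytabloid_def signed_orbit_def tabloid_of_comp by (rule refl)

abbreviation "column \<mu> c \<equiv> {x \<in> young_cells \<mu>. snd x = c}"

lemma column_stabilizerD: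
  assumes "\<pi> \<in> column_stabilizer \<mu> t"
  shows "\<pi> permutes {1..sum_list \<mu>}" "\<And>c. \<pi> ` t ` column \<mu> c = t ` column \<mu> c"
  using assms by (auto simp: column_stabilizer_def)

lemma finite_column_stabilizer: "finite (column_stabilizer \<mu> t)"
  by (rule finite_subset[OF _ finite_permutations[of "{1..sum_list \<mu>}"]]) (auto simp: column_stabilizer_def)

lemma column_stabilizer_id: "id \<in> column_stabilizer \<mu> t"
  by (simp add: column_stabilizer_def permutes_id)

lemma column_stabilizer_comp:
  assumes "\<pi> \<in> column_stabilizer \<mu> t" "\<rho> \<in> column_stabilizer \<mu> t"
  shows "\<pi> \<circ> \<rho> \<in> column_stabilizer \<mu> t"
proof -
  have c: "(\<pi> \<circ> \<rho>) ` A = \<pi> ` \<rho> ` A" for A by (simp add: image_comp)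
  show ?thesis
    using assms unfolding column_stabilizer_def mem_Collect_eq c by (metis permutes_compose)
qed

lemma column_stabilizer_inv:
  assumes "\<pi> \<in> column_stabilizer \<mu> t" shows "inv' \<pi> \<in> column_stabilizer \<mu> t"
proof -
  note p = column_stabilizerD[OF assms]
  have "inv' \<pi> ` t ` column \<mu> c = t ` column \<mu> c" for c
  proof -
    have "inv' \<pi> ` (\<pi> ` t ` column \<mu> c) = t ` column \<mu> c"
      by (rule image_inv_f_f[OF permutes_inj[OF p(1)]])
    thus ?thesis by (simp only: p(2))
  qed
  thus ?thesis using permutes_inv[OF p(1)] by (simp add: column_stabilizer_def)
qed

lemma sign_column_stabilizer:
  "\<pi> \<in> column_stabilizer \<mu> t \<Longrightarrow> permutation \<pi>"
  using column_stabilizerD(1) permutation_permutes by blast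

lemma bij_comp_column_stabilizer:
  assumes \<rho>: "\<rho> \<in> column_stabilizer \<mu> t"
  shows "bij_betw (\<lambda>\<pi>. \<pi> \<circ> \<rho>) (column_stabilizer \<mu> t) (column_stabilizer \<mu> t)"
proof (rule bij_betw_byWitness[where f' = "\<lambda>\<pi>. \<pi> \<circ> inv' \<rho>"])
  note b = permutes_inv_o[OF column_stabilizerD(1)[OF \<rho>]]
  show "\<forall>\<pi>\<in>column_stabilizer \<mu> t. (\<pi> \<circ> \<rho>) \<circ> inv' \<rho> = \<pi>"
    by (simp add: comp_assoc b)
  show "\<forall>\<pi>\<in>column_stabilizer \<mu> t. (\<pi> \<circ> inv' \<rho>) \<circ> \<rho> = \<pi>"
    by (simp add: comp_assoc b)
qed (use column_stabilizer_comp column_stabilizer_inv \<rho> in auto)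

text \<open>Right translation by \<rho> permutes the column stabilizer and multiplies every sign by
  that of \<rho>.\<close>

lemma signed_orbit_act:
  assumes \<rho>: "\<rho> \<in> column_stabilizer \<mu> t"
  shows "signed_orbit \<mu> t (act_tabloid \<rho> S) T = of_int (sign \<rho>) * signed_orbit \<mu> t S T"
proof -
  have "signed_orbit \<mu> t S T = (\<Sum>\<pi>\<in>column_stabilizer \<mu> t. of_int (sign (\<pi> \<circ> \<rho>)) * of_bool (T = act_tabloid (\<pi> \<circ> \<rho>) S))"
    unfolding signed_orbit_def
    using sum.reindex_bij_betw[OF bij_comp_column_stabilizer[OF \<rho>],
      of "\<lambda>\<pi>. of_int (sign \<pi>) * of_bool (T = act_tabloid \<pi> S) :: complex"] by simp
  also have "\<dots> = (\<Sum>\<pi>\<in>column_stabilizer \<mu> t. of_int (sign \<rho>) * (of_int (sign \<pi>) * of_bool (T = act_tabloid \<pi> (act_tabloid \<rho> S))))"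
  proof (rule sum.cong[OF refl])
    fix \<pi> assume "\<pi> \<in> column_stabilizer \<mu> t"
    thus "of_int (sign (\<pi> \<circ> \<rho>)) * of_bool (T = act_tabloid (\<pi> \<circ> \<rho>) S)
       = of_int (sign \<rho>) * (of_int (sign \<pi>) * of_bool (T = act_tabloid \<pi> (act_tabloid \<rho> S)) :: complex)"
      using sign_compose[OF sign_column_stabilizer sign_column_stabilizer, of \<pi> \<mu> t \<rho> \<mu> t] \<rho>
      by (simp add: image_comp)
  qed
  also have "\<dots> = of_int (sign \<rho>) * signed_orbit \<mu> t (act_tabloid \<rho> S) T"
    by (simp add: signed_orbit_def sum_distrib_left)
  finally have e: "signed_orbit \<mu> t S T = of_int (sign \<rho>) * signed_orbit \<mu> t (act_tabloid \<rho> S) T" .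
  have "(of_int (sign \<rho>) * of_int (sign \<rho>) :: complex) = 1" by (simp add: sign_def)
  thus ?thesis unfolding e by (simp add: mult.assoc[symmetric])
qed

text \<open>The transposition of the two entries belongs to the column stabilizer and fixes
  \<open>S\<close>, but has sign -1, so the value equals its own negative.\<close>

lemma signed_orbit_zero:
  assumes t: "t \<in> tableaux \<mu>" and x: "x \<in> young_cells \<mu>" "y \<in> young_cells \<mu>" "x \<noteq> y" "snd x = snd y"
    and r: "\<And>r. t x \<in> S r \<longleftrightarrow> t y \<in> S r"
  shows "signed_orbit \<mu> t S T = 0"
proof -
  let ?\<tau> = "transpose (t x) (t y)"
  have b: "bij_betw t (young_cells \<mu>) {1..sum_list \<mu>}" using t by (simp add: tableaux_def)
  have ne: "t x \<noteq> t y" using b x by (auto simp: bij_betw_def inj_on_def)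
  have m: "t x \<in> {1..sum_list \<mu>}" "t y \<in> {1..sum_list \<mu>}" using b x unfolding bij_betw_def by blast+
  have im: "?\<tau> ` A = A" if "t x \<in> A \<longleftrightarrow> t y \<in> A" for A
    using that by (auto simp: transpose_image_eq)
  have \<tau>: "?\<tau> \<in> column_stabilizer \<mu> t"
    unfolding column_stabilizer_def mem_Collect_eq
  proof (intro conjI allI im)
    show "?\<tau> permutes {1..sum_list \<mu>}" using m by (rule permutes_swap_id)
    have i: "t z \<in> t ` column \<mu> c \<longleftrightarrow> snd z = c" if "z \<in> young_cells \<mu>" for z c
      using b that by (auto simp: bij_betw_def inj_on_def)
    show "t x \<in> t ` column \<mu> c \<longleftrightarrow> t y \<in> t ` column \<mu> c" for c
      using i x by auto
  qed
  have "act_tabloid ?\<tau> S = S" using im r by auto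
  with signed_orbit_act[OF \<tau>, of S T] have "signed_orbit \<mu> t S T = - signed_orbit \<mu> t S T"
    using ne by (simp add: sign_swap_id)
  thus ?thesis by simp
qed

text \<open>Padded with zeros, so that partial sums of partitions of different lengths can be
  compared in the dominance order.\<close>

definition part :: "nat list \<Rightarrow> nat \<Rightarrow> nat" where
  "part \<mu> r = (if r < length \<mu> then \<mu> ! r else 0)"

lemma young_cells_iff: "(r, c) \<in> young_cells \<mu> \<longleftrightarrow> c < part \<mu> r"
  by (auto simp: young_cells_def part_def)

lemma young_cells_row: "{x \<in> young_cells \<mu>. fst x = r} = {r} \<times> {..<part \<mu> r}"
  by (auto simp: young_cells_iff)

lemma finite_young_cells: "finite (young_cells \<mu>)"
proof -
  have "young_cells \<mu> = (SIGMA r:{..<length \<mu>}. {..<\<mu> ! r})" by (auto simp: young_cells_def)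
  thus ?thesis by simp
qed

lemma card_young_cells: "card (young_cells \<mu>) = sum_list \<mu>"
proof -
  have "young_cells \<mu> = (SIGMA r:{..<length \<mu>}. {..<\<mu> ! r})" by (auto simp: young_cells_def)
  thus ?thesis by (simp add: sum_list_sum_nth atLeast0LessThan)
qed

lemma tableaux_nonempty: "tableaux \<mu> \<noteq> {}"
proof -
  obtain t where "bij_betw t (young_cells \<mu>) {1..sum_list \<mu>}"
    using finite_same_card_bij[OF finite_young_cells, of "{1..sum_list \<mu>}" \<mu>] by (auto simp: card_young_cells)
  thus ?thesis by (auto simp: tableaux_def)
qed

lemma tableauxD:
  assumes "t \<in> tableaux \<mu>"
  shows "bij_betw t (young_cells \<mu>) {1..sum_list \<mu>}" "inj_on t (young_cells \<mu>)" "t ` young_cells \<mu> = {1..sum_list \<mu>}"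
  using assms by (auto simp: tableaux_def bij_betw_def)

lemma tabloidD:
  assumes "S \<in> tabloids \<nu>"
  shows "S r \<inter> S r' \<noteq> {} \<Longrightarrow> r = r'" "S r \<subseteq> {1..sum_list \<nu>}" "card (S r) = part \<nu> r"
    "i \<in> {1..sum_list \<nu>} \<Longrightarrow> \<exists>r. i \<in> S r"
proof -
  obtain s where s: "s \<in> tableaux \<nu>" "S = tabloid_of \<nu> s" using assms by (auto simp: tabloids_def)
  note sD = tableauxD[OF s(1)]
  show "r = r'" if "S r \<inter> S r' \<noteq> {}" using that sD(2) unfolding s(2) tabloid_of_def by (auto simp: inj_on_def)
  show "S r \<subseteq> {1..sum_list \<nu>}" unfolding s(2) tabloid_of_def sD(3)[symmetric] by blast
  have "card (S r) = card {x \<in> young_cells \<nu>. fst x = r}"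
    unfolding s(2) tabloid_of_def by (rule card_image) (use sD(2) in \<open>auto simp: inj_on_def\<close>)
  thus "card (S r) = part \<nu> r" by (simp add: young_cells_row)
  show "\<exists>r. i \<in> S r" if "i \<in> {1..sum_list \<nu>}"
    using that unfolding sD(3)[symmetric] s(2) tabloid_of_def by auto
qed

lemma finite_tabloids: "finite (tabloids \<nu>)"
proof -
  have "tabloids \<nu> \<subseteq> {S. \<forall>r. (r \<in> {..<length \<nu>} \<longrightarrow> S r \<in> Pow {1..sum_list \<nu>}) \<and> (r \<notin> {..<length \<nu>} \<longrightarrow> S r = {})}"
  proof (intro subsetI CollectI allI conjI impI)
    fix S r assume S: "S \<in> tabloids \<nu>"
    show "S r \<in> Pow {1..sum_list \<nu>}" using tabloidD(2)[OF S] by blast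
    assume "r \<notin> {..<length \<nu>}"
    hence "card (S r) = 0" using tabloidD(3)[OF S] by (simp add: part_def)
    thus "S r = {}" using tabloidD(2)[OF S, of r] finite_subset by fastforce
  qed
  moreover have "finite {S. \<forall>r. (r \<in> {..<length \<nu>} \<longrightarrow> S r \<in> Pow {1..sum_list \<nu>}) \<and> (r \<notin> {..<length \<nu>} \<longrightarrow> S r = {})}"
    by (rule finite_set_of_finite_funs) auto
  ultimately show ?thesis by (rule finite_subset)
qed

lemma tableaux_permutation:
  assumes t: "t \<in> tableaux \<mu>" and u: "u \<in> tableaux \<mu>"
  shows "\<exists>\<pi>. \<pi> permutes {1..sum_list \<mu>} \<and> (\<forall>x\<in>young_cells \<mu>. \<pi> (t x) = u x)"
proof -
  note tD = tableauxD[OF t]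
  let ?f = "\<lambda>j. if j \<in> {1..sum_list \<mu>} then u (the_inv_into (young_cells \<mu>) t j) else j"
  have "bij_betw (u \<circ> the_inv_into (young_cells \<mu>) t) {1..sum_list \<mu>} {1..sum_list \<mu>}"
    by (rule bij_betw_trans[OF bij_betw_the_inv_into[OF tD(1)] tableauxD(1)[OF u]])
  moreover have "bij_betw ?f {1..sum_list \<mu>} {1..sum_list \<mu>}
      \<longleftrightarrow> bij_betw (u \<circ> the_inv_into (young_cells \<mu>) t) {1..sum_list \<mu>} {1..sum_list \<mu>}"
    by (rule bij_betw_cong) simp
  ultimately have "bij_betw ?f {1..sum_list \<mu>} {1..sum_list \<mu>}" by blast
  hence "?f permutes {1..sum_list \<mu>}" by (rule bij_imp_permutes) (simp only: if_False)
  moreover have "?f (t y) = u y" if y: "y \<in> young_cells \<mu>" for y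
  proof -
    have "t y \<in> {1..sum_list \<mu>}" using tD(3) y by blast
    thus ?thesis using y by (simp add: the_inv_into_f_f[OF tD(2)])
  qed
  ultimately show ?thesis by blast
qed

lemma young_cells_down: "int_partition k \<mu> \<Longrightarrow> (r, c) \<in> young_cells \<mu> \<Longrightarrow> r' \<le> r \<Longrightarrow> (r', c) \<in> young_cells \<mu>"
proof -
  assume p: "int_partition k \<mu>" and x: "(r, c) \<in> young_cells \<mu>" "r' \<le> r"
  have "\<mu> ! r' \<ge> \<mu> ! r"
  proof (cases "r' = r")
    case False
    thus ?thesis using p x sorted_wrt_nth_less[of "(\<ge>)" \<mu> r' r] by (auto simp: int_partition_def young_cells_def)
  qed simp
  thus ?thesis using x by (auto simp: young_cells_def)
qed

text \<open>
  If no two entries of a column of \<open>t\<close> lie in one row of \<open>S\<close>, then a column has at most \<open>k\<close>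
  entries in the first \<open>k\<close> rows of \<open>S\<close>.
\<close>

context
  fixes \<mu> \<nu> :: "nat list" and k :: nat and t :: "nat \<times> nat \<Rightarrow> nat" and S :: tabloid
  assumes \<mu>: "int_partition k \<mu>" and sum: "sum_list \<nu> = k" and t: "t \<in> tableaux \<mu>" and S: "S \<in> tabloids \<nu>"
    and good: "\<And>x y r. x \<in> young_cells \<mu> \<Longrightarrow> y \<in> young_cells \<mu> \<Longrightarrow> snd x = snd y \<Longrightarrow> t x \<in> S r \<Longrightarrow> t y \<in> S r \<Longrightarrow> x = y"
begin

private definition "col c = t ` column \<mu> c"
private definition "columns = snd ` young_cells \<mu>"
private definition "first q = (\<Union>r<q. S r)"

private lemma k: "sum_list \<mu> = k" using \<mu> by (simp add: int_partition_def)
private lemma finC: "finite columns" by (simp add: columns_def finite_young_cells)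
private lemma fincol: "finite (col c)" using finite_young_cells by (simp add: col_def)

private lemma col_disjoint: "col c \<inter> col c' \<noteq> {} \<Longrightarrow> c = c'"
  using tableauxD(2)[OF t] by (auto simp: col_def inj_on_def)

private lemma card_first: "card (first q) = (\<Sum>r<q. part \<nu> r)"
proof -
  have "card (first q) = (\<Sum>r<q. card (S r))"
    unfolding first_def
  proof (rule card_UN_disjoint)
    show "\<forall>i\<in>{..<q}. finite (S i)" using finite_subset[OF tabloidD(2)[OF S]] by blast
    show "\<forall>i\<in>{..<q}. \<forall>j\<in>{..<q}. i \<noteq> j \<longrightarrow> S i \<inter> S j = {}" using tabloidD(1)[OF S] by blast
  qed simp
  thus ?thesis by (simp add: tabloidD(3)[OF S])
qed

private lemma card_first_col: "card (first q) = (\<Sum>c\<in>columns. card (col c \<inter> first q))"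
proof -
  have "first q = (\<Union>c\<in>columns. col c \<inter> first q)"
  proof (intro equalityI subsetI)
    fix i assume i: "i \<in> first q"
    then obtain r where "i \<in> S r" by (auto simp: first_def)
    hence "i \<in> {1..sum_list \<nu>}" using tabloidD(2)[OF S] by blast
    hence "i \<in> t ` young_cells \<mu>" using sum k tableauxD(3)[OF t] by simp
    with i show "i \<in> (\<Union>c\<in>columns. col c \<inter> first q)" by (auto simp: columns_def col_def)
  qed auto
  also have "card \<dots> = (\<Sum>c\<in>columns. card (col c \<inter> first q))"
    by (rule card_UN_disjoint) (use finC fincol col_disjoint in auto)
  finally show ?thesis .
qed

private lemma card_col: "card (col c \<inter> first q) \<le> card {r. r < q \<and> (r, c) \<in> young_cells \<mu>}"
\<comment> \<open>Either the column reaches row q, and then there is at most one entry for each of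
  the q rows before it, or all cells of the column lie in these rows.\<close>
proof (cases "(q, c) \<in> young_cells \<mu>")
  case True
  have "\<forall>i\<in>col c \<inter> first q. \<exists>r. r < q \<and> i \<in> S r" by (auto simp: first_def)
  then obtain f where f: "\<And>i. i \<in> col c \<inter> first q \<Longrightarrow> f i < q \<and> i \<in> S (f i)" by metis
  have "card (col c \<inter> first q) \<le> card {..<q}"
  proof (rule card_inj_on_le[of f])
    show "inj_on f (col c \<inter> first q)"
    proof (rule inj_onI)
      fix i j assume ij: "i \<in> col c \<inter> first q" "j \<in> col c \<inter> first q" "f i = f j"
      then obtain x y where "x \<in> young_cells \<mu>" "y \<in> young_cells \<mu>" "snd x = c" "snd y = c" "i = t x" "j = t y"
        by (auto simp: col_def)
      thus "i = j" using good[of x y "f i"] f[OF ij(1)] f[OF ij(2)] ij(3) by simp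
    qed
  qed (use f in auto)
  also have "{..<q} = {r. r < q \<and> (r, c) \<in> young_cells \<mu>}" using young_cells_down[OF \<mu> True] by auto
  finally show ?thesis .
next
  case False
  have "card (col c \<inter> first q) \<le> card (col c)" using fincol by (intro card_mono) auto
  also have "\<dots> \<le> card (column \<mu> c)"
    unfolding col_def using finite_young_cells by (intro card_image_le) auto
  also have "column \<mu> c = (\<lambda>r. (r, c)) ` {r. r < q \<and> (r, c) \<in> young_cells \<mu>}"
  proof -
    have "r < q" if "(r, c) \<in> young_cells \<mu>" for r using young_cells_down[OF \<mu> that, of q] False by (cases "r < q") auto
    thus ?thesis by auto
  qed
  also have "card \<dots> = card {r. r < q \<and> (r, c) \<in> young_cells \<mu>}" by (rule card_image) (auto simp: inj_on_def)
  finally show ?thesis .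
qed

private lemma card_cells_rows: "(\<Sum>c\<in>columns. card {r. r < q \<and> (r, c) \<in> young_cells \<mu>}) = (\<Sum>r<q. part \<mu> r)"
proof -
  let ?A = "{x \<in> young_cells \<mu>. fst x < q}"
  have "card ?A = (\<Sum>c\<in>columns. card {r. r < q \<and> (r, c) \<in> young_cells \<mu>})"
  proof -
    have "?A = (\<lambda>(c, r). (r, c)) ` (SIGMA c:columns. {r. r < q \<and> (r, c) \<in> young_cells \<mu>})"
      by (force simp: columns_def image_iff)
    moreover have "inj_on (\<lambda>(c, r). (r, c)) X" for X :: "(nat \<times> nat) set" by (auto simp: inj_on_def)
    ultimately show ?thesis using finC by (simp add: card_image)
  qed
  moreover have "?A = (SIGMA r:{..<q}. {..<part \<mu> r})" by (auto simp: young_cells_iff)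
  ultimately show ?thesis by simp
qed

text \<open>The column bounds summed over all columns: the left side counts the entries in the first
  q rows of \<open>S\<close>, the right side the cells in the first q rows of the shape
  \<mu>.\<close>

lemma dominance: "(\<Sum>r<q. part \<nu> r) \<le> (\<Sum>r<q. part \<mu> r)"
  unfolding card_first[symmetric] card_cells_rows[symmetric] card_first_col
  by (rule sum_mono) (rule card_col)

text \<open>The equality case of dominance: for all q, each column has as many entries in the first
  q rows of \<open>S\<close> as it has cells there, so it meets each row that it reaches exactly
  once. Sorting the columns by these rows gives the permutation.\<close>

lemma exists_column_permutation:
  assumes "\<nu> = \<mu>"
  shows "\<exists>\<pi>\<in>column_stabilizer \<mu> t. S = act_tabloid \<pi> (tabloid_of \<mu> t)"
proof -
  have eq: "card (col c \<inter> first q) = card {r. r < q \<and> (r, c) \<in> young_cells \<mu>}" if "c \<in> columns" for c q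
  proof (rule ccontr)
    assume "card (col c \<inter> first q) \<noteq> card {r. r < q \<and> (r, c) \<in> young_cells \<mu>}"
    hence "card (col c \<inter> first q) < card {r. r < q \<and> (r, c) \<in> young_cells \<mu>}" using card_col[of c q] by simp
    hence "(\<Sum>c\<in>columns. card (col c \<inter> first q)) < (\<Sum>c\<in>columns. card {r. r < q \<and> (r, c) \<in> young_cells \<mu>})"
      using card_col that finC by (intro sum_strict_mono_ex1) auto
    thus False using card_first_col card_first card_cells_rows assms by simp
  qed
  have ex: "\<exists>i. i \<in> col c \<and> i \<in> S r" if x: "(r, c) \<in> young_cells \<mu>" for r c
  proof (rule ccontr)
    assume no: "\<not> ?thesis"
    have c: "c \<in> columns" using x by (force simp: columns_def)
    have "col c \<inter> first (Suc r) = col c \<inter> first r" using no by (auto simp: first_def less_Suc_eq)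
    hence "card {q. q < Suc r \<and> (q, c) \<in> young_cells \<mu>} = card {q. q < r \<and> (q, c) \<in> young_cells \<mu>}"
      using eq[OF c, of "Suc r"] eq[OF c, of r] by simp
    moreover have "{q. q < Suc r \<and> (q, c) \<in> young_cells \<mu>} = insert r {q. q < r \<and> (q, c) \<in> young_cells \<mu>}"
      using x by (auto simp: less_Suc_eq)
    ultimately show False by simp
  qed
  define u where "u x = (SOME i. i \<in> col (snd x) \<and> i \<in> S (fst x))" for x
  have u: "u x \<in> col (snd x) \<and> u x \<in> S (fst x)" if "x \<in> young_cells \<mu>" for x
    unfolding u_def by (rule someI_ex) (use ex[of "fst x" "snd x"] that in simp)
  have inj: "inj_on u (young_cells \<mu>)"
  proof (rule inj_onI)
    fix x y assume xy: "x \<in> young_cells \<mu>" "y \<in> young_cells \<mu>" "u x = u y"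
    have "snd x = snd y" using col_disjoint[of "snd x" "snd y"] u[OF xy(1)] u[OF xy(2)] xy(3) by auto
    moreover have "fst x = fst y" using tabloidD(1)[OF S, of "fst x" "fst y"] u[OF xy(1)] u[OF xy(2)] xy(3) by auto
    ultimately show "x = y" by (simp add: prod_eq_iff)
  qed
  have ran: "u ` young_cells \<mu> \<subseteq> {1..sum_list \<mu>}" using u tabloidD(2)[OF S] assms by blast
  have bu: "bij_betw u (young_cells \<mu>) {1..sum_list \<mu>}"
    unfolding bij_betw_def using inj ran by (simp add: card_subset_eq card_image card_young_cells)
  obtain \<pi> where perm: "\<pi> permutes {1..sum_list \<mu>}" and \<pi>t: "\<And>x. x \<in> young_cells \<mu> \<Longrightarrow> \<pi> (t x) = u x"
    using tableaux_permutation[OF t, of u] bu by (auto simp: tableaux_def)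
  have "\<pi> ` t ` column \<mu> c = t ` column \<mu> c" for c
  proof (rule card_subset_eq)
    show "\<pi> ` t ` column \<mu> c \<subseteq> t ` column \<mu> c"
      using \<pi>t u by (auto simp: col_def)
    show "card (\<pi> ` t ` column \<mu> c) = card (t ` column \<mu> c)"
      by (rule card_image) (rule inj_on_subset[OF permutes_inj[OF perm]], simp)
  qed (use finite_young_cells in auto)
  hence "\<pi> \<in> column_stabilizer \<mu> t" using perm by (simp add: column_stabilizer_def)
  moreover have "S r = act_tabloid \<pi> (tabloid_of \<mu> t) r" for r
  proof (rule sym, rule card_subset_eq)
    show "finite (S r)" using finite_subset[OF tabloidD(2)[OF S]] by blast
    show "\<pi> ` tabloid_of \<mu> t r \<subseteq> S r" using \<pi>t u by (auto simp: tabloid_of_def)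
    have "card (\<pi> ` tabloid_of \<mu> t r) = card (tabloid_of \<mu> t r)"
      by (rule card_image) (rule inj_on_subset[OF permutes_inj[OF perm]], simp)
    also have "\<dots> = part \<mu> r" by (rule tabloidD(3)) (use t in \<open>simp add: tabloids_def\<close>)
    also have "\<dots> = card (S r)" using tabloidD(3)[OF S] assms by simp
    finally show "card (\<pi> ` tabloid_of \<mu> t r) = card (S r)" .
  qed
  ultimately show ?thesis by blast
qed

end

text \<open>Such a permutation keeps every entry in its column and in its row, and these determine
  the cell.\<close>

lemma column_stabilizer_tabloid_inj:
  assumes t: "t \<in> tableaux \<mu>" and \<pi>: "\<pi> \<in> column_stabilizer \<mu> t"
    and e: "tabloid_of \<mu> t = act_tabloid \<pi> (tabloid_of \<mu> t)"
  shows "\<pi> = id"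
proof
  fix i
  note tD = tableauxD[OF t]
  show "\<pi> i = id i"
  proof (cases "i \<in> {1..sum_list \<mu>}")
    case True
    then obtain x where x: "x \<in> young_cells \<mu>" "i = t x" using tD(3) by blast
    have "\<pi> i \<in> \<pi> ` t ` {y \<in> young_cells \<mu>. snd y = snd x}" using x by blast
    then obtain y where y: "y \<in> young_cells \<mu>" "\<pi> i = t y" "snd y = snd x"
      unfolding column_stabilizerD(2)[OF \<pi>] by blast
    have "\<pi> i \<in> act_tabloid \<pi> (tabloid_of \<mu> t) (fst x)" using x by (auto simp: tabloid_of_def)
    hence "\<pi> i \<in> tabloid_of \<mu> t (fst x)" using e by metis
    then obtain z where z: "z \<in> young_cells \<mu>" "\<pi> i = t z" "fst z = fst x" by (auto simp: tabloid_of_def)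
    have "y = z" using tD(2) y z by (auto simp: inj_on_def)
    hence "y = x" using y z by (simp add: prod_eq_iff)
    thus ?thesis using x y by simp
  next
    case False
    thus ?thesis using column_stabilizerD(1)[OF \<pi>] by (simp add: permutes_def)
  qed
qed

lemma polytabloid_self:
  assumes t: "t \<in> tableaux \<mu>" shows "polytabloid \<mu> t (tabloid_of \<mu> t) = 1"
proof -
  have "polytabloid \<mu> t (tabloid_of \<mu> t) = (\<Sum>\<pi>\<in>column_stabilizer \<mu> t. if \<pi> = id then 1 else 0)"
    unfolding polytabloid_eq signed_orbit_def
    by (rule sum.cong[OF refl]) (use column_stabilizer_tabloid_inj[OF t] in \<open>auto simp: sign_id\<close>)
  thus ?thesis by (simp add: finite_column_stabilizer column_stabilizer_id)
qed

text \<open>Either \<open>S\<close> lies in the column orbit of \<open>t\<close>, and a sign comes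
  out, or two entries of a column of \<open>t\<close> share a row of \<open>S\<close>, and both
  sides vanish. Thus the signed column sum maps into the line of the polytabloid, which is the key
  to James's argument.\<close>

lemma signed_orbit_eq:
  assumes \<mu>: "int_partition k \<mu>" and t: "t \<in> tableaux \<mu>" and S: "S \<in> tabloids \<mu>"
  shows "signed_orbit \<mu> t S T = polytabloid \<mu> t S * polytabloid \<mu> t T"
proof (cases "\<exists>\<pi>\<in>column_stabilizer \<mu> t. S = act_tabloid \<pi> (tabloid_of \<mu> t)")
  case True
  then obtain \<pi> where \<pi>: "\<pi> \<in> column_stabilizer \<mu> t" "S = act_tabloid \<pi> (tabloid_of \<mu> t)" by blast
  have 1: "signed_orbit \<mu> t S T = of_int (sign \<pi>) * polytabloid \<mu> t T" for T
    unfolding \<pi>(2) polytabloid_eq by (rule signed_orbit_act[OF \<pi>(1)])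
  have "polytabloid \<mu> t S = of_int (sign \<pi>)"
  proof -
    have "polytabloid \<mu> t S = (\<Sum>\<rho>\<in>column_stabilizer \<mu> t. if \<rho> = \<pi> then of_int (sign \<pi>) else 0)"
      unfolding polytabloid_eq signed_orbit_def
    proof (rule sum.cong[OF refl])
      fix \<rho> assume \<rho>: "\<rho> \<in> column_stabilizer \<mu> t"
      have "\<rho> = \<pi>" if "S = act_tabloid \<rho> (tabloid_of \<mu> t)"
      proof -
        have b: "bij \<pi>" using permutes_bij[OF column_stabilizerD(1)[OF \<pi>(1)]] .
        have "act_tabloid (inv' \<pi> \<circ> \<rho>) (tabloid_of \<mu> t) = act_tabloid (inv' \<pi>) (act_tabloid \<rho> (tabloid_of \<mu> t))"
          by (simp add: image_comp)
        also have "\<dots> = act_tabloid (inv' \<pi>) (act_tabloid \<pi> (tabloid_of \<mu> t))" using that \<pi>(2) by metis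
        also have "\<dots> = tabloid_of \<mu> t" using b by (simp add: image_inv_f_f bij_is_inj)
        finally have "inv' \<pi> \<circ> \<rho> = id"
          using column_stabilizer_tabloid_inj[OF t column_stabilizer_comp[OF column_stabilizer_inv[OF \<pi>(1)] \<rho>]] by metis
        hence "\<pi> \<circ> (inv' \<pi> \<circ> \<rho>) = \<pi>" by simp
        moreover have "\<pi> \<circ> inv' \<pi> = id" using b by (simp add: surj_iff[symmetric] bij_is_surj)
        ultimately show ?thesis by (simp add: comp_assoc[symmetric])
      qed
      thus "of_int (sign \<rho>) * of_bool (S = act_tabloid \<rho> (tabloid_of \<mu> t)) = (if \<rho> = \<pi> then of_int (sign \<pi>) else 0 :: complex)"
        using \<pi>(2) by auto
    qed
    thus ?thesis using \<pi>(1) by (simp add: finite_column_stabilizer)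
  qed
  thus ?thesis using 1 by simp
next
  case False
  hence e0: "polytabloid \<mu> t S = 0"
    unfolding polytabloid_eq signed_orbit_def by (intro sum.neutral) auto
  have "sum_list \<mu> = k" using \<mu> by (simp add: int_partition_def)
  then obtain x y r where "x \<in> young_cells \<mu>" "y \<in> young_cells \<mu>" "snd x = snd y" "t x \<in> S r" "t y \<in> S r" "x \<noteq> y"
    using exists_column_permutation[OF \<mu> _ t S] False by blast
  moreover have "t x \<in> S q \<longleftrightarrow> t y \<in> S q" for q
    using tabloidD(1)[OF S, of r q] calculation by blast
  ultimately have "signed_orbit \<mu> t S T = 0" using signed_orbit_zero[OF t] by blast
  thus ?thesis using e0 by simp
qed

text \<open>If no two entries of a column of \<open>t\<close> shared a row of \<open>S\<close>,
  dominance would hold; so some transposition makes the sum vanish. This separates the Specht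
  modules of different shapes.\<close>

lemma signed_orbit_not_dominated:
  assumes \<mu>: "int_partition k \<mu>" and \<nu>: "sum_list \<nu> = k" and t: "t \<in> tableaux \<mu>" and S: "S \<in> tabloids \<nu>"
    and n: "(\<Sum>r<q. part \<nu> r) > (\<Sum>r<q. part \<mu> r)"
  shows "signed_orbit \<mu> t S T = 0"
proof -
  obtain x y r where "x \<in> young_cells \<mu>" "y \<in> young_cells \<mu>" "snd x = snd y" "t x \<in> S r" "t y \<in> S r" "x \<noteq> y"
    using dominance[OF \<mu> \<nu> t S, of q] n by (metis leD)
  moreover have "t x \<in> S q \<longleftrightarrow> t y \<in> S q" for q
    using tabloidD(1)[OF S, of r q] calculation by blast
  ultimately show ?thesis using signed_orbit_zero[OF t] by blast
qed

lemma int_partition_eqI: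
  assumes "int_partition k \<mu>" "int_partition k' \<nu>" "\<And>q. (\<Sum>r<q. part \<mu> r) = (\<Sum>r<q. part \<nu> r)"
  shows "\<mu> = \<nu>"
proof -
  have p: "part \<mu> r = part \<nu> r" for r using assms(3)[of "Suc r"] assms(3)[of r] by simp
  have pos: "part \<mu> r > 0 \<longleftrightarrow> r < length \<mu>" "part \<nu> r > 0 \<longleftrightarrow> r < length \<nu>" for r
    using assms(1,2) by (auto simp: part_def int_partition_def)
  have "r < length \<mu> \<longleftrightarrow> r < length \<nu>" for r using pos p by simp
  hence l: "length \<mu> = length \<nu>" by (metis linorder_neqE_nat less_irrefl)
  show ?thesis by (rule nth_equalityI[OF l]) (use p l in \<open>auto simp: part_def split: if_splits\<close>, metis)
qed

section \<open>Outer tensor products of Specht modules\<close>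

definition multi_tabloids :: "nat \<Rightarrow> (nat \<Rightarrow> nat list) \<Rightarrow> (nat \<Rightarrow> tabloid) set" where
  "multi_tabloids l \<mu> = (\<Pi>\<^sub>E i\<in>{1..l}. tabloids (\<mu> i))"

definition multi_tableaux :: "nat \<Rightarrow> (nat \<Rightarrow> nat list) \<Rightarrow> (nat \<Rightarrow> nat \<times> nat \<Rightarrow> nat) set" where
  "multi_tableaux l \<mu> = {t. \<forall>i\<in>{1..l}. t i \<in> tableaux (\<mu> i)}"

definition multi_polytabloid ::
    "nat \<Rightarrow> (nat \<Rightarrow> nat list) \<Rightarrow> (nat \<Rightarrow> nat \<times> nat \<Rightarrow> nat) \<Rightarrow> (nat \<Rightarrow> tabloid) \<Rightarrow> complex" where
  "multi_polytabloid l \<mu> t = pure_tensor l (\<lambda>i. polytabloid (\<mu> i) (t i))"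

text \<open>The scalar multiplication of \<open>specht_module\<close> with the group given by
  \<open>m\<close> instead of \<mu>, so that one and the same \<open>z\<close> can act on the Specht
  modules of different multipartitions.\<close>

definition group_act ::
    "nat \<Rightarrow> (nat \<Rightarrow> nat) \<Rightarrow> ((nat \<Rightarrow> nat \<Rightarrow> nat) \<Rightarrow> complex) \<Rightarrow> ((nat \<Rightarrow> tabloid) \<Rightarrow> complex) \<Rightarrow> (nat \<Rightarrow> tabloid) \<Rightarrow> complex" where
  "group_act l m z x = (\<lambda>T. \<Sum>\<sigma>\<in>carrier (multi_sym_group l m).
      z \<sigma> * x (permute_tabloids l (inv\<^bsub>multi_sym_group l m\<^esub> \<sigma>) T))"

definition specht_carrier :: "nat \<Rightarrow> (nat \<Rightarrow> nat list) \<Rightarrow> ((nat \<Rightarrow> tabloid) \<Rightarrow> complex) set" where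
  "specht_carrier l \<mu> = carrier (specht_module l \<mu>)"

lemma specht_module_simps:
  "carrier (specht_module l \<mu>) = specht_carrier l \<mu>"
  "ring.zero (specht_module l \<mu>) = (\<lambda>T. 0)"
  "add (specht_module l \<mu>) = (\<lambda>x y T. x T + y T)"
  "smult (specht_module l \<mu>) = group_act l (size_vector \<mu>)"
  by (simp_all add: specht_module_def Let_def specht_carrier_def group_act_def fun_eq_iff)

lemma multi_sym_group_carrier:
  "carrier (multi_sym_group l m) = (\<Pi>\<^sub>E i\<in>{1..l}. {p. p permutes {1..m i}})"
  by (simp add: multi_sym_group_def sym_group_def)

lemma multi_sym_group_group: "group (multi_sym_group l m)"
  unfolding multi_sym_group_def by (rule product_group) (rule sym_group_is_group)

lemma finite_multi_sym_group: "finite (carrier (multi_sym_group l m))"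
  unfolding multi_sym_group_carrier by (intro finite_PiE finite_permutations) auto

lemma multi_sym_groupD: "\<sigma> \<in> carrier (multi_sym_group l m) \<Longrightarrow> i \<in> {1..l} \<Longrightarrow> \<sigma> i permutes {1..m i}"
  unfolding multi_sym_group_carrier by (drule PiE_mem) auto

lemma multi_sym_group_mult: "i \<in> {1..l} \<Longrightarrow> (\<sigma> \<otimes>\<^bsub>multi_sym_group l m\<^esub> \<tau>) i = \<sigma> i \<circ> \<tau> i"
  by (simp add: multi_sym_group_def sym_group_def)

lemma multi_sym_group_one: "i \<in> {1..l} \<Longrightarrow> \<one>\<^bsub>multi_sym_group l m\<^esub> i = id"
  by (simp add: multi_sym_group_def sym_group_def)

lemma multi_sym_group_inv:
  assumes "\<sigma> \<in> carrier (multi_sym_group l m)" "i \<in> {1..l}"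
  shows "(inv\<^bsub>multi_sym_group l m\<^esub> \<sigma>) i = inv' (\<sigma> i)"
proof -
  have "\<sigma> \<in> (\<Pi>\<^sub>E i\<in>{1..l}. carrier (sym_group (m i)))" using assms(1) by (simp add: multi_sym_group_def)
  hence "inv\<^bsub>multi_sym_group l m\<^esub> \<sigma> = (\<lambda>i\<in>{1..l}. inv\<^bsub>sym_group (m i)\<^esub> \<sigma> i)"
    unfolding multi_sym_group_def by (rule inv_product_group) (rule sym_group_is_group)
  moreover have "\<sigma> i \<in> carrier (sym_group (m i))"
    using multi_sym_groupD[OF assms] by (simp add: sym_group_def)
  ultimately show ?thesis using assms(2) by simp
qed

lemma permute_tabloids_apply: "i \<in> {1..l} \<Longrightarrow> permute_tabloids l \<sigma> T i = act_tabloid (\<sigma> i) (T i)"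
  by (simp add: permute_tabloids_def)

lemma permute_tabloids_outside: "i \<notin> {1..l} \<Longrightarrow> permute_tabloids l \<sigma> T i = T i"
  by (simp only: permute_tabloids_def if_False)

lemma permute_tabloids_extensional: "permute_tabloids l \<sigma> T \<in> extensional {1..l} \<longleftrightarrow> T \<in> extensional {1..l}"
  unfolding extensional_def mem_Collect_eq using permute_tabloids_outside[of _ l \<sigma> T] by metis

lemma permute_tabloids_mult:
  "permute_tabloids l (\<sigma> \<otimes>\<^bsub>multi_sym_group l m\<^esub> \<tau>) T = permute_tabloids l \<sigma> (permute_tabloids l \<tau> T)"
proof
  fix i
  show "permute_tabloids l (\<sigma> \<otimes>\<^bsub>multi_sym_group l m\<^esub> \<tau>) T i = permute_tabloids l \<sigma> (permute_tabloids l \<tau> T) i"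
  proof (cases "i \<in> {1..l}")
    case True
    thus ?thesis by (simp only: permute_tabloids_apply multi_sym_group_mult image_comp[symmetric])
  next
    case False
    thus ?thesis by (simp only: permute_tabloids_outside not_False_eq_True)
  qed
qed

lemma permute_tabloids_one: "permute_tabloids l \<one>\<^bsub>multi_sym_group l m\<^esub> T = T"
proof
  fix i
  show "permute_tabloids l \<one>\<^bsub>multi_sym_group l m\<^esub> T i = T i"
  proof (cases "i \<in> {1..l}")
    case True
    thus ?thesis by (simp only: permute_tabloids_apply multi_sym_group_one image_id id_apply)
  next
    case False
    thus ?thesis by (simp only: permute_tabloids_outside not_False_eq_True)
  qed
qed

lemma finite_multi_tabloids: "finite (multi_tabloids l \<mu>)"
  unfolding multi_tabloids_def by (intro finite_PiE finite_tabloids) auto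

lemma specht_space_support:
  assumes "x \<in> specht_space \<mu>" "T \<notin> tabloids \<mu>" shows "x T = 0"
proof -
  have "x T = 0" if "x \<in> specht_space \<mu>" using that unfolding specht_space_def
  proof (induction rule: complex_span_induct)
    case (base x)
    then obtain t where t: "t \<in> tableaux \<mu>" "x = polytabloid \<mu> t" by blast
    have "T \<noteq> tabloid_of \<mu> (\<pi> \<circ> t)" if \<pi>: "\<pi> \<in> column_stabilizer \<mu> t" for \<pi>
    proof -
      have "\<pi> \<circ> t \<in> tableaux \<mu>"
        unfolding tableaux_def mem_Collect_eq
        by (rule bij_betw_trans[OF tableauxD(1)[OF t(1)] permutes_imp_bij[OF column_stabilizerD(1)[OF \<pi>]]])
      thus ?thesis using assms(2) by (auto simp: tabloids_def)
    qed
    thus ?case unfolding t(2) polytabloid_def by (intro sum.neutral) auto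
  qed auto
  thus ?thesis using assms by blast
qed

lemma polytabloid_in_specht: "t \<in> tableaux \<mu> \<Longrightarrow> polytabloid \<mu> t \<in> specht_space \<mu>"
  unfolding specht_space_def by (rule complex_span_closed(4)) simp

text \<open>Multilinear expansion: the factors of a pure tensor are replaced by polytabloids one at
  a time.\<close>

lemma specht_carrier_eq:
  "specht_carrier l \<mu> = complex_span (multi_polytabloid l \<mu> ` multi_tableaux l \<mu>)"
proof -
  let ?E = "multi_polytabloid l \<mu> ` multi_tableaux l \<mu>"
  let ?P = "{pure_tensor l v | v. \<forall>i\<in>{1..l}. v i \<in> specht_space (\<mu> i)}"
  have carr: "specht_carrier l \<mu> = complex_span ?P"
    by (simp add: specht_carrier_def specht_module_def Let_def)
  \<comment> \<open>Intermediate stage: the first \<open>k\<close> factors are arbitrary Specht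
    vectors, the remaining ones are polytabloids already.\<close>
  have "pure_tensor l v \<in> complex_span ?E"
    if "k \<le> l" "\<forall>i\<in>{1..k}. v i \<in> specht_space (\<mu> i)" "\<forall>i\<in>{Suc k..l}. v i \<in> polytabloid (\<mu> i) ` tableaux (\<mu> i)" for k v
    using that
  proof (induction k arbitrary: v)
    case 0
    have "\<forall>i\<in>{1..l}. \<exists>t. t \<in> tableaux (\<mu> i) \<and> v i = polytabloid (\<mu> i) t" using 0(3) by auto
    then obtain t where t: "\<And>i. i \<in> {1..l} \<Longrightarrow> t i \<in> tableaux (\<mu> i) \<and> v i = polytabloid (\<mu> i) (t i)" by metis
    have "pure_tensor l v = multi_polytabloid l \<mu> t"
      unfolding pure_tensor_def multi_polytabloid_def using t by (auto intro!: ext prod.cong)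
    moreover have "t \<in> multi_tableaux l \<mu>" using t by (simp add: multi_tableaux_def)
    ultimately show ?case by (intro complex_span_closed(4)) auto
  next
    case (Suc k)
    let ?k = "Suc k"
    have k: "?k \<in> {1..l}" using Suc.prems(1) by simp
    have split: "pure_tensor l (v(?k := x)) T = (if T \<in> extensional {1..l} then x (T ?k) * (\<Prod>i\<in>{1..l} - {?k}. v i (T i)) else 0)" for x T
    proof -
      have "(\<Prod>i=1..l. (v(?k := x)) i (T i)) = (v(?k := x)) ?k (T ?k) * (\<Prod>i\<in>{1..l} - {?k}. (v(?k := x)) i (T i))"
        by (rule prod.remove) (use k in auto)
      also have "(\<Prod>i\<in>{1..l} - {?k}. (v(?k := x)) i (T i)) = (\<Prod>i\<in>{1..l} - {?k}. v i (T i))"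
        by (rule prod.cong) auto
      finally show ?thesis by (simp add: pure_tensor_def)
    qed
    have "pure_tensor l (v(?k := x)) \<in> complex_span ?E" if "x \<in> specht_space (\<mu> ?k)" for x
      using that unfolding specht_space_def
    proof (induction rule: complex_span_induct)
      case zero
      have "pure_tensor l (v(?k := (\<lambda>T. 0))) = (\<lambda>T. 0)" unfolding fun_eq_iff split by simp
      thus ?case by (simp only: complex_span_closed(3))
    next
      case (add x y)
      have e: "pure_tensor l (v(?k := (\<lambda>T. x T + y T))) = (\<lambda>T. pure_tensor l (v(?k := x)) T + pure_tensor l (v(?k := y)) T)"
        unfolding fun_eq_iff split by (simp add: algebra_simps)
      show ?case unfolding e by (rule complex_span_closed(1)[OF add])
    next
      case (scale c x)
      have e: "pure_tensor l (v(?k := (\<lambda>T. c * x T))) = (\<lambda>T. c * pure_tensor l (v(?k := x)) T)"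
        unfolding fun_eq_iff split by (simp add: algebra_simps)
      show ?case unfolding e by (rule complex_span_closed(2)[OF scale])
    next
      case (base x)
      show ?case
      proof (rule Suc.IH)
        show "\<forall>i\<in>{1..k}. (v(?k := x)) i \<in> specht_space (\<mu> i)" using Suc.prems(2) by auto
        show "\<forall>i\<in>{?k..l}. (v(?k := x)) i \<in> polytabloid (\<mu> i) ` tableaux (\<mu> i)"
        proof
          fix i assume i: "i \<in> {?k..l}"
          show "(v(?k := x)) i \<in> polytabloid (\<mu> i) ` tableaux (\<mu> i)"
            using Suc.prems(3) base i by (cases "i = ?k") auto
        qed
      qed (use Suc.prems(1) in simp)
    qed
    from this[of "v ?k"] show ?case using Suc.prems(1,2) by simp
  qed
  from this[of l] have "?P \<subseteq> complex_span ?E" by auto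
  moreover have "?E \<subseteq> ?P"
    using polytabloid_in_specht by (fastforce simp: multi_polytabloid_def multi_tableaux_def)
  ultimately show ?thesis
    unfolding carr using complex_span_subset complex_span_closed(4) by (metis (no_types, lifting) subset_antisym subset_iff)
qed

lemma specht_carrier_support:
  assumes "x \<in> specht_carrier l \<mu>" "T \<notin> multi_tabloids l \<mu>" shows "x T = 0"
proof -
  have "x T = 0" if "x \<in> specht_carrier l \<mu>" using that unfolding specht_carrier_eq
  proof (induction rule: complex_span_induct)
    case (base x)
    then obtain t where t: "t \<in> multi_tableaux l \<mu>" "x = multi_polytabloid l \<mu> t" by blast
    show ?case
    proof (cases "T \<in> extensional {1..l}")
      case True
      then obtain i where i: "i \<in> {1..l}" "T i \<notin> tabloids (\<mu> i)"
        using assms(2) by (auto simp: multi_tabloids_def PiE_iff)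
      have "polytabloid (\<mu> i) (t i) (T i) = 0"
        using specht_space_support[OF polytabloid_in_specht i(2)] t(1) i(1) by (simp add: multi_tableaux_def)
      thus ?thesis using i(1) unfolding t(2) multi_polytabloid_def pure_tensor_def
        by (auto intro!: prod_zero)
    qed (simp add: t(2) multi_polytabloid_def pure_tensor_def)
  qed auto
  thus ?thesis using assms by blast
qed

definition column_antisymmetrizer ::
    "nat \<Rightarrow> (nat \<Rightarrow> nat list) \<Rightarrow> (nat \<Rightarrow> nat \<times> nat \<Rightarrow> nat) \<Rightarrow> (nat \<Rightarrow> nat \<Rightarrow> nat) \<Rightarrow> complex" where
  "column_antisymmetrizer l \<mu> t \<sigma> =
     (if \<sigma> \<in> (\<Pi>\<^sub>E i\<in>{1..l}. column_stabilizer (\<mu> i) (t i)) then \<Prod>i=1..l. of_int (sign (\<sigma> i)) else 0)"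

text \<open>A sum over the product of the column stabilizers of a product over the components is the
  product of the sums. Since \<nu> may differ from \<mu>, the formula serves irreducibility and
  separation alike.\<close>

lemma column_antisymmetrizer_act:
  assumes m: "\<And>i. i \<in> {1..l} \<Longrightarrow> m i = sum_list (\<mu> i)"
    and x: "\<And>T. T \<notin> multi_tabloids l \<nu> \<Longrightarrow> x T = 0" and T: "T \<in> extensional {1..l}"
  shows "group_act l m (column_antisymmetrizer l \<mu> t) x T =
    (\<Sum>S\<in>multi_tabloids l \<nu>. x S * (\<Prod>i=1..l. signed_orbit (\<mu> i) (t i) (S i) (T i)))"
proof -
  let ?G = "multi_sym_group l m" and ?C = "\<Pi>\<^sub>E i\<in>{1..l}. column_stabilizer (\<mu> i) (t i)"
  have sub: "?C \<subseteq> carrier ?G"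
    unfolding multi_sym_group_carrier by (rule PiE_mono) (use m column_stabilizerD(1) in auto)
  have S: "S = permute_tabloids l (inv\<^bsub>?G\<^esub> \<sigma>) T \<longleftrightarrow> (\<forall>i\<in>{1..l}. T i = act_tabloid (\<sigma> i) (S i))"
    if \<sigma>: "\<sigma> \<in> carrier ?G" and S: "S \<in> multi_tabloids l \<nu>" for S \<sigma>
  proof -
    have Se: "S \<in> extensional {1..l}" using S by (auto simp: multi_tabloids_def PiE_def)
    have b: "bij (\<sigma> i)" if "i \<in> {1..l}" for i using permutes_bij[OF multi_sym_groupD[OF \<sigma> that]] .
    have e: "S i = act_tabloid (inv' (\<sigma> i)) (T i) \<longleftrightarrow> T i = act_tabloid (\<sigma> i) (S i)" if i: "i \<in> {1..l}" for i
    proof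
      assume "S i = act_tabloid (inv' (\<sigma> i)) (T i)"
      thus "T i = act_tabloid (\<sigma> i) (S i)" using b[OF i] by (simp add: image_f_inv_f bij_is_surj)
    next
      assume e: "T i = act_tabloid (\<sigma> i) (S i)"
      show "S i = act_tabloid (inv' (\<sigma> i)) (T i)" unfolding e using b[OF i] by (simp add: image_inv_f_f bij_is_inj)
    qed
    have "S = permute_tabloids l (inv\<^bsub>?G\<^esub> \<sigma>) T \<longleftrightarrow> (\<forall>i\<in>{1..l}. S i = permute_tabloids l (inv\<^bsub>?G\<^esub> \<sigma>) T i)"
    proof
      assume r: "\<forall>i\<in>{1..l}. S i = permute_tabloids l (inv\<^bsub>?G\<^esub> \<sigma>) T i"
      show "S = permute_tabloids l (inv\<^bsub>?G\<^esub> \<sigma>) T"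
        by (rule extensionalityI[OF Se]) (use T r in \<open>simp_all only: permute_tabloids_extensional Ball_def\<close>)
    qed simp
    also have "\<dots> \<longleftrightarrow> (\<forall>i\<in>{1..l}. T i = act_tabloid (\<sigma> i) (S i))"
      by (rule ball_cong[OF refl]) (simp only: permute_tabloids_apply multi_sym_group_inv[OF \<sigma>] e)
    finally show ?thesis .
  qed
  have xS: "x U = (\<Sum>S\<in>multi_tabloids l \<nu>. x S * of_bool (S = U))" for U
  proof -
    have "(\<Sum>S\<in>multi_tabloids l \<nu>. x S * of_bool (S = U)) = (\<Sum>S\<in>multi_tabloids l \<nu>. if S = U then x S else 0)"
      by (rule sum.cong) auto
    also have "\<dots> = x U" using x by (simp add: sum.delta finite_multi_tabloids)
    finally show ?thesis by simp
  qed
  have "group_act l m (column_antisymmetrizer l \<mu> t) x T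
      = (\<Sum>\<sigma>\<in>?C. (\<Prod>i=1..l. of_int (sign (\<sigma> i))) * x (permute_tabloids l (inv\<^bsub>?G\<^esub> \<sigma>) T))"
    unfolding group_act_def
    by (rule sum.mono_neutral_cong_right) (use sub finite_multi_sym_group in \<open>auto simp: column_antisymmetrizer_def\<close>)
  also have "\<dots> = (\<Sum>\<sigma>\<in>?C. \<Sum>S\<in>multi_tabloids l \<nu>. x S * (\<Prod>i=1..l. of_int (sign (\<sigma> i)) * of_bool (T i = act_tabloid (\<sigma> i) (S i))))"
  proof (rule sum.cong[OF refl])
    fix \<sigma> assume "\<sigma> \<in> ?C"
    hence \<sigma>: "\<sigma> \<in> carrier ?G" using sub by blast
    have pb: "of_bool (\<forall>i\<in>{1..l}. Q i) = (\<Prod>i=1..l. of_bool (Q i) :: complex)" for Q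
    proof (cases "\<forall>i\<in>{1..l}. Q i")
      case True
      hence "(\<Prod>i=1..l. of_bool (Q i) :: complex) = (\<Prod>i=1..l. 1)" by (intro prod.cong) auto
      thus ?thesis using True by simp
    next
      case False
      then obtain i where "i \<in> {1..l}" "\<not> Q i" by blast
      hence "(\<Prod>i=1..l. of_bool (Q i) :: complex) = 0" by (intro prod_zero) auto
      thus ?thesis using False by simp
    qed
    have "(\<Prod>i=1..l. of_int (sign (\<sigma> i))) * x (permute_tabloids l (inv\<^bsub>?G\<^esub> \<sigma>) T)
       = (\<Sum>S\<in>multi_tabloids l \<nu>. x S * ((\<Prod>i=1..l. of_int (sign (\<sigma> i))) * of_bool (S = permute_tabloids l (inv\<^bsub>?G\<^esub> \<sigma>) T)))"
      by (subst xS) (simp add: sum_distrib_left mult_ac)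
    also have "\<dots> = (\<Sum>S\<in>multi_tabloids l \<nu>. x S * (\<Prod>i=1..l. of_int (sign (\<sigma> i)) * of_bool (T i = act_tabloid (\<sigma> i) (S i))))"
      by (rule sum.cong[OF refl]) (simp only: S[OF \<sigma>] pb prod.distrib)
    finally show "(\<Prod>i=1..l. of_int (sign (\<sigma> i))) * x (permute_tabloids l (inv\<^bsub>?G\<^esub> \<sigma>) T)
       = (\<Sum>S\<in>multi_tabloids l \<nu>. x S * (\<Prod>i=1..l. of_int (sign (\<sigma> i)) * of_bool (T i = act_tabloid (\<sigma> i) (S i))))" .
  qed
  also have "\<dots> = (\<Sum>S\<in>multi_tabloids l \<nu>. x S * (\<Sum>\<sigma>\<in>?C. \<Prod>i=1..l. of_int (sign (\<sigma> i)) * of_bool (T i = act_tabloid (\<sigma> i) (S i))))"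
    by (subst sum.swap) (simp add: sum_distrib_left)
  also have "\<dots> = (\<Sum>S\<in>multi_tabloids l \<nu>. x S * (\<Prod>i=1..l. signed_orbit (\<mu> i) (t i) (S i) (T i)))"
    unfolding signed_orbit_def
    by (rule sum.cong[OF refl], subst prod_sum_PiE) (auto simp: finite_column_stabilizer)
  finally show ?thesis .
qed

lemma column_stabilizer_conj:
  assumes \<pi>: "\<pi> permutes {1..sum_list \<mu>}" and \<rho>: "\<rho> \<in> column_stabilizer \<mu> t"
  shows "\<pi> \<circ> \<rho> \<circ> inv' \<pi> \<in> column_stabilizer \<mu> (\<pi> \<circ> t)"
  unfolding column_stabilizer_def mem_Collect_eq
proof (intro conjI allI)
  show "\<pi> \<circ> \<rho> \<circ> inv' \<pi> permutes {1..sum_list \<mu>}"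
    using column_stabilizerD(1)[OF \<rho>] \<pi> by (intro permutes_compose permutes_inv)
  fix c
  have "\<pi> \<circ> \<rho> \<circ> inv' \<pi> \<circ> (\<pi> \<circ> t) = \<pi> \<circ> (\<rho> \<circ> t)"
    by (rule ext) (simp add: inv_f_f[OF permutes_inj[OF \<pi>]])
  hence e: "(\<pi> \<circ> \<rho> \<circ> inv' \<pi>) ` (\<pi> \<circ> t) ` A = \<pi> ` \<rho> ` t ` A" for A
    by (simp only: image_comp)
  show "(\<pi> \<circ> \<rho> \<circ> inv' \<pi>) ` (\<pi> \<circ> t) ` column \<mu> c = (\<pi> \<circ> t) ` column \<mu> c"
    by (simp only: e column_stabilizerD(2)[OF \<rho>]) (simp only: image_comp)
qed

text \<open>Conjugation by \<pi> maps the column stabilizer of \<open>t\<close> onto that of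
  \<open>\<pi> \<circ> t\<close> and preserves signs. On coefficient functions \<pi> acts by
  substituting its inverse.\<close>

lemma polytabloid_act:
  assumes t: "t \<in> tableaux \<mu>" and \<pi>: "\<pi> permutes {1..sum_list \<mu>}"
  shows "polytabloid \<mu> t (act_tabloid (inv' \<pi>) T) = polytabloid \<mu> (\<pi> \<circ> t) T"
proof -
  note po = permutes_inv_o[OF \<pi>]
  have inj: "inj \<pi>" "surj \<pi>" using permutes_bij[OF \<pi>] by (auto simp: bij_def)
  have conj: "\<pi> \<circ> \<rho> \<circ> inv' \<pi> \<in> column_stabilizer \<mu> (\<pi> \<circ> t)" if "\<rho> \<in> column_stabilizer \<mu> t" for \<rho>
    by (rule column_stabilizer_conj[OF \<pi> that])
  have "inv' \<pi> \<circ> (\<pi> \<circ> t) = t" by (simp add: comp_assoc[symmetric] po)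
  hence conj': "inv' \<pi> \<circ> \<rho> \<circ> \<pi> \<in> column_stabilizer \<mu> t" if "\<rho> \<in> column_stabilizer \<mu> (\<pi> \<circ> t)" for \<rho>
    using column_stabilizer_conj[OF permutes_inv[OF \<pi>] that] permutes_inv_inv[OF \<pi>] by simp
  have b: "bij_betw (\<lambda>\<rho>. \<pi> \<circ> \<rho> \<circ> inv' \<pi>) (column_stabilizer \<mu> t) (column_stabilizer \<mu> (\<pi> \<circ> t))"
  proof (rule bij_betw_byWitness[where f' = "\<lambda>\<rho>. inv' \<pi> \<circ> \<rho> \<circ> \<pi>"])
    have "inv' \<pi> \<circ> (\<pi> \<circ> \<rho> \<circ> inv' \<pi>) \<circ> \<pi> = (inv' \<pi> \<circ> \<pi>) \<circ> \<rho> \<circ> (inv' \<pi> \<circ> \<pi>)" for \<rho> by (simp add: comp_assoc)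
    thus "\<forall>\<rho>\<in>column_stabilizer \<mu> t. inv' \<pi> \<circ> (\<pi> \<circ> \<rho> \<circ> inv' \<pi>) \<circ> \<pi> = \<rho>" by (simp add: po)
    have "\<pi> \<circ> (inv' \<pi> \<circ> \<rho> \<circ> \<pi>) \<circ> inv' \<pi> = (\<pi> \<circ> inv' \<pi>) \<circ> \<rho> \<circ> (\<pi> \<circ> inv' \<pi>)" for \<rho> by (simp add: comp_assoc)
    thus "\<forall>\<rho>\<in>column_stabilizer \<mu> (\<pi> \<circ> t). \<pi> \<circ> (inv' \<pi> \<circ> \<rho> \<circ> \<pi>) \<circ> inv' \<pi> = \<rho>" by (simp add: po)
  qed (use conj conj' in auto)
  have sgn: "sign (\<pi> \<circ> \<rho> \<circ> inv' \<pi>) = sign \<rho>" if "\<rho> \<in> column_stabilizer \<mu> t" for \<rho>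
  proof -
    have p: "permutation \<pi>" "permutation \<rho>" "permutation (inv' \<pi>)"
      using \<pi> sign_column_stabilizer[OF that] permutes_inv[OF \<pi>] permutation_permutes by blast+
    have "sign (\<pi> \<circ> \<rho> \<circ> inv' \<pi>) = sign \<pi> * sign \<rho> * sign \<pi>"
      using p by (simp add: sign_compose permutation_compose sign_inverse)
    thus ?thesis by (simp add: sign_def)
  qed
  have "polytabloid \<mu> (\<pi> \<circ> t) T = (\<Sum>\<rho>\<in>column_stabilizer \<mu> t.
      of_int (sign (\<pi> \<circ> \<rho> \<circ> inv' \<pi>)) * of_bool (T = tabloid_of \<mu> ((\<pi> \<circ> \<rho> \<circ> inv' \<pi>) \<circ> (\<pi> \<circ> t))))"
    unfolding polytabloid_def by (rule sum.reindex_bij_betw[OF b, symmetric])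
  also have "\<dots> = (\<Sum>\<rho>\<in>column_stabilizer \<mu> t. of_int (sign \<rho>) * of_bool (act_tabloid (inv' \<pi>) T = tabloid_of \<mu> (\<rho> \<circ> t)))"
  proof (rule sum.cong[OF refl])
    fix \<rho> assume \<rho>: "\<rho> \<in> column_stabilizer \<mu> t"
    have "(\<pi> \<circ> \<rho> \<circ> inv' \<pi>) \<circ> (\<pi> \<circ> t) = \<pi> \<circ> \<rho> \<circ> (inv' \<pi> \<circ> \<pi>) \<circ> t" by (simp add: comp_assoc)
    hence "tabloid_of \<mu> ((\<pi> \<circ> \<rho> \<circ> inv' \<pi>) \<circ> (\<pi> \<circ> t)) = act_tabloid \<pi> (tabloid_of \<mu> (\<rho> \<circ> t))"
      by (simp add: po comp_assoc tabloid_of_comp)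
    moreover have "T = act_tabloid \<pi> S \<longleftrightarrow> act_tabloid (inv' \<pi>) T = S" for S
    proof
      assume e: "T = act_tabloid \<pi> S"
      show "act_tabloid (inv' \<pi>) T = S" unfolding e using inj by (simp add: image_inv_f_f)
    next
      assume e: "act_tabloid (inv' \<pi>) T = S"
      show "T = act_tabloid \<pi> S" unfolding e[symmetric] using inj by (simp add: image_f_inv_f)
    qed
    ultimately show "of_int (sign (\<pi> \<circ> \<rho> \<circ> inv' \<pi>)) * of_bool (T = tabloid_of \<mu> ((\<pi> \<circ> \<rho> \<circ> inv' \<pi>) \<circ> (\<pi> \<circ> t)))
      = of_int (sign \<rho>) * of_bool (act_tabloid (inv' \<pi>) T = tabloid_of \<mu> (\<rho> \<circ> t))"
      by (simp only: sgn[OF \<rho>])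
  qed
  finally show ?thesis unfolding polytabloid_def by simp
qed

lemma group_act_linear:
  "group_act l m z (\<lambda>T. 0) = (\<lambda>T. 0)"
  "group_act l m z (\<lambda>T. x T + y T) = (\<lambda>T. group_act l m z x T + group_act l m z y T)"
  "group_act l m z (\<lambda>T. c * x T) = (\<lambda>T. c * group_act l m z x T)"
  "group_act l m (\<lambda>g. 0) x = (\<lambda>T. 0)"
  "group_act l m (\<lambda>g. z g + z' g) x = (\<lambda>T. group_act l m z x T + group_act l m z' x T)"
  "group_act l m (\<lambda>g. c * z g) x = (\<lambda>T. c * group_act l m z x T)"
  by (simp_all add: group_act_def algebra_simps sum.distrib sum_distrib_left)

context
  fixes l :: nat and \<mu> :: "nat \<Rightarrow> nat list" and m :: "nat \<Rightarrow> nat"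
  assumes \<mu>: "\<And>i. i \<in> {1..l} \<Longrightarrow> int_partition (m i) (\<mu> i)"
begin

private abbreviation "G \<equiv> multi_sym_group l m"
private abbreviation "Sp \<equiv> specht_carrier l \<mu>"
private abbreviation "mp \<equiv> multi_polytabloid l \<mu>"
private abbreviation "MT \<equiv> multi_tableaux l \<mu>"
private abbreviation "gact \<equiv> group_act l m"

private lemma sum_list_\<mu>: "i \<in> {1..l} \<Longrightarrow> m i = sum_list (\<mu> i)"
  using \<mu> by (auto simp: int_partition_def)

lemma translate_polytabloid:
  assumes t: "t \<in> MT" and \<sigma>: "\<sigma> \<in> carrier G"
  shows "(\<lambda>T. mp t (permute_tabloids l (inv\<^bsub>G\<^esub> \<sigma>) T)) = mp (\<lambda>i. \<sigma> i \<circ> t i)"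
    "(\<lambda>i. \<sigma> i \<circ> t i) \<in> MT"
proof -
  have \<sigma>i: "\<sigma> i permutes {1..sum_list (\<mu> i)}" if "i \<in> {1..l}" for i
    using multi_sym_groupD[OF \<sigma> that] sum_list_\<mu>[OF that] by simp
  show "(\<lambda>i. \<sigma> i \<circ> t i) \<in> MT"
    unfolding multi_tableaux_def tableaux_def mem_Collect_eq
    using bij_betw_trans[OF tableauxD(1) permutes_imp_bij[OF \<sigma>i]] t by (auto simp: multi_tableaux_def)
  show "(\<lambda>T. mp t (permute_tabloids l (inv\<^bsub>G\<^esub> \<sigma>) T)) = mp (\<lambda>i. \<sigma> i \<circ> t i)"
  proof
    fix T
    have "polytabloid (\<mu> i) (t i) (permute_tabloids l (inv\<^bsub>G\<^esub> \<sigma>) T i) = polytabloid (\<mu> i) (\<sigma> i \<circ> t i) (T i)" if i: "i \<in> {1..l}" for i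
      unfolding permute_tabloids_apply[OF i] multi_sym_group_inv[OF \<sigma> i]
      by (rule polytabloid_act) (use t i \<sigma>i in \<open>auto simp: multi_tableaux_def\<close>)
    thus "mp t (permute_tabloids l (inv\<^bsub>G\<^esub> \<sigma>) T) = mp (\<lambda>i. \<sigma> i \<circ> t i) T"
      unfolding multi_polytabloid_def pure_tensor_def permute_tabloids_extensional by (intro if_cong prod.cong refl)
  qed
qed

lemma specht_translate_closed:
  assumes \<sigma>: "\<sigma> \<in> carrier G" and x: "x \<in> Sp"
  shows "(\<lambda>T. x (permute_tabloids l (inv\<^bsub>G\<^esub> \<sigma>) T)) \<in> Sp"
  using x unfolding specht_carrier_eq
proof (induction rule: complex_span_induct)
  case (base x)
  then obtain t where t: "t \<in> MT" "x = mp t" by blast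
  show ?case unfolding t(2) translate_polytabloid(1)[OF t(1) \<sigma>]
    by (rule complex_span_closed(4)) (use translate_polytabloid(2)[OF t(1) \<sigma>] in blast)
qed (auto intro: complex_span_closed)

lemma group_act_closed:
  assumes x: "x \<in> Sp" shows "gact z x \<in> Sp"
  unfolding group_act_def specht_carrier_eq
  by (intro complex_span_sum complex_span_closed(2)) (rule specht_translate_closed[OF _ x, unfolded specht_carrier_eq])

text \<open>Bilinear rather than Hermitian; as polytabloids are real, it is nevertheless the
  standard inner product with a polytabloid.\<close>

private definition "ip x t = (\<Sum>S\<in>multi_tabloids l \<mu>. x S * mp t S)"

lemma antisymmetrizer_specht:
  assumes t: "t \<in> MT" and x: "x \<in> Sp"
  shows "gact (column_antisymmetrizer l \<mu> t) x = (\<lambda>T. ip x t * mp t T)"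
proof
  fix T
  show "gact (column_antisymmetrizer l \<mu> t) x T = ip x t * mp t T"
  proof (cases "T \<in> extensional {1..l}")
    case True
    have "gact (column_antisymmetrizer l \<mu> t) x T =
      (\<Sum>S\<in>multi_tabloids l \<mu>. x S * (\<Prod>i=1..l. signed_orbit (\<mu> i) (t i) (S i) (T i)))"
      by (rule column_antisymmetrizer_act[OF sum_list_\<mu> specht_carrier_support[OF x] True])
    also have "\<dots> = (\<Sum>S\<in>multi_tabloids l \<mu>. x S * mp t S * mp t T)"
    proof (rule sum.cong[OF refl])
      fix S assume S: "S \<in> multi_tabloids l \<mu>"
      have Se: "S \<in> extensional {1..l}" using S by (auto simp: multi_tabloids_def PiE_def)
      have "(\<Prod>i=1..l. signed_orbit (\<mu> i) (t i) (S i) (T i))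
          = (\<Prod>i=1..l. polytabloid (\<mu> i) (t i) (S i) * polytabloid (\<mu> i) (t i) (T i))"
      proof (rule prod.cong[OF refl])
        fix i assume i: "i \<in> {1..l}"
        show "signed_orbit (\<mu> i) (t i) (S i) (T i) = polytabloid (\<mu> i) (t i) (S i) * polytabloid (\<mu> i) (t i) (T i)"
          by (rule signed_orbit_eq[OF \<mu>[OF i]]) (use t S i in \<open>auto simp: multi_tableaux_def multi_tabloids_def\<close>)
      qed
      thus "x S * (\<Prod>i=1..l. signed_orbit (\<mu> i) (t i) (S i) (T i)) = x S * mp t S * mp t T"
        using Se True by (simp add: multi_polytabloid_def pure_tensor_def prod.distrib)
    qed
    also have "\<dots> = ip x t * mp t T" by (simp add: ip_def sum_distrib_right)
    finally show ?thesis .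
  next
    case False
    have "x (permute_tabloids l s T) = 0" for s
      using specht_carrier_support[OF x, of "permute_tabloids l s T"] permute_tabloids_extensional[of l s T] False
      by (auto simp: multi_tabloids_def PiE_def)
    thus ?thesis using False by (simp add: group_act_def multi_polytabloid_def pure_tensor_def)
  qed
qed

lemma exists_multi_tableau: "\<exists>t. t \<in> MT"
proof -
  have "\<forall>i. \<exists>t. t \<in> tableaux (\<mu> i)" using tableaux_nonempty by blast
  then obtain t where "\<And>i. t i \<in> tableaux (\<mu> i)" by metis
  thus ?thesis by (auto simp: multi_tableaux_def)
qed

lemma ip_self_nonzero:
  assumes t: "t \<in> MT" shows "\<exists>T. mp t T = 1"
proof -
  let ?T = "\<lambda>i\<in>{1..l}. tabloid_of (\<mu> i) (t i)"
  have "(\<Prod>i=1..l. polytabloid (\<mu> i) (t i) (?T i)) = (\<Prod>i=1..l. 1)"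
    by (rule prod.cong[OF refl]) (use t polytabloid_self in \<open>auto simp: multi_tableaux_def\<close>)
  hence "mp t ?T = 1" by (simp add: multi_polytabloid_def pure_tensor_def)
  thus ?thesis by blast
qed

lemma polytabloid_real: "cnj (mp t T) = mp t T"
proof -
  have "cnj (of_bool P) = of_bool P" for P by (cases P) auto
  thus ?thesis by (simp add: multi_polytabloid_def pure_tensor_def polytabloid_def)
qed

text \<open>Real polytabloids make the Specht space closed under complex conjugation. So
  \<open>x\<close> pairs to zero with its own conjugate, and its sum of squared moduli
  vanishes.\<close>

lemma ip_nondegenerate:
  assumes x: "x \<in> Sp" and 0: "\<And>t. t \<in> MT \<Longrightarrow> ip x t = 0"
  shows "x = (\<lambda>T. 0)"
proof
  fix T
  have cnj: "(\<lambda>T. cnj (y T)) \<in> Sp" if "y \<in> Sp" for y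
    using that unfolding specht_carrier_eq
  proof (induction rule: complex_span_induct)
    case (base y)
    then obtain t where "t \<in> MT" "y = mp t" by blast
    thus ?case by (simp add: polytabloid_real complex_span_closed(4))
  qed (auto intro: complex_span_closed)
  have z: "(\<Sum>S\<in>multi_tabloids l \<mu>. x S * y S) = 0" if "y \<in> Sp" for y
    using that unfolding specht_carrier_eq
  proof (induction rule: complex_span_induct)
    case (scale c y)
    have "(\<Sum>S\<in>multi_tabloids l \<mu>. x S * (c * y S)) = c * (\<Sum>S\<in>multi_tabloids l \<mu>. x S * y S)"
      by (simp add: sum_distrib_left mult_ac)
    thus ?case using scale by simp
  next
    case (base y)
    thus ?case using 0 by (auto simp: ip_def)
  qed (simp_all add: algebra_simps sum.distrib)
  have "complex_of_real (\<Sum>S\<in>multi_tabloids l \<mu>. (cmod (x S))\<^sup>2) = (\<Sum>S\<in>multi_tabloids l \<mu>. x S * cnj (x S))"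
    by (simp only: of_real_sum complex_norm_square)
  also have "\<dots> = 0" by (rule z[OF cnj[OF x]])
  finally have "(\<Sum>S\<in>multi_tabloids l \<mu>. (cmod (x S))\<^sup>2) = 0" by (simp only: of_real_eq_0_iff)
  hence "\<forall>S\<in>multi_tabloids l \<mu>. (cmod (x S))\<^sup>2 = 0" by (subst (asm) sum_nonneg_eq_0_iff) (auto simp: finite_multi_tabloids)
  thus "x T = 0" using specht_carrier_support[OF x, of T] by (cases "T \<in> multi_tabloids l \<mu>") auto
qed

lemma group_act_translate:
  assumes \<sigma>: "\<sigma> \<in> carrier G"
  shows "gact (\<lambda>\<tau>. z (inv\<^bsub>G\<^esub> \<sigma> \<otimes>\<^bsub>G\<^esub> \<tau>)) x = (\<lambda>T. gact z x (permute_tabloids l (inv\<^bsub>G\<^esub> \<sigma>) T))"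
proof
  fix T
  interpret G: group G by (rule multi_sym_group_group)
  have b: "bij_betw (\<lambda>\<rho>. \<sigma> \<otimes>\<^bsub>G\<^esub> \<rho>) (carrier G) (carrier G)"
    by (rule bij_betw_byWitness[where f' = "\<lambda>\<rho>. inv\<^bsub>G\<^esub> \<sigma> \<otimes>\<^bsub>G\<^esub> \<rho>"]) (use \<sigma> in \<open>auto simp: G.m_assoc[symmetric]\<close>)
  have "gact (\<lambda>\<tau>. z (inv\<^bsub>G\<^esub> \<sigma> \<otimes>\<^bsub>G\<^esub> \<tau>)) x T
     = (\<Sum>\<rho>\<in>carrier G. z (inv\<^bsub>G\<^esub> \<sigma> \<otimes>\<^bsub>G\<^esub> (\<sigma> \<otimes>\<^bsub>G\<^esub> \<rho>)) * x (permute_tabloids l (inv\<^bsub>G\<^esub> (\<sigma> \<otimes>\<^bsub>G\<^esub> \<rho>)) T))"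
    unfolding group_act_def by (rule sum.reindex_bij_betw[OF b, symmetric])
  also have "\<dots> = gact z x (permute_tabloids l (inv\<^bsub>G\<^esub> \<sigma>) T)"
    unfolding group_act_def
    by (rule sum.cong[OF refl]) (use \<sigma> in \<open>simp add: G.m_assoc[symmetric] G.inv_mult_group permute_tabloids_mult\<close>)
  finally show "gact (\<lambda>\<tau>. z (inv\<^bsub>G\<^esub> \<sigma> \<otimes>\<^bsub>G\<^esub> \<tau>)) x T = gact z x (permute_tabloids l (inv\<^bsub>G\<^esub> \<sigma>) T)" .
qed

text \<open>Some polytabloid pairs nontrivially with \<open>v\<close>; its antisymmetrizer carries
  \<open>v\<close> to a nonzero multiple of it, and the translates of one polytabloid span.\<close>

lemma specht_irreducible:
  assumes v: "v \<in> Sp" "v \<noteq> (\<lambda>T. 0)" and w: "w \<in> Sp"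
  shows "\<exists>z. w = gact z v"
proof -
  interpret G: group G by (rule multi_sym_group_group)
  obtain t where t: "t \<in> MT" "ip v t \<noteq> 0" using ip_nondegenerate[OF v(1)] v(2) by blast
  show ?thesis
    using w unfolding specht_carrier_eq
  proof (induction rule: complex_span_induct)
    case zero
    show ?case using group_act_linear(4)[of l m v] by metis
  next
    case (add x y)
    then obtain z z' where "x = gact z v" "y = gact z' v" by blast
    thus ?case by (intro exI[of _ "\<lambda>g. z g + z' g"]) (simp only: group_act_linear(5))
  next
    case (scale c x)
    then obtain z where "x = gact z v" by blast
    thus ?case by (intro exI[of _ "\<lambda>g. c * z g"]) (simp only: group_act_linear(6))
  next
    case (base x)
    then obtain s where s: "s \<in> MT" "x = mp s" by blast
    have "\<forall>i\<in>{1..l}. \<exists>\<pi>. \<pi> permutes {1..m i} \<and> (\<forall>y\<in>young_cells (\<mu> i). \<pi> (t i y) = s i y)"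
    proof
      fix i assume i: "i \<in> {1..l}"
      have ti: "t i \<in> tableaux (\<mu> i)" and si: "s i \<in> tableaux (\<mu> i)" using t(1) s(1) i by (auto simp: multi_tableaux_def)
      show "\<exists>\<pi>. \<pi> permutes {1..m i} \<and> (\<forall>y\<in>young_cells (\<mu> i). \<pi> (t i y) = s i y)"
        unfolding sum_list_\<mu>[OF i] by (rule tableaux_permutation[OF ti si])
    qed
    then obtain \<sigma>' where \<sigma>': "\<And>i. i \<in> {1..l} \<Longrightarrow> \<sigma>' i permutes {1..m i} \<and> (\<forall>y\<in>young_cells (\<mu> i). \<sigma>' i (t i y) = s i y)"
      by metis
    define \<sigma> where "\<sigma> = (\<lambda>i\<in>{1..l}. \<sigma>' i)"
    have \<sigma>: "\<sigma> \<in> carrier G" unfolding multi_sym_group_carrier \<sigma>_def using \<sigma>' by auto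
    \<comment> \<open>The composite of \<sigma> with \<open>t\<close> agrees with \<open>s\<close>
      on cells only, and nothing else enters a polytabloid.\<close>
    have poly_cong: "polytabloid \<nu> t1 = polytabloid \<nu> t2" if c: "\<And>y. y \<in> young_cells \<nu> \<Longrightarrow> t1 y = t2 y" for \<nu> t1 t2
    proof -
      have im: "t1 ` {y \<in> young_cells \<nu>. Q y} = t2 ` {y \<in> young_cells \<nu>. Q y}" for Q
        by (rule image_cong[OF refl]) (use c in auto)
      have "tabloid_of \<nu> t1 = tabloid_of \<nu> t2" by (rule ext) (simp only: tabloid_of_def im)
      moreover have "column_stabilizer \<nu> t1 = column_stabilizer \<nu> t2" by (simp only: column_stabilizer_def im)
      ultimately show ?thesis by (simp only: polytabloid_def tabloid_of_comp)
    qed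
    have "mp (\<lambda>i. \<sigma> i \<circ> t i) = mp s"
    proof -
      have "polytabloid (\<mu> i) (\<sigma> i \<circ> t i) = polytabloid (\<mu> i) (s i)" if i: "i \<in> {1..l}" for i
        by (rule poly_cong) (use \<sigma>'[OF i] i in \<open>simp add: \<sigma>_def\<close>)
      thus ?thesis unfolding multi_polytabloid_def pure_tensor_def by (intro ext if_cong prod.cong refl) simp
    qed
    hence x: "x = (\<lambda>T. mp t (permute_tabloids l (inv\<^bsub>G\<^esub> \<sigma>) T))"
      using translate_polytabloid(1)[OF t(1) \<sigma>] s(2) by simp
    define z where "z = (\<lambda>\<tau>. (1 / ip v t) * column_antisymmetrizer l \<mu> t \<tau>)"
    have "gact z v = mp t"
      unfolding z_def group_act_linear(6) antisymmetrizer_specht[OF t(1) v(1)] using t(2) by simp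
    hence "gact (\<lambda>\<tau>. z (inv\<^bsub>G\<^esub> \<sigma> \<otimes>\<^bsub>G\<^esub> \<tau>)) v = x"
      unfolding group_act_translate[OF \<sigma>] x by simp
    thus ?case by metis
  qed
qed

lemma specht_nonzero: "\<exists>v\<in>Sp. v \<noteq> (\<lambda>T. 0)"
proof -
  obtain t where t: "t \<in> MT" using exists_multi_tableau by blast
  hence "mp t \<in> Sp" unfolding specht_carrier_eq by (intro complex_span_closed(4)) blast
  thus ?thesis using ip_self_nonzero[OF t] by (metis zero_neq_one)
qed

text \<open>The antisymmetrizer of a tableau of \<mu> annihilates all tabloids of \<nu>, by the
  component in which dominance fails, but sends a suitable Specht vector of \<mu> to a nonzero
  multiple of its polytabloid.\<close>

lemma specht_separated:
  assumes \<nu>: "\<And>i. i \<in> {1..l} \<Longrightarrow> int_partition (m i) (\<nu> i)" and i: "i \<in> {1..l}"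
    and dom: "(\<Sum>r<q. part (\<nu> i) r) > (\<Sum>r<q. part (\<mu> i) r)"
  shows "\<exists>z. (\<forall>v\<in>specht_carrier l \<nu>. gact z v = (\<lambda>T. 0)) \<and> (\<exists>v\<in>Sp. gact z v \<noteq> (\<lambda>T. 0))"
proof -
  obtain v where v: "v \<in> Sp" "v \<noteq> (\<lambda>T. 0)" using specht_nonzero by blast
  then obtain t where t: "t \<in> MT" "ip v t \<noteq> 0" using ip_nondegenerate by blast
  let ?z = "column_antisymmetrizer l \<mu> t"
  have "gact ?z v T = 0" if v: "v \<in> specht_carrier l \<nu>" for v T
  proof (cases "T \<in> extensional {1..l}")
    case True
    have z: "(\<Prod>i=1..l. signed_orbit (\<mu> i) (t i) (S i) (T i)) = 0" if S: "S \<in> multi_tabloids l \<nu>" for S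
    proof -
      have "sum_list (\<nu> i) = m i" using \<nu>[OF i] by (simp add: int_partition_def)
      hence "signed_orbit (\<mu> i) (t i) (S i) (T i) = 0"
        by (rule signed_orbit_not_dominated[OF \<mu>[OF i] _ _ _ dom])
          (use t(1) S i in \<open>auto simp: multi_tableaux_def multi_tabloids_def\<close>)
      thus ?thesis using i by (intro prod_zero) auto
    qed
    have "gact ?z v T = (\<Sum>S\<in>multi_tabloids l \<nu>. v S * (\<Prod>i=1..l. signed_orbit (\<mu> i) (t i) (S i) (T i)))"
      by (rule column_antisymmetrizer_act[OF sum_list_\<mu> specht_carrier_support[OF v] True])
    also have "\<dots> = 0" by (intro sum.neutral ballI) (simp only: z mult_zero_right)
    finally show ?thesis .
  next
    case False
    have "v (permute_tabloids l s T) = 0" for s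
      using specht_carrier_support[OF v, of "permute_tabloids l s T"] permute_tabloids_extensional[of l s T] False
      by (auto simp: multi_tabloids_def PiE_def)
    thus ?thesis by (simp add: group_act_def)
  qed
  moreover have "gact ?z v \<noteq> (\<lambda>T. 0)"
    unfolding antisymmetrizer_specht[OF t(1) v(1)] using t(2) ip_self_nonzero[OF t(1)] by (metis mult.right_neutral)
  ultimately show ?thesis using v(1) by (intro exI[of _ ?z]) (auto simp: fun_eq_iff)
qed

end

text \<open>Distinct partitions differ in some partial sum, and the larger sum belongs to a
  partition that the other one does not dominate. Which of the two it is remains open, hence the
  disjunction.\<close>

lemma specht_modules_separated:
  assumes \<mu>: "\<And>i. i \<in> {1..l} \<Longrightarrow> int_partition (m i) (\<mu> i)"
    and \<nu>: "\<And>i. i \<in> {1..l} \<Longrightarrow> int_partition (m i) (\<nu> i)" and ne: "\<exists>i\<in>{1..l}. \<mu> i \<noteq> \<nu> i"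
  shows "(\<exists>z. (\<forall>v\<in>specht_carrier l \<nu>. group_act l m z v = (\<lambda>T. 0)) \<and> (\<exists>v\<in>specht_carrier l \<mu>. group_act l m z v \<noteq> (\<lambda>T. 0)))
       \<or> (\<exists>z. (\<forall>v\<in>specht_carrier l \<mu>. group_act l m z v = (\<lambda>T. 0)) \<and> (\<exists>v\<in>specht_carrier l \<nu>. group_act l m z v \<noteq> (\<lambda>T. 0)))"
proof -
  obtain i where i: "i \<in> {1..l}" "\<mu> i \<noteq> \<nu> i" using ne by blast
  obtain q where "(\<Sum>r<q. part (\<mu> i) r) \<noteq> (\<Sum>r<q. part (\<nu> i) r)"
    using int_partition_eqI[OF \<mu>[OF i(1)] \<nu>[OF i(1)]] i(2) by blast
  hence "(\<Sum>r<q. part (\<nu> i) r) > (\<Sum>r<q. part (\<mu> i) r) \<or> (\<Sum>r<q. part (\<mu> i) r) > (\<Sum>r<q. part (\<nu> i) r)" by linarith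
  thus ?thesis
  proof
    assume "(\<Sum>r<q. part (\<nu> i) r) > (\<Sum>r<q. part (\<mu> i) r)"
    hence "\<exists>z. (\<forall>v\<in>specht_carrier l \<nu>. group_act l m z v = (\<lambda>T. 0)) \<and> (\<exists>v\<in>specht_carrier l \<mu>. group_act l m z v \<noteq> (\<lambda>T. 0))"
      using \<mu> \<nu> i(1) by (intro specht_separated[of l m \<mu> \<nu> i q])
    thus ?thesis by (rule disjI1)
  next
    assume "(\<Sum>r<q. part (\<mu> i) r) > (\<Sum>r<q. part (\<nu> i) r)"
    hence "\<exists>z. (\<forall>v\<in>specht_carrier l \<mu>. group_act l m z v = (\<lambda>T. 0)) \<and> (\<exists>v\<in>specht_carrier l \<nu>. group_act l m z v \<noteq> (\<lambda>T. 0))"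
      using \<mu> \<nu> i(1) by (intro specht_separated[of l m \<nu> \<mu> i q])
    thus ?thesis by (rule disjI2)
  qed
qed

section \<open>Descent in the index poset\<close>

section \<open>Factorisation through the diagrams a\<close>

lemma bij_preserving_classes:
  assumes "finite A" "finite B" "\<And>v. card {a \<in> A. f a = v} = card {b \<in> B. g b = v}"
  shows "\<exists>\<beta>. bij_betw \<beta> A B \<and> (\<forall>a\<in>A. g (\<beta> a) = f a)"
proof -
  have "\<forall>v. \<exists>h. bij_betw h {a \<in> A. f a = v} {b \<in> B. g b = v}"
    using assms by (intro allI finite_same_card_bij) auto
  then obtain h where h: "\<And>v. bij_betw (h v) {a \<in> A. f a = v} {b \<in> B. g b = v}" by metis
  have hm: "h (f a) a \<in> B \<and> g (h (f a) a) = f a" if "a \<in> A" for a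
    using bij_betwE[OF h[of "f a"]] that by blast
  have "inj_on (\<lambda>a. h (f a) a) A"
  proof (rule inj_onI)
    fix a a' assume a: "a \<in> A" "a' \<in> A" "h (f a) a = h (f a') a'"
    hence "f a = f a'" using hm by metis
    thus "a = a'" using a bij_betw_imp_inj_on[OF h[of "f a"]] by (auto simp: inj_on_def)
  qed
  moreover have "(\<lambda>a. h (f a) a) ` A = B"
  proof
    show "B \<subseteq> (\<lambda>a. h (f a) a) ` A"
    proof
      fix b assume "b \<in> B"
      hence "b \<in> h (g b) ` {a \<in> A. f a = g b}" using bij_betw_imp_surj_on[OF h[of "g b"]] by blast
      then obtain a where "a \<in> A" "f a = g b" "b = h (g b) a" by blast
      thus "b \<in> (\<lambda>a. h (f a) a) ` A" by (intro image_eqI[of _ _ a]) simp_all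
    qed
  qed (use hm in blast)
  ultimately show ?thesis using hm by (intro exI[of _ "\<lambda>a. h (f a) a"]) (simp add: bij_betw_def)
qed

lemma relcomp_Id_on: "snd ` P \<subseteq> B \<Longrightarrow> P O Id_on B = P"
  by force

lemma half_absorb:
  assumes l: "1 \<le> l" and m: "m \<in> index_set l n" and q: "q \<in> half_diagrams l n m"
  shows "dcomp n q (a_diagram l n m) = q"
    "loops n q (a_diagram l n m) = card (cut_blocks l n (weight l m))"
proof -
  let ?B = "through_blocks l m" and ?C = "cut_blocks l n (weight l m)"
  obtain P W where j: "joinable n P W ?C" "snd ` P = ?B" "q = joined P W ?C" using half_diagramE[OF l m q] by metis
  have a: "joinable n (Id_on ?B) ?C ?C" by (rule joinable_Id[OF blocks_row_split[OF l m]])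
  have "fst ` Id_on ?B = ?B" by force
  hence m: "snd ` P = fst ` Id_on ?B" using j(2) by simp
  show "dcomp n q (a_diagram l n m) = q"
    "loops n q (a_diagram l n m) = card ?C"
    unfolding j(3) a_diagram_eq[OF l] matched_comp[OF j(1) a m] using j(2) by (simp_all add: relcomp_Id_on)
qed

text \<open>Each propagating part is routed through a block of \<open>a\<close> whose size is the
  tone class of the part; the number of blocks of each size is right because the index is the
  propagating vector of \<open>d\<close> itself.\<close>

lemma tonal_factor:
  assumes l: "1 \<le> l" and d: "d \<in> tonal_diagrams l n"
  shows "propagating_vector l d \<in> index_set l n"
    "\<exists>p q. p \<in> half_diagrams l n (propagating_vector l d) \<and> q \<in> tonal_diagrams l n \<and> dcomp n p q = d"
proof -
  obtain P W W' where j: "joinable n P W W'" "d = joined P W W'" using diagram_eq_joined[OF tonal_diagramsD[OF d]] by blast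
  let ?m = "propagating_vector l d"
  show m: "?m \<in> index_set l n" unfolding j(2) by (rule propagating_vector_index[OF j(1) l d[unfolded j(2)]])
  let ?B = "through_blocks l ?m" and ?C = "cut_blocks l n (weight l ?m)"
  note r = blocks_row_split[OF l m]
  have "card {z \<in> P. tone_class l (card (fst z)) = i} = card {y \<in> ?B. card y = i}" for i
  proof (cases "i \<in> {1..l}")
    case True
    thus ?thesis unfolding through_blocks_of_card(2)[OF True] using propagating_vector_joined[OF j(1) l] j(2) by presburger
  next
    case False
    have "{z \<in> P. tone_class l (card (fst z)) = i} = {}" "{y \<in> ?B. card y = i} = {}"
      using False tone_class(1)[OF l] card_through_block by blast+
    thus ?thesis by (simp only: card.empty)
  qed
  from bij_preserving_classes[OF joinableD(7)[OF j(1)] row_splitD(7)[OF r] this]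
  obtain \<beta> where \<beta>: "bij_betw \<beta> P ?B" "\<And>z. z \<in> P \<Longrightarrow> card (\<beta> z) = tone_class l (card (fst z))"
    by blast
  \<comment> \<open>The left factor keeps the top halves and the right factor the bottom halves;
    \<beta> names the block in which they meet.\<close>
  let ?P1 = "(\<lambda>z. (fst z, \<beta> z)) ` P" and ?P2 = "(\<lambda>z. (\<beta> z, snd z)) ` P"
  have \<beta>P: "\<beta> ` P = ?B" and \<beta>i: "inj_on \<beta> P" using \<beta>(1) by (auto simp: bij_betw_def)
  have im: "fst ` ?P1 = fst ` P" "snd ` ?P1 = ?B" "fst ` ?P2 = ?B" "snd ` ?P2 = snd ` P"
    by (simp_all add: image_image \<beta>P)
  have inj: "inj_on fst ?P1" "inj_on snd ?P1" "inj_on fst ?P2" "inj_on snd ?P2"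
    using joinableD(5,6)[OF j(1)] \<beta>i by (auto simp: inj_on_def)
  have j1: "joinable n ?P1 W ?C" and j2: "joinable n ?P2 ?C W'"
    using inj r joinableD(1,2)[OF j(1)] by (simp_all add: joinable_def im)
  have t: "\<And>z. z \<in> P \<Longrightarrow> card (fst z) mod l = card (snd z) mod l" "\<forall>u\<in>W \<union> W'. card u mod l = 0"
    using d unfolding j(2) joined_tonal_iff[OF j(1)] by auto
  have \<beta>t: "card (\<beta> z) mod l = card (fst z) mod l" if "z \<in> P" for z
    using \<beta>(2)[OF that] tone_class(2)[OF l] by simp
  have t1: "joined ?P1 W ?C \<in> tonal_diagrams l n" and t2: "joined ?P2 ?C W' \<in> tonal_diagrams l n"
    unfolding joined_tonal_iff[OF j1] joined_tonal_iff[OF j2]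
    using t \<beta>t card_cut_block by auto
  have h: "joined ?P1 W ?C \<in> half_diagrams l n ?m"
    unfolding half_diagrams_iff[OF l m] using j1 im(2) t1 by blast
  have PP: "?P1 O ?P2 = P"
  proof (intro equalityI subsetI)
    fix w assume "w \<in> ?P1 O ?P2"
    then obtain z z' where z: "z \<in> P" "z' \<in> P" "\<beta> z = \<beta> z'" "w = (fst z, snd z')" by auto
    hence "z = z'" using \<beta>i by (auto dest: inj_onD)
    thus "w \<in> P" using z by simp
  next
    fix w assume w: "w \<in> P"
    hence "(fst w, \<beta> w) \<in> ?P1" "(\<beta> w, snd w) \<in> ?P2" by auto
    hence "(fst w, snd w) \<in> ?P1 O ?P2" by (rule relcompI)
    thus "w \<in> ?P1 O ?P2" by simp
  qed
  have mid: "snd ` ?P1 = fst ` ?P2" unfolding im ..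
  have "dcomp n (joined ?P1 W ?C) (joined ?P2 ?C W') = d"
    using matched_comp(1)[OF j1 j2 mid] by (simp only: PP j(2)[symmetric])
  thus "\<exists>p q. p \<in> half_diagrams l n ?m \<and> q \<in> tonal_diagrams l n \<and> dcomp n p q = d"
    using h t2 by blast
qed

section \<open>Descent in the index poset\<close>

lemma sum_sum_delta:
  fixes l s t :: nat
  assumes "s \<in> {1..l}" "t \<in> {s..l}"
  shows "(\<Sum>i=1..l. \<Sum>j=i..l. int (of_bool (i = s \<and> j = t)) * (F i j :: int)) = F s t"
proof -
  have "(\<Sum>i=1..l. \<Sum>j=i..l. int (of_bool (i = s \<and> j = t)) * F i j) = (\<Sum>i=1..l. if i = s then F s t else 0)"
  proof (rule sum.cong[OF refl])
    fix i
    show "(\<Sum>j=i..l. int (of_bool (i = s \<and> j = t)) * F i j) = (if i = s then F s t else 0)"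
    proof (cases "i = s")
      case True
      have "(\<Sum>j=i..l. int (of_bool (i = s \<and> j = t)) * F i j) = (\<Sum>j=i..l. if j = t then F s t else 0)"
        by (rule sum.cong[OF refl]) (use True in auto)
      also have "\<dots> = F s t" using assms(2) True by (subst sum.delta) auto
      finally show ?thesis using True by simp
    qed simp
  qed
  also have "\<dots> = F s t" using assms(1) by (subst sum.delta) auto
  finally show ?thesis .
qed

text \<open>The order is defined by a sum over pairs with i at most j, so a merge of s and t is
  entered with the smaller one first.\<close>

lemma index_le_step:
  assumes st: "s \<in> {1..l}" "t \<in> {1..l}"
    and d: "\<And>k. k \<in> {1..l} \<Longrightarrow> int (m' k) - int (m k) = merge_vec l s t k"
  shows "index_le l m' m"
proof -
  have sym: "merge_vec l s t = merge_vec l t s" by (auto simp: merge_vec_def add.commute)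
  have "\<exists>s t. s \<in> {1..l} \<and> t \<in> {s..l} \<and> (\<forall>k\<in>{1..l}. int (m' k) - int (m k) = merge_vec l s t k)"
  proof (cases "s \<le> t")
    case True
    thus ?thesis using st d by (intro exI[of _ s] exI[of _ t]) auto
  next
    case False
    thus ?thesis using st d sym by (intro exI[of _ t] exI[of _ s]) auto
  qed
  then obtain s t where st: "s \<in> {1..l}" "t \<in> {s..l}" "\<forall>k\<in>{1..l}. int (m' k) - int (m k) = merge_vec l s t k" by blast
  show ?thesis
    unfolding index_le_def
  proof (intro exI[of _ "\<lambda>i j. of_bool (i = s \<and> j = t)"] ballI)
    fix k assume "k \<in> {1..l}"
    thus "int (m' k) - int (m k) = (\<Sum>i=1..l. \<Sum>j=i..l. int (of_bool (i = s \<and> j = t)) * merge_vec l i j k)"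
      unfolding sum_sum_delta[OF st(1,2), of "\<lambda>i j. merge_vec l i j k"] using st(3) by blast
  qed
qed

lemma unit_vec_eq:
  assumes "1 \<le> l" "k \<in> {1..l}" shows "unit_vec l s k = of_bool (tone_class l s = k)"
proof -
  have "(k \<in> {1..l} \<and> k mod l = s mod l) \<longleftrightarrow> tone_class l s = k"
    using tone_class(3)[OF assms, of s] assms(2) by metis
  thus ?thesis unfolding unit_vec_def by (simp only:)
qed

text \<open>Every \<open>merge_vec\<close> has coordinate sum -1, so the number of propagating parts
  drops by the total of the coefficients. That total is positive, as otherwise the indices would
  agree.\<close>

lemma index_less_sum:
  assumes l: "1 \<le> l" and le: "index_less l m' m" and m: "m \<in> index_set l n" "m' \<in> index_set l n"
  shows "(\<Sum>i=1..l. m' i) < (\<Sum>i=1..l. m i)"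
proof -
  obtain c :: "nat \<Rightarrow> nat \<Rightarrow> nat" where c: "\<And>k. k \<in> {1..l} \<Longrightarrow>
      int (m' k) - int (m k) = (\<Sum>i=1..l. \<Sum>j=i..l. int (c i j) * merge_vec l i j k)"
    using le unfolding index_less_def index_le_def by blast
  have u: "(\<Sum>k=1..l. unit_vec l s k) = 1" for s
  proof -
    have "(\<Sum>k=1..l. unit_vec l s k) = (\<Sum>k=1..l. if tone_class l s = k then 1 else 0)"
      by (rule sum.cong[OF refl]) (simp only: unit_vec_eq[OF l] of_bool_def)
    also have "\<dots> = 1" using tone_class(1)[OF l, of s] by (subst sum.delta') auto
    finally show ?thesis .
  qed
  have mv: "(\<Sum>k=1..l. merge_vec l i j k) = -1" for i j
    unfolding merge_vec_def sum_subtractf u by simp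
  have "(\<Sum>k=1..l. int (m' k) - int (m k)) = (\<Sum>k=1..l. \<Sum>i=1..l. \<Sum>j=i..l. int (c i j) * merge_vec l i j k)"
    by (rule sum.cong[OF refl]) (rule c)
  also have "\<dots> = (\<Sum>i=1..l. \<Sum>k=1..l. \<Sum>j=i..l. int (c i j) * merge_vec l i j k)" by (rule sum.swap)
  also have "\<dots> = (\<Sum>i=1..l. \<Sum>j=i..l. \<Sum>k=1..l. int (c i j) * merge_vec l i j k)"
    by (rule sum.cong[OF refl]) (rule sum.swap)
  also have "\<dots> = - (\<Sum>i=1..l. \<Sum>j=i..l. int (c i j))"
    by (simp only: sum_distrib_left[symmetric] mv) (simp add: sum_negf)
  finally have s: "int (\<Sum>k=1..l. m' k) - int (\<Sum>k=1..l. m k) = - (\<Sum>i=1..l. \<Sum>j=i..l. int (c i j))"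
    by (simp add: sum_subtractf)
  have "(\<Sum>i=1..l. \<Sum>j=i..l. int (c i j)) \<noteq> 0"
  proof
    assume z: "(\<Sum>i=1..l. \<Sum>j=i..l. int (c i j)) = 0"
    hence "\<forall>i\<in>{1..l}. (\<Sum>j=i..l. int (c i j)) = 0"
      by (subst (asm) sum_nonneg_eq_0_iff) (auto intro: sum_nonneg)
    hence c0: "c i j = 0" if "i \<in> {1..l}" "j \<in> {i..l}" for i j
      using that by (auto simp: sum_nonneg_eq_0_iff)
    have "m' k = m k" for k
    proof (cases "k \<in> {1..l}")
      case True
      have "(\<Sum>i=1..l. \<Sum>j=i..l. int (c i j) * merge_vec l i j k) = 0"
        by (intro sum.neutral ballI) (simp only: c0 of_nat_0 mult_zero_left)
      thus ?thesis using c[OF True] by simp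
    next
      case False
      thus ?thesis using index_setD(3)[OF m(1)] index_setD(3)[OF m(2)] by simp
    qed
    hence "m' = m" by (rule ext)
    thus False using le by (simp add: index_less_def)
  qed
  moreover have "(\<Sum>i=1..l. \<Sum>j=i..l. int (c i j)) \<ge> 0" by (intro sum_nonneg) simp
  ultimately show ?thesis using s by linarith
qed

lemma row_split_mergeI:
  assumes r: "row_split n B C" and b: "b \<in> B" "b' \<in> B" "b \<noteq> b'"
  shows "row_split n (insert (b \<union> b') (B - {b, b'})) C" "b \<union> b' \<notin> B" "b \<inter> b' = {}"
proof -
  note R = row_splitD[OF r]
  have ne: "b \<noteq> {}" "b' \<noteq> {}" using R(3) b by blast+
  show d: "b \<inter> b' = {}" using R(5)[of b b'] b by blast
  have u: "x = b \<or> x = b'" if x: "x \<in> B \<union> C" "i \<in> x" "i \<in> b \<union> b'" for x i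
    using R(5)[of x b i] R(5)[of x b' i] x b by blast
  show nB: "b \<union> b' \<notin> B"
  proof
    assume "b \<union> b' \<in> B"
    moreover obtain i where "i \<in> b" using ne by blast
    ultimately have "b \<union> b' = b \<or> b \<union> b' = b'" using u[of "b \<union> b'" i] by blast
    thus False using d ne by blast
  qed
  have nC: "b \<union> b' \<notin> C"
  proof
    assume c: "b \<union> b' \<in> C"
    obtain i where "i \<in> b" using ne by blast
    hence "b \<union> b' = b" using R(5)[of "b \<union> b'" b i] b c by blast
    with c have "b \<in> C" by (simp only:)
    thus False using b(1) R(1) by blast
  qed
  show "row_split n (insert (b \<union> b') (B - {b, b'})) C"
  proof (rule row_splitI)
    show "insert (b \<union> b') (B - {b, b'}) \<inter> C = {}" using nC R(1) by blast
    have "\<Union>(insert (b \<union> b') (B - {b, b'}) \<union> C) = \<Union>(B \<union> C)" using b by blast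
    thus "\<Union>(insert (b \<union> b') (B - {b, b'}) \<union> C) = {1..n}" using R(2) by simp
    show "{} \<notin> insert (b \<union> b') (B - {b, b'}) \<union> C" using R(3) ne by blast
    fix x y i assume x: "x \<in> insert (b \<union> b') (B - {b, b'}) \<union> C" and y: "y \<in> insert (b \<union> b') (B - {b, b'}) \<union> C"
      and i: "i \<in> x" "i \<in> y"
    have nbC: "b \<notin> C" "b' \<notin> C" using R(1) b by blast+
    have nu: "z = b \<union> b' \<or> z \<in> B \<union> C \<and> z \<noteq> b \<and> z \<noteq> b'" if "z \<in> insert (b \<union> b') (B - {b, b'}) \<union> C" for z
      using that nbC by blast
    from nu[OF x] nu[OF y] show "x = y"
    proof (elim disjE conjE)
      assume "x = b \<union> b'" "y \<in> B \<union> C" "y \<noteq> b" "y \<noteq> b'"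
      thus "x = y" using u[of y i] i by blast
    next
      assume "y = b \<union> b'" "x \<in> B \<union> C" "x \<noteq> b" "x \<noteq> b'"
      thus "x = y" using u[of x i] i by blast
    next
      assume "x \<in> B \<union> C" "y \<in> B \<union> C"
      thus "x = y" using R(5) i by blast
    qed simp
  qed
qed

lemma row_split_cutI:
  assumes r: "row_split n B C" and b: "b \<in> B"
  shows "row_split n (B - {b}) (insert b C)"
proof -
  have "(B - {b}) \<union> insert b C = B \<union> C" "(B - {b}) \<inter> insert b C = {}" using b r by (auto simp: row_split_def)
  thus ?thesis using r by (simp add: row_split_def)
qed

lemma propagating_vector_diagonal:
  assumes r: "row_split n B C" and l: "1 \<le> l" and i: "i \<in> {1..l}"
  shows "int (propagating_vector l (joined (Id_on B) C C) i) = (\<Sum>y\<in>B. of_bool (tone_class l (card y) = i))"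
proof -
  have "{z \<in> Id_on B. tone_class l (card (fst z)) = i} = (\<lambda>y. (y, y)) ` {y \<in> B. tone_class l (card y) = i}" by fastforce
  moreover have "card ((\<lambda>y. (y, y)) ` X) = card X" for X :: "nat set set" by (rule card_image) (simp add: inj_on_def)
  ultimately have "propagating_vector l (joined (Id_on B) C C) i = card {y \<in> B. tone_class l (card y) = i}"
    using i by (simp only: propagating_vector_joined[OF joinable_Id[OF r] l] if_True)
  also have "int \<dots> = (\<Sum>y\<in>B. of_bool (tone_class l (card y) = i))"
  proof -
    have "{y \<in> B. tone_class l (card y) = i} = B \<inter> {y. tone_class l (card y) = i}" by blast
    thus ?thesis using row_splitD(7)[OF r] by simp
  qed
  finally show ?thesis .
qed

lemma propagating_vector_diagonal_sum:
  assumes r: "row_split n B C" and l: "1 \<le> l"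
  shows "(\<Sum>i=1..l. propagating_vector l (joined (Id_on B) C C) i) = card B"
proof -
  have "Id_on B = (\<lambda>y. (y, y)) ` B" by auto
  hence "card (Id_on B) = card B" by (simp add: card_image inj_on_def)
  thus ?thesis using weight_propagating_vector(2)[OF joinable_Id[OF r] l] by simp
qed

context
  fixes l n :: nat and m :: "nat \<Rightarrow> nat"
  assumes l: "1 \<le> l" and m: "m \<in> index_set l n"
begin

private abbreviation "TB \<equiv> through_blocks l m"
private abbreviation "CB \<equiv> cut_blocks l n (weight l m)"

private lemma r: "row_split n TB CB" by (rule blocks_row_split[OF l m])

private lemma pv_a: "i \<in> {1..l} \<Longrightarrow> int (m i) = (\<Sum>y\<in>TB. of_bool (tone_class l (card y) = i))"
proof -
  assume i: "i \<in> {1..l}"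
  have "propagating_vector l (a_diagram l n m) = m" using a_diagram_half[OF l m] by (simp add: half_diagrams_def)
  thus ?thesis using propagating_vector_diagonal[OF r l i] by (simp add: a_diagram_eq[OF l])
qed

text \<open>Joining two blocks replaces their two tone classes by the class of the sum, which is one
  step of the order.\<close>

private lemma merge_less:
  assumes b: "b \<in> TB" "b' \<in> TB" "b \<noteq> b'"
  shows "index_less l (propagating_vector l (joined (Id_on (insert (b \<union> b') (TB - {b, b'}))) CB CB)) m"
proof -
  let ?B' = "insert (b \<union> b') (TB - {b, b'})"
  let ?m' = "propagating_vector l (joined (Id_on ?B') CB CB)"
  note r' = row_split_mergeI[OF r b]
  have finB: "finite TB" by (rule row_splitD(7)[OF r])
  have fin: "finite b" "finite b'" using row_splitD(9)[OF r] b by blast+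
  have cu: "card (b \<union> b') = card b + card b'" by (rule card_Un_disjoint[OF fin r'(3)])
  have "int (?m' k) - int (m k) = merge_vec l (card b) (card b') k" if k: "k \<in> {1..l}" for k
  proof -
    let ?T = "\<lambda>y. of_bool (tone_class l (card y) = k) :: int"
    have "int (?m' k) = (\<Sum>y\<in>?B'. ?T y)" by (rule propagating_vector_diagonal[OF r'(1) l k])
    also have "\<dots> = ?T (b \<union> b') + (\<Sum>y\<in>TB - {b, b'}. ?T y)"
      by (rule sum.insert) (use finB r'(2) in auto)
    finally have 1: "int (?m' k) = ?T (b \<union> b') + (\<Sum>y\<in>TB - {b, b'}. ?T y)" .
    have "int (m k) = (\<Sum>y\<in>TB. ?T y)" by (rule pv_a[OF k])
    also have "\<dots> = ?T b + (\<Sum>y\<in>TB - {b}. ?T y)" by (rule sum.remove[OF finB b(1)])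
    also have "(\<Sum>y\<in>TB - {b}. ?T y) = ?T b' + (\<Sum>y\<in>TB - {b} - {b'}. ?T y)" by (rule sum.remove) (use finB b in auto)
    also have "TB - {b} - {b'} = TB - {b, b'}" by blast
    finally have "int (m k) = ?T b + (?T b' + (\<Sum>y\<in>TB - {b, b'}. ?T y))" .
    thus ?thesis using 1 by (simp add: merge_vec_def unit_vec_eq[OF l k] cu)
  qed
  hence "index_le l ?m' m"
    using card_through_block[OF b(1)] card_through_block[OF b(2)] by (intro index_le_step[of "card b" l "card b'"])
  moreover have "?m' \<noteq> m"
  proof
    assume e: "?m' = m"
    have "card ?B' = (\<Sum>i=1..l. m i)" using propagating_vector_diagonal_sum[OF r'(1) l] e by simp
    hence "card ?B' = card TB" by (simp add: card_through_blocks)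
    moreover have "card ?B' = Suc (card (TB - {b, b'}))" using finB r'(2) by (subst card_insert_disjoint) auto
    moreover have "card (TB - {b, b'}) = card TB - 2" using b finB by (subst card_Diff_subset) auto
    moreover have "card TB \<ge> 2" using card_mono[OF finB, of "{b, b'}"] b by simp
    ultimately show False by linarith
  qed
  ultimately show ?thesis by (simp add: index_less_def)
qed

private lemma cut_less:
  assumes b: "b \<in> TB" "card b = l"
  shows "index_less l (propagating_vector l (joined (Id_on (TB - {b})) (insert b CB) (insert b CB))) m"
proof -
  let ?m' = "propagating_vector l (joined (Id_on (TB - {b})) (insert b CB) (insert b CB))"
  note r' = row_split_cutI[OF r b(1)]
  have finB: "finite TB" by (rule row_splitD(7)[OF r])
  \<comment> \<open>Twice l has the same class as l, so the vector for i = j = l is minus the basis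
    vector of l: it removes a block of size l.\<close>
  have lt: "tone_class l (l + l) = tone_class l l" by (simp add: tone_class_def)
  have "int (?m' k) - int (m k) = merge_vec l l l k" if k: "k \<in> {1..l}" for k
  proof -
    let ?T = "\<lambda>y. of_bool (tone_class l (card y) = k) :: int"
    have 1: "int (?m' k) = (\<Sum>y\<in>TB - {b}. ?T y)" by (rule propagating_vector_diagonal[OF r' l k])
    have "int (m k) = (\<Sum>y\<in>TB. ?T y)" by (rule pv_a[OF k])
    also have "\<dots> = ?T b + (\<Sum>y\<in>TB - {b}. ?T y)" by (rule sum.remove[OF finB b(1)])
    finally show ?thesis using 1 b(2) by (simp add: merge_vec_def unit_vec_eq[OF l k] lt)
  qed
  hence "index_le l ?m' m" using l by (intro index_le_step[of l l l]) auto
  moreover have "?m' \<noteq> m"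
  proof
    assume e: "?m' = m"
    have "card (TB - {b}) = (\<Sum>i=1..l. m i)" using propagating_vector_diagonal_sum[OF r' l] e by simp
    hence "card (TB - {b}) = card TB" by (simp add: card_through_blocks)
    thus False using b(1) finB by (metis card_Diff1_less less_irrefl)
  qed
  ultimately show ?thesis by (simp add: index_less_def)
qed

lemma half_bottom:
  assumes q: "q \<in> half_diagrams l n m" and c: "compatible q f g" and b: "b \<in> TB \<union> CB"
  shows "unsplit b g"
proof -
  obtain P W where j: "snd ` P = TB" "q = joined P W CB" using half_diagramE[OF l m q] by metis
  show ?thesis
  proof (cases "b \<in> CB")
    case False
    then obtain x where "(x, b) \<in> P" using j(1) b by force
    thus ?thesis using c unsplit2_unsplit unfolding j(2) compatible_joined by blast
  qed (use c in \<open>simp add: j(2) compatible_joined\<close>)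
qed

text \<open>Multiplication on the left can only join bottom blocks: a bottom set compatible with the
  product is compatible with \<open>q\<close> for some middle set, and the cut blocks of
  \<open>q\<close> remain compatible on their own.\<close>

lemma comp_half_bottom:
  assumes p: "p \<in> tonal_diagrams l n" and q: "q \<in> half_diagrams l n m"
  shows "\<And>f g b. compatible (dcomp n p q) f g \<Longrightarrow> f \<subseteq> {1..n} \<Longrightarrow> g \<subseteq> {1..n} \<Longrightarrow> b \<in> TB \<union> CB \<Longrightarrow> unsplit b g"
    "\<And>u. u \<in> CB \<Longrightarrow> row_pair {} u \<in> dcomp n p q"
proof -
  have qt: "q \<in> diagrams n n" using q by (simp add: half_diagrams_def tonal_diagrams_def)
  note pd = tonal_diagramsD[OF p]
  show un: "unsplit b g" if c: "compatible (dcomp n p q) f g" "f \<subseteq> {1..n}" "g \<subseteq> {1..n}" "b \<in> TB \<union> CB" for f g b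
  proof -
    obtain h where "compatible q h g" using compatible_comp_iff[OF pd qt c(2,3)] c(1) by blast
    thus ?thesis using half_bottom[OF q] c(4) by blast
  qed
  show "row_pair {} u \<in> dcomp n p q" if u: "u \<in> CB" for u
  proof (rule part_if_minimal[OF diagram_comp_closed[OF pd qt]])
    have usub: "u \<subseteq> {1..n}" using row_splitD(4)[OF r] u by blast
    obtain P W where j: "joinable n P W CB" "q = joined P W CB" using half_diagramE[OF l m q] by metis
    have "row_pair {} u \<in> q" using joined_parts(3)[OF j(1)] u j(2) by blast
    hence "compatible q {} u" by (rule compatible_part[OF qt])
    thus "compatible (dcomp n p q) {} u"
      using compatible_comp_iff[OF pd qt, of "{}" u] usub by auto
    show "row_pair {} u \<noteq> {}" using row_splitD(3)[OF r, of u] u by simp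
    show "row_pair {} u \<subseteq> row_pair f g \<or> row_pair {} u \<inter> row_pair f g = {}"
      if "f \<subseteq> {1..n}" "g \<subseteq> {1..n}" "compatible (dcomp n p q) f g" for f g
      using un[OF that(3,1,2)] u by (simp add: unsplit_def)
  qed (use row_splitD(4)[OF r] u in auto)
qed

text \<open>
  If a diagram with the bottom row of \<open>a\<close> is not a half diagram, then it merges two of the
  through blocks or cuts one of size \<open>l\<close>, and so it factors through a smaller index.
\<close>

lemma half_or_descends:
  assumes q: "q \<in> tonal_diagrams l n"
    and un: "\<And>f g b. compatible q f g \<Longrightarrow> f \<subseteq> {1..n} \<Longrightarrow> g \<subseteq> {1..n} \<Longrightarrow> b \<in> TB \<union> CB \<Longrightarrow> unsplit b g"
    and C: "\<And>u. u \<in> CB \<Longrightarrow> row_pair {} u \<in> q"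
  shows "q \<in> half_diagrams l n m \<or> (\<exists>d k. d \<in> tonal_diagrams l n \<and> index_less l (propagating_vector l d) m
     \<and> dcomp n q d = q)"
proof -
  note R = row_splitD[OF r]
  have qd: "q \<in> diagrams n n" by (rule tonal_diagramsD[OF q])
  obtain P W W' where j: "joinable n P W W'" "q = joined P W W'" using diagram_eq_joined[OF qd] by blast
  note Y = row_splitD[OF joinableD(2)[OF j(1)]]
  have Cz: "card u mod l = 0" if "u \<in> CB" for u using card_cut_block[OF that] by simp
  have un': "b \<subseteq> g \<or> b \<inter> g = {}" if "compatible q f g" "f \<subseteq> {1..n}" "g \<subseteq> {1..n}" "b \<in> TB \<union> CB" for f g b
    using un[OF that] by (simp add: unsplit_def)
  \<comment> \<open>The first alternative says that b and b' always have the same colour, so that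
    they lie in one part; the last one collects the negations of the first two.\<close>
  consider (merge) b b' where "b \<in> TB" "b' \<in> TB" "b \<noteq> b'"
        "\<And>f g. compatible q f g \<Longrightarrow> f \<subseteq> {1..n} \<Longrightarrow> g \<subseteq> {1..n} \<Longrightarrow> unsplit (b \<union> b') g"
    | (cut) b where "b \<in> TB" "row_pair {} b \<in> q"
    | (half) "\<And>b b'. b \<in> TB \<Longrightarrow> b' \<in> TB \<Longrightarrow> b \<noteq> b' \<Longrightarrow> \<exists>f g. compatible q f g \<and> f \<subseteq> {1..n} \<and> g \<subseteq> {1..n} \<and> \<not> unsplit (b \<union> b') g"
        "\<And>b. b \<in> TB \<Longrightarrow> row_pair {} b \<notin> q"
    by metis
  thus ?thesis
  proof cases
    case merge
    let ?B' = "insert (b \<union> b') (TB - {b, b'})"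
    note r' = row_split_mergeI(1)[OF r merge(1-3)]
    have "joined (Id_on ?B') CB CB \<in> tonal_diagrams l n" by (rule diagonal_tonal[OF l m r' Cz])
    moreover have "dcomp n q (joined (Id_on ?B') CB CB) = q"
    proof (rule diagonal_absorb(1)[OF qd r' _ C])
      fix f g x assume "compatible q f g" "f \<subseteq> {1..n}" "g \<subseteq> {1..n}" "x \<in> ?B'"
      thus "x \<subseteq> g \<or> x \<inter> g = {}" using un'[of f g x] merge(4)[of f g, unfolded unsplit_def] by blast
    qed
    ultimately show ?thesis using merge_less[OF merge(1-3)] by blast
  next
    case cut
    \<comment> \<open>Tonality makes the size of a part in the bottom row alone divisible by l;
      among the through blocks this leaves size l.\<close>
    have "card b mod l = 0"
      using q joined_parts(3)[OF j(1), of b] cut(2) unfolding j(2) joined_tonal_iff[OF j(1)] by blast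
    hence cb: "card b = l" using card_through_block[OF cut(1)] mod_class_unique[of "card b" l l] l by auto
    note r' = row_split_cutI[OF r cut(1)]
    have "joined (Id_on (TB - {b})) (insert b CB) (insert b CB) \<in> tonal_diagrams l n"
      by (rule diagonal_tonal[OF l m r']) (use Cz cb in auto)
    moreover have "dcomp n q (joined (Id_on (TB - {b})) (insert b CB) (insert b CB)) = q"
      by (rule diagonal_absorb(1)[OF qd r']) (use un' C cut in blast)+
    ultimately show ?thesis using cut_less[OF cut(1) cb] by blast
  next
    case half
    have CW: "CB \<subseteq> W'" using C joined_parts(3)[OF j(1)] j(2) by blast
    have sub: "y \<in> TB \<union> CB" if y: "y \<in> snd ` P \<union> W'" for y
    proof -
      obtain i where i: "i \<in> y" using Y(3)[OF y] by blast
      hence "i \<in> {1..n}" using Y(4)[OF y] by blast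
      from R(6)[OF this] obtain b where b: "b \<in> TB \<union> CB" "i \<in> b" by blast
      obtain x where x: "row_pair x y \<in> q"
      proof (cases "y \<in> W'")
        case True thus ?thesis using joined_parts(3)[OF j(1)] j(2) that by blast
      next
        case False
        then obtain x where "(x, y) \<in> P" using y by force
        thus ?thesis using joined_parts(1)[OF j(1), of x y] j(2) that by blast
      qed
      have xy: "x \<subseteq> {1..n}" "y \<subseteq> {1..n}"
      proof -
        have "row_pair x y \<subseteq> row_pair {1..n} {1..n}" using diagramsD(4)[OF qd x] by (simp add: row_pair_def)
        thus "x \<subseteq> {1..n}" "y \<subseteq> {1..n}" by simp_all
      qed
      have cy: "compatible q x y" by (rule compatible_part[OF qd x])
      have by': "z \<subseteq> y" if "z \<in> TB \<union> CB" "k \<in> z" "k \<in> y" for z k using un'[OF cy xy that(1)] that by blast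
      have Cy: "z = y" if "z \<in> CB" "k \<in> z" "k \<in> y" for z k using Y(5)[of z y k] that CW y by blast
      show ?thesis
      proof (cases "b \<in> CB")
        case True thus ?thesis using Cy b i by blast
      next
        case False
        hence bB: "b \<in> TB" using b by blast
        \<comment> \<open>A second through block inside the same part could not be separated from b
          by any compatible set.\<close>
        have "y = b"
        proof (rule ccontr)
          assume "y \<noteq> b"
          then obtain k where k: "k \<in> y" "k \<notin> b" using by'[OF b(1,2) i] by blast
          hence "k \<in> {1..n}" using xy by blast
          from R(6)[OF this] obtain b' where b': "b' \<in> TB \<union> CB" "k \<in> b'" by blast
          have "b' \<notin> CB"
          proof
            assume "b' \<in> CB"
            hence "b' = y" using Cy b' k by blast
            hence "b' = b" using R(5)[OF b'(1) b(1), of i] i b by blast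
            thus False using b' k by blast
          qed
          hence b'B: "b' \<in> TB" using b' by blast
          have bb: "b \<union> b' \<subseteq> y" "b \<noteq> b'" using by'[OF b(1,2) i] by'[OF b' k(1)] b' k by blast+
          obtain f g where fg: "compatible q f g" "\<not> unsplit (b \<union> b') g" using half(1)[OF bB b'B bb(2)] by blast
          have "row_pair x y \<subseteq> row_pair f g \<or> row_pair x y \<inter> row_pair f g = {}"
            using fg(1) x unfolding compatible_def by blast
          hence "y \<subseteq> g \<or> y \<inter> g = {}" by auto
          thus False using bb(1) fg(2) unfolding unsplit_def by blast
        qed
        thus ?thesis using bB by blast
      qed
    qed
    have "W' \<inter> TB = {}" using half(2) joined_parts(3)[OF j(1)] j(2) by blast
    hence W'C: "W' = CB" using sub CW by blast
    have "snd ` P = TB"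
    proof
      show "snd ` P \<subseteq> TB" using sub Y(1) W'C by blast
      show "TB \<subseteq> snd ` P"
      proof
        fix b assume b: "b \<in> TB"
        then obtain i where i: "i \<in> b" using R(3)[of b] by blast
        hence "i \<in> {1..n}" using R(4)[of b] b by blast
        from Y(6)[OF this] obtain y where y: "y \<in> snd ` P \<union> W'" "i \<in> y" by blast
        have "y = b" using R(5)[OF sub[OF y(1)], of b i] b y(2) i by blast
        thus "b \<in> snd ` P" using y(1) b R(1) W'C by blast
      qed
    qed
    hence "q \<in> half_diagrams l n m" unfolding half_diagrams_iff[OF l m] using q j W'C by blast
    thus ?thesis by blast
  qed
qed

end

section \<open>The layer of a single index: left ideal, right action of the symmetric groups,
  standard modules\<close>

section \<open>The quotient algebra and its left ideal\<close>

locale tonal_layer =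
  fixes \<delta> :: complex and l n :: nat and m :: "nat \<Rightarrow> nat"
  assumes l: "1 \<le> l" and delta: "\<delta> \<noteq> 0" and m: "m \<in> index_set l n"
begin

abbreviation "R \<equiv> tonal_algebra \<delta> l n"
abbreviation "D \<equiv> tonal_diagrams l n"
abbreviation "H \<equiv> half_diagrams l n m"
abbreviation "I \<equiv> lower_ideal \<delta> l n m"
abbreviation "B \<equiv> through_blocks l m"
abbreviation "C \<equiv> cut_blocks l n (weight l m)"
abbreviation "cp \<equiv> dcomp n"
abbreviation "cl \<equiv> loops n"
abbreviation "bv \<equiv> basis_vector"
abbreviation R_times (infixl "\<star>" 70) where "f \<star> g \<equiv> f \<otimes>\<^bsub>R\<^esub> g"
abbreviation "a \<equiv> a_diagram l n m"
abbreviation "cls \<equiv> quotient_class \<delta> l n m"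
abbreviation "HF \<equiv> {f :: diagram \<Rightarrow> complex. \<forall>p. p \<notin> H \<longrightarrow> f p = 0}"

sublocale R: ring R by (rule tonal_algebra_ring)

lemma R_iff: "f \<in> carrier R \<longleftrightarrow> (\<forall>p. p \<notin> D \<longrightarrow> f p = 0)"
  by (simp add: tonal_algebra_simps)

lemma R_add: "f \<oplus>\<^bsub>R\<^esub> g = (\<lambda>q. f q + g q)" and R_zero: "\<zero>\<^bsub>R\<^esub> = (\<lambda>q. 0)"
  by (simp_all add: tonal_algebra_simps)

lemma R_mult: "(f \<star> g) q = (\<Sum>p\<in>D. \<Sum>p'\<in>D. f p * g p' * \<delta> ^ cl p p' * of_bool (cp p p' = q))"
  by (simp add: tonal_algebra_simps)

lemma R_uminus: "f \<in> carrier R \<Longrightarrow> \<ominus>\<^bsub>R\<^esub> f = (\<lambda>q. - f q)"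
  by (rule R.minus_equality) (auto simp: tonal_algebra_simps)

lemma R_minus: "f \<in> carrier R \<Longrightarrow> g \<in> carrier R \<Longrightarrow> f \<ominus>\<^bsub>R\<^esub> g = (\<lambda>q. f q - g q)"
  by (simp add: a_minus_def R_uminus R_add)

lemma R_scale: "f \<in> carrier R \<Longrightarrow> (\<lambda>q. c * f q) \<in> carrier R"
  by (simp add: R_iff)

lemma R_mult_scale:
  "(\<lambda>p. c * f p) \<star> g = (\<lambda>q. c * (f \<star> g) q)" "f \<star> (\<lambda>p. c * g p) = (\<lambda>q. c * (f \<star> g) q)"
  by (simp_all add: R_mult fun_eq_iff sum_distrib_left mult_ac)

lemma R_mult_sum:
  "f \<star> (\<lambda>p. \<Sum>i\<in>A. g i p) = (\<lambda>q. \<Sum>i\<in>A. (f \<star> g i) q)"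
  "(\<lambda>p. \<Sum>i\<in>A. g i p) \<star> f = (\<lambda>q. \<Sum>i\<in>A. (g i \<star> f) q)"
proof -
  have sw: "(\<Sum>p\<in>D. \<Sum>p'\<in>D. \<Sum>i\<in>A. F p p' i) = (\<Sum>i\<in>A. \<Sum>p\<in>D. \<Sum>p'\<in>D. F p p' i)" for F :: "_ \<Rightarrow> _ \<Rightarrow> _ \<Rightarrow> complex"
  proof -
    have "(\<Sum>p\<in>D. \<Sum>p'\<in>D. \<Sum>i\<in>A. F p p' i) = (\<Sum>p\<in>D. \<Sum>i\<in>A. \<Sum>p'\<in>D. F p p' i)" by (intro sum.cong refl sum.swap)
    also have "\<dots> = (\<Sum>i\<in>A. \<Sum>p\<in>D. \<Sum>p'\<in>D. F p p' i)" by (rule sum.swap)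
    finally show ?thesis .
  qed
  show "f \<star> (\<lambda>p. \<Sum>i\<in>A. g i p) = (\<lambda>q. \<Sum>i\<in>A. (f \<star> g i) q)"
    "(\<lambda>p. \<Sum>i\<in>A. g i p) \<star> f = (\<lambda>q. \<Sum>i\<in>A. (g i \<star> f) q)"
    unfolding R_mult fun_eq_iff sum_distrib_left sum_distrib_right sw by simp_all
qed

lemma bv_closed: "p \<in> D \<Longrightarrow> bv p \<in> carrier R"
  by (auto simp: R_iff basis_vector_def)

lemma bv_mult: "p \<in> D \<Longrightarrow> p' \<in> D \<Longrightarrow> bv p \<star> bv p' = (\<lambda>q. \<delta> ^ cl p p' * bv (cp p p') q)"
  by (rule mult_basis_vector)

lemma half_tonal: "p \<in> H \<Longrightarrow> p \<in> D"
  by (simp add: half_diagrams_def)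

lemma finite_half: "finite H"
  by (rule finite_subset[OF _ finite_tonal_diagrams[of l n]]) (auto simp: half_tonal)

lemma HF_closed: "f \<in> HF \<Longrightarrow> f \<in> carrier R"
  using half_tonal by (auto simp: R_iff)

lemma a_closed: "a \<in> H" "a \<in> D"
  using a_diagram_half[OF l m] half_tonal by blast+

lemma lower_ideal: "ideal I R"
  and lower_ideal_generator: "m' \<in> index_set l n \<Longrightarrow> index_less l m' m \<Longrightarrow> bv (a_diagram l n m') \<in> I"
proof -
  let ?S = "{bv (a_diagram l n m') | m'. m' \<in> index_set l n \<and> index_less l m' m}"
  have "a_diagram l n m' \<in> D" if "m' \<in> index_set l n" for m'
    using a_diagram_half[OF l that] by (simp add: half_diagrams_def)
  hence S: "?S \<subseteq> carrier R" using bv_closed by blast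
  show "ideal I R" unfolding lower_ideal_def by (rule R.genideal_ideal[OF S])
  show "bv (a_diagram l n m') \<in> I" if "m' \<in> index_set l n" "index_less l m' m"
    using R.genideal_self[OF S] that unfolding lower_ideal_def by blast
qed

lemma I_add: "f \<in> I \<Longrightarrow> g \<in> I \<Longrightarrow> (\<lambda>q. f q + g q) \<in> I"
  and I_zero: "(\<lambda>q. 0) \<in> I"
  and I_closed: "f \<in> I \<Longrightarrow> f \<in> carrier R"
  and I_left: "f \<in> I \<Longrightarrow> g \<in> carrier R \<Longrightarrow> g \<star> f \<in> I"
  and I_right: "f \<in> I \<Longrightarrow> g \<in> carrier R \<Longrightarrow> f \<star> g \<in> I"
proof -
  interpret I: ideal I R by (rule lower_ideal)
  show "f \<in> I \<Longrightarrow> g \<in> I \<Longrightarrow> (\<lambda>q. f q + g q) \<in> I" using I.a_closed[of f g] by (simp add: R_add)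
  show "(\<lambda>q. 0) \<in> I" using additive_subgroup.zero_closed[OF I.additive_subgroup_axioms] by (simp add: R_zero)
  show "f \<in> I \<Longrightarrow> f \<in> carrier R" by (rule I.Icarr)
  show "f \<in> I \<Longrightarrow> g \<in> carrier R \<Longrightarrow> g \<star> f \<in> I" by (rule I.I_l_closed)
  show "f \<in> I \<Longrightarrow> g \<in> carrier R \<Longrightarrow> f \<star> g \<in> I" by (rule I.I_r_closed)
qed

lemma I_scale: "f \<in> I \<Longrightarrow> (\<lambda>q. c * f q) \<in> I"
  using I_left[OF _ R_scale[OF R.one_closed, of c], of f] I_closed[of f] by (simp add: R_mult_scale)

lemma I_sum: "(\<And>i. i \<in> A \<Longrightarrow> h i \<in> I) \<Longrightarrow> (\<lambda>q. \<Sum>i\<in>A. h i q) \<in> I"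
proof (induction A rule: infinite_finite_induct)
  case (insert x A)
  thus ?case using I_add[of "h x" "\<lambda>q. \<Sum>i\<in>A. h i q"] by simp
qed (simp_all add: I_zero)

text \<open>Invertibility of \<delta> enters here: a product of basis vectors carries a power of
  \<delta> for its loops, which is divided out to leave the diagram itself.\<close>

lemma I_unscale: "(\<lambda>q. \<delta> ^ k * f q) \<in> I \<Longrightarrow> f \<in> I"
  using I_scale[of "\<lambda>q. \<delta> ^ k * f q" "inverse (\<delta> ^ k)"] delta by (simp add: mult.assoc[symmetric])

text \<open>The factorisation of \<open>d\<close> starts with a half diagram \<open>p\<close> of its
  own index, and \<open>p\<close> absorbs the generator \<open>a\<close> of that index up to a power
  of \<delta>.\<close>

lemma lower_diagram_in_I:
  assumes d: "d \<in> D" and le: "index_less l (propagating_vector l d) m"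
  shows "bv d \<in> I"
proof -
  let ?m = "propagating_vector l d"
  note i = tonal_factor(1)[OF l d]
  obtain p q where pq: "p \<in> half_diagrams l n ?m" "q \<in> D" "cp p q = d" using tonal_factor(2)[OF l d] by blast
  have p: "p \<in> D" using pq(1) by (simp add: half_diagrams_def)
  have a': "a_diagram l n ?m \<in> D" using a_diagram_half[OF l i] by (simp add: half_diagrams_def)
  have "bv p \<star> bv (a_diagram l n ?m) \<in> I"
    by (rule I_left[OF lower_ideal_generator[OF i le] bv_closed[OF p]])
  hence "bv p \<in> I" unfolding bv_mult[OF p a'] half_absorb(1)[OF l i pq(1)] by (rule I_unscale)
  from I_right[OF this bv_closed[OF pq(2)]] show ?thesis unfolding bv_mult[OF p pq(2)] pq(3) by (rule I_unscale)
qed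

text \<open>A product that has left the half diagrams absorbs a diagram of smaller index on the
  right, and that diagram lies in the ideal already.\<close>

lemma comp_half:
  assumes p: "p \<in> D" and q: "q \<in> H" and n: "cp p q \<notin> H"
  shows "bv (cp p q) \<in> I"
proof -
  have d: "cp p q \<in> D" by (rule diagram_comp_tonal[OF p half_tonal[OF q]])
  obtain d' where d': "d' \<in> D" "index_less l (propagating_vector l d') m" "cp (cp p q) d' = cp p q"
    using half_or_descends[OF l m d] comp_half_bottom[OF l m p q] n by metis
  from I_left[OF lower_diagram_in_I[OF d'(1,2)] bv_closed[OF d]]
  show ?thesis unfolding bv_mult[OF d d'(1)] d'(3) by (rule I_unscale)
qed

text \<open>The diagrams with fewer propagating parts than \<open>a\<close> span an ideal containing \<open>I\<close>.\<close>

lemma I_vanishes_on_half: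
  assumes f: "f \<in> I" and q: "q \<in> H" shows "f q = 0"
proof -
  define J where "J = {f \<in> carrier R. \<forall>p. f p \<noteq> 0 \<longrightarrow> card (prop_pairs p) < (\<Sum>i=1..l. m i)}"
  have "ideal J R"
  proof (rule idealI[OF tonal_algebra_ring])
    show "subgroup J (add_monoid R)"
    proof (rule R.add.subgroupI)
      show "J \<subseteq> carrier R" by (auto simp: J_def)
      show "J \<noteq> {}" by (auto simp: J_def R_iff intro: exI[of _ "\<lambda>q. 0"])
      show "\<ominus>\<^bsub>R\<^esub> f \<in> J" if "f \<in> J" for f
        using that R_uminus[of f] R_scale[of f "-1"] by (simp add: J_def)
      show "f \<oplus>\<^bsub>R\<^esub> g \<in> J" if fg: "f \<in> J" "g \<in> J" for f g
      proof -
        have "f \<oplus>\<^bsub>R\<^esub> g \<in> carrier R" using fg by (simp add: J_def)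
        moreover have "card (prop_pairs p) < (\<Sum>i=1..l. m i)" if "f p + g p \<noteq> 0" for p
        proof -
          from that have "f p \<noteq> 0 \<or> g p \<noteq> 0" by auto
          thus ?thesis using fg by (auto simp: J_def)
        qed
        ultimately show ?thesis by (simp add: J_def R_add)
      qed
    qed
    have bound: "\<exists>p\<in>D. \<exists>p'\<in>D. f p \<noteq> 0 \<and> g p' \<noteq> 0 \<and> cp p p' = q" if "(f \<star> g) q \<noteq> 0" for f g q
    proof (rule ccontr)
      assume *: "\<not> ?thesis"
      have "(f \<star> g) q = 0" unfolding R_mult by (intro sum.neutral ballI) (use * in auto)
      thus False using that by contradiction
    qed
    show "g \<star> f \<in> J" "f \<star> g \<in> J" if f: "f \<in> J" and g: "g \<in> carrier R" for f g
    proof -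
      have fc: "f \<in> carrier R" using f by (simp add: J_def)
      have "card (prop_pairs q) < (\<Sum>i=1..l. m i)" if nz: "(g \<star> f) q \<noteq> 0" for q
      proof -
        obtain p p' where p: "p \<in> D" "p' \<in> D" "f p' \<noteq> 0" "cp p p' = q" using bound[OF nz] by blast
        have "card (prop_pairs q) \<le> card (prop_pairs p')"
          using card_prop_pairs_comp[OF p(1,2)[THEN tonal_diagramsD]] p(4) by simp
        also have "\<dots> < (\<Sum>i=1..l. m i)" using f p(3) by (simp add: J_def)
        finally show ?thesis .
      qed
      thus "g \<star> f \<in> J" using fc g by (simp add: J_def)
      have "card (prop_pairs q) < (\<Sum>i=1..l. m i)" if nz: "(f \<star> g) q \<noteq> 0" for q
      proof -
        obtain p p' where p: "p \<in> D" "p' \<in> D" "f p \<noteq> 0" "cp p p' = q" using bound[OF nz] by blast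
        have "card (prop_pairs q) \<le> card (prop_pairs p)"
          using card_prop_pairs_comp'[OF p(1,2)[THEN tonal_diagramsD]] p(4) by simp
        also have "\<dots> < (\<Sum>i=1..l. m i)" using f p(3) by (simp add: J_def)
        finally show ?thesis .
      qed
      thus "f \<star> g \<in> J" using fc g by (simp add: J_def)
    qed
  qed
  moreover have "bv (a_diagram l n m') \<in> J" if m': "m' \<in> index_set l n" "index_less l m' m" for m'
  proof -
    note h = a_diagram_half[OF l m'(1)]
    have "card (prop_pairs (a_diagram l n m')) < (\<Sum>i=1..l. m i)"
      using card_prop_pairs_half[OF l m'(1) h] index_less_sum[OF l m'(2) m m'(1)] by simp
    thus ?thesis using bv_closed[of "a_diagram l n m'"] h by (simp add: J_def half_diagrams_def basis_vector_def)
  qed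
  ultimately have "I \<subseteq> J" unfolding lower_ideal_def by (intro R.genideal_minimal) blast+
  hence "f \<in> J" using f by blast
  thus ?thesis using card_prop_pairs_half[OF l m q] by (auto simp: J_def)
qed

lemma a_diff_in_I_iff: "f \<in> carrier R \<Longrightarrow> g \<in> carrier R \<Longrightarrow> cls f = cls g \<longleftrightarrow> (\<lambda>q. f q - g q) \<in> I"
  using R.quotient_eq_iff_same_a_r_cos[OF lower_ideal, of f g] R_minus[of f g] by simp

text \<open>Elements of \<open>I\<close> vanish on half diagrams, so half diagrams stay independent
  modulo \<open>I\<close>. This makes the definite description in \<open>half_coeffs\<close>
  meaningful.\<close>

lemma cls_inj: "f \<in> HF \<Longrightarrow> g \<in> HF \<Longrightarrow> cls f = cls g \<longleftrightarrow> f = g"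
proof
  assume f: "f \<in> HF" "g \<in> HF" "cls f = cls g"
  hence "(\<lambda>q. f q - g q) \<in> I" using a_diff_in_I_iff[OF HF_closed HF_closed] by blast
  hence "f q - g q = 0" if "q \<in> H" for q using I_vanishes_on_half that by blast
  thus "f = g" using f(1,2) by (intro ext) (metis (mono_tags, lifting) eq_iff_diff_eq_0 mem_Collect_eq)
qed simp

lemma half_coeffs_cls: "f \<in> HF \<Longrightarrow> half_coeffs \<delta> l n m (cls f) = f"
  unfolding half_coeffs_def by (rule the_equality) (use cls_inj in auto)

text \<open>For a product with a function supported on half diagrams this is the normal form modulo
  \<open>I\<close>, since the discarded terms lie in \<open>I\<close>.\<close>

definition half_part :: "(diagram \<Rightarrow> complex) \<Rightarrow> diagram \<Rightarrow> complex" where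
  "half_part f = (\<lambda>q. if q \<in> H then f q else 0)"

lemma half_part_HF: "half_part f \<in> HF"
  by (simp add: half_part_def)

lemma half_part_mult:
  assumes g: "g \<in> carrier R" and f: "f \<in> HF"
  shows "(\<lambda>q. (g \<star> f) q - half_part (g \<star> f) q) \<in> I"
proof -
  let ?t = "\<lambda>p p'. (\<lambda>q. g p * f p' * \<delta> ^ cl p p' * (if cp p p' \<in> H then 0 else bv (cp p p') q))"
  have "(\<lambda>q. \<Sum>p\<in>D. \<Sum>p'\<in>D. ?t p p' q) \<in> I"
  proof (rule I_sum, rule I_sum)
    fix p p' assume p: "p \<in> D" "p' \<in> D"
    show "?t p p' \<in> I"
    proof (cases "p' \<in> H \<and> cp p p' \<notin> H")
      case True thus ?thesis using I_scale[OF comp_half[of p p']] p(1) by simp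
    next
      case False thus ?thesis using f I_zero by auto
    qed
  qed
  moreover have "(\<Sum>p\<in>D. \<Sum>p'\<in>D. ?t p p' q) = (g \<star> f) q - half_part (g \<star> f) q" for q
  proof (cases "q \<in> H")
    case True
    hence "(\<Sum>p\<in>D. \<Sum>p'\<in>D. ?t p p' q) = 0" by (intro sum.neutral ballI) (auto simp: basis_vector_def)
    thus ?thesis using True by (simp add: half_part_def)
  next
    case False
    have "(\<Sum>p\<in>D. \<Sum>p'\<in>D. ?t p p' q) = (g \<star> f) q"
      unfolding R_mult by (intro sum.cong refl) (use False in \<open>auto simp: basis_vector_def\<close>)
    thus ?thesis using False by (simp add: half_part_def)
  qed
  ultimately show ?thesis by simp
qed

lemma cls_half_part: "g \<in> carrier R \<Longrightarrow> f \<in> HF \<Longrightarrow> cls (g \<star> f) = cls (half_part (g \<star> f))"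
  using half_part_mult[of g f] a_diff_in_I_iff[OF R.m_closed HF_closed[OF half_part_HF]] HF_closed[of f] by blast

text \<open>Truncating an inner product changes it by an element of the ideal, and the ideal
  vanishes on half diagrams. This gives associativity of the truncated action.\<close>

lemma half_part_mult_eq:
  assumes g: "g \<in> carrier R" and f: "f \<in> HF" and h: "h \<in> carrier R"
  shows "q \<in> H \<Longrightarrow> (h \<star> half_part (g \<star> f)) q = (h \<star> (g \<star> f)) q"
    "q \<in> H \<Longrightarrow> (half_part (g \<star> f) \<star> h) q = ((g \<star> f) \<star> h) q"
proof -
  let ?d = "\<lambda>q. (g \<star> f) q - half_part (g \<star> f) q"
  note c = HF_closed[OF half_part_HF, of "g \<star> f"]
  have d: "?d \<in> I" by (rule half_part_mult[OF g f])
  have dc: "?d \<in> carrier R" by (rule I_closed[OF d])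
  have e: "g \<star> f = half_part (g \<star> f) \<oplus>\<^bsub>R\<^esub> ?d" by (simp add: R_add)
  have "h \<star> (g \<star> f) = h \<star> half_part (g \<star> f) \<oplus>\<^bsub>R\<^esub> h \<star> ?d"
    by (subst e) (rule R.r_distr[OF c dc h])
  thus "q \<in> H \<Longrightarrow> (h \<star> half_part (g \<star> f)) q = (h \<star> (g \<star> f)) q"
    using I_vanishes_on_half[OF I_left[OF d h]] by (simp add: R_add)
  have "(g \<star> f) \<star> h = half_part (g \<star> f) \<star> h \<oplus>\<^bsub>R\<^esub> ?d \<star> h"
    by (subst e) (rule R.l_distr[OF c dc h])
  thus "q \<in> H \<Longrightarrow> (half_part (g \<star> f) \<star> h) q = ((g \<star> f) \<star> h) q"
    using I_vanishes_on_half[OF I_right[OF d h]] by (simp add: R_add)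
qed

lemma HF_mult_bv:
  assumes f: "f \<in> HF" and x: "x \<in> D"
  shows "(f \<star> bv x) q = (\<Sum>p\<in>H. f p * \<delta> ^ cl p x * of_bool (cp p x = q))"
proof -
  have "(f \<star> bv x) q = (\<Sum>p\<in>D. \<Sum>p'\<in>D. of_bool (p' = x) * (f p * \<delta> ^ cl p p' * of_bool (cp p p' = q)))"
    unfolding R_mult by (simp add: basis_vector_def mult_ac)
  also have "\<dots> = (\<Sum>p\<in>D. f p * \<delta> ^ cl p x * of_bool (cp p x = q))"
    using x by (intro sum.cong refl, subst sum_mult_of_bool(2)) (simp_all add: finite_tonal_diagrams)
  also have "\<dots> = (\<Sum>p\<in>H. f p * \<delta> ^ cl p x * of_bool (cp p x = q))"
    by (rule sum.mono_neutral_right[OF finite_tonal_diagrams]) (use f half_tonal in auto)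
  finally show ?thesis .
qed

lemma HF_mult_a: "f \<in> HF \<Longrightarrow> f \<star> bv a = (\<lambda>q. \<delta> ^ card C * f q)"
proof
  fix q assume f: "f \<in> HF"
  have "(f \<star> bv a) q = (\<Sum>p\<in>H. \<delta> ^ card C * f p * of_bool (q = p))"
    unfolding HF_mult_bv[OF f a_closed(2)] by (intro sum.cong refl) (auto simp: half_absorb[OF l m])
  also have "\<dots> = \<delta> ^ card C * f q" using f by (subst sum_mult_of_bool(1)) (auto simp: finite_half)
  finally show "(f \<star> bv a) q = \<delta> ^ card C * f q" .
qed

abbreviation "M \<equiv> left_ideal_module \<delta> l n m"

lemma Q_mult: "f \<in> carrier R \<Longrightarrow> g \<in> carrier R \<Longrightarrow> cls f \<otimes>\<^bsub>quotient_algebra \<delta> l n m\<^esub> cls g = cls (f \<star> g)"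
  unfolding quotient_algebra_def FactRing_def using ideal.rcoset_mult_add[OF lower_ideal, of f g] by simp

lemma left_ideal_carrier: "carrier M = cls ` HF"
proof -
  have Q: "carrier (quotient_algebra \<delta> l n m) = cls ` carrier R"
    unfolding quotient_algebra_def FactRing_def A_RCOSETS_def' by auto
  have M: "carrier M = (\<lambda>g. cls (g \<star> bv a)) ` carrier R"
    using Q_mult[OF _ bv_closed[OF a_closed(2)]] unfolding left_ideal_module_def Let_def Q by auto
  have bvH: "bv a \<in> HF" using a_closed(1) by (auto simp: basis_vector_def)
  show ?thesis
  proof
    show "carrier M \<subseteq> cls ` HF" unfolding M using cls_half_part[OF _ bvH] half_part_HF by blast
    show "cls ` HF \<subseteq> carrier M"
    proof
      fix X assume "X \<in> cls ` HF"
      then obtain f where f: "f \<in> HF" "X = cls f" by blast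
      \<comment> \<open>Right multiplication by \<open>a\<close> is the scalar \<delta> to the power
        \<open>card C\<close> on functions supported on half diagrams, so dividing by it gives a
        preimage.\<close>
      let ?g = "\<lambda>q. inverse (\<delta> ^ card C) * f q"
      have "?g \<star> bv a = f" unfolding R_mult_scale HF_mult_a[OF f(1)] using delta by (simp add: mult.assoc[symmetric])
      moreover have "?g \<in> carrier R" by (rule R_scale[OF HF_closed[OF f(1)]])
      ultimately show "X \<in> carrier M" unfolding M f(2) by (metis imageI)
    qed
  qed
qed

lemma left_ideal_simps:
  assumes f: "f \<in> HF"
  shows "g \<in> HF \<Longrightarrow> cls f \<oplus>\<^bsub>M\<^esub> cls g = cls (\<lambda>q. f q + g q)"
    "g \<in> carrier R \<Longrightarrow> g \<odot>\<^bsub>M\<^esub> cls f = cls (half_part (g \<star> f))"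
proof -
  interpret I: abelian_subgroup I R by (rule abelian_subgroupI3[OF ideal.axioms(1)[OF lower_ideal] R.abelian_group_axioms])
  show "g \<in> HF \<Longrightarrow> cls f \<oplus>\<^bsub>M\<^esub> cls g = cls (\<lambda>q. f q + g q)"
    using I.a_rcos_sum[OF HF_closed[OF f] HF_closed[of g]]
    by (simp add: left_ideal_module_def Let_def quotient_algebra_def FactRing_def R_add)
  show "g \<in> carrier R \<Longrightarrow> g \<odot>\<^bsub>M\<^esub> cls f = cls (half_part (g \<star> f))"
    using Q_mult[OF _ HF_closed[OF f], of g] cls_half_part[OF _ f, of g] by (simp add: left_ideal_module_def Let_def)
qed

end

section \<open>The right action of the symmetric groups on half diagrams\<close>

lemma snd_relcomp: "snd ` P = fst ` Q \<Longrightarrow> snd ` (P O Q) = snd ` Q"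
proof (intro equalityI subsetI)
  fix z assume m: "snd ` P = fst ` Q" and "z \<in> snd ` Q"
  then obtain y where y: "(y, z) \<in> Q" by force
  hence "y \<in> snd ` P" using m by force
  then obtain x where "(x, y) \<in> P" by force
  thus "z \<in> snd ` (P O Q)" using y by force
qed force

text \<open>Each pair runs from block \<sigma>(j) to block j, so that relational composition with it
  on the right is the renaming done by \<open>permute_blocks\<close>.\<close>

definition block_perm :: "nat \<Rightarrow> (nat \<Rightarrow> nat) \<Rightarrow> (nat \<Rightarrow> nat \<Rightarrow> nat) \<Rightarrow> (nat set \<times> nat set) set" where
  "block_perm l m \<sigma> = {(blk l m i (\<sigma> i j), blk l m i j) | i j. i \<in> {1..l} \<and> j \<in> {1..m i}}"

context tonal_layer begin

abbreviation "G \<equiv> multi_sym_group l m"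
abbreviation "pm \<equiv> permute_blocks l m"
abbreviation "gi \<sigma> \<equiv> inv\<^bsub>G\<^esub> \<sigma>"
text \<open>Realises \<sigma> as a diagram. The right action then is right multiplication up to a
  power of \<delta>, and commutes with left multiplication by associativity.\<close>

abbreviation "\<rho> \<sigma> \<equiv> joined (block_perm l m \<sigma>) C C"

sublocale G: group G by (rule multi_sym_group_group)

lemma G_in: "\<sigma> \<in> carrier G \<Longrightarrow> i \<in> {1..l} \<Longrightarrow> j \<in> {1..m i} \<Longrightarrow> \<sigma> i j \<in> {1..m i}"
  using permutes_in_image[OF multi_sym_groupD[of \<sigma> l m i], of j] by blast

lemma blk_closed: "i \<in> {1..l} \<Longrightarrow> j \<in> {1..m i} \<Longrightarrow> blk l m i j \<in> B"
  by (rule blk_in)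

lemma blk_inj: "i \<in> {1..l} \<Longrightarrow> j \<in> {1..m i} \<Longrightarrow> j' \<in> {1..m i} \<Longrightarrow> blk l m i j = blk l m i j' \<Longrightarrow> j = j'"
  using blk_eq_iff[of i l j m i j'] by blast

lemma G_eqI:
  assumes "\<sigma> \<in> carrier G" "\<tau> \<in> carrier G" "\<And>i j. i \<in> {1..l} \<Longrightarrow> j \<in> {1..m i} \<Longrightarrow> \<sigma> i j = \<tau> i j"
  shows "\<sigma> = \<tau>"
proof (rule PiE_ext[OF assms(1,2)[unfolded multi_sym_group_carrier]])
  fix i assume i: "i \<in> {1..l}"
  show "\<sigma> i = \<tau> i"
  proof
    fix j show "\<sigma> i j = \<tau> i j"
      using assms(3)[OF i, of j] multi_sym_groupD[OF assms(1) i] multi_sym_groupD[OF assms(2) i]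
      by (cases "j \<in> {1..m i}") (auto simp: permutes_not_in)
  qed
qed

lemma block_perm_iff:
  "i \<in> {1..l} \<Longrightarrow> j \<in> {1..m i} \<Longrightarrow> \<sigma> \<in> carrier G \<Longrightarrow> (x, blk l m i j) \<in> block_perm l m \<sigma> \<longleftrightarrow> x = blk l m i (\<sigma> i j)"
  unfolding block_perm_def using blk_eq_iff[of i l j m] by auto

lemma block_permD:
  assumes s: "\<sigma> \<in> carrier G"
  shows "fst ` block_perm l m \<sigma> = B" "snd ` block_perm l m \<sigma> = B" "joinable n (block_perm l m \<sigma>) C C"
    "\<rho> \<sigma> \<in> D"
proof -
  have "\<exists>j'\<in>{1..m i}. \<sigma> i j' = j" if "i \<in> {1..l}" "j \<in> {1..m i}" for i j
    using permutes_image[OF multi_sym_groupD[OF s that(1)]] that(2) by (metis imageE)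
  note pre = this
  show f: "fst ` block_perm l m \<sigma> = B"
  proof (intro equalityI subsetI)
    fix y assume "y \<in> fst ` block_perm l m \<sigma>"
    then obtain i j where "i \<in> {1..l}" "j \<in> {1..m i}" "y = blk l m i (\<sigma> i j)" unfolding block_perm_def by auto
    thus "y \<in> B" using blk_closed G_in[OF s] by blast
  next
    fix y assume "y \<in> B"
    then obtain i j where y: "i \<in> {1..l}" "j \<in> {1..m i}" "y = blk l m i j" by (elim through_blocksE)
    then obtain j' where "j' \<in> {1..m i}" "\<sigma> i j' = j" using pre by blast
    hence "(y, blk l m i j') \<in> block_perm l m \<sigma>" using y unfolding block_perm_def by blast
    thus "y \<in> fst ` block_perm l m \<sigma>" by force
  qed
  show t: "snd ` block_perm l m \<sigma> = B"
    unfolding block_perm_def through_blocks_def by force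
  have "inj_on fst (block_perm l m \<sigma>)"
  proof (rule inj_onI)
    fix z z' assume z: "z \<in> block_perm l m \<sigma>" "z' \<in> block_perm l m \<sigma>" "fst z = fst z'"
    then obtain i j i' j' where e: "z = (blk l m i (\<sigma> i j), blk l m i j)" "z' = (blk l m i' (\<sigma> i' j'), blk l m i' j')"
      "i \<in> {1..l}" "j \<in> {1..m i}" "i' \<in> {1..l}" "j' \<in> {1..m i'}" unfolding block_perm_def by blast
    have "i = i' \<and> \<sigma> i j = \<sigma> i' j'"
      using z(3) blk_eq_iff[OF e(3) G_in[OF s e(3,4)] e(5) G_in[OF s e(5,6)]] unfolding e(1,2) fst_conv by blast
    hence ij: "i = i'" "\<sigma> i j = \<sigma> i j'" by metis+
    have "j = j'" by (rule injD[OF permutes_inj[OF multi_sym_groupD[OF s e(3)]] ij(2)])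
    thus "z = z'" using e ij(1) by simp
  qed
  moreover have "inj_on snd (block_perm l m \<sigma>)"
    by (rule inj_onI) (auto simp: block_perm_def blk_eq_iff)
  ultimately show j: "joinable n (block_perm l m \<sigma>) C C"
    using blocks_row_split[OF l m] by (simp add: joinable_def f t)
  show "\<rho> \<sigma> \<in> D" unfolding joined_tonal_iff[OF j] using card_cut_block by (auto simp: block_perm_def)
qed

lemma block_perm_mult:
  assumes s: "\<sigma> \<in> carrier G" and t: "\<tau> \<in> carrier G"
  shows "block_perm l m \<sigma> O block_perm l m \<tau> = block_perm l m (\<sigma> \<otimes>\<^bsub>G\<^esub> \<tau>)"
proof (intro equalityI subsetI)
  fix w assume "w \<in> block_perm l m \<sigma> O block_perm l m \<tau>"
  then obtain x i j where w: "w = (x, blk l m i j)" "i \<in> {1..l}" "j \<in> {1..m i}" "(x, blk l m i (\<tau> i j)) \<in> block_perm l m \<sigma>"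
    unfolding block_perm_def[of _ _ \<tau>] by auto
  hence "x = blk l m i (\<sigma> i (\<tau> i j))" using block_perm_iff[OF w(2) G_in[OF t w(2,3)] s] by simp
  thus "w \<in> block_perm l m (\<sigma> \<otimes>\<^bsub>G\<^esub> \<tau>)" using w block_perm_iff[OF w(2,3) G.m_closed[OF s t]] by (simp add: multi_sym_group_mult)
next
  fix w assume "w \<in> block_perm l m (\<sigma> \<otimes>\<^bsub>G\<^esub> \<tau>)"
  then obtain i j where w: "i \<in> {1..l}" "j \<in> {1..m i}" "w = (blk l m i (\<sigma> i (\<tau> i j)), blk l m i j)"
    unfolding block_perm_def by (auto simp: multi_sym_group_mult)
  thus "w \<in> block_perm l m \<sigma> O block_perm l m \<tau>"
    using block_perm_iff[OF w(1,2) t, of "blk l m i (\<tau> i j)"] block_perm_iff[OF w(1) G_in[OF t w(1,2)] s, of "blk l m i (\<sigma> i (\<tau> i j))"]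
    by auto
qed

lemma block_perm_one: "block_perm l m \<one>\<^bsub>G\<^esub> = Id_on B"
proof -
  have "\<one>\<^bsub>G\<^esub> i j = j" if "i \<in> {1..l}" for i j using that by (simp add: multi_sym_group_one)
  hence "block_perm l m \<one>\<^bsub>G\<^esub> = {(blk l m i j, blk l m i j) | i j. i \<in> {1..l} \<and> j \<in> {1..m i}}"
    unfolding block_perm_def by (intro Collect_cong iff_exI) auto
  also have "\<dots> = Id_on B"
  proof (intro equalityI subsetI)
    fix w assume "w \<in> {(blk l m i j, blk l m i j) | i j. i \<in> {1..l} \<and> j \<in> {1..m i}}"
    then obtain i j where "i \<in> {1..l}" "j \<in> {1..m i}" "w = (blk l m i j, blk l m i j)" by blast
    thus "w \<in> Id_on B" using blk_closed by (simp only: Id_onI)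
  next
    fix w assume "w \<in> Id_on B"
    then obtain y where y: "y \<in> B" "w = (y, y)" by (elim Id_onE)
    then obtain i j where "i \<in> {1..l}" "j \<in> {1..m i}" "y = blk l m i j" by (elim through_blocksE)
    thus "w \<in> {(blk l m i j, blk l m i j) | i j. i \<in> {1..l} \<and> j \<in> {1..m i}}" using y(2) by blast
  qed
  finally show ?thesis .
qed

lemma block_perm_surj:
  assumes S: "fst ` S = B" "snd ` S = B" "inj_on fst S" "inj_on snd S" "\<And>x y. (x, y) \<in> S \<Longrightarrow> card x = card y"
  shows "\<exists>\<sigma>\<in>carrier G. S = block_perm l m \<sigma>"
proof -
  have ex: "\<exists>j'. j' \<in> {1..m i} \<and> (blk l m i j', blk l m i j) \<in> S" if i: "i \<in> {1..l}" "j \<in> {1..m i}" for i j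
  proof -
    have "blk l m i j \<in> snd ` S" using blk_closed[OF i] S(2) by blast
    then obtain x where x: "(x, blk l m i j) \<in> S" by force
    hence "x \<in> B" using S(1) by force
    hence "x \<in> {y \<in> B. card y = i}" using S(5)[OF x] by simp
    thus ?thesis using x through_blocks_of_card(1)[OF i(1)] by auto
  qed
  \<comment> \<open>Elements of the product group are undefined outside {1..l}, and each component
    fixes everything outside its range; the default values are chosen accordingly.\<close>
  define \<sigma> where "\<sigma> = (\<lambda>i. if i \<in> {1..l} then
      (\<lambda>j. if j \<in> {1..m i} then SOME j'. j' \<in> {1..m i} \<and> (blk l m i j', blk l m i j) \<in> S else j) else undefined)"
  have s: "\<sigma> i j \<in> {1..m i} \<and> (blk l m i (\<sigma> i j), blk l m i j) \<in> S" if i: "i \<in> {1..l}" "j \<in> {1..m i}" for i j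
    using someI_ex[OF ex[OF i]] i by (simp add: \<sigma>_def)
  have "\<sigma> i permutes {1..m i}" if i: "i \<in> {1..l}" for i
  proof (rule bij_imp_permutes)
    have "inj_on (\<sigma> i) {1..m i}"
    proof (rule inj_onI)
      fix j j' assume j: "j \<in> {1..m i}" "j' \<in> {1..m i}" "\<sigma> i j = \<sigma> i j'"
      have "blk l m i j = blk l m i j'"
        using s[OF i j(1)] s[OF i j(2)] j(3) S(3) by (metis fst_conv snd_conv inj_onD)
      thus "j = j'" by (rule blk_inj[OF i j(1,2)])
    qed
    moreover have "\<sigma> i ` {1..m i} \<subseteq> {1..m i}" using s[OF i] by blast
    ultimately show "bij_betw (\<sigma> i) {1..m i} {1..m i}"
      by (simp add: bij_betw_def endo_inj_surj)
    show "\<sigma> i x = x" if "x \<notin> {1..m i}" for x using that i by (simp only: \<sigma>_def if_True if_False simp_thms)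
  qed
  hence sG: "\<sigma> \<in> carrier G" unfolding multi_sym_group_carrier by (auto simp: \<sigma>_def)
  have "S = block_perm l m \<sigma>"
  proof (intro equalityI subsetI)
    fix w assume w: "w \<in> S"
    hence "snd w \<in> B" using S(2) by blast
    then obtain i j where ij: "i \<in> {1..l}" "j \<in> {1..m i}" "snd w = blk l m i j" by (elim through_blocksE)
    have "w = (blk l m i (\<sigma> i j), blk l m i j)" by (rule inj_onD[OF S(4) _ w]) (use s[OF ij(1,2)] ij(3) in auto)
    thus "w \<in> block_perm l m \<sigma>" using ij unfolding block_perm_def by blast
  qed (use s in \<open>auto simp: block_perm_def\<close>)
  thus ?thesis using sG by blast
qed

lemma permute_joined:
  assumes j: "joinable n P W C" and s: "\<sigma> \<in> carrier G"
  shows "pm \<sigma> (joined P W C) = joined (P O block_perm l m \<sigma>) W C"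
proof -
  have Top: "row_pair x y \<inter> range Top = row_pair x {}" and Bot: "row_pair x y \<inter> range Bot = row_pair {} y" for x y
    by (auto simp: row_pair_def)
  have pr: "propagating (row_pair x y) \<longleftrightarrow> x \<noteq> {} \<and> y \<noteq> {}" for x y
    by (simp add: propagating_def Top Bot)
  have uni: "row_pair x {} \<union> row_pair {} y = row_pair x y" for x y by (auto simp: row_pair_def)
  have P: "s \<in> joined P W C \<and> propagating s \<longleftrightarrow> (\<exists>x y. (x, y) \<in> P \<and> s = row_pair x y)" for s
    using joined_parts(1)[OF j] joinedE[of s P W C] pr by metis
  have 1: "{s \<in> joined P W C. \<not> propagating s} = (\<lambda>u. row_pair u {}) ` W \<union> (\<lambda>u. row_pair {} u) ` C"
  proof -
    have "s \<in> joined P W C \<and> \<not> propagating s \<longleftrightarrow> (\<exists>u\<in>W. s = row_pair u {}) \<or> (\<exists>u\<in>C. s = row_pair {} u)" for s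
      using joined_parts[OF j] joinedE[of s P W C] pr by metis
    thus ?thesis by blast
  qed
  have 2: "{(s \<inter> range Top) \<union> block l m i j | s i j.
        s \<in> joined P W C \<and> propagating s \<and> i \<in> {1..l} \<and> j \<in> {1..m i}
        \<and> s \<inter> range Bot = block l m i (\<sigma> i j)} = (\<lambda>(x, y). row_pair x y) ` (P O block_perm l m \<sigma>)" (is "?L = ?R")
  proof (intro equalityI subsetI)
    fix t assume "t \<in> ?L"
    then obtain s i j where t: "t = (s \<inter> range Top) \<union> block l m i j" "s \<in> joined P W C \<and> propagating s" "i \<in> {1..l}" "j \<in> {1..m i}"
      "s \<inter> range Bot = block l m i (\<sigma> i j)" by blast
    from t(2) obtain x y where xy: "(x, y) \<in> P" "s = row_pair x y" unfolding P by blast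
    have "y = blk l m i (\<sigma> i j)" using t(5) by (simp add: xy(2) Bot block_eq)
    hence "(x, blk l m i j) \<in> P O block_perm l m \<sigma>" using xy(1) t(3,4) by (auto simp: block_perm_def)
    moreover have "t = row_pair x (blk l m i j)" by (simp add: t(1) xy(2) Top block_eq uni)
    ultimately show "t \<in> ?R" by (auto simp: image_iff)
  next
    fix t assume "t \<in> ?R"
    then obtain x i j where t: "t = row_pair x (blk l m i j)" "i \<in> {1..l}" "j \<in> {1..m i}" "(x, blk l m i (\<sigma> i j)) \<in> P"
      by (auto simp: block_perm_def)
    have s: "row_pair x (blk l m i (\<sigma> i j)) \<in> joined P W C \<and> propagating (row_pair x (blk l m i (\<sigma> i j)))"
      unfolding P using t(4) by blast
    have "t = (row_pair x (blk l m i (\<sigma> i j)) \<inter> range Top) \<union> block l m i j"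
      "row_pair x (blk l m i (\<sigma> i j)) \<inter> range Bot = block l m i (\<sigma> i j)"
      by (simp_all only: t(1) Top Bot block_eq uni)
    thus "t \<in> ?L" using s t(2,3) by blast
  qed
  show ?thesis unfolding permute_blocks_def 1 2 by (simp add: joined_def Un_ac)
qed

lemma permute_half:
  assumes p: "p \<in> H" and s: "\<sigma> \<in> carrier G"
  shows "pm \<sigma> p = cp p (\<rho> \<sigma>)" "cl p (\<rho> \<sigma>) = card C" "pm \<sigma> p \<in> H"
proof -
  obtain P W where j: "joinable n P W C" "snd ` P = B" "p = joined P W C" "p \<in> D" using half_diagramE[OF l m p] by metis
  note b = block_permD[OF s]
  have mid: "snd ` P = fst ` block_perm l m \<sigma>" using j(2) b(1) by simp
  note c = matched_comp[OF j(1) b(3) mid]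
  show e: "pm \<sigma> p = cp p (\<rho> \<sigma>)" "cl p (\<rho> \<sigma>) = card C"
    unfolding j(3) permute_joined[OF j(1) s] c by simp_all
  have "snd ` (P O block_perm l m \<sigma>) = B" using snd_relcomp[OF mid] b(2) by simp
  moreover have "pm \<sigma> p \<in> D" unfolding e(1) by (rule diagram_comp_tonal[OF j(4) b(4)])
  ultimately show "pm \<sigma> p \<in> H"
    unfolding half_diagrams_iff[OF l m] using joinable_relcomp[OF j(1) b(3) mid] permute_joined[OF j(1) s] j(3) by metis
qed

lemma permute_mult:
  assumes p: "p \<in> H" and s: "\<sigma> \<in> carrier G" and t: "\<tau> \<in> carrier G"
  shows "pm \<tau> (pm \<sigma> p) = pm (\<sigma> \<otimes>\<^bsub>G\<^esub> \<tau>) p"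
proof -
  obtain P W where j: "joinable n P W C" "snd ` P = B" "p = joined P W C" using half_diagramE[OF l m p] by metis
  have "snd ` P = fst ` block_perm l m \<sigma>" using j(2) block_permD(1)[OF s] by simp
  from joinable_relcomp[OF j(1) block_permD(3)[OF s] this]
  show ?thesis unfolding j(3) permute_joined[OF j(1) s] permute_joined[OF j(1) G.m_closed[OF s t]]
    using permute_joined[OF _ t] by (simp add: block_perm_mult[OF s t, symmetric] O_assoc)
qed

lemma permute_one: "p \<in> H \<Longrightarrow> pm \<one>\<^bsub>G\<^esub> p = p"
proof -
  assume "p \<in> H"
  then obtain P W where j: "joinable n P W C" "snd ` P = B" "p = joined P W C" using half_diagramE[OF l m] by metis
  thus ?thesis using relcomp_Id_on[of P B] by (simp add: permute_joined[OF j(1) G.one_closed] block_perm_one)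
qed

lemma permute_eq_iff:
  assumes p: "p \<in> H" and q: "q \<in> H" and s: "\<sigma> \<in> carrier G"
  shows "pm \<sigma> p = q \<longleftrightarrow> p = pm (gi \<sigma>) q"
  using permute_mult[OF p s G.inv_closed[OF s]] permute_mult[OF q G.inv_closed[OF s] s] permute_one p q s by auto

text \<open>The top block matched with block \<sigma>(j) becomes matched with block j, and a top
  block has one partner only.\<close>

lemma permute_free:
  assumes p: "p \<in> H" and s: "\<sigma> \<in> carrier G" and t: "\<tau> \<in> carrier G" and e: "pm \<sigma> p = pm \<tau> p"
  shows "\<sigma> = \<tau>"
proof (rule G_eqI[OF s t])
  fix i j assume i: "i \<in> {1..l}" "j \<in> {1..m i}"
  obtain P W where j: "joinable n P W C" "snd ` P = B" "p = joined P W C" using half_diagramE[OF l m p] by metis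
  have jr: "joinable n (P O block_perm l m \<sigma>) W C" if "\<sigma> \<in> carrier G" for \<sigma>
    using joinable_relcomp[OF j(1) block_permD(3)[OF that]] j(2) block_permD(1)[OF that] by simp
  have PP: "P O block_perm l m \<sigma> = P O block_perm l m \<tau>"
    using e joined_eq_iff[OF jr[OF s] jr[OF t]] unfolding j(3) permute_joined[OF j(1) s] permute_joined[OF j(1) t] by simp
  have "blk l m i (\<sigma> i j) \<in> snd ` P" using blk_closed[OF i(1) G_in[OF s i]] j(2) by simp
  then obtain x where x: "(x, blk l m i (\<sigma> i j)) \<in> P" by force
  hence "(x, blk l m i j) \<in> P O block_perm l m \<tau>" using block_perm_iff[OF i s] PP by blast
  then obtain y where "(x, y) \<in> P" "(y, blk l m i j) \<in> block_perm l m \<tau>" by blast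
  hence "(x, blk l m i (\<tau> i j)) \<in> P" using block_perm_iff[OF i t] by simp
  thus "\<sigma> i j = \<tau> i j" using joinableD(3)[OF j(1) x] blk_inj[OF i(1) G_in[OF s i] G_in[OF t i]] by blast
qed

lemma HF_mult_perm:
  assumes f: "f \<in> HF" and s: "\<sigma> \<in> carrier G"
  shows "f \<star> bv (\<rho> \<sigma>) = (\<lambda>q. \<delta> ^ card C * half_part (\<lambda>q. f (pm (gi \<sigma>) q)) q)"
proof
  fix q
  have "(f \<star> bv (\<rho> \<sigma>)) q = (\<Sum>p\<in>H. \<delta> ^ card C * f p * of_bool (pm \<sigma> p = q))"
    unfolding HF_mult_bv[OF f block_permD(4)[OF s]] by (intro sum.cong refl) (simp add: permute_half(1,2)[OF _ s])
  also have "\<dots> = \<delta> ^ card C * half_part (\<lambda>q. f (pm (gi \<sigma>) q)) q"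
  proof (cases "q \<in> H")
    case True
    hence "(\<Sum>p\<in>H. \<delta> ^ card C * f p * of_bool (pm \<sigma> p = q)) = (\<Sum>p\<in>H. \<delta> ^ card C * f p * of_bool (pm (gi \<sigma>) q = p))"
      by (intro sum.cong refl) (auto simp: permute_eq_iff[OF _ True s])
    also have "\<dots> = \<delta> ^ card C * f (pm (gi \<sigma>) q)"
      using True s permute_half(3)[of q "gi \<sigma>"] by (subst sum_mult_of_bool(1)) (simp_all add: finite_half)
    finally show ?thesis using True by (simp add: half_part_def)
  next
    case False
    hence "(\<Sum>p\<in>H. \<delta> ^ card C * f p * of_bool (pm \<sigma> p = q)) = 0" using permute_half(3)[OF _ s] by (intro sum.neutral) auto
    thus ?thesis using False by (simp add: half_part_def)
  qed
  finally show "(f \<star> bv (\<rho> \<sigma>)) q = \<delta> ^ card C * half_part (\<lambda>q. f (pm (gi \<sigma>) q)) q" .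
qed

text \<open>Translation of the argument is right multiplication by a permutation diagram up to a
  nonzero scalar; associativity moves \<open>r\<close> past it and the scalar cancels.\<close>

lemma mult_permute:
  assumes r: "r \<in> carrier R" and f: "f \<in> HF" and q: "q \<in> H" and s: "\<sigma> \<in> carrier G"
  shows "(r \<star> f) (pm \<sigma> q) = (r \<star> half_part (\<lambda>p. f (pm \<sigma> p))) q"
proof -
  have i: "gi \<sigma> \<in> carrier G" using s by simp
  have b: "bv (\<rho> (gi \<sigma>)) \<in> carrier R" by (rule bv_closed[OF block_permD(4)[OF i]])
  have "\<delta> ^ card C * (r \<star> half_part (\<lambda>p. f (pm \<sigma> p))) q = (r \<star> (f \<star> bv (\<rho> (gi \<sigma>)))) q"
    unfolding HF_mult_perm[OF f i] R_mult_scale using s by simp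
  also have "\<dots> = ((r \<star> f) \<star> bv (\<rho> (gi \<sigma>))) q" using R.m_assoc[OF r HF_closed[OF f] b] by simp
  also have "\<dots> = (half_part (r \<star> f) \<star> bv (\<rho> (gi \<sigma>))) q" using half_part_mult_eq(2)[OF r f b q] by simp
  also have "\<dots> = \<delta> ^ card C * (r \<star> f) (pm \<sigma> q)"
    unfolding HF_mult_perm[OF half_part_HF i] using s permute_half(3)[OF q s] q by (simp add: half_part_def)
  finally show ?thesis using delta by simp
qed

end

text \<open>Convolution in the group algebra, indexed so that the coefficients match the values of a
  right multiple on an orbit.\<close>

lemma group_act_mult:
  assumes "group G" and G: "G = multi_sym_group l m"
  shows "group_act l m z (group_act l m z' v) = group_act l m (\<lambda>\<sigma>. \<Sum>\<tau>\<in>carrier G. z (\<sigma> \<otimes>\<^bsub>G\<^esub> inv\<^bsub>G\<^esub> \<tau>) * z' \<tau>) v"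
proof
  fix T
  interpret group G by fact
  have pt: "permute_tabloids l (inv\<^bsub>G\<^esub> \<tau>) (permute_tabloids l (inv\<^bsub>G\<^esub> \<sigma>) T) = permute_tabloids l (inv\<^bsub>G\<^esub> (\<sigma> \<otimes>\<^bsub>G\<^esub> \<tau>)) T"
    if "\<sigma> \<in> carrier G" "\<tau> \<in> carrier G" for \<sigma> \<tau>
    using that by (simp add: inv_mult_group) (simp add: G permute_tabloids_mult)
  have "group_act l m z (group_act l m z' v) T
    = (\<Sum>\<sigma>\<in>carrier G. \<Sum>\<tau>\<in>carrier G. z \<sigma> * z' \<tau> * v (permute_tabloids l (inv\<^bsub>G\<^esub> (\<sigma> \<otimes>\<^bsub>G\<^esub> \<tau>)) T))"
    unfolding group_act_def G[symmetric] sum_distrib_left by (intro sum.cong refl) (simp add: pt mult.assoc)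
  also have "\<dots> = (\<Sum>\<tau>\<in>carrier G. \<Sum>\<sigma>\<in>carrier G. z \<sigma> * z' \<tau> * v (permute_tabloids l (inv\<^bsub>G\<^esub> (\<sigma> \<otimes>\<^bsub>G\<^esub> \<tau>)) T))"
    by (rule sum.swap)
  also have "\<dots> = (\<Sum>\<tau>\<in>carrier G. \<Sum>\<sigma>\<in>carrier G. z (\<sigma> \<otimes>\<^bsub>G\<^esub> inv\<^bsub>G\<^esub> \<tau>) * z' \<tau> * v (permute_tabloids l (inv\<^bsub>G\<^esub> \<sigma>) T))"
  proof (rule sum.cong[OF refl])
    fix \<tau> assume "\<tau> \<in> carrier G"
    thus "(\<Sum>\<sigma>\<in>carrier G. z \<sigma> * z' \<tau> * v (permute_tabloids l (inv\<^bsub>G\<^esub> (\<sigma> \<otimes>\<^bsub>G\<^esub> \<tau>)) T))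
      = (\<Sum>\<sigma>\<in>carrier G. z (\<sigma> \<otimes>\<^bsub>G\<^esub> inv\<^bsub>G\<^esub> \<tau>) * z' \<tau> * v (permute_tabloids l (inv\<^bsub>G\<^esub> \<sigma>) T))"
      by (intro sum.reindex_bij_witness[of _ "\<lambda>\<sigma>. \<sigma> \<otimes>\<^bsub>G\<^esub> inv\<^bsub>G\<^esub> \<tau>" "\<lambda>\<sigma>. \<sigma> \<otimes>\<^bsub>G\<^esub> \<tau>"]) (simp_all add: m_assoc)
  qed
  also have "\<dots> = group_act l m (\<lambda>\<sigma>. \<Sum>\<tau>\<in>carrier G. z (\<sigma> \<otimes>\<^bsub>G\<^esub> inv\<^bsub>G\<^esub> \<tau>) * z' \<tau>) v T"
    unfolding group_act_def G[symmetric] sum_distrib_right by (rule sum.swap)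
  finally show "group_act l m z (group_act l m z' v) T = \<dots>" .
qed

section \<open>A model of the standard modules\<close>

text \<open>
  The tensor product \<open>p \<otimes> v\<close> becomes the function \<open>q \<mapsto> \<Sum>\<^sub>\<sigma> [p \<cdot> \<sigma>\<inverse> = q] \<sigma> v\<close>; its values determine it,
  so that the standard module is realised by equivariant functions from half diagrams to the Specht module.
\<close>

locale standard_layer = tonal_layer +
  fixes \<mu> :: "nat \<Rightarrow> nat list"
  assumes \<mu>: "\<mu> \<in> multipartitions m"
begin

abbreviation "Sp \<equiv> specht_carrier l \<mu>"
abbreviation "ga \<equiv> group_act l m"

lemma mu_partition: "int_partition (m i) (\<mu> i)" using \<mu> by (simp add: multipartitions_def)

lemma size_mu: "size_vector \<mu> = m"
  using mu_partition by (auto simp: size_vector_def int_partition_def)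

lemma Sp_add: "v \<in> Sp \<Longrightarrow> w \<in> Sp \<Longrightarrow> (\<lambda>T. v T + w T) \<in> Sp" and Sp_scale: "v \<in> Sp \<Longrightarrow> (\<lambda>T. c * v T) \<in> Sp"
  and Sp_zero: "(\<lambda>T. 0) \<in> Sp" and Sp_sum: "(\<And>i. i \<in> A \<Longrightarrow> g i \<in> Sp) \<Longrightarrow> (\<lambda>T. \<Sum>i\<in>A. g i T) \<in> Sp"
  unfolding specht_carrier_eq by (rule complex_span_closed complex_span_sum; assumption)+

lemma ga_closed: "v \<in> Sp \<Longrightarrow> ga z v \<in> Sp"
  by (rule group_act_closed[OF mu_partition])

text \<open>Equivariance means that the value at the translate of q by \<sigma> is the inverse of
  \<sigma> applied to the value at q; on coefficient functions this substitutes \<sigma>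
  itself.\<close>

definition model :: "(diagram \<Rightarrow> (nat \<Rightarrow> tabloid) \<Rightarrow> complex) set" where
  "model = {F. (\<forall>q. F q \<in> Sp) \<and> (\<forall>q. q \<notin> H \<longrightarrow> F q = (\<lambda>T. 0))
     \<and> (\<forall>\<sigma>\<in>carrier G. \<forall>q\<in>H. F (pm \<sigma> q) = (\<lambda>T. F q (permute_tabloids l \<sigma> T)))}"

text \<open>Left multiplication in the diagram variable for each fixed \<open>T\<close>, reduced
  modulo \<open>I\<close> by truncation.\<close>

definition act :: "(diagram \<Rightarrow> complex) \<Rightarrow> (diagram \<Rightarrow> (nat \<Rightarrow> tabloid) \<Rightarrow> complex) \<Rightarrow> diagram \<Rightarrow> (nat \<Rightarrow> tabloid) \<Rightarrow> complex" where
  "act r F = (\<lambda>q T. half_part (r \<star> (\<lambda>p. F p T)) q)"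

definition \<phi> :: "(diagram \<Rightarrow> complex) \<Rightarrow> ((nat \<Rightarrow> tabloid) \<Rightarrow> complex) \<Rightarrow> diagram \<Rightarrow> (nat \<Rightarrow> tabloid) \<Rightarrow> complex" where
  "\<phi> f v = (\<lambda>q. if q \<in> H then ga (\<lambda>\<sigma>. f (pm \<sigma> q)) v else (\<lambda>T. 0))"

definition V :: "(diagram \<Rightarrow> complex, diagram \<Rightarrow> (nat \<Rightarrow> tabloid) \<Rightarrow> complex) module" where
  "V = \<lparr>carrier = model, monoid.mult = undefined, one = undefined, ring.zero = (\<lambda>q T. 0),
     add = (\<lambda>F F' q T. F q T + F' q T), smult = act\<rparr>"

lemma V_simps: "carrier V = model" "\<zero>\<^bsub>V\<^esub> = (\<lambda>q T. 0)" "F \<oplus>\<^bsub>V\<^esub> F' = (\<lambda>q T. F q T + F' q T)" "r \<odot>\<^bsub>V\<^esub> F = act r F"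
  by (simp_all add: V_def)

lemma modelD:
  assumes "F \<in> model"
  shows "F q \<in> Sp" "q \<notin> H \<Longrightarrow> F q = (\<lambda>T. 0)" "\<sigma> \<in> carrier G \<Longrightarrow> q \<in> H \<Longrightarrow> F (pm \<sigma> q) T = F q (permute_tabloids l \<sigma> T)"
    "(\<lambda>p. F p T) \<in> HF"
  using assms by (auto simp: model_def)

lemma act_closed:
  assumes r: "r \<in> carrier R" and F: "F \<in> model"
  shows "act r F \<in> model"
  unfolding model_def
proof (intro CollectI conjI allI impI ballI)
  fix q
  show "act r F q \<in> Sp"
  proof (cases "q \<in> H")
    case True
    have "act r F q = (\<lambda>T. \<Sum>p\<in>D. \<Sum>p'\<in>D. (r p * \<delta> ^ cl p p' * of_bool (cp p p' = q)) * F p' T)"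
      using True by (simp add: act_def half_part_def R_mult mult_ac)
    thus ?thesis using modelD(1)[OF F] by (simp only:) (intro Sp_sum Sp_scale)
  qed (simp add: act_def half_part_def Sp_zero)
  show "q \<notin> H \<Longrightarrow> act r F q = (\<lambda>T. 0)" by (simp add: act_def half_part_def)
next
  fix \<sigma> q assume s: "\<sigma> \<in> carrier G" and q: "q \<in> H"
  show "act r F (pm \<sigma> q) = (\<lambda>T. act r F q (permute_tabloids l \<sigma> T))"
  proof
    fix T
    have "half_part (\<lambda>p. F (pm \<sigma> p) T) = (\<lambda>p. F p (permute_tabloids l \<sigma> T))"
      using modelD(2,3)[OF F] s by (auto simp: half_part_def)
    thus "act r F (pm \<sigma> q) T = act r F q (permute_tabloids l \<sigma> T)"
      using mult_permute[OF r modelD(4)[OF F] q s] permute_half(3)[OF q s] q by (simp add: act_def half_part_def)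
  qed
qed

lemma half_part_linear:
  "half_part (\<lambda>q. f q + g q) = (\<lambda>q. half_part f q + half_part g q)" "half_part (\<lambda>q. c * f q) = (\<lambda>q. c * half_part f q)"
  by (auto simp: half_part_def)

lemma half_part_in: "q \<in> H \<Longrightarrow> half_part f q = f q" and half_part_out: "q \<notin> H \<Longrightarrow> half_part f q = 0"
  by (simp_all add: half_part_def)

lemma act_linear:
  "r \<in> carrier R \<Longrightarrow> r' \<in> carrier R \<Longrightarrow> F \<in> model \<Longrightarrow> act (\<lambda>q. r q + r' q) F = (\<lambda>q T. act r F q T + act r' F q T)"
  "r \<in> carrier R \<Longrightarrow> F \<in> model \<Longrightarrow> F' \<in> model \<Longrightarrow> act r (\<lambda>q T. F q T + F' q T) = (\<lambda>q T. act r F q T + act r F' q T)"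
  "r \<in> carrier R \<Longrightarrow> r' \<in> carrier R \<Longrightarrow> F \<in> model \<Longrightarrow> act (r \<star> r') F = act r (act r' F)"
  "F \<in> model \<Longrightarrow> act \<one>\<^bsub>R\<^esub> F = F"
  "act (\<lambda>q. c * r q) F = (\<lambda>q T. c * act r F q T)"
proof -
  have h: "(\<lambda>p. F p T) \<in> carrier R" if "F \<in> model" for F T by (rule HF_closed[OF modelD(4)[OF that]])
  show "act (\<lambda>q. r q + r' q) F = (\<lambda>q T. act r F q T + act r' F q T)"
    if "r \<in> carrier R" "r' \<in> carrier R" "F \<in> model"
    using R.l_distr[OF that(1,2) h[OF that(3)]] by (simp add: act_def R_add half_part_linear)
  show "act r (\<lambda>q T. F q T + F' q T) = (\<lambda>q T. act r F q T + act r F' q T)"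
    if "r \<in> carrier R" "F \<in> model" "F' \<in> model"
    using R.r_distr[OF h[OF that(2)] h[OF that(3)] that(1)] by (simp add: act_def R_add half_part_linear)
  show "act (r \<star> r') F = act r (act r' F)" if r: "r \<in> carrier R" "r' \<in> carrier R" and F: "F \<in> model"
  proof (intro ext)
    fix q T show "act (r \<star> r') F q T = act r (act r' F) q T"
      using half_part_mult_eq(1)[OF r(2) modelD(4)[OF F] r(1), of q T] R.m_assoc[OF r h[OF F, of T]]
      by (cases "q \<in> H") (simp_all add: act_def half_part_in half_part_out)
  qed
  show "act \<one>\<^bsub>R\<^esub> F = F" if F: "F \<in> model"
  proof (intro ext)
    fix q T show "act \<one>\<^bsub>R\<^esub> F q T = F q T"
      using R.l_one[OF h[OF F, of T]] modelD(2)[OF F, of q]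
      by (cases "q \<in> H") (simp_all add: act_def half_part_in half_part_out)
  qed
  show "act (\<lambda>q. c * r q) F = (\<lambda>q T. c * act r F q T)"
    by (simp add: act_def R_mult_scale half_part_linear)
qed

lemma model_add: "F \<in> model \<Longrightarrow> F' \<in> model \<Longrightarrow> (\<lambda>q T. F q T + F' q T) \<in> model"
  and model_scale: "F \<in> model \<Longrightarrow> (\<lambda>q T. c * F q T) \<in> model"
  and model_zero: "(\<lambda>q T. 0) \<in> model"
  by (auto simp: model_def Sp_add Sp_scale Sp_zero)

lemma V_left_module: "left_module R V"
proof (intro left_module.intro left_module_axioms.intro)
  show "ring R" by (rule tonal_algebra_ring)
  show "abelian_group V"
  proof (rule abelian_groupI)
    show "\<exists>F'\<in>carrier V. F' \<oplus>\<^bsub>V\<^esub> F = \<zero>\<^bsub>V\<^esub>" if "F \<in> carrier V" for F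
      using model_scale[of F "-1"] that by (intro bexI[of _ "\<lambda>q T. - F q T"]) (auto simp: V_simps)
  qed (auto simp: V_simps model_add model_zero add_ac)
qed (simp_all add: V_simps act_closed act_linear R_add)

lemma phi_closed:
  assumes v: "v \<in> Sp" shows "\<phi> f v \<in> model"
  unfolding model_def
proof (intro CollectI conjI allI impI ballI)
  show "\<phi> f v q \<in> Sp" for q using v by (simp add: \<phi>_def ga_closed Sp_zero)
  show "q \<notin> H \<Longrightarrow> \<phi> f v q = (\<lambda>T. 0)" for q by (simp add: \<phi>_def)
  fix \<sigma> q assume s: "\<sigma> \<in> carrier G" and q: "q \<in> H"
  let ?z = "\<lambda>\<tau>. f (pm \<tau> q)"
  have "ga (\<lambda>\<tau>. f (pm \<tau> (pm \<sigma> q))) v = ga (\<lambda>\<tau>. ?z (gi (gi \<sigma>) \<otimes>\<^bsub>G\<^esub> \<tau>)) v"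
    unfolding group_act_def by (rule ext, intro sum.cong refl) (simp add: permute_mult[OF q s] s)
  also have "\<dots> = (\<lambda>T. ga ?z v (permute_tabloids l \<sigma> T))"
    using group_act_translate[OF mu_partition G.inv_closed[OF s], where z = ?z and x = v] s by simp
  finally show "\<phi> f v (pm \<sigma> q) = (\<lambda>T. \<phi> f v q (permute_tabloids l \<sigma> T))"
    using permute_half(3)[OF q s] q by (simp add: \<phi>_def)
qed

lemma phi_linear:
  "\<phi> (\<lambda>q. f q + g q) v = (\<lambda>q T. \<phi> f v q T + \<phi> g v q T)" "\<phi> f (\<lambda>T. v T + w T) = (\<lambda>q T. \<phi> f v q T + \<phi> f w q T)"
  "\<phi> (\<lambda>q. c * f q) v = (\<lambda>q T. c * \<phi> f v q T)" "\<phi> f (\<lambda>T. 0) = (\<lambda>q T. 0)" "\<phi> (\<lambda>q. 0) v = (\<lambda>q T. 0)"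
  by (auto simp: \<phi>_def fun_eq_iff group_act_linear)

definition right_mult :: "(diagram \<Rightarrow> complex) \<Rightarrow> ((nat \<Rightarrow> nat \<Rightarrow> nat) \<Rightarrow> complex) \<Rightarrow> diagram \<Rightarrow> complex" where
  "right_mult f z = (\<lambda>q. \<Sum>p\<in>H. \<Sum>\<sigma>\<in>carrier G. f p * z \<sigma> * of_bool (pm \<sigma> p = q))"

lemma right_mult_HF: "right_mult f z \<in> HF"
  unfolding right_mult_def using permute_half(3) by (intro CollectI allI impI sum.neutral ballI) auto

lemma right_mult_eq:
  assumes q: "q \<in> H"
  shows "right_mult f z q = (\<Sum>\<sigma>\<in>carrier G. f (pm (gi \<sigma>) q) * z \<sigma>)"
proof -
  have "right_mult f z q = (\<Sum>\<sigma>\<in>carrier G. \<Sum>p\<in>H. (f p * z \<sigma>) * of_bool (pm (gi \<sigma>) q = p))"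
    unfolding right_mult_def by (subst sum.swap) (intro sum.cong refl, auto simp: permute_eq_iff[OF _ q])
  also have "\<dots> = (\<Sum>\<sigma>\<in>carrier G. f (pm (gi \<sigma>) q) * z \<sigma>)"
    using permute_half(3)[OF q] by (intro sum.cong refl, subst sum_mult_of_bool(1)) (simp_all add: finite_half)
  finally show ?thesis .
qed

text \<open>The balancing relation of the tensor product becomes the compatibility of the group
  action with convolution.\<close>

lemma phi_balanced: "\<phi> (right_mult f z) v = \<phi> f (ga z v)"
proof
  fix q
  show "\<phi> (right_mult f z) v q = \<phi> f (ga z v) q"
  proof (cases "q \<in> H")
    case True
    have "ga (\<lambda>\<sigma>. right_mult f z (pm \<sigma> q)) v = ga (\<lambda>\<sigma>. \<Sum>\<tau>\<in>carrier G. f (pm (\<sigma> \<otimes>\<^bsub>G\<^esub> gi \<tau>) q) * z \<tau>) v"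
      unfolding group_act_def
      by (rule ext, intro sum.cong refl) (simp add: right_mult_eq permute_half(3)[OF True] permute_mult[OF True])
    thus ?thesis using True group_act_mult[OF G.group_axioms refl, of "\<lambda>\<sigma>. f (pm \<sigma> q)" z v] by (simp add: \<phi>_def)
  qed (simp add: \<phi>_def)
qed

text \<open>For fixed \<open>T\<close> the tensor is a combination of translates of \<open>f\<close>
  with coefficients taken from \<open>v\<close>, and multiplication by \<open>r\<close> commutes
  with each translation.\<close>

lemma act_phi:
  assumes r: "r \<in> carrier R" and f: "f \<in> HF"
  shows "act r (\<phi> f v) = \<phi> (half_part (r \<star> f)) v"
proof (intro ext)
  fix q T
  show "act r (\<phi> f v) q T = \<phi> (half_part (r \<star> f)) v q T"
  proof (cases "q \<in> H")
    case True
    let ?v = "\<lambda>\<sigma>. v (permute_tabloids l (gi \<sigma>) T)"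
    have 1: "(\<lambda>p. \<phi> f v p T) = (\<lambda>p. \<Sum>\<sigma>\<in>carrier G. ?v \<sigma> * half_part (\<lambda>p. f (pm \<sigma> p)) p)"
      by (auto simp: \<phi>_def half_part_def group_act_def mult.commute)
    have "act r (\<phi> f v) q T = (\<Sum>\<sigma>\<in>carrier G. ?v \<sigma> * (r \<star> half_part (\<lambda>p. f (pm \<sigma> p))) q)"
      unfolding act_def 1 R_mult_sum R_mult_scale using True by (simp add: half_part_def)
    also have "\<dots> = (\<Sum>\<sigma>\<in>carrier G. half_part (r \<star> f) (pm \<sigma> q) * ?v \<sigma>)"
      using mult_permute[OF r f True] permute_half(3)[OF True] by (intro sum.cong refl) (simp add: half_part_def)
    finally show ?thesis using True by (simp add: \<phi>_def group_act_def)
  qed (simp add: act_def \<phi>_def half_part_def)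
qed

text \<open>By equivariance the half diagrams in the orbit of q contribute equally, one term for
  each group element; dividing by the order of the group gives back the value.\<close>

lemma model_eq_sum_phi:
  assumes F: "F \<in> model"
  shows "F q T = (\<Sum>p\<in>H. \<phi> (\<lambda>q. inverse (of_nat (card (carrier G))) * bv p q) (F p) q T)"
proof (cases "q \<in> H")
  case True
  let ?c = "inverse (of_nat (card (carrier G))) :: complex"
  have nz: "card (carrier G) \<noteq> 0" using finite_multi_sym_group[of l m] G.one_closed by auto
  have "(\<Sum>p\<in>H. \<phi> (\<lambda>q. ?c * bv p q) (F p) q T)
    = (\<Sum>\<sigma>\<in>carrier G. \<Sum>p\<in>H. ?c * F p (permute_tabloids l (gi \<sigma>) T) * of_bool (pm \<sigma> q = p))"
    using True by (subst sum.swap) (simp add: \<phi>_def group_act_def basis_vector_def mult_ac)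
  also have "\<dots> = (\<Sum>\<sigma>\<in>carrier G. ?c * F (pm \<sigma> q) (permute_tabloids l (gi \<sigma>) T))"
    using permute_half(3)[OF True] by (intro sum.cong refl, subst sum_mult_of_bool(1)) (simp_all add: finite_half)
  also have "\<dots> = (\<Sum>\<sigma>\<in>carrier G. ?c * F q T)"
  proof (rule sum.cong[OF refl])
    fix \<sigma> assume s: "\<sigma> \<in> carrier G"
    have "permute_tabloids l \<sigma> (permute_tabloids l (gi \<sigma>) T) = T"
      using permute_tabloids_mult[where l = l and m = m and \<sigma> = \<sigma> and \<tau> = "gi \<sigma>" and T = T] s by (simp add: permute_tabloids_one)
    thus "?c * F (pm \<sigma> q) (permute_tabloids l (gi \<sigma>) T) = ?c * F q T" by (simp add: modelD(3)[OF F s True])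
  qed
  finally show ?thesis using nz by simp
next
  case False thus ?thesis using modelD(2)[OF F False] by (simp add: \<phi>_def)
qed

end

section \<open>The standard modules are isomorphic to the model\<close>

context standard_layer begin

abbreviation "S \<equiv> standard_module \<delta> l n \<mu>"

lemma right_action_cls: "f \<in> HF \<Longrightarrow> right_action \<delta> l n m (cls f) z = cls (right_mult f z)"
  by (simp add: right_action_def half_coeffs_cls right_mult_def)

text \<open>The counterpart of \<open>model_eq_sum_phi\<close> in the left ideal: each half diagram
  q is multiplied by the group algebra element formed from the values of \<open>f\<close> on its
  orbit, and every term of \<open>f\<close> arises once for each group element.\<close>

lemma sum_right_mult:
  assumes f: "f \<in> HF"
  shows "(\<lambda>q'. \<Sum>q\<in>H. right_mult (\<lambda>p. inverse (of_nat (card (carrier G))) * bv q p) (\<lambda>\<sigma>. if \<sigma> \<in> carrier G then f (pm \<sigma> q) else 0) q') = f"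
proof
  let ?c = "inverse (of_nat (card (carrier G))) :: complex"
  fix q'
  show "(\<Sum>q\<in>H. right_mult (\<lambda>p. ?c * bv q p) (\<lambda>\<sigma>. if \<sigma> \<in> carrier G then f (pm \<sigma> q) else 0) q') = f q'"
  proof (cases "q' \<in> H")
    case True
    have nz: "card (carrier G) \<noteq> 0" using finite_multi_sym_group[of l m] G.one_closed by auto
    have "(\<Sum>q\<in>H. right_mult (\<lambda>p. ?c * bv q p) (\<lambda>\<sigma>. if \<sigma> \<in> carrier G then f (pm \<sigma> q) else 0) q')
      = (\<Sum>\<sigma>\<in>carrier G. \<Sum>q\<in>H. ?c * f (pm \<sigma> q) * of_bool (pm (gi \<sigma>) q' = q))"
      unfolding right_mult_eq[OF True] by (subst sum.swap) (intro sum.cong refl, simp add: basis_vector_def)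
    also have "\<dots> = (\<Sum>\<sigma>\<in>carrier G. ?c * f (pm \<sigma> (pm (gi \<sigma>) q')))"
      using permute_half(3)[OF True] by (intro sum.cong refl, subst sum_mult_of_bool(1)) (simp_all add: finite_half)
    also have "\<dots> = (\<Sum>\<sigma>\<in>carrier G. ?c * f q')"
      by (intro sum.cong refl) (simp add: permute_mult[OF True] permute_one[OF True])
    finally show ?thesis using nz by simp
  next
    case False
    have "right_mult g z q' = 0" for g z using right_mult_HF False by blast
    thus ?thesis using f False by simp
  qed
qed

text \<open>The universal property gives a homomorphism \<open>h\<close> from formal sums to the
  model, and \<open>\<psi>\<close> is an explicit section of it. The relations generate exactly the
  kernel of \<open>h\<close>, so cosets are the fibres of \<open>h\<close>, and
  \<open>\<Psi>\<close> sends a function to its fibre.\<close>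

lemma exists_model_iso: "\<exists>\<Psi>. left_module_iso R V S \<Psi>"
proof -
  interpret V: left_module R V by (rule V_left_module)
  let ?A = "carrier M \<times> Sp"
  let ?ok = "\<lambda>c. Poly_Mapping.keys c \<subseteq> ?A"
  let ?F = "free_Abelian_group ?A"
  let ?rel = "tensor_relations (group_algebra G) M (right_action \<delta> l n m) (specht_module l \<mu>)"
  let ?K = "generate ?F ?rel"
  let ?c = "inverse (of_nat (card (carrier G))) :: complex"
  have cM: "X \<in> carrier M \<longleftrightarrow> (\<exists>f\<in>HF. X = cls f)" for X unfolding left_ideal_carrier by blast
  have clsM: "f \<in> HF \<Longrightarrow> cls f \<in> carrier M" for f unfolding cM by blast
  have addM: "f \<in> HF \<Longrightarrow> g \<in> HF \<Longrightarrow> cls f \<oplus>\<^bsub>M\<^esub> cls g = cls (\<lambda>q. f q + g q)" for f g by (rule left_ideal_simps(1))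
  have HFa: "f \<in> HF \<Longrightarrow> g \<in> HF \<Longrightarrow> (\<lambda>q. f q + g q) \<in> HF" for f g by simp
  have bvH: "q \<in> H \<Longrightarrow> (\<lambda>p. ?c * bv q p) \<in> HF" for q by (auto simp: basis_vector_def)
  have sm: "z \<odot>\<^bsub>specht_module l \<mu>\<^esub> v = ga z v" for z v by (simp add: specht_module_simps size_mu)
  have sa: "v \<oplus>\<^bsub>specht_module l \<mu>\<^esub> w = (\<lambda>T. v T + w T)" for v w by (simp add: specht_module_simps)
  have rel1: "frag_of (cls (\<lambda>q. f q + g q), v) - frag_of (cls f, v) - frag_of (cls g, v) \<in> ?rel"
    if "f \<in> HF" "g \<in> HF" "v \<in> Sp" for f g v
    using tensor_relationsI(1)[where R = "group_algebra G" and ac = "right_action \<delta> l n m" and N = "specht_module l \<mu>", OF clsM[OF that(1)] clsM[OF that(2)], of v] addM[OF that(1,2)] that(3)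
    by (simp only: specht_module_simps(1))
  have rel2: "frag_of (X, \<lambda>T. v T + w T) - frag_of (X, v) - frag_of (X, w) \<in> ?rel"
    if "X \<in> carrier M" "v \<in> Sp" "w \<in> Sp" for X v w
    using tensor_relationsI(2)[where R = "group_algebra G" and ac = "right_action \<delta> l n m" and N = "specht_module l \<mu>", OF that(1), of v w] that(2,3) sa[of v w] by (simp only: specht_module_simps(1))
  have rel3: "frag_of (cls (right_mult f z), v) - frag_of (cls f, ga z v) \<in> ?rel"
    if "f \<in> HF" "\<forall>g. g \<notin> carrier G \<longrightarrow> z g = 0" "v \<in> Sp" for f z v
  proof -
    have "z \<in> carrier (group_algebra G)" using that(2) by (simp add: group_algebra_def)
    from tensor_relationsI(3)[OF clsM[OF that(1)] this, of v "specht_module l \<mu>" "right_action \<delta> l n m"]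
    show ?thesis unfolding sm right_action_cls[OF that(1)] specht_module_simps(1) using that(3) .
  qed
  have kf: "Poly_Mapping.keys (frag_of x) = {x}" for x :: "(diagram \<Rightarrow> complex) set \<times> ((nat \<Rightarrow> tabloid) \<Rightarrow> complex)" by simp
  have kd: "?ok c \<Longrightarrow> Poly_Mapping.keys c' \<subseteq> ?A \<Longrightarrow> ?ok (c - c')" for c c'
    using keys_diff[of c c'] by blast
  have ka: "?ok c \<Longrightarrow> Poly_Mapping.keys c' \<subseteq> ?A \<Longrightarrow> ?ok (c + c')" for c c'
    using keys_add[of c c'] by blast
  have gen: "f \<in> HF \<Longrightarrow> v \<in> Sp \<Longrightarrow> ?ok (frag_of (cls f, v))" for f v using clsM by simp
  interpret F: group ?F by simp
  have "(\<lambda>(X, v). \<phi> (half_coeffs \<delta> l n m X) v) ` ?A \<subseteq> carrier (add_monoid V)"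
    using phi_closed by (auto simp: V_simps)
  from comm_group.free_Abelian_group_universal[OF V.M.a_comm_group this]
  obtain h where h: "h \<in> hom ?F (add_monoid V)" "\<And>x. x \<in> ?A \<Longrightarrow> h (frag_of x) = (\<lambda>(X, v). \<phi> (half_coeffs \<delta> l n m X) v) x" by blast
  have hg: "h (frag_of (cls f, v)) = \<phi> f v" if "f \<in> HF" "v \<in> Sp" for f v
    using h(2)[of "(cls f, v)"] clsM[OF that(1)] that half_coeffs_cls[OF that(1)] by simp
  have hc: "h c \<in> model" if "?ok c" for c using hom_carrier[OF h(1)] that by (auto simp: V_simps)
  have ha: "h (c + c') = (\<lambda>q T. h c q T + h c' q T)" if "?ok c" "Poly_Mapping.keys c' \<subseteq> ?A" for c c'
    using hom_mult[OF h(1), of c c'] that by (simp add: V_def)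
  have h0: "h 0 = (\<lambda>q T. 0)" using ha[of 0 0] by (simp add: fun_eq_iff)
  have hd: "h (c - c') = (\<lambda>q T. h c q T - h c' q T)" if "?ok c" "Poly_Mapping.keys c' \<subseteq> ?A" for c c'
    using ha[OF kd[OF that] that(2)] by (simp add: fun_eq_iff)
  have relF: "c \<in> carrier ?F \<and> h c = (\<lambda>q T. 0)" if "c \<in> ?rel" for c
    using that
  proof (cases rule: tensor_relationsE)
    case (left x x' v)
    obtain f where f: "x = cls f" "f \<in> HF" using left(1) cM by blast
    obtain g where g: "x' = cls g" "g \<in> HF" using left(2) cM by blast
    note x = f(1) g(1) note a = f(2) g(2)
    have v: "v \<in> Sp" using left(3) by (simp only: specht_module_simps(1))
    note k = gen[OF HFa[OF a] v] gen[OF a(1) v] gen[OF a(2) v]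
    show ?thesis unfolding left(4) x addM[OF a] using kd[OF kd[OF k(1,2)] k(3)]
      by (simp add: hd[OF kd[OF k(1,2)] k(3)] hd[OF k(1,2)] hg[OF HFa[OF a] v] hg[OF a(1) v] hg[OF a(2) v] phi_linear)
  next
    case (right x v w)
    obtain f where x: "x = cls f" and a: "f \<in> HF" using right(1) cM by blast
    have v: "v \<in> Sp" "w \<in> Sp" using right(2,3) by (simp_all only: specht_module_simps(1))
    note s = Sp_add[OF v] note k = gen[OF a s] gen[OF a v(1)] gen[OF a v(2)]
    show ?thesis unfolding right(4) x sa using kd[OF kd[OF k(1,2)] k(3)]
      by (simp add: hd[OF kd[OF k(1,2)] k(3)] hd[OF k(1,2)] hg[OF a s] hg[OF a v(1)] hg[OF a v(2)] phi_linear)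
  next
    case (balanced x z v)
    obtain f where x: "x = cls f" and a: "f \<in> HF" using balanced(1) cM by blast
    have v: "v \<in> Sp" using balanced(3) by (simp only: specht_module_simps(1))
    note k = gen[OF right_mult_HF[of f z] v] gen[OF a ga_closed[OF v]]
    show ?thesis unfolding balanced(4) x sm right_action_cls[OF a] using kd[OF k]
      by (simp add: hd[OF k] hg[OF right_mult_HF v] hg[OF a ga_closed[OF v]] phi_balanced)
  qed
  have Ks: "subgroup ?K ?F" by (rule F.generate_is_subgroup) (use relF in blast)
  have K0: "0 \<in> ?K" using subgroup.one_closed[OF Ks] by simp
  have Kc: "x \<in> ?K \<Longrightarrow> ?ok x" for x using subgroup.mem_carrier[OF Ks] by simp
  have Ka: "x \<in> ?K \<Longrightarrow> y \<in> ?K \<Longrightarrow> x + y \<in> ?K" for x y using subgroup.m_closed[OF Ks, of x y] by simp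
  have Kn: "x \<in> ?K \<Longrightarrow> - x \<in> ?K" for x using subgroup.m_inv_closed[OF Ks, of x] Kc[of x] by simp
  have Kd: "x \<in> ?K \<Longrightarrow> y \<in> ?K \<Longrightarrow> x - y \<in> ?K" for x y using Ka[OF _ Kn, of x y] by simp
  have Ksum: "(\<And>i. i \<in> Q \<Longrightarrow> g i \<in> ?K) \<Longrightarrow> sum g Q \<in> ?K" for g and Q :: "diagram set"
    by (induction Q rule: infinite_finite_induct) (simp_all add: K0 Ka)
  have Kr: "x \<in> ?rel \<Longrightarrow> x \<in> ?K" for x by (rule generate.incl)
  have "subgroup {c \<in> carrier ?F. h c = (\<lambda>q T. 0)} ?F"
    by (rule F.subgroupI) (use ka hd[of 0] in \<open>auto simp: ha h0\<close>)
  hence Kh: "?K \<subseteq> {c \<in> carrier ?F. h c = (\<lambda>q T. 0)}" by (intro F.generate_subgroup_incl) (use relF in blast)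
  \<comment> \<open>Suggested by the averaging formula: F is represented by the sum over q of q
    tensor F(q), divided by the order of the group.\<close>
  define \<psi> :: "(diagram \<Rightarrow> (nat \<Rightarrow> tabloid) \<Rightarrow> complex) \<Rightarrow> _" where "\<psi> F = (\<Sum>q\<in>H. frag_of (cls (\<lambda>p. ?c * bv q p), F q))" for F
  have \<psi>c: "?ok (\<psi> F)" if "F \<in> model" for F
    using sum_closed_free_Abelian_group[of H "\<lambda>q. frag_of (cls (\<lambda>p. ?c * bv q p), F q)" ?A] clsM[OF bvH] modelD(1)[OF that]
    by (simp add: \<psi>_def)
  have h\<psi>: "h (\<psi> F) = F" if F: "F \<in> model" for F
  proof -
    have "?ok (\<Sum>q\<in>Q. frag_of (cls (\<lambda>p. ?c * bv q p), F q)) \<and>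
       h (\<Sum>q\<in>Q. frag_of (cls (\<lambda>p. ?c * bv q p), F q)) = (\<lambda>q' T. \<Sum>q\<in>Q. \<phi> (\<lambda>p. ?c * bv q p) (F q) q' T)" if "Q \<subseteq> H" for Q
      using finite_subset[OF that finite_half] that
    proof (induction Q rule: finite_induct)
      case (insert x Q)
      have x: "x \<in> H" using insert.prems by blast
      note k = gen[OF bvH[OF x] modelD(1)[OF F, of x]]
      show ?case using insert ka[OF k, of "\<Sum>q\<in>Q. frag_of (cls (\<lambda>p. ?c * bv q p), F q)"]
        by (simp add: ha[OF k] hg[OF bvH[OF x] modelD(1)[OF F]] del: mem_Collect_eq)
    qed (simp add: h0)
    from this[OF order_refl] show ?thesis unfolding \<psi>_def using model_eq_sum_phi[OF F] by (simp add: fun_eq_iff)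
  qed
  have \<psi>a: "\<psi> (\<lambda>q T. F q T + F' q T) - \<psi> F - \<psi> F' \<in> ?K" if "F \<in> model" "F' \<in> model" for F F'
    unfolding \<psi>_def sum_subtractf[symmetric]
    by (intro Ksum Kr rel2 clsM[OF bvH] modelD(1)[OF that(1)] modelD(1)[OF that(2)])
  have \<psi>0: "\<psi> (\<lambda>q T. 0) \<in> ?K" using Kn[OF \<psi>a[OF model_zero model_zero]] by simp
  have fsum: "frag_of (cls (\<lambda>p. \<Sum>q\<in>Q. g q p), v) - (\<Sum>q\<in>Q. frag_of (cls (g q), v)) \<in> ?K"
    if v: "v \<in> Sp" and g: "\<And>q. g q \<in> HF" and Q: "finite Q" for g v and Q :: "diagram set"
    using Q
  proof (induction Q rule: finite_induct)
    case empty
    show ?case using Kn[OF Kr[OF rel1[of "\<lambda>p. 0" "\<lambda>p. 0", OF _ _ v]]] by simp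
  next
    case (insert x Q)
    have "(\<lambda>p. \<Sum>q\<in>Q. g q p) \<in> HF" using g by simp
    from Ka[OF Kr[OF rel1[OF g this v]] insert.IH] show ?case using insert(1,2) by (simp add: algebra_simps)
  qed
  \<comment> \<open>Every tensor can be rewritten modulo the relations into the averaged form. As
    \<open>h\<close> vanishes on the relations, this identifies the subgroup they generate with the
    kernel.\<close>
  have \<psi>h: "\<psi> (h c) - c \<in> ?K" if "?ok c" for c
    using that
  proof (induction c rule: free_Abelian_group_induct[where S = ?A, consumes 1, case_names zero diff base])
    case zero show ?case using \<psi>0 by (simp add: h0)
  next
    case (diff x y)
    have "h x = (\<lambda>q T. h (x - y) q T + h y q T)" using hd[OF diff.hyps(1,2)] by simp
    hence "\<psi> (h x) - \<psi> (h (x - y)) - \<psi> (h y) \<in> ?K" using \<psi>a[OF hc[OF kd[OF diff.hyps(1,2)]] hc[OF diff.hyps(2)]] by simp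
    from Kd[OF Kd[OF diff.IH(1,2)] this] show ?case by (simp add: algebra_simps)
  next
    case (base x)
    obtain f v where x: "x = (cls f, v)" "f \<in> HF" "v \<in> Sp" using base.hyps cM by (cases x) auto
    let ?z = "\<lambda>q \<sigma>. if \<sigma> \<in> carrier G then f (pm \<sigma> q) else 0"
    let ?g = "\<lambda>q. right_mult (\<lambda>p. ?c * bv q p) (?z q)"
    have z: "\<phi> f v q = ga (?z q) v" if "q \<in> H" for q using that by (simp add: \<phi>_def group_act_def)
    \<comment> \<open>The group algebra element that produces the value at q is moved from the right
      factor to the left one; the left factors then add up to \<open>f\<close>.\<close>
    have "(\<Sum>q\<in>H. frag_of (cls (?g q), v) - frag_of (cls (\<lambda>p. ?c * bv q p), \<phi> f v q)) \<in> ?K"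
      by (rule Ksum) (use rel3[OF bvH _ x(3)] in \<open>auto simp: z intro!: Kr\<close>)
    moreover have "frag_of (cls (\<lambda>q'. \<Sum>q\<in>H. ?g q q'), v) - (\<Sum>q\<in>H. frag_of (cls (?g q), v)) \<in> ?K"
      by (rule fsum[OF x(3) right_mult_HF finite_half])
    ultimately have "- (frag_of (cls f, v) - (\<Sum>q\<in>H. frag_of (cls (\<lambda>p. ?c * bv q p), \<phi> f v q))) \<in> ?K"
      using Kn[OF Ka] unfolding sum_right_mult[OF x(2)] sum_subtractf by fastforce
    thus ?case unfolding x(1) hg[OF x(2,3)] \<psi>_def by simp
  qed
  have Kiff: "c \<in> ?K \<longleftrightarrow> ?ok c \<and> h c = (\<lambda>q T. 0)" for c
    using Kh \<psi>h[of c] Kn[OF Kd[OF _ \<psi>0, of "\<psi> (h c) - c"]] by auto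
  define \<Psi> where "\<Psi> F = {c. ?ok c \<and> h c = F}" for F
  have rc: "d \<in> ?K #>\<^bsub>?F\<^esub> c \<longleftrightarrow> (\<exists>k\<in>?K. d = k + c)" for c d by (simp add: r_coset_def)
  have sm: "d \<in> set_mult ?F X Y \<longleftrightarrow> (\<exists>x\<in>X. \<exists>y\<in>Y. d = x + y)" for d X Y by (simp add: set_mult_def)
  have coset: "?K #>\<^bsub>?F\<^esub> c = \<Psi> (h c)" if c: "?ok c" for c
  proof (intro equalityI subsetI)
    fix d assume "d \<in> ?K #>\<^bsub>?F\<^esub> c"
    then obtain k where "k \<in> ?K" "d = k + c" unfolding rc by blast
    thus "d \<in> \<Psi> (h c)" using c ka[of k c] by (simp add: Kiff \<Psi>_def ha)
  next
    fix d assume "d \<in> \<Psi> (h c)"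
    hence "d - c \<in> ?K" "d = (d - c) + c" using c kd[of d c] by (auto simp: Kiff \<Psi>_def hd)
    thus "d \<in> ?K #>\<^bsub>?F\<^esub> c" unfolding rc by blast
  qed
  have S: "carrier S = rcosets\<^bsub>?F\<^esub> ?K" "\<zero>\<^bsub>S\<^esub> = ?K" "add S = set_mult ?F"
    "\<And>r X. r \<odot>\<^bsub>S\<^esub> X = (\<Union>c\<in>X. ?K #>\<^bsub>?F\<^esub> frag_extend (\<lambda>(x, y). frag_of (r \<odot>\<^bsub>M\<^esub> x, y)) c)"
    by (simp_all add: standard_module_def tensor_module_def Let_def size_mu specht_module_simps)
  have ne: "\<psi> F \<in> \<Psi> F" if "F \<in> model" for F using \<psi>c[OF that] h\<psi>[OF that] by (simp add: \<Psi>_def)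
  have "left_module_iso R V S \<Psi>"
  proof (intro left_module_iso.intro V_left_module left_module_iso_axioms.intro)
    have "inj_on \<Psi> model"
      by (rule inj_onI) (metis (mono_tags, lifting) ne \<Psi>_def mem_Collect_eq)
    moreover have "\<Psi> ` model = carrier S"
    proof -
      have "F \<in> h ` {c. ?ok c}" if "F \<in> model" for F
        by (rule image_eqI[of _ _ "\<psi> F"]) (simp_all add: h\<psi>[OF that] \<psi>c[OF that])
      hence "h ` {c. ?ok c} = model" using hc by blast
      hence "\<Psi> ` model = (\<lambda>c. \<Psi> (h c)) ` {c. ?ok c}" by (metis image_image)
      also have "\<dots> = (\<lambda>c. ?K #>\<^bsub>?F\<^esub> c) ` carrier ?F" by (rule image_cong) (auto simp: coset)
      finally show ?thesis unfolding S RCOSETS_def by auto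
    qed
    ultimately show "bij_betw \<Psi> (carrier V) (carrier S)" by (simp add: bij_betw_def V_simps)
    show "\<Psi> \<zero>\<^bsub>V\<^esub> = \<zero>\<^bsub>S\<^esub>" unfolding S V_simps using Kiff by (auto simp: \<Psi>_def)
  next
    fix F F' assume "F \<in> carrier V" "F' \<in> carrier V"
    hence F: "F \<in> model" "F' \<in> model" by (simp_all add: V_simps)
    show "\<Psi> (F \<oplus>\<^bsub>V\<^esub> F') = \<Psi> F \<oplus>\<^bsub>S\<^esub> \<Psi> F'"
    proof (intro equalityI subsetI)
      fix c assume "c \<in> \<Psi> (F \<oplus>\<^bsub>V\<^esub> F')"
      hence c: "?ok c" "h c = (\<lambda>q T. F q T + F' q T)" by (simp_all add: \<Psi>_def V_simps)
      have "c - \<psi> F' \<in> \<Psi> F" using kd[OF c(1) \<psi>c[OF F(2)]] c by (simp add: \<Psi>_def hd[OF c(1) \<psi>c[OF F(2)]] h\<psi>[OF F(2)])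
      moreover have "c = (c - \<psi> F') + \<psi> F'" by simp
      ultimately show "c \<in> \<Psi> F \<oplus>\<^bsub>S\<^esub> \<Psi> F'" unfolding S sm using ne[OF F(2)] by blast
    next
      fix c assume "c \<in> \<Psi> F \<oplus>\<^bsub>S\<^esub> \<Psi> F'"
      then obtain x y where "x \<in> \<Psi> F" "y \<in> \<Psi> F'" "c = x + y" unfolding S sm by blast
      thus "c \<in> \<Psi> (F \<oplus>\<^bsub>V\<^esub> F')" using ka[of x y] by (simp add: \<Psi>_def V_simps ha)
    qed
  next
    fix r F assume r: "r \<in> carrier R" and "F \<in> carrier V"
    hence F: "F \<in> model" by (simp add: V_simps)
    let ?E = "frag_extend (\<lambda>(x, y). frag_of (r \<odot>\<^bsub>M\<^esub> x, y)) :: ((diagram \<Rightarrow> complex) set \<times> ((nat \<Rightarrow> tabloid) \<Rightarrow> complex) \<Rightarrow>\<^sub>0 int) \<Rightarrow> _"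
    \<comment> \<open>Scalars act on cosets through formal sums, so the compatibility with
      \<open>h\<close> is checked there, by induction from the generators.\<close>
    have E: "?ok (?E c) \<and> h (?E c) = act r (h c)" if "?ok c" for c
      using that
    proof (induction c rule: free_Abelian_group_induct[where S = ?A, consumes 1, case_names zero diff base])
      case zero show ?case using act_linear(2)[OF r model_zero model_zero] by (simp add: h0 fun_eq_iff)
    next
      case (diff x y)
      have "h x = (\<lambda>q T. h (x - y) q T + h y q T)" using hd[OF diff.hyps(1,2)] by simp
      hence "act r (h x) = (\<lambda>q T. act r (h (x - y)) q T + act r (h y) q T)"
        using act_linear(2)[OF r hc[OF kd[OF diff.hyps(1,2)]] hc[OF diff.hyps(2)]] by simp
      thus ?case using diff.IH kd[of "?E x" "?E y"] by (simp add: frag_extend_diff hd)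
    next
      case (base x)
      obtain f v where x: "x = (cls f, v)" "f \<in> HF" "v \<in> Sp" using base.hyps cM by (cases x) auto
      show ?case unfolding x(1) using left_ideal_simps(2)[OF x(2) r] gen[OF half_part_HF x(3)]
        hg[OF half_part_HF x(3)] hg[OF x(2,3)] act_phi[OF r x(2)] by simp
    qed
    have "r \<odot>\<^bsub>S\<^esub> \<Psi> F = (\<Union>c\<in>\<Psi> F. \<Psi> (act r F))"
      unfolding S using E by (intro SUP_cong refl) (simp add: \<Psi>_def coset[unfolded \<Psi>_def])
    thus "\<Psi> (r \<odot>\<^bsub>V\<^esub> F) = r \<odot>\<^bsub>S\<^esub> \<Psi> F" using ne[OF F] by (auto simp: V_simps)
  qed
  thus ?thesis by blast
qed

end

section \<open>Composition series\<close>

context standard_layer begin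

sublocale V: left_module R V by (rule V_left_module)

lemma R_scalar: "(\<lambda>q. c * \<one>\<^bsub>R\<^esub> q) \<in> carrier R"
  by (rule R_scale[OF R.one_closed])

lemma submodule_linear:
  assumes N: "submodule N R V"
  shows "F \<in> N \<Longrightarrow> F \<in> model" "F \<in> N \<Longrightarrow> (\<lambda>q T. c * F q T) \<in> N" "F \<in> N \<Longrightarrow> F' \<in> N \<Longrightarrow> (\<lambda>q T. F q T + F' q T) \<in> N"
    "(\<lambda>q T. 0) \<in> N" "r \<in> carrier R \<Longrightarrow> F \<in> N \<Longrightarrow> act r F \<in> N"
proof -
  note d = V.submoduleD[OF N, unfolded V_simps]
  show 1: "F \<in> N \<Longrightarrow> F \<in> model" for F by (rule d(5))
  show "F \<in> N \<Longrightarrow> (\<lambda>q T. c * F q T) \<in> N" using d(4)[OF R_scalar, of F c] by (simp add: act_linear 1)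
  show "F \<in> N \<Longrightarrow> F' \<in> N \<Longrightarrow> (\<lambda>q T. F q T + F' q T) \<in> N" "(\<lambda>q T. 0) \<in> N" "r \<in> carrier R \<Longrightarrow> F \<in> N \<Longrightarrow> act r F \<in> N"
    by (rule d(3) d(2) d(4); assumption?)+
qed

lemma submodule_sum:
  "submodule N R V \<Longrightarrow> (\<And>i. i \<in> A \<Longrightarrow> g i \<in> N) \<Longrightarrow> (\<lambda>q T. \<Sum>i\<in>A. g i q T) \<in> N"
proof (induction A rule: infinite_finite_induct)
  case (insert x A)
  thus ?case using submodule_linear(3)[of N "g x" "\<lambda>q T. \<Sum>i\<in>A. g i q T"] by simp
qed (simp_all add: submodule_linear(4))

text \<open>The positions of leading coefficients play the role of the dimension.\<close>

lemma exists_strict_mono_rank: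
  "\<exists>d :: _ \<Rightarrow> nat. \<forall>N N'. submodule N R V \<longrightarrow> submodule N' R V \<longrightarrow> N \<subset> N' \<longrightarrow> d N < d N'"
proof -
  let ?X = "H \<times> multi_tabloids l \<mu>"
  have fin: "finite ?X" using finite_half finite_multi_tabloids by blast
  obtain s where s: "bij_betw s ?X {0..<card ?X}" using ex_bij_betw_finite_nat[OF fin] by blast
  define L where "L N = {x \<in> ?X. \<exists>F\<in>N. F (fst x) (snd x) \<noteq> 0 \<and> (\<forall>y\<in>?X. s y < s x \<longrightarrow> F (fst y) (snd y) = 0)}"
    for N :: "(diagram \<Rightarrow> (nat \<Rightarrow> tabloid) \<Rightarrow> complex) set"
  have "card (L N) < card (L N')" if N: "submodule N R V" "submodule N' R V" "N \<subset> N'" for N N'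
  proof (rule psubset_card_mono)
    show "finite (L N')" using fin by (simp add: L_def)
    have "N' \<subseteq> N" if L: "L N' = L N"
    proof -
      \<comment> \<open>Induction from the last position: \<open>j\<close> bounds the number of
        positions, counted from the end, at which F may be nonzero.\<close>
      have "\<forall>F\<in>N'. (\<forall>y\<in>?X. s y < card ?X - j \<longrightarrow> F (fst y) (snd y) = 0) \<longrightarrow> F \<in> N" for j
      proof (induction j)
        case 0
        show ?case
        proof (intro ballI impI)
          fix F assume F: "F \<in> N'" "\<forall>y\<in>?X. s y < card ?X - 0 \<longrightarrow> F (fst y) (snd y) = 0"
          note m = submodule_linear(1)[OF N(2) F(1)]
          have "F q T = 0" for q T
          proof (cases "(q, T) \<in> ?X")
            case True
            hence "s (q, T) < card ?X" using bij_betwE[OF s] by auto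
            thus ?thesis using F(2) True by force
          next
            case False thus ?thesis using modelD(2)[OF m, of q] specht_carrier_support[OF modelD(1)[OF m], of T q] by auto
          qed
          hence "F = (\<lambda>q T. 0)" by blast
          thus "F \<in> N" using submodule_linear(4)[OF N(1)] by simp
        qed
      next
        case (Suc j)
        show ?case
        proof (intro ballI impI)
          fix F assume F: "F \<in> N'" "\<forall>y\<in>?X. s y < card ?X - Suc j \<longrightarrow> F (fst y) (snd y) = 0"
          show "F \<in> N"
          proof (cases "\<exists>x\<in>?X. s x = card ?X - Suc j \<and> F (fst x) (snd x) \<noteq> 0")
            case False
            have "\<forall>y\<in>?X. s y < card ?X - j \<longrightarrow> F (fst y) (snd y) = 0"
            proof (intro ballI impI)
              fix y assume "y \<in> ?X" "s y < card ?X - j"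
              thus "F (fst y) (snd y) = 0" using False F(2) by (cases "s y < card ?X - Suc j") auto
            qed
            thus ?thesis using Suc F(1) by blast
          next
            case True
            then obtain x where x: "x \<in> ?X" "s x = card ?X - Suc j" "F (fst x) (snd x) \<noteq> 0" by blast
            hence "x \<in> L N" using F L[symmetric] unfolding L_def by auto
            then obtain G where G: "G \<in> N" "G (fst x) (snd x) \<noteq> 0" "\<And>y. y \<in> ?X \<Longrightarrow> s y < s x \<Longrightarrow> G (fst y) (snd y) = 0"
              unfolding L_def by blast
            \<comment> \<open>Gaussian elimination: this multiple of G cancels the coefficient of F
              at x without disturbing earlier positions.\<close>
            define c where "c = F (fst x) (snd x) / G (fst x) (snd x)"
            let ?F = "\<lambda>q T. F q T + (- c) * G q T"
            have GN: "G \<in> N'" using G(1) N(3) by blast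
            have FN: "?F \<in> N'" by (rule submodule_linear(3)[OF N(2) F(1) submodule_linear(2)[OF N(2) GN]])
            have "?F (fst y) (snd y) = 0" if y: "y \<in> ?X" "s y < card ?X - j" for y
            proof (cases "s y < s x")
              case True thus ?thesis using F(2)[THEN bspec, OF y(1)] G(3)[OF y(1)] x(2) by simp
            next
              case False
              hence "s y = s x" using y(2) x(2) by simp
              hence "y = x" using inj_onD[OF bij_betw_imp_inj_on[OF s]] x(1) y(1) by blast
              thus ?thesis using G(2) by (simp add: c_def)
            qed
            hence "\<forall>y\<in>?X. s y < card ?X - j \<longrightarrow> ?F (fst y) (snd y) = 0" by blast
            from Suc[THEN bspec, OF FN, THEN mp, OF this] have "?F \<in> N" .
            from submodule_linear(3)[OF N(1) this submodule_linear(2)[OF N(1) G(1), of c]] show ?thesis by simp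
          qed
        qed
      qed
      from this[of "card ?X"] show ?thesis by auto
    qed
    moreover have "L N \<subseteq> L N'" using N(3) by (auto simp: L_def)
    ultimately show "L N \<subset> L N'" using N(3) by blast
  qed
  thus ?thesis by (intro exI[of _ "\<lambda>N. card (L N)"]) blast
qed

end

section \<open>Weight idempotents, generation of the standard modules and separation of
  heads\<close>

section \<open>Idempotents of given weight\<close>

text \<open>The index with r parts of size 1. The through blocks of its diagram \<open>a\<close> are
  singletons, which no set can split.\<close>

definition ones :: "nat \<Rightarrow> nat \<Rightarrow> nat" where
  "ones r = (\<lambda>i. if i = 1 then r else 0)"

definition weight_idempotent :: "complex \<Rightarrow> nat \<Rightarrow> nat \<Rightarrow> nat \<Rightarrow> diagram \<Rightarrow> complex" where
  "weight_idempotent \<delta> l n r = (\<lambda>q. inverse (\<delta> ^ card (cut_blocks l n r)) * basis_vector (a_diagram l n (ones r)) q)"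

text \<open>A basis for the image of the weight idempotent on the left ideal: it fixes these
  diagrams, and whatever it is applied to becomes supported on them.\<close>

definition core_diagrams :: "nat \<Rightarrow> nat \<Rightarrow> nat \<Rightarrow> (nat \<Rightarrow> nat) \<Rightarrow> diagram set" where
  "core_diagrams l n r m = {q \<in> half_diagrams l n m. \<forall>u\<in>cut_blocks l n r. row_pair u {} \<in> q}"

lemma weight_ones: "1 \<le> l \<Longrightarrow> weight l (ones r) = r"
proof -
  assume l: "1 \<le> l"
  have "weight l (ones r) = (\<Sum>i=1..l. if i = 1 then r else 0)" unfolding weight_def ones_def by (intro sum.cong) auto
  thus ?thesis using l by (simp del: One_nat_def)
qed

lemma ones_index: "1 \<le> l \<Longrightarrow> m \<in> index_set l n \<Longrightarrow> ones (weight l m) \<in> index_set l n"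
  using weight_ones[of l] by (auto simp: index_set_def ones_def)

lemma through_block_ones: "b \<in> through_blocks l (ones r) \<Longrightarrow> \<exists>k. b = {k}"
  by (elim through_blocksE) (auto simp: ones_def card_1_singleton_iff[symmetric] split: if_splits)

lemma mem_flip: "p \<in> diagrams n n \<Longrightarrow> row_pair x y \<in> flip p \<longleftrightarrow> row_pair y x \<in> p"
proof -
  assume "p \<in> diagrams n n"
  then obtain P W W' where p: "p = joined P W W'" using diagram_eq_joined by metis
  show ?thesis unfolding p flip_joined mem_joined by auto
qed

lemma relcomp_converse: "inj_on snd P \<Longrightarrow> P O P\<inverse> = Id_on (fst ` P)"
  by (auto simp: inj_on_def Id_on_def image_iff) force+

lemma converse_relcomp': "inj_on fst P \<Longrightarrow> P\<inverse> O P = Id_on (snd ` P)"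
  by (auto simp: inj_on_def Id_on_def image_iff) force+

lemma card_blocks_of_size:
  assumes "inj_on fst P" "inj_on snd P" "\<And>x y. (x, y) \<in> P \<Longrightarrow> card x = card y"
  shows "card {x \<in> fst ` P. card x = i} = card {y \<in> snd ` P. card y = i}"
proof -
  have "{x \<in> fst ` P. card x = i} = fst ` {z \<in> P. card (fst z) = i}" "{y \<in> snd ` P. card y = i} = snd ` {z \<in> P. card (snd z) = i}"
    by auto
  moreover have "{z \<in> P. card (fst z) = i} = {z \<in> P. card (snd z) = i}" using assms(3) by force
  ultimately show ?thesis using assms(1,2) by (simp add: card_image inj_on_subset)
qed

context
  fixes l n r :: nat
  assumes l: "1 \<le> l" and r: "ones r \<in> index_set l n"
begin

private abbreviation "Er \<equiv> a_diagram l n (ones r)"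
private abbreviation "Cr \<equiv> cut_blocks l n r"

private lemma E: "Er \<in> half_diagrams l n (ones r)" "Er \<in> tonal_diagrams l n" "flip Er = Er"
  using a_diagram_half[OF l r] by (simp_all add: half_diagrams_def a_diagram_eq[OF l] flip_joined)

text \<open>The mirror image of the survival of cut blocks under left multiplication.\<close>

lemma weight_idempotent_cut:
  assumes p: "p \<in> tonal_diagrams l n" and u: "u \<in> Cr"
  shows "row_pair u {} \<in> dcomp n Er p"
proof -
  have "row_pair {} u \<in> dcomp n (flip p) Er"
    by (rule comp_half_bottom(2)[OF l r flip_tonal[OF p] E(1)]) (simp add: u weight_ones[OF l])
  hence "row_pair {} u \<in> flip (dcomp n Er p)"
    using flip_comp(1)[OF tonal_diagramsD[OF E(2)] tonal_diagramsD[OF p]] E(3) by simp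
  thus ?thesis using mem_flip[OF diagram_comp_closed[OF tonal_diagramsD[OF E(2)] tonal_diagramsD[OF p]]] by simp
qed

text \<open>The mirror image of \<open>diagonal_absorb\<close>, whose condition on through blocks
  holds for every set because they are singletons.\<close>

lemma weight_idempotent_absorb:
  assumes q: "q \<in> diagrams n n" and u: "\<And>u. u \<in> Cr \<Longrightarrow> row_pair u {} \<in> q"
  shows "dcomp n Er q = q" "loops n Er q = card Cr"
proof -
  note f = flip_closed[OF q]
  have rs: "row_split n (through_blocks l (ones r)) Cr" using blocks_row_split[OF l r] by (simp add: weight_ones[OF l])
  have B: "b \<subseteq> g \<or> b \<inter> g = {}" if "b \<in> through_blocks l (ones r)" for b g using through_block_ones[OF that] by auto
  have C: "row_pair {} v \<in> flip q" if "v \<in> Cr" for v using mem_flip[OF q] u[OF that] by simp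
  have e: "joined (Id_on (through_blocks l (ones r))) Cr Cr = Er" by (simp add: a_diagram_eq[OF l] weight_ones[OF l])
  note d = diagonal_absorb[OF f(1) rs B C, unfolded e]
  note fc = flip_comp[OF tonal_diagramsD[OF E(2)] q, unfolded E(3)]
  have "flip q = flip (dcomp n Er q)" using d(1) fc(1) by simp
  thus "dcomp n Er q = q"
    using f(3) flip_closed(3)[OF diagram_comp_closed[OF tonal_diagramsD[OF E(2)] q]] by metis
  show "loops n Er q = card Cr" using d(2) fc(2) by simp
qed

lemma weight_idempotent_closed: "weight_idempotent \<delta> l n r \<in> carrier (tonal_algebra \<delta> l n)"
  using E(2) by (auto simp: weight_idempotent_def tonal_algebra_simps basis_vector_def)

lemma weight_idempotent_idem:
  assumes d: "\<delta> \<noteq> 0"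
  shows "weight_idempotent \<delta> l n r \<otimes>\<^bsub>tonal_algebra \<delta> l n\<^esub> weight_idempotent \<delta> l n r = weight_idempotent \<delta> l n r"
proof -
  interpret tonal_layer \<delta> l n "ones r" by unfold_locales (rule l d r)+
  have c: "cp Er Er = Er" "cl Er Er = card Cr" using half_absorb[OF l r E(1)] by (simp_all add: weight_ones[OF l])
  show ?thesis unfolding weight_idempotent_def R_mult_scale bv_mult[OF E(2) E(2)] c using d by (auto simp: fun_eq_iff)
qed

text \<open>A count of the top row: the prescribed cut blocks take n - r vertices, and each
  propagating block is at least as large as its partner below, where the sizes sum to the weight. In
  the case of equality all these estimates are tight.\<close>

lemma core_diagram_cases:
  assumes m: "m \<in> index_set l n" and q: "q \<in> core_diagrams l n r m"
  shows "weight l m \<le> r"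
    "weight l m = r \<Longrightarrow> \<exists>P. joinable n P Cr Cr \<and> snd ` P = through_blocks l m \<and> q = joined P Cr Cr \<and> (\<forall>x y. (x, y) \<in> P \<longrightarrow> card x = card y)"
proof -
  let ?C = "cut_blocks l n (weight l m)"
  have qh: "q \<in> half_diagrams l n m" using q by (simp add: core_diagrams_def)
  obtain P W where j: "joinable n P W ?C" "snd ` P = through_blocks l m" "q = joined P W ?C"
    "\<And>z. z \<in> P \<Longrightarrow> card (snd z) \<le> card (fst z)" using half_diagramE[OF l m qh] by metis
  have W: "Cr \<subseteq> W" using q joined_parts(2)[OF j(1)] j(3) by (auto simp: core_diagrams_def)
  note rs = row_splitD[OF joinableD(1)[OF j(1)]]
  have n: "n = (\<Sum>z\<in>P. card (fst z)) + (\<Sum>u\<in>W. card u)" by (rule sum_card_fst[OF j(1)])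
  have Us: "(\<Sum>u\<in>Cr. card u) = n - r" and rn: "r \<le> n"
    using sum_cut_blocks[OF l r] index_setD(2)[OF r] by (simp_all add: weight_ones[OF l])
  have Ws: "(\<Sum>u\<in>W. card u) = (n - r) + (\<Sum>u\<in>W - Cr. card u)"
    using sum.subset_diff[OF W rs(8), of card] Us by simp
  have Ps: "(\<Sum>z\<in>P. card (snd z)) = weight l m"
    using sum.reindex[OF joinableD(6)[OF j(1)], of card] sum_through_blocks[OF l m] by (simp add: j(2) o_def)
  have le: "(\<Sum>z\<in>P. card (snd z)) \<le> (\<Sum>z\<in>P. card (fst z))" by (rule sum_mono) (rule j(4))
  show "weight l m \<le> r" using n Ws Ps le rn by linarith
  assume w: "weight l m = r"
  have e: "(\<Sum>z\<in>P. card (snd z)) = (\<Sum>z\<in>P. card (fst z))" and 0: "(\<Sum>u\<in>W - Cr. card u) = 0"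
    using n Ws Ps le rn w by linarith+
  have "card (snd z) = card (fst z)" if "z \<in> P" for z
    by (rule sum_mono_inv[OF e j(4) that joinableD(7)[OF j(1)]])
  hence c: "\<forall>x y. (x, y) \<in> P \<longrightarrow> card x = card y" by force
  have "W - Cr = {}"
  proof (rule ccontr)
    assume "W - Cr \<noteq> {}"
    then obtain u where u: "u \<in> W - Cr" by blast
    hence "card u = 0" using 0 rs(8) by simp
    thus False using u rs(3)[of u] rs(9)[of u] by simp
  qed
  hence "W = Cr" using W by blast
  thus "\<exists>P. joinable n P Cr Cr \<and> snd ` P = through_blocks l m \<and> q = joined P Cr Cr \<and> (\<forall>x y. (x, y) \<in> P \<longrightarrow> card x = card y)"
    using j(1-3) c w by blast
qed

end

context tonal_layer begin

abbreviation "H0 \<equiv> core_diagrams l n (weight l m) m"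

lemmas ones_m = ones_index[OF l m]

lemma core_half: "q \<in> H0 \<Longrightarrow> q \<in> H"
  by (simp add: core_diagrams_def)

lemma coreE:
  assumes "q \<in> H0"
  obtains P where "joinable n P C C" "snd ` P = B" "q = joined P C C" "\<And>x y. (x, y) \<in> P \<Longrightarrow> card x = card y"
  using core_diagram_cases(2)[OF l ones_m m assms refl] by blast

lemma a_core: "a \<in> H0"
  using a_closed(1) by (auto simp: core_diagrams_def a_diagram_eq[OF l] mem_joined)

lemma transporter_joined:
  assumes p: "joinable n P W C" "snd ` P = B" and q: "joinable n P' C C" "snd ` P' = B"
  shows "joinable n (P O P'\<inverse>) W C" "cp (joined P W C) (flip (joined P' C C)) = joined (P O P'\<inverse>) W C" "snd ` (P O P'\<inverse>) = fst ` P'"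
proof -
  have q': "joinable n (P'\<inverse>) C C" using q(1) joinable_converse by blast
  have im: "fst ` (P'\<inverse>) = snd ` P'" "snd ` (P'\<inverse>) = fst ` P'" by force+
  hence mid: "snd ` P = fst ` (P'\<inverse>)" using p(2) q(2) by simp
  show "joinable n (P O P'\<inverse>) W C" by (rule joinable_relcomp[OF p(1) q' mid])
  show "cp (joined P W C) (flip (joined P' C C)) = joined (P O P'\<inverse>) W C"
    unfolding flip_joined by (rule matched_comp(1)[OF p(1) q' mid])
  show "snd ` (P O P'\<inverse>) = fst ` P'" using snd_relcomp[OF mid] im by simp
qed

text \<open>For a diagram \<open>q\<close> in the core, \<open>p q\<^sup>*\<close> sends \<open>q\<close> to \<open>p\<close> and annihilates everything in the core outside the orbit of \<open>q\<close>.\<close>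

lemma transporter:
  assumes p: "p \<in> H" and q: "q \<in> H0" and s: "\<sigma> \<in> carrier G"
  shows "cp p (flip q) \<in> D" "cp (cp p (flip q)) (pm \<sigma> q) = pm \<sigma> p" "cl (cp p (flip q)) (pm \<sigma> q) = card C"
proof -
  note qH = core_half[OF q]
  let ?x = "cp p (flip q)"
  show x: "?x \<in> D" by (rule diagram_comp_tonal[OF half_tonal[OF p] flip_tonal[OF half_tonal[OF qH]]])
  obtain P W where j: "joinable n P W C" "snd ` P = B" "p = joined P W C" using half_diagramE[OF l m p] by metis
  obtain P' where j': "joinable n P' C C" "snd ` P' = B" "q = joined P' C C" using coreE[OF q] by metis
  note t = transporter_joined[OF j(1,2) j'(1,2)]
  have "(P O P'\<inverse>) O P' = P" using converse_relcomp'[OF joinableD(5)[OF j'(1)]] relcomp_Id_on[of P B] j(2) j'(2) by (simp add: O_assoc)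
  hence b: "cp ?x q = p" "cl ?x q = card C"
    using matched_comp[OF t(1) j'(1) t(3)] unfolding j(3) j'(3) t(2) by simp_all
  note as = diagram_comp_assoc[OF tonal_diagramsD[OF x] tonal_diagramsD[OF half_tonal[OF qH]] tonal_diagramsD[OF block_permD(4)[OF s]]]
  show "cp ?x (pm \<sigma> q) = pm \<sigma> p" "cl ?x (pm \<sigma> q) = card C"
    using as unfolding b permute_half(1,2)[OF qH s, symmetric] permute_half(1,2)[OF p s] by (simp_all add: permute_half[OF qH s])
qed

text \<open>If the product with \<open>q'\<close> still has all its through blocks, each propagating
  top block of \<open>q'\<close> contains one of \<open>q\<close>. Comparing numbers makes this
  inclusion a bijection, and since both families cover the same vertices the blocks agree. Admitting
  a second index of the same weight covers both cases in which heads have to be separated.\<close>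

lemma transporter_orbit:
  assumes p: "p \<in> H" and q: "q \<in> H0" and m': "m' \<in> index_set l n" "weight l m' = weight l m"
    and q': "q' \<in> core_diagrams l n (weight l m) m'" and h: "cp (cp p (flip q)) q' \<in> half_diagrams l n m'"
    and le: "(\<Sum>i=1..l. m i) \<le> (\<Sum>i=1..l. m' i)"
  shows "m' = m" "\<exists>\<sigma>\<in>carrier G. q' = pm \<sigma> q"
proof -
  let ?x = "cp p (flip q)" and ?B' = "through_blocks l m'"
  obtain P W where j: "joinable n P W C" "snd ` P = B" "p = joined P W C" using half_diagramE[OF l m p] by metis
  obtain Q where jq: "joinable n Q C C" "snd ` Q = B" "q = joined Q C C" "\<And>x y. (x, y) \<in> Q \<Longrightarrow> card x = card y" using coreE[OF q] by metis
  obtain Q' where jq': "joinable n Q' C C" "snd ` Q' = ?B'" "q' = joined Q' C C" "\<And>x y. (x, y) \<in> Q' \<Longrightarrow> card x = card y"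
    using core_diagram_cases(2)[OF l ones_m m'(1) q' m'(2)] by blast
  note t = transporter_joined[OF j(1,2) jq(1,2)]
  have x: "?x = joined (P O Q\<inverse>) W C" using t(2) j(3) jq(3) by simp
  have xd: "?x \<in> diagrams n n" and qd: "q' \<in> diagrams n n" unfolding x jq'(3) by (rule joined_closed[OF t(1)] joined_closed[OF jq'(1)])+
  obtain Z X where z: "joinable n Z X C" "snd ` Z = ?B'" "cp ?x q' = joined Z X C" using half_diagramE[OF l m'(1) h] m'(2) by metis
  note Y = row_splitD[OF joinableD(1)[OF jq(1)]] and Y' = row_splitD[OF joinableD(1)[OF jq'(1)]]
  note B' = row_splitD[OF joinableD(2)[OF jq'(1)]]
  have "\<exists>y\<in>fst ` Q. y \<subseteq> y'" if y': "y' \<in> fst ` Q'" for y'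
  proof -
    obtain b where b: "(y', b) \<in> Q'" using y' by force
    hence bB: "b \<in> ?B'" "b \<in> snd ` Q' \<union> C" using jq'(2) by force+
    then obtain c where c: "(c, b) \<in> Z" using z(2) by force
    hence rp: "row_pair c b \<in> cp ?x q'" unfolding z(3) mem_joined by blast
    have sub: "c \<subseteq> {1..n}" "b \<subseteq> {1..n}"
      using row_splitD(4)[OF joinableD(1)[OF z(1)], of c] mem_fst_snd(1)[OF c] B'(4)[OF bB(2)] by blast+
    have "compatible (cp ?x q') c b" by (rule compatible_part[OF diagram_comp_closed[OF xd qd] rp])
    \<comment> \<open>The trace of the part on the middle row; among the propagating top blocks of
      \<open>q'\<close> it meets only y'.\<close>
    then obtain g where g: "compatible ?x c g" "compatible q' g b" using compatible_comp_iff[OF xd qd sub] by blast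
    have in_g: "y'' \<inter> g \<noteq> {} \<Longrightarrow> y'' = y'" if y'': "y'' \<in> fst ` Q'" for y''
    proof -
      assume ne: "y'' \<inter> g \<noteq> {}"
      obtain b'' where b'': "(y'', b'') \<in> Q'" using y'' by force
      hence "b'' \<in> snd ` Q' \<union> C" by force
      note B'' = B'(5)[OF this bB(2)] B'(3)[OF this]
      have "unsplit2 y'' b'' g b" using g(2) b'' unfolding jq'(3) compatible_joined by blast
      hence "b'' \<subseteq> b" using ne unfolding unsplit2_def by blast
      hence "b'' = b" using B'' by blast
      thus "y'' = y'" using joinableD(4)[OF jq'(1) b''] b by blast
    qed
    have "unsplit2 y' b g b" using g(2) b unfolding jq'(3) compatible_joined by blast
    hence yg: "y' \<subseteq> g" using B'(3)[OF bB(2)] unfolding unsplit2_def by blast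
    obtain i where i: "i \<in> y'" using Y'(3)[of y'] y' by blast
    have notC: "u \<notin> C" if "k \<in> u" "k \<in> v" "v \<in> fst ` Q'" for k u v using Y'(5)[of u v k] Y'(1) that by blast
    have "i \<in> {1..n}" using Y'(4)[of y'] y' i by blast
    from Y(6)[OF this] obtain y where y: "y \<in> fst ` Q \<union> C" "i \<in> y" by blast
    have yQ: "y \<in> fst ` Q" using notC[OF y(2) i y'] y(1) by blast
    have "y \<in> snd ` (P O Q\<inverse>)" using yQ t(3) by simp
    then obtain d where "(d, y) \<in> P O Q\<inverse>" by (metis imageE prod.collapse)
    hence "unsplit2 d y c g" using g(1) unfolding x compatible_joined by blast
    hence "y \<subseteq> g" using y(2) yg i unfolding unsplit2_def by blast
    have "y \<subseteq> y'"
    proof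
      fix k assume k: "k \<in> y"
      hence "k \<in> {1..n}" using Y(4)[OF y(1)] by blast
      from Y'(6)[OF this] obtain y'' where y'': "y'' \<in> fst ` Q' \<union> C" "k \<in> y''" by blast
      have "y'' \<notin> C" using Y(5)[of y'' y k] Y(1) k y'' yQ by blast
      hence "y'' = y'" using in_g[of y''] y'' k \<open>y \<subseteq> g\<close> by blast
      thus "k \<in> y'" using y'' by simp
    qed
    thus ?thesis using yQ by blast
  qed
  then obtain f where f: "\<And>y'. y' \<in> fst ` Q' \<Longrightarrow> f y' \<in> fst ` Q \<and> f y' \<subseteq> y'" by metis
  have inj: "inj_on f (fst ` Q')"
  proof (rule inj_onI)
    fix u v assume u: "u \<in> fst ` Q'" "v \<in> fst ` Q'" "f u = f v"
    obtain k where "k \<in> f u" using Y(3)[of "f u"] f[OF u(1)] by blast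
    hence "k \<in> u" "k \<in> v" using f[OF u(1)] f[OF u(2)] u(3) by auto
    thus "u = v" using Y'(5)[of u v k] u by blast
  qed
  have cQ: "card (fst ` Q) = (\<Sum>i=1..l. m i)" "card (fst ` Q') = (\<Sum>i=1..l. m' i)"
    using card_image[OF joinableD(5)[OF jq(1)]] card_image[OF joinableD(6)[OF jq(1)]] card_through_blocks[of l m] jq(2)
      card_image[OF joinableD(5)[OF jq'(1)]] card_image[OF joinableD(6)[OF jq'(1)]] card_through_blocks[of l m'] jq'(2) by simp_all
  have im: "f ` fst ` Q' = fst ` Q"
    by (rule card_seteq[OF Y(7)]) (use f cQ le card_image[OF inj] in auto)
  \<comment> \<open>Every vertex of y' lies in a block of \<open>q\<close>, which by surjectivity is
    assigned to some block of \<open>q'\<close> containing it; that block meets y', so it is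
    y'.\<close>
  have "f y' = y'" if y': "y' \<in> fst ` Q'" for y'
  proof
    show "f y' \<subseteq> y'" using f[OF y'] by blast
    show "y' \<subseteq> f y'"
    proof
      fix k assume k: "k \<in> y'"
      hence "k \<in> {1..n}" using Y'(4)[of y'] y' by blast
      from Y(6)[OF this] obtain y where y: "y \<in> fst ` Q \<union> C" "k \<in> y" by blast
      have "y \<notin> C" using Y'(5)[of y y' k] Y'(1) k y y' by blast
      hence "y \<in> f ` fst ` Q'" using y(1) im by simp
      then obtain y2 where y2: "y = f y2" "y2 \<in> fst ` Q'" by (rule imageE)
      hence "y2 = y'" using y2 f[OF y2(2)] Y'(5)[of y2 y' k] k y(2) y' by blast
      thus "k \<in> f y'" using y2(1) y(2) by simp
    qed
  qed
  hence YY: "fst ` Q' = fst ` Q" using im by force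
  show mm: "m' = m"
  proof
    fix i show "m' i = m i"
    proof (cases "i \<in> {1..l}")
      case True
      have "m' i = card {y \<in> fst ` Q'. card y = i}" "m i = card {y \<in> fst ` Q. card y = i}"
        using card_blocks_of_size[OF joinableD(5,6)[OF jq(1)] jq(4), of i] card_blocks_of_size[OF joinableD(5,6)[OF jq'(1)] jq'(4), of i]
          through_blocks_of_card(2)[OF True, of m] through_blocks_of_card(2)[OF True, of m'] unfolding jq(2) jq'(2) by simp_all
      thus ?thesis using YY by simp
    next
      case False thus ?thesis using index_setD(3)[OF m] index_setD(3)[OF m'(1)] by simp
    qed
  qed
  \<comment> \<open>Back along \<open>q\<close> and forth along \<open>q'\<close>: a bijection of
    the bottom blocks that keeps sizes, hence a permutation of blocks.\<close>
  let ?S = "Q\<inverse> O Q'"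
  have cv: "fst ` (K\<inverse>) = snd ` K" "snd ` (K\<inverse>) = fst ` K" for K :: "(nat set \<times> nat set) set" by force+
  have jc: "joinable n (Q\<inverse>) C C" using jq(1) joinable_converse by blast
  have js: "joinable n ?S C C" by (rule joinable_relcomp[OF jc jq'(1)]) (simp add: cv YY)
  have sS: "snd ` ?S = B" using snd_relcomp[of "Q\<inverse>" Q'] cv[of Q] YY jq'(2) mm by simp
  have "fst ` ?S = snd ` (Q'\<inverse> O Q)" using cv(2)[of ?S] by (simp add: converse_relcomp)
  hence fS: "fst ` ?S = B" using snd_relcomp[of "Q'\<inverse>" Q] cv[of Q'] YY jq(2) by simp
  have "card x = card y" if "(x, y) \<in> ?S" for x y using that jq(4) jq'(4) by fastforce
  then obtain \<sigma> where \<sigma>: "\<sigma> \<in> carrier G" "?S = block_perm l m \<sigma>" using block_perm_surj[OF fS sS joinableD(5,6)[OF js]] by blast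
  have "Q O ?S = Id_on (fst ` Q') O Q'"
    using relcomp_converse[OF joinableD(6)[OF jq(1)]] YY by (simp add: O_assoc[symmetric])
  also have "\<dots> = Q'" by force
  finally have "pm \<sigma> q = q'" unfolding jq(3) jq'(3) permute_joined[OF jq(1) \<sigma>(1)] \<sigma>(2)[symmetric] by simp
  thus "\<exists>\<sigma>\<in>carrier G. q' = pm \<sigma> q" using \<sigma>(1) by blast
qed

end

section \<open>Submodules of the standard modules\<close>

context standard_layer begin

abbreviation "e r \<equiv> weight_idempotent \<delta> l n r"

lemma bv_mult_HF:
  assumes f: "f \<in> HF" and x: "x \<in> D"
  shows "(bv x \<star> f) q = (\<Sum>p\<in>H. f p * \<delta> ^ cl x p * of_bool (cp x p = q))"
proof -
  have "(bv x \<star> f) q = (\<Sum>p\<in>D. of_bool (p = x) * (\<Sum>p'\<in>D. f p' * \<delta> ^ cl p p' * of_bool (cp p p' = q)))"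
    unfolding R_mult by (simp add: basis_vector_def mult_ac sum_distrib_left)
  also have "\<dots> = (\<Sum>p\<in>D. f p * \<delta> ^ cl x p * of_bool (cp x p = q))"
    using x by (subst sum_mult_of_bool(2)) (simp_all add: finite_tonal_diagrams)
  also have "\<dots> = (\<Sum>p\<in>H. f p * \<delta> ^ cl x p * of_bool (cp x p = q))"
    by (rule sum.mono_neutral_right[OF finite_tonal_diagrams]) (use f half_tonal in auto)
  finally show ?thesis .
qed

lemma act_bv:
  assumes "F \<in> model" "x \<in> D" "q \<in> H"
  shows "act (bv x) F q T = (\<Sum>p\<in>H. F p T * \<delta> ^ cl x p * of_bool (cp x p = q))"
  using bv_mult_HF[OF modelD(4)[OF assms(1)] assms(2)] assms(3) by (simp add: act_def half_part_in)

lemma act_zero: "r \<in> carrier R \<Longrightarrow> act r (\<lambda>q T. 0) = (\<lambda>q T. 0)"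
  using V.smult_r_null by (simp add: V_simps)

lemma act_sum: "act (\<lambda>q. \<Sum>i\<in>A. g i q) F = (\<lambda>q T. \<Sum>i\<in>A. act (g i) F q T)"
  by (intro ext) (simp add: act_def R_mult_sum half_part_def)

lemma e_support:
  assumes r: "ones r \<in> index_set l n" and F: "F \<in> model" and q: "q \<notin> core_diagrams l n r m"
  shows "act (e r) F q T = 0"
proof (cases "q \<in> H")
  case True
  have E: "a_diagram l n (ones r) \<in> D" using a_diagram_half[OF l r] by (simp add: half_diagrams_def)
  have "cp (a_diagram l n (ones r)) p \<noteq> q" if "p \<in> H" for p
    using weight_idempotent_cut[OF l r half_tonal[OF that]] q True by (auto simp: core_diagrams_def)
  hence "act (bv (a_diagram l n (ones r))) F q T = 0" unfolding act_bv[OF F E True] by (intro sum.neutral) auto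
  thus ?thesis unfolding weight_idempotent_def by (simp add: act_linear)
qed (simp add: act_def half_part_def)

lemma e_kills:
  assumes r: "ones r \<in> index_set l n" "r < weight l m" and F: "F \<in> model"
  shows "act (e r) F = (\<lambda>q T. 0)"
proof (intro ext)
  fix q T
  have "q \<notin> core_diagrams l n r m" using core_diagram_cases(1)[OF l r(1) m, of q] r(2) by auto
  thus "act (e r) F q T = 0" by (rule e_support[OF r(1) F])
qed

abbreviation "ew \<equiv> e (weight l m)"

lemma e_closed: "ew \<in> carrier R"
  by (rule weight_idempotent_closed[OF l ones_m])

lemma e_phi:
  assumes q: "q \<in> H0"
  shows "act ew (\<phi> (bv q) v) = \<phi> (bv q) v"
proof -
  have qH: "q \<in> H" by (rule core_half[OF q])
  have bH: "bv q \<in> HF" using qH by (auto simp: basis_vector_def)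
  have E: "a_diagram l n (ones (weight l m)) \<in> D" using a_diagram_half[OF l ones_m] by (simp add: half_diagrams_def)
  have u: "\<And>u. u \<in> C \<Longrightarrow> row_pair u {} \<in> q" using q by (simp add: core_diagrams_def)
  have ab: "cp (a_diagram l n (ones (weight l m))) q = q" "cl (a_diagram l n (ones (weight l m))) q = card C"
    by (rule weight_idempotent_absorb[OF l ones_m tonal_diagramsD[OF half_tonal[OF qH]]]; rule u; assumption)+
  have "ew \<star> bv q = bv q"
    unfolding weight_idempotent_def R_mult_scale bv_mult[OF E half_tonal[OF qH]] ab
    using delta by (auto simp: fun_eq_iff)
  moreover have "half_part (bv q) = bv q" using qH by (auto simp: half_part_def basis_vector_def)
  ultimately show ?thesis using act_phi[OF e_closed bH] by simp
qed

text \<open>The group acts freely on half diagrams, so only the identity contributes. A vector can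
  thus be recovered from its tensor with p.\<close>

lemma phi_self:
  assumes p: "p \<in> H" shows "\<phi> (bv p) w p = w"
proof
  fix T
  have "\<phi> (bv p) w p T = (\<Sum>\<sigma>\<in>carrier G. of_bool (\<sigma> = \<one>\<^bsub>G\<^esub>) * w (permute_tabloids l (gi \<sigma>) T))"
  proof -
    have "pm \<sigma> p = p \<longleftrightarrow> \<sigma> = \<one>\<^bsub>G\<^esub>" if "\<sigma> \<in> carrier G" for \<sigma>
      using permute_one[OF p] permute_free[OF p that G.one_closed] by metis
    hence "bv p (pm \<sigma> p) = of_bool (\<sigma> = \<one>\<^bsub>G\<^esub>)" if "\<sigma> \<in> carrier G" for \<sigma>
      using that by (simp add: basis_vector_def)
    hence "(\<Sum>\<sigma>\<in>carrier G. bv p (pm \<sigma> p) * w (permute_tabloids l (gi \<sigma>) T))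
      = (\<Sum>\<sigma>\<in>carrier G. of_bool (\<sigma> = \<one>\<^bsub>G\<^esub>) * w (permute_tabloids l (gi \<sigma>) T))"
      by (intro sum.cong refl) (simp only:)
    moreover have "\<phi> (bv p) w p T = (\<Sum>\<sigma>\<in>carrier G. bv p (pm \<sigma> p) * w (permute_tabloids l (gi \<sigma>) T))"
      unfolding \<phi>_def group_act_def using p by (simp only: if_True)
    ultimately show ?thesis by (simp only:)
  qed
  also have "\<dots> = w T"
    by (subst sum_mult_of_bool(2)[OF finite_multi_sym_group]) (simp add: permute_tabloids_one)
  finally show "\<phi> (bv p) w p T = w T" .
qed

lemma phi_group_act:
  assumes p: "p \<in> H"
  shows "\<phi> (bv p) (ga z v) = (\<lambda>q T. \<Sum>\<tau>\<in>carrier G. z \<tau> * \<phi> (bv (pm \<tau> p)) v q T)" "right_mult (bv p) z = (\<lambda>q. \<Sum>\<tau>\<in>carrier G. z \<tau> * bv (pm \<tau> p) q)"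
proof -
  show r: "right_mult (bv p) z = (\<lambda>q. \<Sum>\<tau>\<in>carrier G. z \<tau> * bv (pm \<tau> p) q)"
  proof
    fix q
    have "right_mult (bv p) z q = (\<Sum>p'\<in>H. of_bool (p' = p) * (\<Sum>\<tau>\<in>carrier G. z \<tau> * of_bool (pm \<tau> p' = q)))"
      by (simp add: right_mult_def basis_vector_def sum_distrib_left mult_ac)
    also have "\<dots> = (\<Sum>\<tau>\<in>carrier G. z \<tau> * of_bool (pm \<tau> p = q))"
      by (subst sum_mult_of_bool(2)[OF finite_half]) (use p in simp)
    finally show "right_mult (bv p) z q = (\<Sum>\<tau>\<in>carrier G. z \<tau> * bv (pm \<tau> p) q)" by (simp add: basis_vector_def eq_commute)
  qed
  have "\<phi> (\<lambda>q. \<Sum>\<tau>\<in>A. z \<tau> * bv (pm \<tau> p) q) v = (\<lambda>q T. \<Sum>\<tau>\<in>A. z \<tau> * \<phi> (bv (pm \<tau> p)) v q T)" for A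
    by (induction A rule: infinite_finite_induct) (simp_all add: phi_linear)
  thus "\<phi> (bv p) (ga z v) = (\<lambda>q T. \<Sum>\<tau>\<in>carrier G. z \<tau> * \<phi> (bv (pm \<tau> p)) v q T)"
    unfolding phi_balanced[symmetric] r .
qed

text \<open>F vanishes outside the core, and within the core only the orbit of q survives.
  Equivariance expresses the values there through F(q), and what remains is p tensor F(q).\<close>

lemma act_transporter:
  assumes F: "F \<in> model" "\<forall>q. q \<notin> H0 \<longrightarrow> F q = (\<lambda>T. 0)" and q: "q \<in> H0" and p: "p \<in> H"
  shows "act (bv (cp p (flip q))) F = (\<lambda>p' T. \<delta> ^ card C * \<phi> (bv p) (F q) p' T)"
proof (intro ext)
  fix p' T
  let ?x = "cp p (flip q)"
  note x = transporter(1)[OF p q G.one_closed] and qH = core_half[OF q]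
  show "act (bv ?x) F p' T = \<delta> ^ card C * \<phi> (bv p) (F q) p' T"
  proof (cases "p' \<in> H")
    case True
    have inj: "inj_on (\<lambda>\<sigma>. pm \<sigma> q) (carrier G)" by (rule inj_onI) (rule permute_free[OF qH])
    have "act (bv ?x) F p' T = (\<Sum>q'\<in>(\<lambda>\<sigma>. pm \<sigma> q) ` carrier G. F q' T * \<delta> ^ cl ?x q' * of_bool (cp ?x q' = p'))"
      unfolding act_bv[OF F(1) x True]
    proof (rule sum.mono_neutral_right[OF finite_half])
      show "(\<lambda>\<sigma>. pm \<sigma> q) ` carrier G \<subseteq> H" using permute_half(3)[OF qH] by blast
      show "\<forall>q'\<in>H - (\<lambda>\<sigma>. pm \<sigma> q) ` carrier G. F q' T * \<delta> ^ cl ?x q' * of_bool (cp ?x q' = p') = 0"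
      proof
        fix q' assume q': "q' \<in> H - (\<lambda>\<sigma>. pm \<sigma> q) ` carrier G"
        show "F q' T * \<delta> ^ cl ?x q' * of_bool (cp ?x q' = p') = 0"
        proof (cases "q' \<in> H0 \<and> cp ?x q' = p'")
          case True': True
          hence "\<exists>\<sigma>\<in>carrier G. q' = pm \<sigma> q" using transporter_orbit(2)[OF p q m refl, of q'] True by blast
          thus ?thesis using q' by blast
        next
          case False thus ?thesis using F(2) by auto
        qed
      qed
    qed
    also have "\<dots> = (\<Sum>\<sigma>\<in>carrier G. \<delta> ^ card C * (of_bool (p = pm (gi \<sigma>) p') * F q (permute_tabloids l \<sigma> T)))"
      by (subst sum.reindex[OF inj])
        (auto intro!: sum.cong simp: transporter(2,3)[OF p q] modelD(3)[OF F(1) _ qH] permute_eq_iff[OF p True])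
    also have "\<dots> = (\<Sum>\<sigma>\<in>carrier G. \<delta> ^ card C * (of_bool (p = pm \<sigma> p') * F q (permute_tabloids l (gi \<sigma>) T)))"
      by (rule sum.reindex_bij_witness[of _ "\<lambda>\<sigma>. gi \<sigma>" "\<lambda>\<sigma>. gi \<sigma>"]) simp_all
    also have "\<dots> = \<delta> ^ card C * \<phi> (bv p) (F q) p' T"
      using True by (simp add: \<phi>_def group_act_def basis_vector_def sum_distrib_left eq_commute)
    finally show ?thesis .
  qed (simp add: act_def \<phi>_def half_part_def)
qed

text \<open>A group algebra element inserted between p and the reflection of q acts on the value
  F(q) before it is attached to p.\<close>

lemma act_right_mult:
  assumes F: "F \<in> model" "\<forall>q. q \<notin> H0 \<longrightarrow> F q = (\<lambda>T. 0)" and q: "q \<in> H0" and p: "p \<in> H"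
  shows "act (\<lambda>q'. \<Sum>\<tau>\<in>carrier G. z \<tau> * bv (cp (pm \<tau> p) (flip q)) q') F = (\<lambda>p' T. \<delta> ^ card C * \<phi> (bv p) (ga z (F q)) p' T)"
  unfolding act_sum act_linear(5) phi_group_act(1)[OF p]
  by (intro ext, simp add: sum_distrib_left mult_ac, intro sum.cong refl)
    (simp add: act_transporter[OF F q permute_half(3)[OF p]])

lemma transporter_sum_closed:
  "q \<in> H0 \<Longrightarrow> p \<in> H \<Longrightarrow> (\<lambda>q'. \<Sum>\<tau>\<in>carrier G. z \<tau> * bv (cp (pm \<tau> p) (flip q)) q') \<in> carrier R"
  unfolding R_iff using transporter(1)[OF permute_half(3) _ G.one_closed, of p _ q]
  by (auto simp: basis_vector_def intro!: sum.neutral)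

lemma V_idempotent_generated: "idempotent_generated_module R V ew"
proof (intro idempotent_generated_module.intro V_left_module idempotent_generated_module_axioms.intro e_closed)
  show "ew \<star> ew = ew" by (rule weight_idempotent_idem[OF l ones_m delta])
  obtain v where v: "v \<in> Sp" "v \<noteq> (\<lambda>T. 0)" using specht_nonzero[of l m \<mu>] mu_partition by blast
  have "\<phi> (bv a) v \<in> carrier V" using phi_closed[OF v(1)] by (simp add: V_simps)
  moreover have "\<phi> (bv a) v \<noteq> (\<lambda>q T. 0)" using phi_self[OF a_closed(1), of v] v(2) by metis
  hence "ew \<odot>\<^bsub>V\<^esub> \<phi> (bv a) v \<noteq> \<zero>\<^bsub>V\<^esub>" by (simp add: V_simps e_phi[OF a_core])
  ultimately show "\<exists>x\<in>carrier V. ew \<odot>\<^bsub>V\<^esub> x \<noteq> \<zero>\<^bsub>V\<^esub>" by blast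
  fix N assume N: "submodule N R V"
  show "N = carrier V \<or> (\<forall>x\<in>N. ew \<odot>\<^bsub>V\<^esub> x = \<zero>\<^bsub>V\<^esub>)"
  proof (rule disjCI)
    assume "\<not> (\<forall>x\<in>N. ew \<odot>\<^bsub>V\<^esub> x = \<zero>\<^bsub>V\<^esub>)"
    then obtain F0 where F0: "F0 \<in> N" "act ew F0 \<noteq> (\<lambda>q T. 0)" by (auto simp: V_simps)
    \<comment> \<open>This element of \<open>N\<close> is nonzero and supported on the core, where
      the transporters are available.\<close>
    define F where "F = act ew F0"
    have FN: "F \<in> N" using submodule_linear(5)[OF N e_closed F0(1)] by (simp add: F_def)
    note Fm = submodule_linear(1)[OF N FN]
    have s: "\<forall>q. q \<notin> H0 \<longrightarrow> F q = (\<lambda>T. 0)"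
      using e_support[OF ones_m submodule_linear(1)[OF N F0(1)]] by (auto simp: F_def)
    obtain q where q: "F q \<noteq> (\<lambda>T. 0)" using F0(2) unfolding F_def by blast
    hence qH: "q \<in> H0" using s by blast
    have phi: "\<phi> (bv p) w \<in> N" if p: "p \<in> H" and w: "w \<in> Sp" for p w
    proof -
      \<comment> \<open>Irreducibility of the Specht module: from the one nonzero value at q every w
        is reached.\<close>
      obtain z where z: "w = ga z (F q)" using specht_irreducible[of l m \<mu>, OF mu_partition modelD(1)[OF Fm] q w] by blast
      have "(\<lambda>p' T. \<delta> ^ card C * \<phi> (bv p) w p' T) \<in> N"
        using submodule_linear(5)[OF N transporter_sum_closed[OF qH p] FN, of z] unfolding act_right_mult[OF Fm s qH p] z .
      from submodule_linear(2)[OF N this, of "inverse (\<delta> ^ card C)"] show ?thesis using delta by (simp add: mult.assoc[symmetric])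
    qed
    have "F' \<in> N" if F': "F' \<in> model" for F'
    proof -
      have "(\<lambda>q T. \<Sum>p\<in>H. inverse (of_nat (card (carrier G))) * \<phi> (bv p) (F' p) q T) \<in> N"
        by (intro submodule_sum[OF N] submodule_linear(2)[OF N] phi modelD(1)[OF F'])
      moreover have "(\<lambda>q T. \<Sum>p\<in>H. inverse (of_nat (card (carrier G))) * \<phi> (bv p) (F' p) q T) = F'"
        using model_eq_sum_phi[OF F'] by (intro ext) (simp add: phi_linear)
      ultimately show ?thesis by simp
    qed
    thus "N = carrier V" using submodule_linear(1)[OF N] by (auto simp: V_simps)
  qed
qed

lemma standard_composition_series: "\<exists>Ns. composition_series R S Ns"
proof -
  obtain \<Psi> where "left_module_iso R V S \<Psi>" using exists_model_iso by blast
  moreover obtain d :: "_ \<Rightarrow> nat" where "\<forall>N N'. submodule N R V \<longrightarrow> submodule N' R V \<longrightarrow> N \<subset> N' \<longrightarrow> d N < d N'"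
    using exists_strict_mono_rank by blast
  ultimately show ?thesis using left_module_iso.composition_series_iso[of R V S \<Psi> d] by blast
qed

lemma standard_idempotent_generated: "idempotent_generated_module R S ew"
  using exists_model_iso left_module_iso.idempotent_generated_iso[OF _ V_idempotent_generated] by blast

lemma standard_left_module: "left_module R S"
  using exists_model_iso left_module_iso.iso_left_module by blast

lemma standard_killed:
  assumes r: "ones r \<in> index_set l n" "r < weight l m" and x: "x \<in> carrier S"
  shows "e r \<odot>\<^bsub>S\<^esub> x = \<zero>\<^bsub>S\<^esub>"
proof -
  obtain \<Psi> where "left_module_iso R V S \<Psi>" using exists_model_iso by blast
  then interpret \<Psi>: left_module_iso R V S \<Psi> .
  obtain F where F: "F \<in> carrier V" "x = \<Psi> F" using x \<Psi>.carrier_iso by blast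
  have "e r \<odot>\<^bsub>V\<^esub> F = \<zero>\<^bsub>V\<^esub>" using e_kills[OF r] F(1) by (simp add: V_simps)
  thus ?thesis using \<Psi>.iso_smult[OF weight_idempotent_closed[OF l r(1)] F(1)] \<Psi>.iso_zero F(2) by simp
qed

section \<open>Separation of the heads\<close>

text \<open>The idempotent applied first moves everything into the core, so it suffices that
  \<open>A\<close> annihilates functions supported there.\<close>

lemma standard_sandwich_zero:
  assumes A: "A \<in> carrier R" and z: "\<And>F. F \<in> model \<Longrightarrow> \<forall>q. q \<notin> H0 \<longrightarrow> F q = (\<lambda>T. 0) \<Longrightarrow> act A F = (\<lambda>q T. 0)"
    and x: "x \<in> carrier S"
  shows "sandwich S ew A x = \<zero>\<^bsub>S\<^esub>"
proof -
  obtain \<Psi> where "left_module_iso R V S \<Psi>" using exists_model_iso by blast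
  then interpret \<Psi>: left_module_iso R V S \<Psi> .
  obtain F where F: "F \<in> carrier V" "x = \<Psi> F" using x \<Psi>.carrier_iso by blast
  hence Fm: "F \<in> model" by (simp add: V_simps)
  have "act A (act ew F) = (\<lambda>q T. 0)"
    by (rule z[OF act_closed[OF e_closed Fm]]) (use e_support[OF ones_m Fm] in auto)
  hence "sandwich V ew A F = \<zero>\<^bsub>V\<^esub>" using act_zero[OF e_closed] by (simp add: V_simps)
  thus ?thesis using F by (simp add: \<Psi>.iso_smult[symmetric] \<Psi>.iso_zero[symmetric] V.smult_closed A e_closed)
qed

text \<open>Tensors with the diagram \<open>a\<close> are fixed by the idempotent, so on them the
  two outer factors of the sandwich have no effect.\<close>

lemma standard_sandwich_nonzero:
  assumes A: "A \<in> carrier R" and v: "v \<in> Sp" "w \<in> Sp" "w \<noteq> (\<lambda>T. 0)" and c: "c \<noteq> 0"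
    and e: "act A (\<phi> (bv a) v) = (\<lambda>q T. c * \<phi> (bv a) w q T)"
  shows "\<exists>x\<in>carrier S. sandwich S ew A x \<noteq> \<zero>\<^bsub>S\<^esub>"
proof -
  obtain \<Psi> where "left_module_iso R V S \<Psi>" using exists_model_iso by blast
  then interpret \<Psi>: left_module_iso R V S \<Psi> .
  let ?F = "\<phi> (bv a) v"
  have F: "?F \<in> carrier V" using phi_closed[OF v(1)] by (simp add: V_simps)
  have "(\<lambda>q T. c * \<phi> (bv a) w q T) = \<phi> (bv a) (\<lambda>T. c * w T)" by (simp add: \<phi>_def fun_eq_iff group_act_linear)
  hence "sandwich V ew A ?F = \<phi> (bv a) (\<lambda>T. c * w T)"
    using e by (simp add: V_simps e_phi[OF a_core])
  moreover have "\<phi> (bv a) (\<lambda>T. c * w T) a \<noteq> (\<lambda>T. 0)" unfolding phi_self[OF a_closed(1)] using v(3) c by (auto simp: fun_eq_iff)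
  ultimately have "sandwich V ew A ?F \<noteq> \<zero>\<^bsub>V\<^esub>" by (auto simp: V_simps fun_eq_iff)
  hence "\<Psi> (sandwich V ew A ?F) \<noteq> \<Psi> \<zero>\<^bsub>V\<^esub>"
    using \<Psi>.inj_iso F by (simp add: V.smult_closed A e_closed)
  thus ?thesis using F \<Psi>.carrier_iso
    by (intro bexI[of _ "\<Psi> ?F"]) (simp_all add: \<Psi>.iso_smult \<Psi>.iso_zero V.smult_closed A e_closed)
qed

lemma phi_a_support: "v \<in> Sp \<Longrightarrow> \<forall>q. q \<notin> H0 \<longrightarrow> \<phi> (bv a) v q = (\<lambda>T. 0)"
  using e_support[OF ones_m phi_closed, of v _ "bv a"] e_phi[OF a_core, of v] by (auto simp: fun_eq_iff)

lemma flip_a: "flip a = a"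
  by (simp add: a_diagram_eq[OF l] flip_joined)

lemma a_transporter: "p \<in> H \<Longrightarrow> cp p (flip a) = p"
  using half_absorb(1)[OF l m] by (simp add: flip_a)

end

lemma int_partition_0: "int_partition 0 \<mu> \<Longrightarrow> \<mu> = []"
  by (cases \<mu>) (auto simp: int_partition_def)

text \<open>Isomorphic heads would be annihilated by the same elements eAe; equal weights ensure
  that e is the same for both modules.\<close>

lemma heads_not_iso:
  assumes "standard_layer \<delta> l n m \<mu>" "standard_layer \<delta> l n m' \<nu>" and w: "weight l m = weight l m'"
    and A: "A \<in> carrier (tonal_algebra \<delta> l n)"
    and z: "\<And>x. x \<in> carrier (standard_module \<delta> l n \<nu>) \<Longrightarrow>
      sandwich (standard_module \<delta> l n \<nu>) (weight_idempotent \<delta> l n (weight l m')) A x = \<zero>\<^bsub>standard_module \<delta> l n \<nu>\<^esub>"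
    and nz: "\<exists>x\<in>carrier (standard_module \<delta> l n \<mu>).
      sandwich (standard_module \<delta> l n \<mu>) (weight_idempotent \<delta> l n (weight l m)) A x \<noteq> \<zero>\<^bsub>standard_module \<delta> l n \<mu>\<^esub>"
  shows "\<not> module_iso (tonal_algebra \<delta> l n) (simple_head \<delta> l n \<mu>) (simple_head \<delta> l n \<nu>)"
    "\<not> module_iso (tonal_algebra \<delta> l n) (simple_head \<delta> l n \<nu>) (simple_head \<delta> l n \<mu>)"
proof -
  interpret X: standard_layer \<delta> l n m \<mu> by fact
  interpret Y: standard_layer \<delta> l n m' \<nu> by fact
  interpret XS: idempotent_generated_module X.R X.S X.ew by (rule X.standard_idempotent_generated)
  interpret YS: idempotent_generated_module X.R Y.S X.ew using Y.standard_idempotent_generated w by simp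
  show 1: "\<not> module_iso X.R (simple_head \<delta> l n \<nu>) (simple_head \<delta> l n \<mu>)"
    using XS.head_iso_kills[OF YS.idempotent_generated_module_axioms _ A] z nz unfolding simple_head_def w[symmetric] by blast
  show "\<not> module_iso X.R (simple_head \<delta> l n \<mu>) (simple_head \<delta> l n \<nu>)"
    using 1 module_iso_sym[OF XS.head_left_module] unfolding simple_head_def by blast
qed

lemma heads_separated:
  assumes X: "standard_layer \<delta> l n m \<mu>" and Y: "standard_layer \<delta> l n m' \<nu>" and w: "weight l m = weight l m'" and ne: "\<mu> \<noteq> \<nu>"
  shows "\<not> module_iso (tonal_algebra \<delta> l n) (simple_head \<delta> l n \<mu>) (simple_head \<delta> l n \<nu>)"
proof (cases "m = m'")
  case False
  \<comment> \<open>Oriented so that the first index has at most as many propagating parts as the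
    second; in the reverse case the two modules are exchanged.\<close>
  have *: "\<not> module_iso (tonal_algebra \<delta> l n) (simple_head \<delta> l n \<mu>) (simple_head \<delta> l n \<nu>)
      \<and> \<not> module_iso (tonal_algebra \<delta> l n) (simple_head \<delta> l n \<nu>) (simple_head \<delta> l n \<mu>)"
    if "standard_layer \<delta> l n m \<mu>" "standard_layer \<delta> l n m' \<nu>" and w: "weight l m = weight l m'"
      and le: "(\<Sum>i=1..l. m i) \<le> (\<Sum>i=1..l. m' i)" and ne: "m' \<noteq> m" for m m' \<mu> \<nu>
  proof -
    interpret X: standard_layer \<delta> l n m \<mu> by fact
    interpret Y: standard_layer \<delta> l n m' \<nu> by fact
    have A: "X.bv X.a \<in> carrier X.R" by (rule X.bv_closed[OF X.a_closed(2)])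
    have xa: "X.cp X.a (flip X.a) = X.a" by (rule X.a_transporter[OF X.a_closed(1)])
    have "Y.act (X.bv X.a) F = (\<lambda>q T. 0)" if F: "F \<in> Y.model" "\<forall>q. q \<notin> Y.H0 \<longrightarrow> F q = (\<lambda>T. 0)" for F
    proof (intro ext)
      fix q T
      show "Y.act (X.bv X.a) F q T = 0"
      proof (cases "q \<in> Y.H")
        case True
        \<comment> \<open>In a nonzero term the diagram \<open>a\<close> would take a core diagram
          of the other index to a half diagram again, and then the indices would agree.\<close>
        have "F p T = 0 \<or> X.cp X.a p \<noteq> q" for p
        proof (cases "p \<in> Y.H0")
          case p: True
          thus ?thesis using X.transporter_orbit(1)[OF X.a_closed(1) X.a_core Y.m w[symmetric], of p] True le ne w unfolding xa by metis
        qed (simp add: F(2))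
        thus ?thesis unfolding Y.act_bv[OF F(1) X.a_closed(2) True] by (intro sum.neutral) auto
      qed (simp add: Y.act_def Y.half_part_def)
    qed
    note z = Y.standard_sandwich_zero[OF A this]
    obtain v where v: "v \<in> X.Sp" "v \<noteq> (\<lambda>T. 0)" using specht_nonzero[of l m \<mu>] X.mu_partition by blast
    have "X.act (X.bv X.a) (X.\<phi> (X.bv X.a) v) = (\<lambda>q T. \<delta> ^ card X.C * X.\<phi> (X.bv X.a) v q T)"
      using X.act_transporter[OF X.phi_closed[OF v(1)] X.phi_a_support[OF v(1)] X.a_core X.a_closed(1)]
      unfolding xa X.phi_self[OF X.a_closed(1)] .
    from X.standard_sandwich_nonzero[OF A v(1) v _ this] X.delta have nz: "\<exists>x\<in>carrier X.S. sandwich X.S X.ew (X.bv X.a) x \<noteq> \<zero>\<^bsub>X.S\<^esub>" by simp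
    show ?thesis using heads_not_iso[OF that(1,2) w A z nz] by blast
  qed
  show ?thesis
  proof (cases "(\<Sum>i=1..l. m i) \<le> (\<Sum>i=1..l. m' i)")
    case True thus ?thesis using *[OF X Y w] False by blast
  next
    case n: False thus ?thesis using *[OF Y X w[symmetric]] False by auto
  qed
next
  case mm: True
  have *: "\<not> module_iso (tonal_algebra \<delta> l n) (simple_head \<delta> l n \<mu>) (simple_head \<delta> l n \<nu>)
      \<and> \<not> module_iso (tonal_algebra \<delta> l n) (simple_head \<delta> l n \<nu>) (simple_head \<delta> l n \<mu>)"
    if "standard_layer \<delta> l n m \<mu>" "standard_layer \<delta> l n m \<nu>"
      and z: "\<forall>v\<in>specht_carrier l \<nu>. group_act l m z v = (\<lambda>T. 0)" "\<exists>v\<in>specht_carrier l \<mu>. group_act l m z v \<noteq> (\<lambda>T. 0)" for \<mu> \<nu> z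
  proof -
    interpret X: standard_layer \<delta> l n m \<mu> by fact
    interpret Y: standard_layer \<delta> l n m \<nu> by fact
    \<comment> \<open>The group algebra element \<open>z\<close> realised by permuting the through
      blocks of \<open>a\<close>; on core-supported functions it applies \<open>z\<close> to the
      value at \<open>a\<close>.\<close>
    let ?A = "\<lambda>q'. \<Sum>\<tau>\<in>carrier X.G. z \<tau> * X.bv (X.cp (X.pm \<tau> X.a) (flip X.a)) q'"
    have A: "?A \<in> carrier X.R" by (rule X.transporter_sum_closed[OF X.a_core X.a_closed(1)])
    have "Y.act ?A F = (\<lambda>q T. 0)" if F: "F \<in> Y.model" "\<forall>q. q \<notin> X.H0 \<longrightarrow> F q = (\<lambda>T. 0)" for F
      using Y.act_right_mult[OF F X.a_core X.a_closed(1), of z] z(1) Y.modelD(1)[OF F(1)] by (simp add: Y.phi_linear)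
    note zero = Y.standard_sandwich_zero[OF A this]
    obtain v where v: "v \<in> X.Sp" "X.ga z v \<noteq> (\<lambda>T. 0)" using z(2) by blast
    have "X.act ?A (X.\<phi> (X.bv X.a) v) = (\<lambda>q T. \<delta> ^ card X.C * X.\<phi> (X.bv X.a) (X.ga z v) q T)"
      using X.act_right_mult[OF X.phi_closed[OF v(1)] X.phi_a_support[OF v(1)] X.a_core X.a_closed(1), of z]
      unfolding X.phi_self[OF X.a_closed(1)] .
    from X.standard_sandwich_nonzero[OF A v(1) X.ga_closed[OF v(1)] v(2) _ this] X.delta
    have nz: "\<exists>x\<in>carrier X.S. sandwich X.S X.ew ?A x \<noteq> \<zero>\<^bsub>X.S\<^esub>" by simp
    show ?thesis using heads_not_iso[OF that(1,2) refl A zero nz] by blast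
  qed
  interpret X: standard_layer \<delta> l n m \<mu> by fact
  interpret Y: standard_layer \<delta> l n m \<nu> using Y mm by simp
  \<comment> \<open>Outside {1..l} the index is zero, which forces empty partitions in both
    labels.\<close>
  have "\<exists>i\<in>{1..l}. \<mu> i \<noteq> \<nu> i"
  proof (rule ccontr)
    assume n: "\<not> ?thesis"
    have "\<mu> i = \<nu> i" for i
    proof (cases "i \<in> {1..l}")
      case False
      hence "m i = 0" using index_setD(3)[OF X.m] by blast
      hence "\<mu> i = []" "\<nu> i = []"
        using int_partition_0 X.mu_partition[of i] Y.mu_partition[of i] by simp_all
      thus ?thesis by simp
    qed (use n in blast)
    thus False using ne by blast
  qed
  from specht_modules_separated[OF X.mu_partition Y.mu_partition this]
  show ?thesis using *[OF X.standard_layer_axioms Y.standard_layer_axioms] *[OF Y.standard_layer_axioms X.standard_layer_axioms] by blast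
qed

theorem theorem9p4:
  fixes l n :: nat and \<delta> :: complex
    and ord :: "((nat \<Rightarrow> nat list) \<times> (nat \<Rightarrow> nat list)) set"
  assumes "1 \<le> l" and "\<delta> \<noteq> 0"
    and "partial_order_on (labels l n) ord"
    and "\<And>\<mu> \<nu>. \<mu> \<in> labels l n \<Longrightarrow> \<nu> \<in> labels l n \<Longrightarrow>
           weight l (size_vector \<mu>) < weight l (size_vector \<nu>) \<Longrightarrow> (\<mu>, \<nu>) \<in> ord \<and> \<mu> \<noteq> \<nu>"
  shows "(\<forall>\<mu>\<in>labels l n. decomposition_matrix \<delta> l n \<mu> \<mu> = 1)
       \<and> (\<forall>\<mu>\<in>labels l n. \<forall>\<nu>\<in>labels l n.
            decomposition_matrix \<delta> l n \<mu> \<nu> \<noteq> 0 \<longrightarrow> (\<mu>, \<nu>) \<in> ord)"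
proof -
  let ?R = "tonal_algebra \<delta> l n"
  have layer: "standard_layer \<delta> l n (size_vector \<mu>) \<mu>" if \<mu>: "\<mu> \<in> labels l n" for \<mu>
  proof -
    obtain m where m: "m \<in> index_set l n" "\<mu> \<in> multipartitions m" using \<mu> unfolding labels_def by blast
    interpret standard_layer \<delta> l n m \<mu> by unfold_locales (use assms(1,2) m in auto)
    show ?thesis unfolding size_mu by (rule standard_layer_axioms)
  qed
  \<comment> \<open>For equal weights both modules are governed by the same idempotent, which leaves
    the last factor as the only candidate for the other head.\<close>
  have eq: "decomposition_matrix \<delta> l n \<mu> \<nu> = of_bool (module_iso ?R (simple_head \<delta> l n \<mu>) (simple_head \<delta> l n \<nu>))"
    if \<mu>: "\<mu> \<in> labels l n" and \<nu>: "\<nu> \<in> labels l n" and w: "weight l (size_vector \<mu>) = weight l (size_vector \<nu>)" for \<mu> \<nu>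
  proof -
    interpret X: standard_layer \<delta> l n "size_vector \<mu>" \<mu> by (rule layer[OF \<mu>])
    interpret Y: standard_layer \<delta> l n "size_vector \<nu>" \<nu> by (rule layer[OF \<nu>])
    interpret XS: idempotent_generated_module ?R X.S X.ew by (rule X.standard_idempotent_generated)
    interpret YS: idempotent_generated_module ?R Y.S X.ew using Y.standard_idempotent_generated w by simp
    show ?thesis unfolding decomposition_matrix_def simple_head_def
      by (rule XS.composition_multiplicity_eq[OF X.standard_composition_series YS.head_left_module YS.head_e_nonzero])
  qed
  \<comment> \<open>The idempotent belonging to the label of smaller weight annihilates the first
    module but not the head of the second.\<close>
  have gt: "decomposition_matrix \<delta> l n \<mu> \<nu> = 0"
    if \<mu>: "\<mu> \<in> labels l n" and \<nu>: "\<nu> \<in> labels l n" and w: "weight l (size_vector \<nu>) < weight l (size_vector \<mu>)" for \<mu> \<nu>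
  proof -
    interpret X: standard_layer \<delta> l n "size_vector \<mu>" \<mu> by (rule layer[OF \<mu>])
    interpret Y: standard_layer \<delta> l n "size_vector \<nu>" \<nu> by (rule layer[OF \<nu>])
    interpret YS: idempotent_generated_module ?R Y.S Y.ew by (rule Y.standard_idempotent_generated)
    interpret XS: left_module ?R X.S by (rule X.standard_left_module)
    show ?thesis unfolding decomposition_matrix_def simple_head_def
      by (rule XS.composition_multiplicity_killed[OF X.standard_composition_series Y.e_closed
        X.standard_killed[OF Y.ones_m w] YS.head_left_module YS.head_e_nonzero])
  qed
  have diag: "decomposition_matrix \<delta> l n \<mu> \<mu> = 1" if "\<mu> \<in> labels l n" for \<mu>
    using eq[OF that that refl] module_iso_refl by simp
  have "(\<mu>, \<nu>) \<in> ord" if \<mu>: "\<mu> \<in> labels l n" and \<nu>: "\<nu> \<in> labels l n" and nz: "decomposition_matrix \<delta> l n \<mu> \<nu> \<noteq> 0" for \<mu> \<nu>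
  proof (cases "weight l (size_vector \<mu>)" "weight l (size_vector \<nu>)" rule: linorder_cases)
    case less thus ?thesis using assms(4)[OF \<mu> \<nu>] by blast
  next
    case equal
    hence "\<mu> = \<nu>" using eq[OF \<mu> \<nu> equal] nz heads_separated[OF layer[OF \<mu>] layer[OF \<nu>] equal] by auto
    thus ?thesis using assms(3) \<mu> by (auto simp: partial_order_on_def preorder_on_def refl_on_def)
  next
    case greater thus ?thesis using gt[OF \<mu> \<nu>] nz by blast
  qed
  thus ?thesis using diag by blast
qed

end
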